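(* Let $D\subset\mathbb R^d$ be open, $p>1$, $0<\alpha\le\beta$, and let $f_k$ ($k\in\mathbb N$) and $g^j_k$ ($j,k\in\mathbb N$) be functions in $\mathcal F_{\alpha,\beta}(D)$ with corresponding integral functionals $F_k(u,U)=\int_U f_k(x,\nabla u)\,dx$ and $G^j_k(u,U)=\int_U g^j_k(x,\nabla u)\,dx$. Let $E\subset(0,+\infty)$ be a set with $0\in\overline E$. Assume that for almost all $x\in D$ and for all $t>0$ $$\lim_{j\to+\infty}\ \limsup_{\rho\to0,\ \rho\in E}\ \limsup_{k\to+\infty}\frac1{\rho^d}\int_{B_\rho(x)}\sup_{|\xi|\le t}|f_k(y,\xi)-g^j_k(y,\xi)|\,dy=0.$$ Assume that for every $j$ and every $U\in\mathcal U(D)$ the functionals $G^j_k(\cdot,U)$ $\Gamma$-converge as $k\to+\infty$ to $G^j_\infty(\cdot,U)$, where $G^j_\infty(u,U)=\int_U g^j_\infty(x,\nabla u)\,dx$ with $g^j_\infty\in\mathcal F_{\alpha,\beta}(D)$. Then for almost every $x\in D$ and every $\xi\in\mathbb M^{m\times d}$ the pointwise limit $g_\infty(x,\xi)=\lim_{j\to+\infty}g^j_\infty(x,\xi)$ exists, and for every $U\in\mathcal U(D)$ the functionals $F_k(\cdot,U)$ $\Gamma$-converge to $G_\infty(\cdot,U)$, where $G_\infty(u,U)=\int_U g_\infty(x,\nabla u)\,dx$.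
   Context: $\mathbb M^{m\times d}$ is the space of real $m\times d$ matrices; $B_\rho(x)$ is the open ball of centre $x$ and radius $\rho$. $\mathcal U(D)$ is the family of all bounded open subsets of $D$. $\mathcal F_{\alpha,\beta}(D)$ is the class of Borel functions $f:D\times\mathbb M^{m\times d}\to[0,+\infty)$ such that $\alpha|\xi|^p\le f(x,\xi)\le\beta(1+|\xi|^p)$ for almost all $x\in D$ and all $\xi$, and (standing assumption) $f(x,\cdot)$ is quasiconvex. The functionals are defined for $u\in W^{1,p}(D;\mathbb R^m)$, and $\Gamma$-convergence is with respect to the weak convergence in $W^{1,p}(D;\mathbb R^m)$. *)

theory Defs
  imports "HOL-Analysis.Analysis"
begin

text \<open>Points of R^d: real^'d.  Matrices in M^{m x d}: real^'d^'m (row i = i-th component,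
  column j = j-th partial derivative); the norm is the Frobenius (Euclidean) norm.\<close>

fun pderivs :: "'d list \<Rightarrow> (real^'d \<Rightarrow> real) \<Rightarrow> (real^'d \<Rightarrow> real)" where
  "pderivs [] \<phi> = \<phi>"
| "pderivs (i # is) \<phi> = (\<lambda>x. frechet_derivative (pderivs is \<phi>) (at x) (axis i 1))"

definition smooth_fun :: "(real^'d \<Rightarrow> real) \<Rightarrow> bool" where
  "smooth_fun \<phi> \<longleftrightarrow> (\<forall>is x. pderivs is \<phi> differentiable (at x))"

definition test_fun :: "(real^'d) set \<Rightarrow> (real^'d \<Rightarrow> real) \<Rightarrow> bool" where
  "test_fun D \<phi> \<longleftrightarrow> smooth_fun \<phi> \<and> compact (closure {x. \<phi> x \<noteq> 0}) \<and> closure {x. \<phi> x \<noteq> 0} \<subseteq> D"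

definition test_fun_vec :: "(real^'d) set \<Rightarrow> (real^'d \<Rightarrow> real^'m) \<Rightarrow> bool" where
  "test_fun_vec D \<phi> \<longleftrightarrow> (\<forall>i. test_fun D (\<lambda>x. \<phi> x $ i))"

definition cgrad :: "(real^'d \<Rightarrow> real^'m) \<Rightarrow> real^'d \<Rightarrow> real^'d^'m" where
  "cgrad \<phi> x = (\<chi> i j. frechet_derivative (\<lambda>y. \<phi> y $ i) (at x) (axis j 1))"

definition Lp_on :: "real \<Rightarrow> (real^'d) set \<Rightarrow> (real^'d \<Rightarrow> 'v::euclidean_space) \<Rightarrow> bool" where
  "Lp_on p D u \<longleftrightarrow> set_borel_measurable lebesgue D u \<and>
     set_integrable lebesgue D (\<lambda>x. norm (u x) powr p)"

definition weak_grad :: "(real^'d) set \<Rightarrow> (real^'d \<Rightarrow> real^'m) \<Rightarrow> (real^'d \<Rightarrow> real^'d^'m) \<Rightarrow> bool" where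
  "weak_grad D u G \<longleftrightarrow> (\<forall>\<phi>. test_fun D \<phi> \<longrightarrow> (\<forall>i j.
     (LINT x:D|lebesgue. u x $ i * frechet_derivative \<phi> (at x) (axis j 1))
       = - (LINT x:D|lebesgue. G x $ i $ j * \<phi> x)))"

definition sobolev :: "real \<Rightarrow> (real^'d) set \<Rightarrow> (real^'d \<Rightarrow> real^'m) \<Rightarrow> bool" where
  "sobolev p D u \<longleftrightarrow> Lp_on p D u \<and> (\<exists>G. Lp_on p D G \<and> weak_grad D u G)"

text \<open>The (a.e. unique) weak gradient of a Sobolev function.\<close>
definition sgrad :: "real \<Rightarrow> (real^'d) set \<Rightarrow> (real^'d \<Rightarrow> real^'m) \<Rightarrow> real^'d \<Rightarrow> real^'d^'m" where
  "sgrad p D u = (SOME G. Lp_on p D G \<and> weak_grad D u G)"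

definition weak_Lp :: "real \<Rightarrow> (real^'d) set \<Rightarrow> (nat \<Rightarrow> real^'d \<Rightarrow> 'v::euclidean_space) \<Rightarrow> (real^'d \<Rightarrow> 'v) \<Rightarrow> bool" where
  "weak_Lp p D us u \<longleftrightarrow> (\<forall>v. Lp_on (p / (p - 1)) D v \<longrightarrow>
     (\<lambda>k. LINT x:D|lebesgue. us k x \<bullet> v x) \<longlonglongrightarrow> (LINT x:D|lebesgue. u x \<bullet> v x))"

definition weak_W1p :: "real \<Rightarrow> (real^'d) set \<Rightarrow> (nat \<Rightarrow> real^'d \<Rightarrow> real^'m) \<Rightarrow> (real^'d \<Rightarrow> real^'m) \<Rightarrow> bool" where
  "weak_W1p p D us u \<longleftrightarrow> weak_Lp p D us u \<and> weak_Lp p D (\<lambda>k. sgrad p D (us k)) (sgrad p D u)"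

definition gamma_conv :: "'a set \<Rightarrow> ((nat \<Rightarrow> 'a) \<Rightarrow> 'a \<Rightarrow> bool) \<Rightarrow> (nat \<Rightarrow> 'a \<Rightarrow> real) \<Rightarrow> ('a \<Rightarrow> real) \<Rightarrow> bool" where
  "gamma_conv W conv \<Phi> \<Psi> \<longleftrightarrow>
     (\<forall>u\<in>W. \<forall>us. (\<forall>k. us k \<in> W) \<longrightarrow> conv us u \<longrightarrow> ereal (\<Psi> u) \<le> liminf (\<lambda>k. ereal (\<Phi> k (us k)))) \<and>
     (\<forall>u\<in>W. \<exists>us. (\<forall>k. us k \<in> W) \<and> conv us u \<and> limsup (\<lambda>k. ereal (\<Phi> k (us k))) \<le> ereal (\<Psi> u))"

definition quasiconvex :: "(real^'d^'m \<Rightarrow> real) \<Rightarrow> bool" where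
  "quasiconvex q \<longleftrightarrow> (\<forall>\<xi> (\<phi>::real^'d \<Rightarrow> real^'m). test_fun_vec (box 0 One) \<phi> \<longrightarrow>
     q \<xi> \<le> (LINT x:box 0 One|lebesgue. q (\<xi> + cgrad \<phi> x)))"

definition F_class :: "real \<Rightarrow> real \<Rightarrow> real \<Rightarrow> (real^'d) set \<Rightarrow> (real^'d \<Rightarrow> real^'d^'m \<Rightarrow> real) \<Rightarrow> bool" where
  "F_class p \<alpha> \<beta> D f \<longleftrightarrow>
     (\<lambda>z. f (fst z) (snd z)) \<in> borel_measurable (restrict_space borel (D \<times> UNIV)) \<and>
     (\<forall>x\<in>D. \<forall>\<xi>. 0 \<le> f x \<xi>) \<and>
     (AE x in lebesgue. x \<in> D \<longrightarrow>
        (\<forall>\<xi>. \<alpha> * norm \<xi> powr p \<le> f x \<xi> \<and> f x \<xi> \<le> \<beta> * (1 + norm \<xi> powr p)) \<and> quasiconvex (f x))"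

definition intfun :: "real \<Rightarrow> (real^'d) set \<Rightarrow> (real^'d \<Rightarrow> real^'d^'m \<Rightarrow> real) \<Rightarrow> (real^'d) set \<Rightarrow> (real^'d \<Rightarrow> real^'m) \<Rightarrow> real" where
  "intfun p D f U u = (LINT x:U|lebesgue. f x (sgrad p D u x))"

definition admissible :: "(real^'d) set \<Rightarrow> (real^'d) set \<Rightarrow> bool" where
  "admissible D U \<longleftrightarrow> bounded U \<and> open U \<and> U \<subseteq> D"

end

(*
  Three facts carry the proof.  (1) Gradients of a bounded sequence in W^{1,p} can be replaced by
  p-equiintegrable ones off sets of vanishing measure (Lipschitz truncation by maximal functions).
  For equiintegrable gradients the energies of f_k and g^j_k differ by at most the integral of
  sup_{|xi| <= t} |f_k - g^j_k| plus a small tail, so that closeness in this sense on U gives both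
  Gamma-inequalities and the convergence of the energies int_U g^j_oo(x, grad u) dx.  (2) The
  hypothesis only localises: around almost every x a large index j is good on small balls.  By
  Vitali's theorem U is covered up to small measure by finitely many disjoint balls carrying
  different indices, and gluing the corresponding g^j_k gives Gamma-converging sequences that are
  close to f_k on U.  (3) The indices on the balls may be chosen freely among the good ones.
  Alternating between nearly maximal and nearly minimal values of g^j_oo(x, xi) for affine u forces
  limsup and liminf in j to have the same integral, hence pointwise convergence for xi in a
  countable dense set; the uniform local Lipschitz bound of quasiconvex functions with p-growth
  extends it to all xi.
*)
theory Submission
 imports Defs "HOL-Analysis.Analysis" "HOL-Library.Diagonal_Subsequence"
begin

text \<open>The order of the limits is the obstacle: which \<open>j\<close> is good near
  \<open>x\<close>, and on which balls, depends on \<open>x\<close>, so no single \<open>j\<close>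
  need be close to f_k on all of \<open>U\<close>. This forces the passage through glued integrands,
  and gluing in turn requires recovery sequences that coincide with \<open>u\<close> near the
  boundary of each piece. Nothing is assumed about the boundaries of \<open>U\<close> and
  \<open>D\<close>; compactness is therefore used on compact subsets only, and the strip left over
  is controlled by comparing an upper bound for the energy on \<open>U\<close> with a lower bound on
  an inner set. Moreover every bound \<open>M\<close> on gradients has to be independent of the
  accuracy \<open>eps\<close>: otherwise a diagonal sequence of better and better perturbations
  would not converge weakly. Finally, the Gamma-limit of f_k is the same however the glued indices
  are chosen. Once the pointwise limit exists, index functions tending to infinity everywhere let
  dominated convergence identify the Gamma-limit with the integral of that limit.\<close>

abbreviation pdv :: "'d::finite => (real^'d => real) => real^'d => real" where
 "pdv i phi \<equiv> (%x. frechet_derivative phi (at x) (axis i 1))"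

abbreviation (input) ae_lebesgue (binder "AEL " 10) where "ae_lebesgue P \<equiv> eventually P (ae_filter lebesgue)"
abbreviation (input) ev_seq (binder "EV " 10) where "ev_seq P \<equiv> eventually P sequentially"
abbreviation (input) fq_seq (binder "FQ " 10) where "fq_seq P \<equiv> frequently P sequentially"
abbreviation (input) int_lebesgue (binder "LI " 10) where "int_lebesgue f \<equiv> lebesgue_integral lebesgue f"
abbreviation (input) nn_lebesgue (binder "NN " 10) where "nn_lebesgue f \<equiv> nn_integral lebesgue f"
abbreviation (input) nn_lborel (binder "NB " 10) where "nn_lborel f \<equiv> nn_integral lborel f"
abbreviation (input) "nns A f \<equiv> \<integral>\<^sup>+x\<in>A. f x \<partial>lebesgue"
abbreviation (input) "np p f \<equiv> \<integral>\<^sup>+x. ennreal (abs (f x) powr p) \<partial>lebesgue"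
abbreviation (input) "nq p f \<equiv> \<integral>\<^sup>+x. ennreal (norm (f x) powr p) \<partial>lebesgue"
abbreviation (input) "vol \<equiv> measure lebesgue"
abbreviation (input) "BL \<equiv> borel_measurable lebesgue"
abbreviation (input) "integ \<equiv> integrable lebesgue"
abbreviation (input) ind :: "'a set => 'a => real" where "ind \<equiv> indicat_real"
abbreviation (input) seq_lim (infixr "---->" 60) where "seq_lim X l \<equiv> tendsto X l sequentially"

abbreviation (input) scale (infixr "*R" 75) where "scale \<equiv> scaleR"

subsection \<open>Smooth functions\<close>

text \<open>\<open>smooth_fun\<close> demands differentiability of all iterated partial derivatives,
  so a set of differentiable functions that is stable under partial derivatives consists of smooth
  functions. The basic smoothness proofs below each exhibit such a set.\<close>

lemma smooth_fun_coinduct: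
 assumes "phi : S" and "!!psi x. psi : S ==> psi differentiable (at x)"
  and "!!psi i. psi : S ==> pdv i psi : S"
 shows "smooth_fun phi"
proof -
 have "pderivs is phi : S" for "is" by (induction "is") (use assms in auto)
 thus ?thesis using assms(2) by (auto simp: smooth_fun_def)
qed

lemma smooth_fun_differentiable: "smooth_fun phi ==> phi differentiable (at x)" unfolding smooth_fun_def by (metis pderivs.simps(1))

text \<open>\<open>pderivs\<close> exposes the derivative taken last. This form exposes the one
  taken first, as needed to pass from a smooth function to its partial derivatives.\<close>

lemma pderivs_snoc: "pderivs (is @ [i]) phi = pderivs is (pdv i phi)" by (induction "is") auto

lemma smooth_fun_pdv: "smooth_fun phi ==> smooth_fun (pdv i phi)" unfolding smooth_fun_def by (metis pderivs_snoc)

lemma smooth_fun_has_derivative: "smooth_fun phi ==> (phi has_derivative frechet_derivative phi (at x)) (at x)"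
 using smooth_fun_differentiable frechet_derivative_works by blast

lemma smooth_fun_continuous: "smooth_fun phi ==> continuous_on S phi"
 by (meson continuous_at_imp_continuous_on differentiable_imp_continuous_within smooth_fun_differentiable)

lemma smooth_fun_borel: "smooth_fun phi ==> phi : borel_measurable borel" by (intro borel_measurable_continuous_onI smooth_fun_continuous)

lemma frechet_derivative_pdv:
 assumes "phi differentiable (at x)"
 shows "frechet_derivative phi (at x) h = (\<Sum>i\<in>UNIV. h $ i * pdv i phi x)"
proof -
 have l: "linear (frechet_derivative phi (at x))" using assms linear_frechet_derivative by blast
 have "h = (\<Sum>i\<in>UNIV. (h $ i) *R axis i 1)" by (simp add: basis_expansion scalar_mult_eq_scaleR[symmetric])
 hence "frechet_derivative phi (at x) h = frechet_derivative phi (at x) (\<Sum>i\<in>UNIV. (h $ i) *R axis i 1)" by simp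
 also have "... = (\<Sum>i\<in>UNIV. h $ i * pdv i phi x)" by (simp add: linear_sum[OF l] linear_scale[OF l])
 finally show ?thesis .
qed

lemma pdv_eqI: "(phi has_derivative D) (at x) ==> pdv i phi x = D (axis i 1)" by (metis frechet_derivative_at)

lemma pdv_locally_const:
 assumes "open W" "x : W" "!!y. y : W ==> phi y = c" shows "pdv i phi x = 0"
proof -
 have "(phi has_derivative (%h. 0)) (at x)" by (rule has_derivative_transform_within_open[of "%x. c" _ _ UNIV W]) (use assms in auto)
 thus ?thesis by (rule pdv_eqI)
qed

lemma pdv_const [simp]: "pdv i (%x. c) = (%x. 0)" by (auto simp: fun_eq_iff)

lemma pdv_add:
 assumes "a differentiable (at x)" "b differentiable (at x)"
 shows "pdv i (%x. a x + b x) x = pdv i a x + pdv i b x" using assms by (subst pdv_eqI[OF has_derivative_add[of a _ _ b]])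
   (auto simp: frechet_derivative_works[symmetric])

lemma pdv_mult:
 assumes "a differentiable (at x)" "b differentiable (at x)"
 shows "pdv i (%x. a x * b x) x = a x * pdv i b x + pdv i a x * b x" using assms by (subst pdv_eqI[OF has_derivative_mult[of a _ _ _ b]])
   (auto simp: frechet_derivative_works[symmetric])

section \<open>Stability of smooth functions under algebraic operations and affine
  substitutions\<close>

text \<open>The product rule turns a product into a sum of products, so products of two smooth
  functions do not form a visibly stable set; the algebra generated by the smooth functions
  does.\<close>

inductive_set smooth_alg :: "(real^'d => real) set" where base: "smooth_fun a ==> a : smooth_alg"
| add: "a : smooth_alg ==> b : smooth_alg ==> (%x. a x + b x) : smooth_alg"
| mult: "a : smooth_alg ==> b : smooth_alg ==> (%x. a x * b x) : smooth_alg"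

lemma smooth_alg_differentiable: "a : smooth_alg ==> a differentiable (at x)"
proof (induction rule: smooth_alg.induct)
 case (base a) thus ?case by (rule smooth_fun_differentiable)
next
 case (add a b) thus ?case by (intro differentiable_add)
next
 case (mult a b) thus ?case by (intro differentiable_mult)
qed

lemma smooth_alg_pdv: "a : smooth_alg ==> pdv i a : smooth_alg"
proof (induction rule: smooth_alg.induct)
 case (base a) thus ?case by (rule smooth_alg.base[OF smooth_fun_pdv])
next
 case (add a b)
 have "pdv i (%x. a x + b x) = (%x. pdv i a x + pdv i b x)" by (rule ext, rule pdv_add) (rule smooth_alg_differentiable add)+
 with smooth_alg.add[OF add(3,4)] show ?case by (simp only:)
next
 case (mult a b)
 have "pdv i (%x. a x * b x) = (%x. a x * pdv i b x + pdv i a x * b x)" by (rule ext, rule pdv_mult) (rule smooth_alg_differentiable mult)+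
 with smooth_alg.add[OF smooth_alg.mult[OF mult(1,4)] smooth_alg.mult[OF mult(3,2)]] show ?case by (simp only:)
qed

lemma smooth_alg_smooth: assumes "a : smooth_alg" shows "smooth_fun a"
 by (rule smooth_fun_coinduct[of a smooth_alg]) (rule assms smooth_alg_differentiable smooth_alg_pdv, assumption?)+

lemma smooth_fun_add: "smooth_fun a ==> smooth_fun b ==> smooth_fun (%x. a x + b x)"
 and smooth_fun_mult: "smooth_fun a ==> smooth_fun b ==> smooth_fun (%x. a x * b x)"
 by (rule smooth_alg_smooth[OF smooth_alg.add[OF smooth_alg.base smooth_alg.base]]
   smooth_alg_smooth[OF smooth_alg.mult[OF smooth_alg.base smooth_alg.base]]; assumption)+

lemma smooth_fun_const: "smooth_fun (%x. c)" by (rule smooth_fun_coinduct[of _ "range (%c x. c)"]) auto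

lemma smooth_fun_sum: "(!!i. i : I ==> smooth_fun (f i)) ==> smooth_fun (%x. \<Sum>i\<in>I. f i x)"
 by (induction I rule: infinite_finite_induct) (auto intro: smooth_fun_const smooth_fun_add)

lemma affine_pdv:
 assumes "psi differentiable (at (c *R x + b))"
 shows "((%x. k * psi (c *R x + b)) has_derivative (%h. k * frechet_derivative psi (at (c *R x + b)) (c *R h))) (at x)"
  "pdv i (%x. k * psi (c *R x + b)) x = k * c * pdv i psi (c *R x + b)"
proof -
 have "((%x. c *R x + b) has_derivative (%h. c *R h)) (at x)" by (auto intro!: derivative_eq_intros)
 from diff_chain_at[OF this] assms
 have "((%x. psi (c *R x + b)) has_derivative (%h. frechet_derivative psi (at (c *R x + b)) (c *R h))) (at x)"
  by (auto simp: frechet_derivative_works o_def)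
 thus 1: "((%x. k * psi (c *R x + b)) has_derivative (%h. k * frechet_derivative psi (at (c *R x + b)) (c *R h))) (at x)"
  by (auto intro!: derivative_eq_intros)
 have "linear (frechet_derivative psi (at (c *R x + b)))" using assms linear_frechet_derivative by blast
 thus "pdv i (%x. k * psi (c *R x + b)) x = k * c * pdv i psi (c *R x + b)" by (subst pdv_eqI[OF 1]) (simp add: linear_scale)
qed

lemma smooth_fun_affine:
 assumes "smooth_fun phi" shows "smooth_fun (%x. phi (c *R x + b))"
\<comment> \<open>The chain rule brings out a factor \<open>c\<close>, so the stable set has to
  carry a scalar \<open>k\<close>.\<close>
proof (rule smooth_fun_coinduct[of _ "{%x. k * psi (c *R x + b) |k psi. smooth_fun psi}"])
 show "(%x. phi (c *R x + b)) : {%x. k * psi (c *R x + b) |k psi. smooth_fun psi}"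
  using assms by (intro CollectI exI[of _ 1] exI[of _ phi]) auto
 show "f differentiable at x" if "f : {%x. k * psi (c *R x + b) |k psi. smooth_fun psi}" for f x
  using that affine_pdv(1) smooth_fun_differentiable by (fastforce simp: differentiable_def)
 show "pdv i f : {%x. k * psi (c *R x + b) |k psi. smooth_fun psi}"
  if f: "f : {%x. k * psi (c *R x + b) |k psi. smooth_fun psi}" for f i
 proof -
  obtain k psi where k: "f = (%x. k * psi (c *R x + b))" "smooth_fun psi" using f by auto
  have "pdv i f = (%x. (k * c) * pdv i psi (c *R x + b))" unfolding k(1) by (rule ext, rule affine_pdv(2)) (rule smooth_fun_differentiable k)+
  moreover have "smooth_fun (pdv i psi)" by (rule smooth_fun_pdv k)+
  ultimately show ?thesis by (intro CollectI exI[of _ "k * c"] exI[of _ "pdv i psi"]) simp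
 qed
qed

lemma smooth_fun_reflect: "smooth_fun phi ==> smooth_fun (%y. phi (x - y))" using smooth_fun_affine[of phi "-1" x] by simp

lemma pdv_reflect: "smooth_fun phi ==> pdv i (%y. phi (x - y)) y = - pdv i phi (x - y)"
 using affine_pdv(2)[of phi "-1" y x 1 i] smooth_fun_differentiable[of phi "x - y"] by simp

section \<open>A smooth function with compact support\<close>

text \<open>The case \<open>n = 0\<close> is the usual flat exponential. Its derivatives bring in
  powers of 1/t; with \<open>n\<close> as a parameter the family is stable under differentiation up
  to linear combinations.\<close>

definition exp_cutoff_pow :: "nat => real => real" where "exp_cutoff_pow n t = (if t <= 0 then 0 else (1 / t) ^ n * exp (- (1 / t)))"

lemma exp_cutoff_pow_derivative: "(exp_cutoff_pow n has_real_derivative (- real n * exp_cutoff_pow (Suc n) t + exp_cutoff_pow (Suc (Suc n)) t)) (at t)"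
proof -
 consider "t < 0" | "t > 0" | "t = 0" by linarith
 thus ?thesis
 proof cases
  case 1
  have "((%t. 0) has_real_derivative 0) (at t)" by simp
  hence "(exp_cutoff_pow n has_real_derivative 0) (at t)" by (rule DERIV_cong_ev[THEN iffD1, rotated -1, OF _ refl])
    (use 1 in \<open>auto simp: exp_cutoff_pow_def intro!: eventually_mono[OF eventually_nhds_in_open[of "{..<0}" t]]\<close>)
  thus ?thesis using 1 by (simp add: exp_cutoff_pow_def)
 next
  case 2
  have "((%t. (1 / t) ^ n * exp (- (1 / t))) has_real_derivative
    (- real n * ((1 / t) ^ Suc n * exp (- (1 / t))) + (1 / t) ^ Suc (Suc n) * exp (- (1 / t)))) (at t)"
  proof -
   have "((%t. inverse t ^ n) has_real_derivative (- real n * inverse t ^ Suc n)) (at t)" using DERIV_power[OF DERIV_inverse[of t], of n] 2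
    by (cases n) (auto simp: algebra_simps power2_eq_square numeral_2_eq_2)
   moreover have "((%t. exp (- inverse t)) has_real_derivative (inverse t ^ 2 * exp (- inverse t))) (at t)"
    using 2 by (auto intro!: derivative_eq_intros simp: power2_eq_square)
   ultimately have "((%t. inverse t ^ n * exp (- inverse t)) has_real_derivative
     ((- real n * inverse t ^ Suc n) * exp (- inverse t) + (inverse t ^ 2 * exp (- inverse t)) * inverse t ^ n)) (at t)" by (rule DERIV_mult)
   thus ?thesis by (simp add: inverse_eq_divide power2_eq_square algebra_simps)
  qed
  hence "(exp_cutoff_pow n has_real_derivative (- real n * ((1 / t) ^ Suc n * exp (- (1 / t))) + (1 / t) ^ Suc (Suc n) * exp (- (1 / t)))) (at t)"
   by (rule DERIV_cong_ev[THEN iffD1, rotated -1, OF _ refl])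
    (use 2 in \<open>auto simp: exp_cutoff_pow_def intro!: eventually_mono[OF eventually_nhds_in_open[of "{0<..}" t]]\<close>)
  thus ?thesis using 2 by (simp add: exp_cutoff_pow_def)
 next
  case 3
  \<comment> \<open>From the right, the difference quotient at 0 is (1/h)^(n+1) exp(-1/h). It tends
    to 0 because exponentials beat powers, here in the variable 1/h.\<close>
  have "((%x::real. x ^ Suc n / exp x) \<longlongrightarrow> 0) at_top" by (rule tendsto_power_div_exp_0)
  hence "((%h::real. (1/h) ^ Suc n / exp (1/h)) \<longlongrightarrow> 0) (at_right 0)"
   by (rule filterlim_compose) (simp add: filterlim_inverse_at_top_right divide_inverse)
  hence "((%h. exp_cutoff_pow n h / h) \<longlongrightarrow> 0) (at_right 0)" by (rule tendsto_cong[THEN iffD1, rotated])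
    (auto simp: exp_cutoff_pow_def eventually_at_right_less exp_minus field_simps intro!: eventually_mono[OF eventually_at_right_less[of 0]])
  moreover have "((%h. exp_cutoff_pow n h / h) \<longlongrightarrow> 0) (at_left 0)" by (rule tendsto_cong[THEN iffD1, rotated, OF tendsto_const])
    (auto simp: exp_cutoff_pow_def eventually_at_left_field intro!: exI[of _ "-1"])
  ultimately have "((%h. exp_cutoff_pow n h / h) \<longlongrightarrow> 0) (at 0)" by (simp add: filterlim_split_at)
  thus ?thesis using 3 by (simp add: DERIV_def exp_cutoff_pow_def)
 qed
qed

lemma bump_has_derivative:
 assumes "a differentiable (at x)"
 defines "E \<equiv> %n x. exp_cutoff_pow n (1 - x \<bullet> x)"
 shows "((%x. a x * E n x) has_derivative
  (%h. a x * ((- real n * E (Suc n) x + E (Suc (Suc n)) x) * (- 2 * (x \<bullet> h))) + frechet_derivative a (at x) h * E n x)) (at x)"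
proof -
 have "((%x. 1 - x \<bullet> x) has_derivative (%h. - 2 * (x \<bullet> h))) (at x)"
  by (auto intro!: derivative_eq_intros simp: inner_commute)
 from has_derivative_compose[OF this exp_cutoff_pow_derivative[unfolded has_field_derivative_def]]
 have "(E n has_derivative (%h. (- real n * E (Suc n) x + E (Suc (Suc n)) x) * (- 2 * (x \<bullet> h)))) (at x)" unfolding E_def .
 moreover have "(a has_derivative frechet_derivative a (at x)) (at x)" using assms(1) frechet_derivative_works by blast
 ultimately show ?thesis by (rule has_derivative_mult[rotated])
qed

lemma smooth_fun_nth: "smooth_fun (%x :: real^'d. x $ i)"
proof (rule smooth_fun_coinduct[of _ "insert (%x. x $ i) (range (%c x. c))"])
 have d: "((%x. x $ i) has_derivative (%h. h $ i)) (at x)" for x :: "real^'d"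
  by (rule bounded_linear.has_derivative[OF bounded_linear_vec_nth has_derivative_ident])
 have p: "pdv j (%x. x $ i) = (%x. axis j 1 $ i)" for j :: 'd by (rule ext, rule pdv_eqI[OF d])
 show "psi differentiable (at x)" if "psi : insert (%x. x $ i) (range (%c x. c))" for psi and x :: "real^'d"
  using that differentiableI[OF d] by auto
 show "pdv j psi : insert (%x. x $ i) (range (%c x. c))" if "psi : insert (%x. x $ i) (range (%c x. c))" for psi and j :: 'd
  using that p[of j] by (auto simp: pdv_const)
qed simp

text \<open>The inner derivative of 1 - |x|^2 contributes coordinate factors, so the coefficients
  have to be smooth functions instead of constants.\<close>

inductive_set bump_span :: "(real^'d => real) set" where
 base: "smooth_fun a ==> (%x. a x * exp_cutoff_pow n (1 - x \<bullet> x)) : bump_span"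
| add: "a : bump_span ==> b : bump_span ==> (%x. a x + b x) : bump_span"

lemma bump_span_differentiable: "a : bump_span ==> a differentiable (at x)"
proof (induction rule: bump_span.induct)
 case (base a n) thus ?case using bump_has_derivative[OF smooth_fun_differentiable] unfolding differentiable_def by blast
qed (rule differentiable_add)

lemma smooth_fun_bump: "smooth_fun (%x :: real^'d. exp_cutoff_pow 0 (1 - x \<bullet> x))"
proof (rule smooth_fun_coinduct[of _ bump_span])
 show "(%x :: real^'d. exp_cutoff_pow 0 (1 - x \<bullet> x)) : bump_span" using bump_span.base[OF smooth_fun_const[of 1], of 0] by simp
 show "pdv i a : bump_span" if "a : bump_span" for a :: "real^'d => real" and i using that
 proof induction
  case (base a n)
  note sm = smooth_fun_mult[OF base smooth_fun_mult[OF smooth_fun_const smooth_fun_nth]]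
  have "pdv i (%x. a x * exp_cutoff_pow n (1 - x \<bullet> x)) = (%x. (a x * (2 * real n * x $ i)) * exp_cutoff_pow (Suc n) (1 - x \<bullet> x) +
   ((a x * ((- 2) * x $ i)) * exp_cutoff_pow (Suc (Suc n)) (1 - x \<bullet> x) + pdv i a x * exp_cutoff_pow n (1 - x \<bullet> x)))"
   by (rule ext, subst pdv_eqI[OF bump_has_derivative[OF smooth_fun_differentiable[OF base]]])
    (simp add: inner_axis algebra_simps)
  moreover have "... : bump_span" by (intro bump_span.add bump_span.base smooth_fun_pdv base sm)
  ultimately show ?case by (simp only:)
 next
  case (add a b)
  have "pdv i (%x. a x + b x) = (%x. pdv i a x + pdv i b x)" by (rule ext, rule pdv_add) (rule bump_span_differentiable add)+
  with bump_span.add[OF add(3,4)] show ?case by (simp only:)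
 qed
qed (rule bump_span_differentiable)

subsection \<open>Test functions and convolutions\<close>

lemma sum_axis_mult: "(\<Sum>j\<in>UNIV. axis i 1 $ j * c j) = (c i :: real)"
proof -
 have "(\<Sum>j\<in>UNIV. axis i 1 $ j * c j) = (\<Sum>j\<in>UNIV. if i = j then c j else 0)" by (rule sum.cong) (auto simp: axis_def)
 thus ?thesis by simp
qed

lemma test_fun_mono: "test_fun D phi ==> D <= D' ==> test_fun D' phi" by (auto simp: test_fun_def)

lemma test_fun_smooth: "test_fun D phi ==> smooth_fun phi" by (simp add: test_fun_def)

lemma test_fun_outside: "test_fun D phi ==> x ~: D ==> phi x = 0"
 unfolding test_fun_def using closure_subset[of "{x. phi x ~= 0}"] by blast

lemma test_funI:
 assumes "smooth_fun phi" "compact K" "K <= D" "!!x. x ~: K ==> phi x = 0"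
 shows "test_fun D phi"
proof -
 have "closure {x. phi x ~= 0} <= K" using assms by (intro closure_minimal compact_imp_closed) auto
 thus ?thesis using assms by (auto simp: test_fun_def compact_eq_bounded_closed intro: bounded_subset)
qed

lemma test_funE:
 assumes "test_fun D phi"
 obtains K where "smooth_fun phi" "compact K" "K <= D" "!!x. x ~: K ==> phi x = 0"
  "!!x i. x ~: K ==> pdv i phi x = 0"
proof (rule that[of "closure {x. phi x ~= 0}"])
 show 0: "phi x = 0" if "x ~: closure {x. phi x ~= 0}" for x using that closure_subset[of "{x. phi x ~= 0}"] by blast
 show "pdv i phi x = 0" if x: "x ~: closure {x. phi x ~= 0}" for x i
 proof -
  have "(phi has_derivative (%h. 0)) (at x)"
  proof (rule has_derivative_transform_within_open[of "%x. 0" _ _ UNIV "- closure {x. phi x ~= 0}"])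
   show "0 = phi y" if "y : - closure {x. phi x ~= 0}" for y using 0[of y] that by simp
  qed (use x in auto)
  thus ?thesis by (rule pdv_eqI)
 qed
qed (use assms in "auto simp: test_fun_def")

lemma test_fun_pdv: assumes "test_fun D phi" shows "test_fun D (pdv i phi)"
proof -
 obtain K where K: "smooth_fun phi" "compact K" "K <= D" "!!x i. x ~: K ==> pdv i phi x = 0"
  using assms by (rule test_funE) blast
 show ?thesis by (rule test_funI[OF smooth_fun_pdv[OF K(1)] K(2,3,4)])
qed

lemma test_fun_mult: assumes "smooth_fun a" "test_fun D phi" shows "test_fun D (%x. a x * phi x)"
proof -
 obtain K where K: "smooth_fun phi" "compact K" "K <= D" "!!x. x ~: K ==> phi x = 0" using assms(2) by (rule test_funE) blast
 show ?thesis by (rule test_funI[OF smooth_fun_mult[OF assms(1) K(1)] K(2,3)]) (simp add: K(4))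
qed

lemma test_fun_bounded:
 assumes "test_fun D phi" obtains B where "B >= 0" "!!x. abs (phi x) <= B"
proof -
 obtain K where K: "smooth_fun phi" "compact K" "!!x. x ~: K ==> phi x = 0" using assms by (rule test_funE) blast
 have "bounded (phi ` K)" by (intro compact_imp_bounded compact_continuous_image smooth_fun_continuous K)
 then obtain B where B: "!!x. x : K ==> abs (phi x) <= B" by (auto simp: bounded_iff)
 have "abs (phi x) <= max B 0" for x using B[of x] K(3)[of x] by (cases "x : K") auto
 thus ?thesis using that[of "max B 0"] by simp
qed

lemma test_fun_integrable: assumes "test_fun D phi" shows "integ phi"
proof -
 obtain K where K: "smooth_fun phi" "compact K" "!!x. x ~: K ==> phi x = 0" using assms by (rule test_funE) blast
 have "set_integrable lborel K phi" by (rule borel_integrable_compact[OF K(2) smooth_fun_continuous[OF K(1)], folded set_integrable_def])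
 moreover have "(%x. ind K x *R phi x) = phi" using K(3) by (auto simp: indicator_def fun_eq_iff)
 ultimately have "integrable lborel phi" by (simp add: set_integrable_def)
 thus ?thesis using integrable_completion borel_measurable_integrable by blast
qed

section \<open>Lipschitz and Taylor estimates for test functions\<close>

lemma abs_pdv_sum_le:
 fixes h :: "real^'d"
 assumes "!!i. abs (c i) <= B" "B >= 0"
 shows "abs (\<Sum>i\<in>UNIV. h $ i * c i) <= real CARD('d) * B * norm h"
proof -
 have "abs (\<Sum>i\<in>UNIV. h $ i * c i) <= (\<Sum>i\<in>(UNIV::'d set). norm h * B)" by (rule order_trans[OF sum_abs], rule sum_mono)
    (simp add: abs_mult mult_mono component_le_norm_cart assms)
 thus ?thesis by (simp add: mult_ac)
qed

lemma differentiable_lipschitz: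
 fixes phi :: "real^'d => real"
 assumes "!!y. y : S ==> phi differentiable (at y)" "convex S" "B >= 0"
  "!!y i. y : S ==> abs (pdv i phi y) <= B" "x : S" "y : S"
 shows "abs (phi x - phi y) <= real CARD('d) * B * norm (x - y)"
proof -
 have "norm (phi x - phi y) <= real CARD('d) * B * norm (x - y)"
 proof (rule differentiable_bound[OF assms(2) _ _ assms(5,6)])
  show "(phi has_derivative frechet_derivative phi (at z)) (at z within S)" if "z : S" for z
   using assms(1)[OF that] by (simp add: frechet_derivative_works has_derivative_at_withinI)
  show "onorm (frechet_derivative phi (at z)) <= real CARD('d) * B" if "z : S" for z
  proof (rule onorm_le)
   fix h
   show "norm (frechet_derivative phi (at z) h) <= real CARD('d) * B * norm h" unfolding real_norm_def frechet_derivative_pdv[OF assms(1)[OF that], of h]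
    by (rule abs_pdv_sum_le) (use that assms(3,4) in auto)
  qed
 qed
 thus ?thesis by simp
qed

lemma test_fun_lipschitz:
 fixes phi :: "real^'d => real"
 assumes "test_fun D phi" obtains C where "C >= 0" "!!x y. abs (phi x - phi y) <= C * norm (x - y)"
proof -
 have "EX B>=0. ALL x. abs (pdv i phi x) <= B" for i using test_fun_bounded[OF test_fun_pdv[OF assms, of i]] by metis
 then obtain B where B: "!!i. B i >= 0" "!!i x. abs (pdv i phi x) <= B i" by metis
 have "B i <= sum B UNIV" for i by (rule member_le_sum) (use B in auto)
 hence "abs (pdv i phi x) <= sum B UNIV" for i x using B(2) order_trans by blast
 hence "abs (phi x - phi y) <= real CARD('d) * sum B UNIV * norm (x - y)" for x y by (intro differentiable_lipschitz[where S=UNIV])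
   (auto simp: smooth_fun_differentiable test_fun_smooth[OF assms] sum_nonneg B)
 thus ?thesis using that[of "real CARD('d) * sum B UNIV"] by (simp add: sum_nonneg B)
qed

text \<open>Subtract from \<open>phi\<close> its linear part at \<open>x\<close>. The partial
  derivatives of the difference are increments of those of \<open>phi\<close>, hence at most a
  constant times |h| on the ball of radius |h|, and the mean value inequality gives the second
  factor |h|. The constant is uniform in \<open>x\<close>.\<close>

lemma test_fun_taylor:
 fixes phi :: "real^'d => real"
 assumes "test_fun D phi"
 shows "EX C>=0. ALL x h. abs (phi (x + h) - phi x - (\<Sum>i\<in>UNIV. h $ i * pdv i phi x)) <= C * norm h ^ 2"
proof -
 have sm: "smooth_fun phi" using assms test_fun_smooth by blast
 have "EX B>=0. ALL x y. abs (pdv i phi x - pdv i phi y) <= B * norm (x - y)" for i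
  using test_fun_lipschitz[OF test_fun_pdv[OF assms, of i]] by metis
 then obtain B where B: "!!i. B i >= 0" "!!i x y. abs (pdv i phi x - pdv i phi y) <= B i * norm (x - y)" by metis
 define M where "M = sum B UNIV"
 have M: "M >= 0" "B i <= M" for i unfolding M_def by (rule sum_nonneg member_le_sum; use B in auto)+
 have "abs (phi (x + h) - phi x - (\<Sum>i\<in>UNIV. h $ i * pdv i phi x)) <= (real CARD('d) * M) * norm h ^ 2" for x h
 proof -
  define g where "g y = phi y - (\<Sum>i\<in>UNIV. (y - x) $ i * pdv i phi x)" for y
  have gd: "(g has_derivative (%h. frechet_derivative phi (at y) h - (\<Sum>i\<in>UNIV. h $ i * pdv i phi x))) (at y)" for y
  proof -
   have "((%y. (y - x) $ i) has_derivative (%h. h $ i)) (at y)" for i by (rule bounded_linear.has_derivative[OF bounded_linear_vec_nth])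
     (auto intro!: derivative_eq_intros)
   thus ?thesis unfolding g_def by (intro has_derivative_diff has_derivative_sum has_derivative_mult_left smooth_fun_has_derivative sm)
  qed
  have gp: "pdv i g y = pdv i phi y - pdv i phi x" for i y unfolding pdv_eqI[OF gd[of y]] sum_axis_mult ..
  have "abs (g (x + h) - g x) <= real CARD('d) * (M * norm h) * norm (x + h - x)"
  proof (rule differentiable_lipschitz[where S="cball x (norm h)"])
   show "g differentiable (at y)" for y using gd by (auto simp: differentiable_def)
   show "abs (pdv i g y) <= M * norm h" if "y : cball x (norm h)" for i y
   proof -
    have "abs (pdv i g y) <= B i * norm (y - x)" unfolding gp by (rule B)
    also have "... <= M * norm h" using that M B by (intro mult_mono) (auto simp: dist_norm norm_minus_commute)
    finally show ?thesis .
   qed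
  qed (auto simp: M dist_norm)
  thus ?thesis by (simp add: g_def power2_eq_square algebra_simps)
 qed
 moreover have "0 <= real CARD('d) * M" using M by simp
 ultimately show ?thesis by blast
qed

section \<open>Convolution with a test function\<close>

definition conv :: "(real^'d => real) => (real^'d => real) => real^'d => real" where
 "conv u psi x = (LI y. u y * psi (x - y))"

lemma measurable_lebesgue_borelI: "f : borel_measurable borel ==> f : BL" by (rule measurable_completion) simp

lemma smooth_fun_reflect_measurable: "smooth_fun psi ==> (%y. psi (x - y)) : BL"
 by (intro measurable_lebesgue_borelI smooth_fun_borel smooth_fun_reflect)

lemma integrable_mult_bounded:
 fixes u w :: "'a => real"
 assumes "integrable M u" "w : borel_measurable M" "!!y. abs (w y) <= B"
 shows "integrable M (%y. u y * w y)"
proof (rule Bochner_Integration.integrable_bound[of _ "%y. B * u y"])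
 show "AE x in M. norm (u x * w x) <= norm (B * u x)"
 proof (rule AE_I2)
  fix x
  have "abs (w x) <= abs B" using assms(3)[of x] by linarith
  thus "norm (u x * w x) <= norm (B * u x)" using mult_left_mono[of "abs (w x)" "abs B" "abs (u x)"] by (simp add: abs_mult mult.commute)
 qed
qed (use assms in auto)

lemma conv_integrable:
 assumes "integ u" "test_fun D psi"
 shows "integ (%y. u y * psi (x - y))"
proof -
 obtain B where "!!x. abs (psi x) <= B" using test_fun_bounded[OF assms(2)] by metis
 thus ?thesis by (intro integrable_mult_bounded[OF assms(1), of _ B] smooth_fun_reflect_measurable test_fun_smooth[OF assms(2)])
qed

text \<open>The Taylor remainder of \<open>psi\<close> is uniform in the base point. Differentiating
  under the integral thus costs at most C |h|^2 times the integral of |u|, and integrability of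
  \<open>u\<close> is all that is asked of it.\<close>

lemma conv_has_derivative:
 fixes psi :: "real^'d => real"
 assumes u: "integ u" and t: "test_fun D psi"
 shows "(conv u psi has_derivative (%h. \<Sum>i\<in>UNIV. h $ i * conv u (pdv i psi) x)) (at x)"
proof -
 obtain C where C: "C >= 0" "ALL x h. abs (psi (x + h) - psi x - (\<Sum>i\<in>UNIV. h $ i * pdv i psi x)) <= C * norm h ^ 2"
  using test_fun_taylor[OF t] by (elim exE conjE) (rule that)
 define I where "I = (LI y. abs (u y))"
 have I: "I >= 0" unfolding I_def by simp
 have int: "integ (%y. u y * psi (x - y))" "integ (%y. u y * pdv i psi (x - y))" for x i
  using conv_integrable[OF u t] conv_integrable[OF u test_fun_pdv[OF t]] by auto
 have est: "abs (conv u psi (x + h) - conv u psi x - (\<Sum>i\<in>UNIV. h $ i * conv u (pdv i psi) x)) <= C * I * norm h ^ 2" for h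
 proof -
  define w where "w y = u y * psi (x + h - y) - u y * psi (x - y) - (\<Sum>i\<in>UNIV. h $ i * (u y * pdv i psi (x - y)))" for y
  have wi: "integ w" unfolding w_def by (intro Bochner_Integration.integrable_diff Bochner_Integration.integrable_sum integrable_mult_right int)
  have wb: "abs (w y) <= C * norm h ^ 2 * abs (u y)" for y
  proof -
   have "w y = u y * (psi ((x - y) + h) - psi (x - y) - (\<Sum>i\<in>UNIV. h $ i * pdv i psi (x - y)))" by (simp add: w_def algebra_simps sum_distrib_left)
   thus ?thesis using mult_left_mono[OF C(2)[rule_format, of "x - y" h], of "abs (u y)"] by (simp add: abs_mult mult_ac)
  qed
  have eq: "conv u psi (x + h) - conv u psi x - (\<Sum>i\<in>UNIV. h $ i * conv u (pdv i psi) x)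
   = (LI y. u y * psi (x + h - y) - u y * psi (x - y) - (\<Sum>i\<in>UNIV. h $ i * (u y * pdv i psi (x - y))))"
  proof -
   have "(LI y. u y * psi (x + h - y) - u y * psi (x - y) - (\<Sum>i\<in>UNIV. h $ i * (u y * pdv i psi (x - y))))
    = (LI y. u y * psi (x + h - y)) - (LI y. u y * psi (x - y)) - (LI y. (\<Sum>i\<in>UNIV. h $ i * (u y * pdv i psi (x - y))))"
    by (simp only: Bochner_Integration.integral_diff[OF Bochner_Integration.integrable_diff[OF int(1) int(1)]
       Bochner_Integration.integrable_sum[OF integrable_mult_right[OF int(2)]]] Bochner_Integration.integral_diff[OF int(1) int(1)])
   moreover have "(LI y. (\<Sum>i\<in>UNIV. h $ i * (u y * pdv i psi (x - y)))) = (\<Sum>i\<in>UNIV. h $ i * (LI y. u y * pdv i psi (x - y)))"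
    by (simp only: Bochner_Integration.integral_sum[OF integrable_mult_right[OF int(2)]] integral_mult_right_zero)
   ultimately show ?thesis unfolding conv_def by (simp only:)
  qed
  have "abs (LI y. w y) <= (LI y. abs (w y))" by (rule integral_abs_bound)
  also have "(LI y. abs (w y)) <= (LI y. C * norm h ^ 2 * abs (u y))" by (rule integral_mono) (use u wi wb in auto)
  also have "... = C * I * norm h ^ 2" by (simp add: I_def)
  finally show ?thesis unfolding eq w_def .
 qed
 show ?thesis unfolding has_derivative_at
 proof (intro conjI)
  show "bounded_linear (%h. \<Sum>i\<in>UNIV. h $ i * conv u (pdv i psi) x)"
   by (intro bounded_linear_sum bounded_linear_mult_const bounded_linear_vec_nth)
  have "((%h::real^'d. C * I * norm h) \<longlongrightarrow> C * I * norm (0::real^'d)) (at 0)" by (intro tendsto_intros)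
  hence "((%h::real^'d. C * I * norm h) \<longlongrightarrow> 0) (at 0)" by simp
  thus "(%h. norm (conv u psi (x + h) - conv u psi x - (\<Sum>i\<in>UNIV. h $ i * conv u (pdv i psi) x)) / norm h) \<midarrow>0\<rightarrow> 0"
  proof (rule Lim_null_comparison[rotated])
   show "\<forall>\<^sub>F h in at 0. norm (norm (conv u psi (x + h) - conv u psi x - (\<Sum>i\<in>UNIV. h $ i * conv u (pdv i psi) x)) / norm h) <= C * I * norm h"
   proof (intro always_eventually allI)
    fix h :: "real^'d"
    show "norm (norm (conv u psi (x + h) - conv u psi x - (\<Sum>i\<in>UNIV. h $ i * conv u (pdv i psi) x)) / norm h) <= C * I * norm h"
     using est[of h] by (cases "h = 0") (auto simp: divide_le_eq power2_eq_square mult_ac)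
   qed
  qed
 qed
qed

lemma conv_pdv:
 assumes "integ u" "test_fun D psi"
 shows "pdv i (conv u psi) = conv u (pdv i psi)" by (rule ext, subst pdv_eqI[OF conv_has_derivative[OF assms]]) (rule sum_axis_mult)

lemma conv_smooth:
 assumes "integ u" "test_fun D psi"
 shows "smooth_fun (conv u psi)"
proof (rule smooth_fun_coinduct[of _ "{conv u psi |psi. test_fun D psi}"])
 show "conv u psi : {conv u psi |psi. test_fun D psi}" using assms by blast
 show "f differentiable (at x)" if "f : {conv u psi |psi. test_fun D psi}" for f x
  using that conv_has_derivative[OF assms(1)] by (auto simp: differentiable_def)
 show "pdv i f : {conv u psi |psi. test_fun D psi}" if f: "f : {conv u psi |psi. test_fun D psi}" for f i
 proof -
  obtain psi where "f = conv u psi" "test_fun D psi" using f by auto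
  thus ?thesis using conv_pdv[OF assms(1)] test_fun_pdv[of D psi i] by auto
 qed
qed

subsection \<open>Affine changes of variables\<close>

lemma nn_integral_lborel_affine:
 fixes f :: "'a::euclidean_space => ennreal"
 assumes [measurable]: "f : borel_measurable borel" and c: "c ~= 0"
 shows "(NB x. f x) = ennreal (abs c ^ DIM('a)) * (NB x. f (t + c *R x))" by (subst lborel_affine[OF c, of t])
  (simp add: nn_integral_density nn_integral_distr nn_integral_cmult)

lemma lborel_integrable_affine_iff:
 fixes f :: "'a::euclidean_space => real"
 assumes c: "c ~= 0"
 shows "integrable lborel (%x. f (t + c *R x)) \<longleftrightarrow> integrable lborel f"
proof
 have *: "integrable lborel (%x. f (t + c *R x))" if f: "integrable lborel f" and c: "c ~= 0" for f :: "'a => real" and t c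
 proof (subst integrable_iff_bounded, intro conjI)
  have [measurable]: "f : borel_measurable borel" using f by auto
  show "(%x. f (t + c *R x)) : borel_measurable lborel" by measurable
  have "ennreal (abs c ^ DIM('a)) * (NB x. norm (f (t + c *R x))) < \<infinity>"
   using nn_integral_lborel_affine[of "%x. norm (f x)" c t] c f by (auto simp: integrable_iff_bounded)
  thus "(NB x. norm (f (t + c *R x))) < \<infinity>" using c by (auto simp: ennreal_mult_less_top zero_less_power)
 qed
 show "integrable lborel f ==> integrable lborel (%x. f (t + c *R x))" using * c by blast
 assume "integrable lborel (%x. f (t + c *R x))"
 from *[OF this, of "inverse c" "- (inverse c *R t)"] show "integrable lborel f" using c by (simp add: algebra_simps)
qed

lemma lborel_integral_affine:
 fixes f :: "'a::euclidean_space => real"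
 assumes [measurable]: "f : borel_measurable borel" and c: "c ~= 0"
 shows "(LINT x|lborel. f x) = abs c ^ DIM('a) * (LINT x|lborel. f (t + c *R x))" by (subst lborel_affine[OF c, of t])
  (simp add: integral_density integral_distr)

subsection \<open>Mollifiers and cut-off functions\<close>

text \<open>Positivity at the origin is recorded together with the usual properties: it lets a
  mollifier of larger scale dominate |h| times the gradient of one of smaller scale in
  \<open>pdv_moll_bound\<close>.\<close>

lemma ex_mollifier:
 "EX eta :: real^'d => real. smooth_fun eta & (ALL x. eta x >= 0) & (ALL x. norm x >= 1 --> eta x = 0)
   & (LINT x|lborel. eta x) = 1 & eta 0 > 0"
proof -
 define eta where "eta x = exp_cutoff_pow 0 (1 - x \<bullet> x)" for x :: "real^'d"
 have sm: "smooth_fun eta" unfolding eta_def by (rule smooth_fun_bump)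
 have nn: "eta x >= 0" for x by (simp add: eta_def exp_cutoff_pow_def)
 have supp: "eta x = 0" if "norm x >= 1" for x using one_le_power[OF that, of 2] by (simp add: eta_def exp_cutoff_pow_def dot_square_norm)
 have tf: "test_fun UNIV eta" by (rule test_funI[OF sm compact_cball[of 0 1]]) (auto intro: supp)
 have int: "integrable lborel eta" using test_fun_integrable[OF tf] integrable_completion[of eta lborel] smooth_fun_borel[OF sm] by simp
 have "eta 0 > 0" by (simp add: eta_def exp_cutoff_pow_def)
 have pos: "(LINT x|lborel. eta x) > 0"
 proof -
  have "(LINT x|lborel. eta x) ~= 0"
  proof
   assume "(LINT x|lborel. eta x) = 0"
   hence ae: "AE x in lborel. eta x = 0" using integral_nonneg_eq_0_iff_AE[OF int] nn by auto
   have "open {x. eta x > 0}" by (intro open_Collect_less continuous_intros smooth_fun_continuous sm)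
   moreover have "negligible {x. eta x > 0}"
   proof -
    have "AEL x. x ~: {x. eta x > 0}" using AE_completion[OF ae] by eventually_elim auto
    thus ?thesis by (simp add: AE_iff_null_sets negligible_iff_null_sets eventually_ae_filter) (meson null_sets_completion_subset)
   qed
   ultimately show False using \<open>eta 0 > 0\<close> open_not_negligible by blast
  qed
  moreover have "(LINT x|lborel. eta x) >= 0" by (simp add: nn)
  ultimately show ?thesis by simp
 qed
 define a where "a = inverse (LINT x|lborel. eta x)"
 have "smooth_fun (%x. a * eta x)" by (intro smooth_fun_mult smooth_fun_const sm)
 moreover have "a * eta x >= 0" for x using pos nn by (simp add: a_def)
 moreover have "(LINT x|lborel. a * eta x) = 1" using pos by (simp add: a_def)
 moreover have "a * eta 0 > 0" using pos \<open>eta 0 > 0\<close> by (simp add: a_def)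
 ultimately show ?thesis using supp by (intro exI[of _ "%x. a * eta x"]) auto
qed

definition mollifier_kernel :: "real^'d => real" where
 "mollifier_kernel = (SOME eta. smooth_fun eta & (ALL x. eta x >= 0) & (ALL x. norm x >= 1 --> eta x = 0)
   & (LINT x|lborel. eta x) = 1 & eta 0 > 0)"

definition moll :: "real => real^'d => real" where "moll eps x = inverse eps ^ CARD('d) * mollifier_kernel (inverse eps *R x)"

lemma mollifier_kernel:
 fixes x :: "real^'d"
 shows "smooth_fun (mollifier_kernel :: real^'d => real)" "mollifier_kernel x >= 0" "norm x >= 1 ==> mollifier_kernel x = 0"
 "(LINT x|lborel. mollifier_kernel (x :: real^'d)) = 1" "mollifier_kernel (0 :: real^'d) > 0"
 using someI_ex[OF ex_mollifier, folded mollifier_kernel_def] by blast+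

lemma moll_smooth: "smooth_fun (moll eps)" unfolding moll_def using smooth_fun_affine[OF mollifier_kernel(1), of "inverse eps" 0]
 by (intro smooth_fun_mult smooth_fun_const) simp

lemma moll_nonneg: "eps > 0 ==> moll eps x >= 0" by (simp add: moll_def mollifier_kernel)

lemma moll_outside: "eps > 0 ==> norm x >= eps ==> moll eps x = 0" by (simp add: moll_def mollifier_kernel field_simps)

lemma moll_test_fun: "eps > 0 ==> test_fun UNIV (moll eps)" by (rule test_funI[OF moll_smooth compact_cball[of 0 eps]]) (auto intro: moll_outside)

lemma moll_borel [measurable]: "moll eps : borel_measurable borel" by (rule smooth_fun_borel[OF moll_smooth])

lemma moll_integral: "eps > 0 ==> (LINT x|lborel. moll eps x) = 1" unfolding moll_def
 using lborel_integral_affine[of mollifier_kernel "inverse eps" 0] smooth_fun_borel[OF mollifier_kernel(1)] by (simp add: mollifier_kernel(4))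

lemma moll_integrable: "eps > 0 ==> integrable lborel (moll eps)"
 by (rule integrable_completion[THEN iffD1, OF _ test_fun_integrable[OF moll_test_fun]]) simp_all

lemma moll_nn_integral: "eps > 0 ==> (NB x. moll eps x) = 1"
 by (subst nn_integral_eq_integral[OF moll_integrable]) (simp_all add: moll_nonneg moll_integral)

lemma conv_lborel:
 assumes "integrable lborel u" "test_fun D psi"
 shows "integrable lborel (%y. u y * psi (x - y))" "conv u psi x = (LINT y|lborel. u y * psi (x - y))"
proof -
 have [measurable]: "u : borel_measurable borel" "psi : borel_measurable borel" using assms(1) smooth_fun_borel[OF test_fun_smooth[OF assms(2)]] by auto
 have "integ u" by (rule integrable_completion[THEN iffD2, OF _ assms(1)]) measurable
 from conv_integrable[OF this assms(2)] show 1: "integrable lborel (%y. u y * psi (x - y))"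
  by (rule integrable_completion[THEN iffD1, rotated]) measurable
 show "conv u psi x = (LINT y|lborel. u y * psi (x - y))" unfolding conv_def by (rule integral_completion) measurable
qed

lemma moll_reflect_integral:
 fixes x :: "real^'d"
 assumes "eps > 0"
 shows "integrable lborel (%y. moll eps (x - y))" "(LINT y|lborel. moll eps (x - y)) = 1" "(NB y. moll eps (x - y)) = 1"
proof -
 show 1: "integrable lborel (%y. moll eps (x - y))" using lborel_integrable_affine_iff[of "-1" "moll eps" x] moll_integrable[OF assms] by simp
 show 2: "(LINT y|lborel. moll eps (x - y)) = 1" using lborel_integral_affine[of "moll eps" "-1" x] moll_integral[OF assms, where 'a='d] by simp
 show "(NB y. moll eps (x - y)) = 1" by (subst nn_integral_eq_integral[OF 1]) (simp_all add: moll_nonneg assms 2)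
qed

text \<open>The indicator of the closed \<open>2 * delta\<close>-neighbourhood of \<open>K\<close>,
  mollified at scale \<open>delta\<close>, is 1 within distance \<open>delta\<close> of
  \<open>K\<close> and 0 beyond \<open>3 * delta\<close>, while the complement of \<open>V\<close>
  stays at distance at least \<open>4 * delta\<close>. The value 1 is attained on an open set, so
  the gradient vanishes there as well.\<close>

lemma ex_cutoff:
 fixes K V :: "(real^'d) set"
 assumes "compact K" "open V" "K <= V"
 obtains phi W where "test_fun V phi" "open W" "K <= W" "!!x. x : W ==> phi x = 1"
  "!!x. 0 <= phi x" "!!x. phi x <= 1"
proof -
 obtain d where d: "d > 0" "!!x y. x : K ==> y : - V ==> d <= dist x y"
  using separate_compact_closed[of K "- V"] assms by (metis (no_types, lifting) ComplD Int_emptyI closed_Compl subsetD)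
 define delta where "delta = d / 4"
 have delta: "delta > 0" using d by (simp add: delta_def)
 define N where "N r = (%(x, y). x + y) ` (K \<times> cball 0 r)" for r :: real
 have N: "compact (N r)" for r unfolding N_def using compact_Times[OF assms(1) compact_cball[of 0 r]]
  by (intro compact_continuous_image) (auto intro!: continuous_intros simp: case_prod_unfold)
 have Nmem: "z : N r \<longleftrightarrow> (EX x:K. norm (z - x) <= r)" for z r
  unfolding N_def by (force simp: image_iff intro: bexI[of _ "(x, z - x)" for x])
 have [measurable]: "N r : sets borel" for r by (intro borel_closed compact_imp_closed N)
 define u where "u = ind (N (2 * delta))"
 have ui: "integrable lborel u" unfolding u_def using N[of "2*delta"] emeasure_compact_finite[of "N (2*delta)"] by (auto simp: integrable_indicator_iff)
 note t = moll_test_fun[OF delta]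
 define phi where "phi = conv u (moll delta)"
 have phi: "phi x = (LINT y|lborel. u y * moll delta (x - y))" for x unfolding phi_def using conv_lborel[OF ui t] by simp
 have int: "integrable lborel (%y. u y * moll delta (x - y))" for x using conv_lborel[OF ui t] by simp
 have sm: "smooth_fun phi" unfolding phi_def by (rule conv_smooth[OF integrable_completion[THEN iffD2, OF _ ui] t]) (simp add: u_def)
 have 0: "0 <= phi x" for x unfolding phi by (rule Bochner_Integration.integral_nonneg) (simp add: u_def moll_nonneg delta)
 have 1: "phi x <= 1" for x unfolding phi moll_reflect_integral(2)[OF delta, of x, symmetric]
  by (rule integral_mono[OF int moll_reflect_integral(1)[OF delta]]) (auto simp: u_def indicator_def moll_nonneg delta)
 have out: "phi x = 0" if "x ~: N (3 * delta)" for x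
 proof -
  have "u y * moll delta (x - y) = 0" for y
  proof (cases "y : N (2 * delta)")
   case True
   then obtain k where k: "k : K" "norm (y - k) <= 2 * delta" using Nmem by auto
   have "norm (x - y) > delta" using that k norm_triangle_ineq[of "x - y" "y - k"] unfolding Nmem by (auto simp: not_le)
   thus ?thesis using moll_outside[OF delta, of "x - y"] by simp
  qed (simp add: u_def)
  thus ?thesis unfolding phi by (simp only: Bochner_Integration.integral_zero)
 qed
 have one: "phi z = 1" if zW: "z : (\<Union>x\<in>K. ball x delta)" for z
 proof -
  obtain x where "x : K" "dist x z < delta" using zW by auto
  hence x: "x : K" "norm (z - x) < delta" by (auto simp: dist_norm norm_minus_commute)
  have "u y * moll delta (z - y) = moll delta (z - y)" for y
  proof (cases "norm (z - y) < delta")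
   case True
   have "norm (y - x) <= 2 * delta" using norm_triangle_ineq[of "y - z" "z - x"] True x by (simp add: norm_minus_commute)
   hence "y : N (2 * delta)" using x Nmem by blast
   thus ?thesis by (simp add: u_def)
  next
   case False
   thus ?thesis using moll_outside[OF delta, of "z - y"] by simp
  qed
  thus ?thesis unfolding phi by (simp only: moll_reflect_integral(2)[OF delta])
 qed
 have "N (3 * delta) <= V"
 proof
  fix z assume "z : N (3 * delta)"
  then obtain x where x: "x : K" "norm (z - x) <= 3 * delta" using Nmem by auto
  hence "dist x z < d" using d(1) by (simp add: delta_def dist_norm norm_minus_commute)
  thus "z : V" using d(2)[OF x(1), of z] by force
 qed
 hence "test_fun V phi" by (intro test_funI[OF sm N[of "3 * delta"]] out)
 moreover have "K <= (\<Union>x\<in>K. ball x delta)" using delta by auto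
 ultimately show ?thesis using one 0 1 by (intro that[of phi "\<Union>x\<in>K. ball x delta"]) auto
qed

lemma conv_abs_bound:
 fixes u :: "real^'d => real"
 assumes "integrable lborel u" "eps > 0" "!!x. abs (u x) <= B" shows "abs (conv u (moll eps) x) <= B"
proof -
 note i = conv_lborel[OF assms(1) moll_test_fun[OF assms(2)], of x]
 note m = moll_reflect_integral[OF assms(2), of x]
 have "abs (conv u (moll eps) x) <= (LINT y|lborel. abs (u y * moll eps (x - y)))" unfolding i(2) by (rule integral_abs_bound)
 also have "(LINT y|lborel. abs (u y * moll eps (x - y))) <= (LINT y|lborel. B * moll eps (x - y))"
 proof (rule integral_mono[OF integrable_abs[OF i(1)]])
  show "abs (u y * moll eps (x - y)) <= B * moll eps (x - y)" for y
   using mult_right_mono[OF assms(3)[of y] moll_nonneg[OF assms(2), of "x - y"]] moll_nonneg[OF assms(2), of "x - y"] by (simp add: abs_mult)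
 qed (use m in auto)
 finally show ?thesis using m by simp
qed

text \<open>A translation of the variable turns the difference of two values of the convolution into
  the convolution of a difference that is at most \<open>L * dist x x'\<close>; the mollifier has
  integral one.\<close>

lemma conv_lipschitz:
 fixes u :: "real^'d => real"
 assumes ui: "integrable lborel u" and e: "eps > 0" and L: "!!x y. abs (u x - u y) <= L * dist x y"
 shows "abs (conv u (moll eps) x - conv u (moll eps) x') <= L * dist x x'"
proof -
 have [measurable]: "u : borel_measurable borel" using ui by auto
 note i = conv_lborel[OF ui moll_test_fun[OF e]]
 note m = moll_reflect_integral[OF e, of x']
 define w where "w y = u ((x - x') + y)" for y
 have wi: "integrable lborel w" unfolding w_def using lborel_integrable_affine_iff[of 1 u "x - x'"] ui by simp
 have "conv u (moll eps) x = (LINT y|lborel. u y * moll eps (x - y))" by (rule i(2))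
 also have "... = (LINT y|lborel. u ((x - x') + y) * moll eps (x - ((x - x') + y)))"
  using lborel_integral_affine[of "%y. u y * moll eps (x - y)" 1 "x - x'"] by simp
 also have "... = (LINT y|lborel. w y * moll eps (x' - y))" by (simp add: w_def algebra_simps)
 finally have 1: "conv u (moll eps) x = (LINT y|lborel. w y * moll eps (x' - y))" .
 note wi' = conv_lborel(1)[OF wi moll_test_fun[OF e], of x']
 have 2: "conv u (moll eps) x - conv u (moll eps) x' = (LINT y|lborel. (w y - u y) * moll eps (x' - y))"
  unfolding 1 i(2)[of x'] using wi' i(1)[of x'] by (simp add: left_diff_distrib)
 have pt: "abs ((w y - u y) * moll eps (x' - y)) <= L * dist x x' * moll eps (x' - y)" for y
  using mult_right_mono[OF L[of "(x - x') + y" y] moll_nonneg[OF e, of "x' - y"]] moll_nonneg[OF e, of "x' - y"] by (simp add: w_def abs_mult dist_norm)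
 have "integrable lborel (%y. (w y - u y) * moll eps (x' - y))"
  using Bochner_Integration.integrable_diff[OF wi' i(1)[of x']] by (simp add: left_diff_distrib)
 hence "(LINT y|lborel. abs ((w y - u y) * moll eps (x' - y))) <= (LINT y|lborel. L * dist x x' * moll eps (x' - y))"
  using m by (intro integral_mono pt) auto
 thus ?thesis unfolding 2 using m order_trans[OF integral_abs_bound] by simp
qed

lemma pdv_lipschitz_bound:
 fixes phi :: "real^'d => real"
 assumes "phi differentiable (at x)" "!!y. abs (phi y - phi x) <= L * dist y x" shows "abs (pdv j phi x) <= L"
proof -
 have 1: "((%s. x + s *R axis j 1) has_derivative (%t. t *R axis j 1)) (at (0::real))" by (auto intro!: derivative_eq_intros)
 have "(phi has_derivative frechet_derivative phi (at x)) (at (x + 0 *R axis j 1))" using assms(1) by (simp add: frechet_derivative_works)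
 from diff_chain_at[OF 1 this]
 have "((%s. phi (x + s *R axis j 1)) has_derivative (%t. frechet_derivative phi (at x) (t *R axis j 1))) (at 0)" by (simp add: o_def)
 moreover have "frechet_derivative phi (at x) (t *R axis j 1) = pdv j phi x * t" for t
  using linear_scale[OF linear_frechet_derivative[OF assms(1)], of t "axis j 1"] by simp
 ultimately have "((%s. phi (x + s *R axis j 1)) has_derivative (%t. pdv j phi x * t)) (at 0)" by (simp only:)
 hence "((%s. phi (x + s *R axis j 1)) has_real_derivative pdv j phi x) (at 0)" unfolding has_field_derivative_def .
 hence "((%s. (phi (x + s *R axis j 1) - phi x) / s) \<longlongrightarrow> pdv j phi x) (at 0)" by (simp add: DERIV_def)
 hence "((%s. abs ((phi (x + s *R axis j 1) - phi x) / s)) \<longlongrightarrow> (abs (pdv j phi x))) (at 0)" by (rule tendsto_rabs)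
 moreover have "\<forall>\<^sub>F s in at 0. abs ((phi (x + s *R axis j 1) - phi x) / s) <= L" unfolding eventually_at
 proof (intro exI[of _ 1] conjI ballI impI)
  fix s :: real assume "s ~= 0 & dist s 0 < 1"
  thus "abs ((phi (x + s *R axis j 1) - phi x) / s) <= L" using assms(2)[of "x + s *R axis j 1"] by (simp add: dist_norm abs_divide divide_le_eq)
 qed simp
 ultimately show ?thesis by (rule tendsto_upperbound) simp
qed

subsection \<open>Power inequalities\<close>

lemma powr_add_le:
 fixes a b p :: real
 assumes "a >= 0" "b >= 0" "p >= 0"
 shows "(a + b) powr p <= 2 powr p * (a powr p + b powr p)"
proof -
 have "(a + b) powr p <= (2 * max a b) powr p" using assms by (intro powr_mono2) auto
 also have "... = 2 powr p * max a b powr p" using assms by (simp add: powr_mult)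
 also have "... <= 2 powr p * (a powr p + b powr p)" by (intro mult_left_mono) (auto simp: max_def)
 finally show ?thesis .
qed

lemma norm_add_powr_le:
 assumes "p >= 0" shows "norm (a + b) powr p <= 2 powr p * (norm a powr p + norm b powr p)"
 using order_trans[OF powr_mono2[OF _ _ norm_triangle_ineq[of a b]] powr_add_le[of "norm a" "norm b" p]] assms by simp

lemma powr_sum_le:
 fixes f :: "'i => real"
 assumes "finite I" "!!i. i : I ==> f i >= 0" "p >= 0"
 shows "(\<Sum>i\<in>I. f i) powr p <= real (card I) powr p * (\<Sum>i\<in>I. f i powr p)"
proof (cases "I = {}")
 case False
 define M where "M = Max (f ` I)"
 have M: "M : f ` I" "!!i. i : I ==> f i <= M" unfolding M_def using assms False by auto
 then obtain i where i: "i : I" "M = f i" by auto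
 have "(\<Sum>i\<in>I. f i) <= real (card I) * M" using sum_bounded_above[of I f M] M by simp
 hence "(\<Sum>i\<in>I. f i) powr p <= (real (card I) * M) powr p" using assms by (intro powr_mono2 sum_nonneg)
 also have "... = real (card I) powr p * M powr p" using i assms by (simp add: powr_mult)
 also have "... <= real (card I) powr p * (\<Sum>i\<in>I. f i powr p)" unfolding i(2) by (intro mult_left_mono member_le_sum) (use i assms in auto)
 finally show ?thesis .
qed simp

text \<open>The tangent of t^p at \<open>b\<close> lies below the graph. This is Young's inequality
  for the numbers \<open>a\<close> and \<open>b powr (p - 1)\<close>.\<close>

lemma powr_tangent:
 fixes a b p :: real
 assumes "a >= 0" "b > 0" "p >= 1"
 shows "b powr p + p * b powr (p - 1) * (a - b) <= a powr p"
proof (cases "p = 1")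
 case True thus ?thesis using assms by simp
next
 case False
 define q where "q = p / (p - 1)"
 have q: "q > 1" "1 / p + 1 / q = 1" "p > 1" using assms False by (auto simp: q_def field_simps)
 have "a * b powr (p - 1) <= a powr p / p + (b powr (p - 1)) powr q / q" using q assms by (intro Youngs_inequality) auto
 moreover have "(b powr (p - 1)) powr q = b powr p" using q by (simp add: powr_powr q_def)
 moreover have "b powr p = b powr (p - 1) * b" using assms by (simp add: powr_diff)
 ultimately have "p * (a * b powr (p - 1)) <= a powr p + p * (b powr p / q)" using mult_left_mono[of "a * b powr (p - 1)" "a powr p / p + b powr p / q" p] q
  by (simp add: algebra_simps)
 moreover have "p / q = p - 1" using q by (simp add: q_def field_simps)
 hence "p * (b powr p / q) = (p - 1) * b powr p" by (metis times_divide_eq_right times_divide_eq_left)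
 ultimately show ?thesis using \<open>b powr p = b powr (p - 1) * b\<close> by (simp add: algebra_simps)
qed

text \<open>Integrate the tangent inequality at the mean of \<open>g\<close>. The tangent point has
  to be positive, so a vanishing mean is treated apart, as is an infinite right-hand side.\<close>

lemma jensen_powr:
 assumes "emeasure M (space M) = 1" "integrable M g" "!!y. g y >= 0" "p >= 1"
 shows "ennreal ((LINT y|M. g y) powr p) <= (\<integral>\<^sup>+y. ennreal (g y powr p) \<partial>M)"
proof (cases "(\<integral>\<^sup>+y. ennreal (g y powr p) \<partial>M) = \<infinity> | (LINT y|M. g y) = 0")
 case True thus ?thesis by auto
next
 case False
 interpret finite_measure M by (rule finite_measureI) (simp add: assms(1))
 define b where "b = (LINT y|M. g y)"
 have b: "b > 0" using False assms(3) by (simp add: b_def less_le)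
 have [measurable]: "g : borel_measurable M" using assms by auto
 have ip: "integrable M (%y. g y powr p)" using False by (auto simp: integrable_iff_bounded less_top)
 have "(LINT y|M. b powr p + p * b powr (p - 1) * (g y - b)) <= (LINT y|M. g y powr p)" by (rule integral_mono[OF _ ip]) (use assms b powr_tangent in auto)
 moreover have "(LINT y|M. b powr p + p * b powr (p - 1) * (g y - b)) = b powr p" using assms(1,2) by (simp add: b_def measure_def)
 ultimately show ?thesis unfolding b_def[symmetric] by (subst nn_integral_eq_integral[OF ip]) (auto intro: ennreal_leI)
qed

lemma nn_integral_powr_add:
 fixes u v :: "'a => 'v::{second_countable_topology,banach}"
 assumes [measurable]: "u : borel_measurable M" "v : borel_measurable M" and p: "p >= 0"
 shows "(\<integral>\<^sup>+x. ennreal (norm (u x + v x) powr p) \<partial>M) <=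
   ennreal (2 powr p) * ((\<integral>\<^sup>+x. ennreal (norm (u x) powr p) \<partial>M) + (\<integral>\<^sup>+x. ennreal (norm (v x) powr p) \<partial>M))"
proof -
 have "(\<integral>\<^sup>+x. ennreal (norm (u x + v x) powr p) \<partial>M)
   <= (\<integral>\<^sup>+x. ennreal (2 powr p) * (ennreal (norm (u x) powr p) + ennreal (norm (v x) powr p)) \<partial>M)"
  by (rule nn_integral_mono) (use p in "simp add: norm_add_powr_le ennreal_plus[symmetric] ennreal_mult[symmetric] ennreal_leI del: ennreal_plus")
 also have "... = ennreal (2 powr p) * ((\<integral>\<^sup>+x. ennreal (norm (u x) powr p) \<partial>M) + (\<integral>\<^sup>+x. ennreal (norm (v x) powr p) \<partial>M))"
  by (simp add: nn_integral_cmult nn_integral_add)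
 finally show ?thesis .
qed

subsection \<open>Mollification in Lebesgue spaces\<close>

text \<open>The value of the convolution at \<open>x\<close> is a mean of \<open>u\<close> with
  respect to the probability density \<open>moll eps (x - y)\<close>, so Jensen's inequality
  applies.\<close>

lemma conv_powr_le:
 fixes u :: "real^'d => real"
 assumes "integrable lborel u" "eps > 0" "p >= 1"
 shows "ennreal (abs (conv u (moll eps) x) powr p) <= (NB y. ennreal (abs (u y) powr p) * ennreal (moll eps (x - y)))"
proof -
 have [measurable]: "u : borel_measurable borel" using assms by auto
 define M where "M = density lborel (%y. ennreal (moll eps (x - y)))"
 have em: "emeasure M (space M) = 1" unfolding M_def by (subst emeasure_density) (auto simp: moll_reflect_integral(3)[OF assms(2)])
 have ci: "integrable lborel (%y. u y * moll eps (x - y))" by (rule conv_lborel(1)[OF assms(1) moll_test_fun[OF assms(2)]])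
 have ai: "integrable lborel (%y. abs (u y) * moll eps (x - y))" using integrable_abs[OF ci] by (simp add: abs_mult moll_nonneg assms(2))
 have iM: "integrable M (%y. abs (u y))" unfolding M_def using ai by (subst integrable_density) (auto simp: moll_nonneg assms(2) mult.commute)
 have LM: "(LINT y|M. abs (u y)) = (LINT y|lborel. abs (u y) * moll eps (x - y))"
  unfolding M_def by (subst integral_density) (auto simp: moll_nonneg assms(2) mult.commute)
 have "abs (conv u (moll eps) x) <= (LINT y|M. abs (u y))" unfolding LM conv_lborel(2)[OF assms(1) moll_test_fun[OF assms(2)]]
  using integral_abs_bound[of lborel "%y. u y * moll eps (x - y)"] by (simp add: abs_mult moll_nonneg assms(2))
 hence "ennreal (abs (conv u (moll eps) x) powr p) <= ennreal ((LINT y|M. abs (u y)) powr p)" using assms by (intro ennreal_leI powr_mono2) auto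
 also have "... <= (\<integral>\<^sup>+y. ennreal (abs (u y) powr p) \<partial>M)" by (rule jensen_powr[OF em iM]) (use assms in auto)
 also have "... = (NB y. ennreal (abs (u y) powr p) * ennreal (moll eps (x - y)))"
  unfolding M_def by (subst nn_integral_density) (auto simp: mult.commute)
 finally show ?thesis .
qed

lemma moll_convolution_nn_integral:
 fixes h :: "real^'d => ennreal"
 assumes [measurable]: "h : borel_measurable borel" and "eps > 0"
 shows "(NB x. (NB y. h y * ennreal (moll eps (x - y)))) = (NB y. h y)"
proof -
 have "(NB x. (NB y. h y * ennreal (moll eps (x - y)))) = (NB y. (NB x. h y * ennreal (moll eps (x - y))))" by (rule lborel_pair.Fubini') measurable
 also have "... = (NB y. h y)"
 proof (rule nn_integral_cong)
  fix y :: "real^'d"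
  have "(NB x. ennreal (moll eps (x - y))) = 1"
   using nn_integral_lborel_affine[of "%x. ennreal (moll eps x)" 1 "- y"] moll_nn_integral[OF assms(2), where 'a='d] by simp
  thus "(NB x. h y * ennreal (moll eps (x - y))) = h y" by (subst nn_integral_cmult) auto
 qed
 finally show ?thesis .
qed

text \<open>Tonelli's theorem is used on \<open>lborel\<close>, whereas \<open>integ\<close> refers
  to its completion. Convolutions do not notice the change on a null set.\<close>

lemma borel_representative:
 fixes u :: "real^'d => real"
 assumes "integ u"
 obtains u' where "integrable lborel u'" "AEL x. u x = u' x" "!!psi. test_fun D psi ==> conv u psi = conv u' psi"
proof -
 obtain u' where u': "u' : borel_measurable lborel" "AE x in lborel. u x = u' x"
  using completion_ex_borel_measurable_real[OF borel_measurable_integrable[OF assms]] by blast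
 have ae: "AEL x. u x = u' x" using AE_completion[OF u'(2)] .
 have "integ u'" by (rule integrable_cong_AE_imp[OF assms measurable_completion[OF u'(1)] ae])
 hence "integrable lborel u'" using integrable_completion u'(1) by blast
 moreover have "conv u psi = conv u' psi" if "test_fun D psi" for psi
 proof
  fix x
  have [measurable]: "(%y. psi (x - y)) : BL" using smooth_fun_reflect_measurable test_fun_smooth[OF that] by blast
  have [measurable]: "u : BL" "u' : BL" using assms \<open>integ u'\<close> by auto
  show "conv u psi x = conv u' psi x" unfolding conv_def by (rule integral_cong_AE) (use ae in auto)
 qed
 ultimately show ?thesis using ae that by blast
qed

lemma conv_nn_integral_le:
 fixes u :: "real^'d => real"
 assumes "integ u" "eps > 0" "p >= 1"
 shows "(np p (%x. conv u (moll eps) x)) <= (np p u)"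
proof -
 obtain u' where u': "integrable lborel u'" "AEL x. u x = u' x" "conv u (moll eps) = conv u' (moll eps)"
  using borel_representative[OF assms(1), of UNIV] moll_test_fun[OF assms(2)] by metis
 have [measurable]: "u' : borel_measurable borel" using u' by auto
 have "(np p (%x. conv u (moll eps) x)) <= (NN x. (NB y. ennreal (abs (u' y) powr p) * ennreal (moll eps (x - y))))"
  unfolding u'(3) by (rule nn_integral_mono) (rule conv_powr_le[OF u'(1) assms(2,3)])
 also have "... = (np p u')" unfolding nn_integral_completion by (rule moll_convolution_nn_integral) (use assms in auto)
 also have "... = (np p u)" by (rule nn_integral_cong_AE) (use u'(2) in auto)
 finally show ?thesis .
qed

lemma ball_truncate_limit: "((%n. max (- real n) (min (real n) a)) \<longlongrightarrow> a) sequentially"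
proof (rule tendsto_eventually)
 show "EV n. max (- real n) (min (real n) a) = a" using eventually_ge_at_top[of "nat \<lceil>(abs a)\<rceil>"]
  by eventually_elim (auto simp: nat_ceiling_le_eq max_def min_def)
qed

lemma Lp_approx_bounded:
 fixes u :: "real^'d => real" and e :: real
 assumes [measurable]: "u : BL" and fin: "(np p u) < \<infinity>" and p: "p > 0" and e: "e > 0"
 obtains v N where "v : BL" "!!x. abs (v x) <= real N" "!!x. norm x > real N ==> v x = 0"
  "(np p (%x. u x - v x)) < ennreal e"
proof -
 define v where "v n x = (if norm x <= real n then max (- real n) (min (real n) (u x)) else 0)" for n x
 have [measurable]: "(%x. u x - v n x) : BL" "v n : BL" for n
 proof -
  have [measurable]: "{x. norm x <= real n} : sets lebesgue" by (intro sets_completionI_sets lborelD borel_closed closed_Collect_le continuous_intros)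
  have "(%x. ind {x. norm x <= real n} x * max (- real n) (min (real n) (u x))) : BL" by measurable
  also have "(%x. ind {x. norm x <= real n} x * max (- real n) (min (real n) (u x))) = v n" by (auto simp: v_def fun_eq_iff)
  finally show "v n : BL" .
  thus "(%x. u x - v n x) : BL" by measurable
 qed
 have lim: "(%n. u x - v n x) ----> 0" for x
 proof -
  have "(%n. u x - max (- real n) (min (real n) (u x))) ----> u x - u x" by (intro tendsto_intros ball_truncate_limit)
  moreover have "EV n. u x - max (- real n) (min (real n) (u x)) = u x - v n x" using eventually_ge_at_top[of "nat \<lceil>norm x\<rceil>"]
   by eventually_elim (auto simp: nat_ceiling_le_eq v_def)
  ultimately have "(%n. u x - v n x) ----> u x - u x" by (rule Lim_transform_eventually)
  thus ?thesis by simp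
 qed
 have "(%n. (np p (%x. u x - v n x))) ----> (\<integral>\<^sup>+x. 0 \<partial>(lebesgue :: (real^'d) measure))"
 proof (rule nn_integral_dominated_convergence[where w="%x. ennreal (abs (u x) powr p)"])
  show "AEL x. ennreal (abs (u x - v n x) powr p) <= ennreal (abs (u x) powr p)" for n
   by (rule AE_I2, rule ennreal_leI, rule powr_mono2) (use p in "auto simp: v_def")
  show "AEL x. (%n. ennreal (abs (u x - v n x) powr p)) ----> 0"
  proof (rule AE_I2)
   fix x
   have "(%n. abs (u x - v n x)) ----> 0" using lim[of x] by (rule tendsto_rabs_zero)
   hence "(%n. abs (u x - v n x) powr p) ----> 0" using p by (intro tendsto_zero_powrI[OF _ tendsto_const]) auto
   thus "(%n. ennreal (abs (u x - v n x) powr p)) ----> 0" by (simp add: ennreal_tendsto_0_iff)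
  qed
 qed (use fin in auto)
 hence "EV n. (np p (%x. u x - v n x)) < ennreal e" using e by (intro order_tendstoD(2)) auto
 then obtain n where "(np p (%x. u x - v n x)) < ennreal e" using eventually_happens' trivial_limit_sequentially by blast
 thus ?thesis by (intro that[of "v n" n]) (auto simp: v_def)
qed

text \<open>A Lebesgue measurable function is an almost everywhere limit of continuous ones.
  Clipping these at height \<open>N\<close> and fading them out between the radii \<open>N\<close>
  and \<open>N + 1\<close> does not change the limit and supplies a dominating function.\<close>

lemma Lp_approx_continuous_bounded:
 fixes u :: "real^'d => real" and e :: real
 assumes [measurable]: "u : BL" and b: "!!x. abs (u x) <= N" and out: "!!x. norm x > N ==> u x = 0"
  and p: "p > 0" and e: "e > 0"
 obtains c where "continuous_on UNIV c" "!!x. norm x > N + 1 ==> c x = 0" "(np p (%x. u x - c x)) < ennreal e"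
proof -
 have N: "N >= 0" using b[of 0] by linarith
 obtain Z g where Z: "negligible Z" and g: "!!n. continuous_on UNIV (g n)" "!!x. x ~: Z ==> (%n. g n x) ----> u x"
  using lebesgue_measurable_imp_measurable_on[OF assms(1), of UNIV] unfolding measurable_on_def by auto
 define c where "c n x = max 0 (min 1 (N + 1 - norm x)) * max (- N) (min N (g n x))" for n x
 have cc: "continuous_on UNIV (c n)" for n unfolding c_def by (intro continuous_intros g)
 have cb: "abs (c n x) <= N * ind (cball 0 (N + 1)) x" for n x
 proof -
  have "abs (c n x) <= max 0 (min 1 (N + 1 - norm x)) * N" unfolding c_def abs_mult by (rule mult_mono) (use N in auto)
  also have "... <= N * ind (cball 0 (N + 1)) x" using N by (auto simp: indicator_def mult_left_le_one_le max_def min_def split: if_splits)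
  finally show ?thesis .
 qed
 have ub: "abs (u x) <= N * ind (cball 0 (N + 1)) x" for x using b[of x] out[of x] by (auto simp: indicator_def)
 have lim: "(%n. c n x) ----> u x" if "x ~: Z" for x
 proof -
  have "(%n. c n x) ----> max 0 (min 1 (N + 1 - norm x)) * max (- N) (min N (u x))" unfolding c_def by (intro tendsto_intros g that)
  also have "max 0 (min 1 (N + 1 - norm x)) * max (- N) (min N (u x)) = u x"
   using b[of x] out[of x] N by (cases "norm x > N") (auto simp: abs_le_iff max_def min_def)
  finally show ?thesis .
 qed
 have [measurable]: "c n : BL" for n by (intro measurable_lebesgue_borelI borel_measurable_continuous_onI cc)
 have [measurable]: "cball (0::real^'d) (N + 1) : sets lebesgue" by simp
 have "(%n. (np p (%x. u x - c n x))) ----> (\<integral>\<^sup>+x. 0 \<partial>(lebesgue :: (real^'d) measure))"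
 proof (rule nn_integral_dominated_convergence[where w="%x. ennreal ((2 * N) powr p) * indicator (cball 0 (N + 1)) x"])
  show "AEL x. ennreal (abs (u x - c n x) powr p) <= ennreal ((2 * N) powr p) * indicator (cball 0 (N + 1)) x" for n
  proof (rule AE_I2)
   fix x
   show "ennreal (abs (u x - c n x) powr p) <= ennreal ((2 * N) powr p) * indicator (cball 0 (N + 1)) x"
    using ub[of x] cb[of n x] p by (cases "x : cball 0 (N + 1)") (auto intro!: ennreal_leI powr_mono2)
  qed
  show "AEL x. (%n. ennreal (abs (u x - c n x) powr p)) ----> 0"
  proof -
   have "AEL x. x ~: Z" using Z by (simp add: negligible_iff_null_sets AE_not_in)
   thus ?thesis
   proof eventually_elim
    case (elim x)
    have "(%n. abs (u x - c n x)) ----> abs (u x - u x)" by (intro tendsto_intros lim elim)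
    hence "(%n. abs (u x - c n x) powr p) ----> 0" using p by (intro tendsto_zero_powrI[OF _ tendsto_const]) auto
    thus ?case by (simp add: ennreal_tendsto_0_iff)
   qed
  qed
  have "emeasure lebesgue (cball (0::real^'d) (N + 1)) < \<infinity>" using lmeasurable_cball[of "0::real^'d" "N+1"] by (simp add: fmeasurable_def)
  thus "(NN x. ennreal ((2 * N) powr p) * indicator (cball (0::real^'d) (N + 1)) x) < \<infinity>"
   by (subst nn_integral_cmult_indicator) (auto simp: ennreal_mult_less_top)
 qed auto
 hence "EV n. (np p (%x. u x - c n x)) < ennreal e" using e by (intro order_tendstoD(2)) auto
 then obtain n where "(np p (%x. u x - c n x)) < ennreal e" using eventually_happens' trivial_limit_sequentially by blast
 thus ?thesis using cc by (intro that[of "c n"]) (auto simp: c_def)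
qed

lemma Lp_approx_continuous:
 fixes u :: "real^'d => real" and e :: real
 assumes [measurable]: "u : BL" and fin: "(np p u) < \<infinity>" and p: "p > 0" and e: "e > 0"
 obtains c N where "continuous_on UNIV c" "!!x. norm x > N ==> c x = 0" "N > 0" "(np p (%x. u x - c x)) < ennreal e"
proof -
 define e' where "e' = e / (2 * 2 powr p)"
 have e': "e' > 0" using e by (simp add: e'_def)
 obtain v N where v [measurable]: "v : BL" and v1: "!!x. abs (v x) <= real N" "!!x. norm x > real N ==> v x = 0"
  "(np p (%x. u x - v x)) < ennreal e'" by (rule Lp_approx_bounded[OF assms(1) fin p e']) (rule that)
 obtain c where c: "continuous_on UNIV c" "!!x. norm x > real N + 1 ==> c x = 0" "(np p (%x. v x - c x)) < ennreal e'"
  by (rule Lp_approx_continuous_bounded[OF v v1(1) _ p e']) (erule v1(2), rule that)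
 have [measurable]: "c : BL" by (intro measurable_lebesgue_borelI borel_measurable_continuous_onI c)
 have "(np p (%x. u x - c x)) <= ennreal (2 powr p) * ((np p (%x. u x - v x)) + (np p (%x. v x - c x)))"
  using nn_integral_powr_add[of "%x. u x - v x" lebesgue "%x. v x - c x" p] p by simp
 also have "... < ennreal (2 powr p) * (ennreal e' + ennreal e')"
  by (rule ennreal_mult_strict_left_mono) (use v1 c in "auto intro!: add_strict_mono")
 also have "... = ennreal e" using e' by (simp add: ennreal_plus[symmetric] ennreal_mult[symmetric] e'_def del: ennreal_plus)
 finally have "(np p (%x. u x - c x)) < ennreal e" .
 thus ?thesis using c by (intro that[of c "real N + 1"]) auto
qed

lemma conv_continuous_uniform:
 fixes c :: "real^'d => real"
 assumes c: "continuous_on UNIV c" and out: "!!x. norm x > N ==> c x = 0" and N: "N > 0" and r: "r > 0"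
 shows "EX delta>0. delta <= 1 & (ALL eps x. 0 < eps & eps < delta --> abs (conv c (moll eps) x - c x) <= r * ind (cball 0 (N + 1)) x)"
  and "integrable lborel c"
proof -
 have "set_integrable lborel (cball 0 N) c" unfolding set_integrable_def by (rule borel_integrable_compact) (auto intro: continuous_on_subset[OF c])
 moreover have "(%x. ind (cball 0 N) x *R c x) = c" using out by (auto simp: fun_eq_iff indicator_def not_le)
 ultimately show ci: "integrable lborel c" by (simp add: set_integrable_def)
 have "uniformly_continuous_on (cball 0 (N + 2)) c" by (intro compact_uniformly_continuous continuous_on_subset[OF c]) auto
 then obtain delta where delta: "delta > 0" "!!x y. x : cball 0 (N + 2) ==> y : cball 0 (N + 2) ==> dist y x < delta ==> dist (c y) (c x) < r"
  unfolding uniformly_continuous_on_def using r by metis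
 have "abs (conv c (moll eps) x - c x) <= r * ind (cball 0 (N + 1)) x" if e: "0 < eps" "eps < min delta 1" for eps x
 proof -
  note i1 = conv_lborel[OF ci moll_test_fun[OF e(1)], of x]
  note i2 = moll_reflect_integral[OF e(1), of x]
  have eq: "conv c (moll eps) x - c x = (LINT y|lborel. (c y - c x) * moll eps (x - y))"
  proof -
   have "(LINT y|lborel. (c y - c x) * moll eps (x - y)) = (LINT y|lborel. c y * moll eps (x - y) - c x * moll eps (x - y))" by (simp add: left_diff_distrib)
   also have "... = conv c (moll eps) x - c x" using i1 i2 by (subst Bochner_Integration.integral_diff) auto
   finally show ?thesis by simp
  qed
  have pt: "abs ((c y - c x) * moll eps (x - y)) <= r * ind (cball 0 (N + 1)) x * moll eps (x - y)" for y
  proof (cases "norm (x - y) < eps")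
   case True
   have "abs (c y - c x) <= r * ind (cball 0 (N + 1)) x"
   proof (cases "norm x <= N + 1")
    case True
    have "norm y <= N + 2" using norm_triangle_ineq[of x "y - x"] True \<open>norm (x - y) < eps\<close> e by (simp add: norm_minus_commute)
    hence "dist (c y) (c x) < r" using True \<open>norm (x - y) < eps\<close> e by (intro delta(2)) (auto simp: dist_norm norm_minus_commute)
    thus ?thesis using True by (simp add: dist_norm)
   next
    case False
    have "norm y > N" using norm_triangle_ineq[of y "x - y"] False \<open>norm (x - y) < eps\<close> e by simp
    thus ?thesis using out[of x] out[of y] False by simp
   qed
   thus ?thesis unfolding abs_mult using moll_nonneg[OF e(1), of "x - y"] by (simp add: mult_right_mono)
  next
   case False
   thus ?thesis using moll_outside[OF e(1), of "x - y"] by simp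
  qed
  have "abs (conv c (moll eps) x - c x) <= (LINT y|lborel. abs ((c y - c x) * moll eps (x - y)))" unfolding eq by (rule integral_abs_bound)
  also have "... <= (LINT y|lborel. r * ind (cball 0 (N + 1)) x * moll eps (x - y))"
  proof (rule integral_mono[OF _ _ pt])
   have "integrable lborel (%y. c y * moll eps (x - y) - c x * moll eps (x - y))"
    using i1 i2 by (intro Bochner_Integration.integrable_diff integrable_mult_right)
   thus "integrable lborel (%y. abs ((c y - c x) * moll eps (x - y)))" by (intro integrable_abs) (simp add: left_diff_distrib)
  qed (use i2 in auto)
  also have "... = r * ind (cball 0 (N + 1)) x" using i2 by simp
  finally show ?thesis .
 qed
 thus "EX delta>0. delta <= 1 & (ALL eps x. 0 < eps & eps < delta --> abs (conv c (moll eps) x - c x) <= r * ind (cball 0 (N + 1)) x)"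
  using delta(1) by (intro exI[of _ "min delta 1"]) auto
qed

lemma conv_borel: "integ u ==> test_fun D psi ==> conv u psi : borel_measurable borel" by (intro smooth_fun_borel conv_smooth)

text \<open>Convolution with a mollifier does not increase the Lp norm, so \<open>u\<close> may be
  replaced by a continuous function \<open>c\<close> of compact support, for which the
  mollifications converge uniformly on a fixed ball.\<close>

lemma mollification_tendsto:
 fixes u :: "real^'d => real"
 assumes u: "integ u" and fin: "(np p u) < \<infinity>" and p: "p >= 1"
 shows "((%eps. (np p (%x. conv u (moll eps) x - u x))) \<longlongrightarrow> 0) (at_right 0)"
proof (rule order_tendstoI)
 fix a :: ennreal assume "a < 0" thus "\<forall>\<^sub>F eps in at_right 0. a < (np p (%x. conv u (moll eps) x - u x))" by simp
next
 fix a :: ennreal assume "0 < a"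
 then obtain e :: real where e: "e > 0" "ennreal e < a"
  by (metis ennreal_0 ennreal_enn2real ennreal_less_iff ennreal_top_neq_zero less_top dense enn2real_positive_iff top_greatest less_le_trans)
 have [measurable]: "u : BL" using u by auto
 define T where "T = (2::real) powr p"
 have T: "T > 0" by (simp add: T_def)
 \<comment> \<open>Three errors of size \<open>e1\<close> are combined by two uses of the inequality
   with constant \<open>T\<close>; their sum is at most T (2 T + 1) e1, which is below
   \<open>e\<close>.\<close>
 define e1 where "e1 = e / (T * (T + 1) * 2)"
 have e1: "e1 > 0" using e T by (simp add: e1_def)
 obtain c N where c: "continuous_on UNIV c" "!!x. norm x > N ==> c x = 0" "N > 0" and uc: "(np p (%x. u x - c x)) < ennreal e1"
  by (rule Lp_approx_continuous[OF \<open>u : BL\<close> fin _ e1]) (use p that in auto)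
 define m where "m = vol (cball (0::real^'d) (N + 1))"
 have m: "emeasure lebesgue (cball (0::real^'d) (N + 1)) = ennreal m" "m >= 0"
  using lmeasurable_cball[of "0::real^'d" "N+1"] by (auto simp: m_def emeasure_eq_measure2)
 define r where "r = (e1 / (m + 1)) powr (1 / p)"
 have r: "r > 0" "r powr p * m <= e1"
 proof -
  show "r > 0" using e1 m by (simp add: r_def)
  have "r powr p = e1 / (m + 1)" using p e1 m by (simp add: r_def powr_powr)
  hence "r powr p * m + r powr p = e1" using e1 m by (simp add: field_simps)
  thus "r powr p * m <= e1" using powr_ge_zero[of r p] by linarith
 qed
 note cu = conv_continuous_uniform[OF c r(1)]
 obtain delta where delta: "delta > 0" "ALL eps x. 0 < eps & eps < delta --> abs (conv c (moll eps) x - c x) <= r * ind (cball 0 (N + 1)) x"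
  using cu(1) by blast
 have ci: "integ c" by (rule integrable_completion[THEN iffD2, OF _ cu(2)]) (use cu(2) in auto)
 have [measurable]: "c : BL" using ci by auto
 have "(np p (%x. conv u (moll eps) x - u x)) < a" if ep: "0 < eps" "eps < delta" for eps
 proof -
  note t = moll_test_fun[OF ep(1)]
  have [measurable]: "conv u (moll eps) : BL" "conv c (moll eps) : BL" by (intro measurable_lebesgue_borelI conv_borel[OF _ t] u ci)+
  have sub: "conv u (moll eps) x - conv c (moll eps) x = conv (%x. u x - c x) (moll eps) x" for x
   unfolding conv_def using conv_integrable[OF u t, of x] conv_integrable[OF ci t, of x]
   by (subst Bochner_Integration.integral_diff[symmetric]) (auto simp: left_diff_distrib)
  have 1: "(np p (%x. conv u (moll eps) x - conv c (moll eps) x)) <= ennreal e1" unfolding sub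
   by (rule order_trans[OF conv_nn_integral_le[OF Bochner_Integration.integrable_diff[OF u ci] ep(1) p] less_imp_le[OF uc]])
  have 2: "(np p (%x. c x - u x)) <= ennreal e1" using uc by (simp add: abs_minus_commute)
  have 3: "(np p (%x. conv c (moll eps) x - c x)) <= ennreal e1"
  proof -
   have "(np p (%x. conv c (moll eps) x - c x))
     <= (\<integral>\<^sup>+x. ennreal (r powr p) * indicator (cball 0 (N + 1)) x \<partial>(lebesgue :: (real^'d) measure))"
   proof (rule nn_integral_mono)
    fix x :: "real^'d"
    have "abs (conv c (moll eps) x - c x) <= r * ind (cball 0 (N + 1)) x" using delta ep by blast
    thus "ennreal (abs (conv c (moll eps) x - c x) powr p) <= ennreal (r powr p) * indicator (cball 0 (N + 1)) x"
     using p by (cases "x : cball 0 (N + 1)") (auto intro!: ennreal_leI powr_mono2)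
   qed
   also have "... = ennreal (r powr p * m)" by (subst nn_integral_cmult_indicator) (auto simp: m ennreal_mult)
   also have "... <= ennreal e1" using r by (intro ennreal_leI)
   finally show ?thesis .
  qed
  have 4: "(np p (%x. conv u (moll eps) x - c x)) <= ennreal (T * (e1 + e1))"
  proof -
   have "(np p (%x. conv u (moll eps) x - c x)) <= ennreal T * (ennreal e1 + ennreal e1)"
    using nn_integral_powr_add[of "%x. conv u (moll eps) x - conv c (moll eps) x" lebesgue "%x. conv c (moll eps) x - c x" p] p 1 3
    unfolding T_def[symmetric] by (auto elim!: order_trans intro!: mult_left_mono add_mono)
   also have "ennreal T * (ennreal e1 + ennreal e1) = ennreal (T * (e1 + e1))"
    using T e1 by (simp add: ennreal_plus[symmetric] ennreal_mult[symmetric] del: ennreal_plus)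
   finally show ?thesis .
  qed
  have "(np p (%x. conv u (moll eps) x - u x)) <= ennreal T * (ennreal (T * (e1 + e1)) + ennreal e1)"
   using nn_integral_powr_add[of "%x. conv u (moll eps) x - c x" lebesgue "%x. c x - u x" p] p 4 2
   unfolding T_def[symmetric] by (auto elim!: order_trans intro!: mult_left_mono add_mono)
  also have "... = ennreal (T * (T * (e1 + e1) + e1))" using T e1 by (simp add: ennreal_mult)
  also have "... <= ennreal e"
  proof (rule ennreal_leI)
   have "T * (T * (e1 + e1) + e1) <= T * (T + 1) * 2 * e1" using T e1 by (simp add: algebra_simps)
   thus "T * (T * (e1 + e1) + e1) <= e" using T by (simp add: e1_def)
  qed
  finally show ?thesis using e by simp
 qed
 thus "\<forall>\<^sub>F eps in at_right 0. (np p (%x. conv u (moll eps) x - u x)) < a" using delta(1) by (auto simp: eventually_at_right_field)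
qed

subsection \<open>Lebesgue spaces\<close>

definition Lp :: "real => (real^'d => 'v::euclidean_space) => bool" where
 "Lp p u \<longleftrightarrow> u : BL & (nq p u) < \<infinity>"

text \<open>Zero extension discards the values outside \<open>D\<close>, about which
  \<open>sobolev\<close> and \<open>sgrad\<close> say nothing, and lets all integrals run over the
  whole space. The extension need not be weakly differentiable across the boundary of
  \<open>D\<close>.\<close>

definition ext :: "(real^'d) set => (real^'d => 'v::euclidean_space) => real^'d => 'v" where
 "ext D u x = ind D x *R u x"

lemma ext_simps: "x : D ==> ext D u x = u x" "x ~: D ==> ext D u x = 0" by (auto simp: ext_def)

lemma Lp_measurable: "Lp p u ==> u : BL" by (simp add: Lp_def)

lemma Lp_integrable: "Lp p u \<longleftrightarrow> u : BL & integ (%x. norm (u x) powr p)" by (auto simp: Lp_def integrable_iff_bounded)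

lemma Lp_on_ext: "Lp_on p D u \<longleftrightarrow> Lp p (ext D u)"
proof -
 have "(%x. ind D x *R norm (u x) powr p) = (%x. norm (ext D u x) powr p)" by (auto simp: ext_def fun_eq_iff indicator_def)
 thus ?thesis by (simp add: Lp_on_def Lp_integrable set_borel_measurable_def set_integrable_def ext_def[abs_def])
qed

lemma Lp_bound:
 assumes "v : BL" "Lp p u" "AEL x. norm (v x) <= C * norm (u x)" "C >= 0" "p > 0"
 shows "Lp p v" unfolding Lp_integrable
proof
 show "integ (%x. norm (v x) powr p)"
 proof (rule Bochner_Integration.integrable_bound[of _ "%x. C powr p * norm (u x) powr p"])
  show "AEL x. norm (norm (v x) powr p) <= norm (C powr p * norm (u x) powr p)" using assms(3)
  proof eventually_elim
   case (elim x)
   have "norm (v x) powr p <= (C * norm (u x)) powr p" using elim assms by (intro powr_mono2) auto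
   thus ?case using assms by (simp add: powr_mult)
  qed
 qed (use assms in "auto simp: Lp_integrable")
qed (use assms in auto)

lemma Lp_add: assumes "Lp p u" "Lp p v" "p > 0" shows "Lp p (%x. u x + v x)"
proof -
 have [measurable]: "u : BL" "v : BL" using assms by (auto simp: Lp_def)
 have "(nq p (%x. u x + v x)) < \<infinity>"
  by (rule le_less_trans[OF nn_integral_powr_add]) (use assms in "auto simp: Lp_def ennreal_mult_less_top")
 thus ?thesis by (simp add: Lp_def)
qed

lemma Lp_uminus: "Lp p u ==> Lp p (%x. - u x)" by (auto simp: Lp_def)

lemma Lp_diff: "Lp p u ==> Lp p v ==> p > 0 ==> Lp p (%x. u x - v x)"
 using Lp_add[OF _ Lp_uminus, of p u v] by simp

lemma Lp_0 [simp]: "Lp p (%x. 0)" by (auto simp: Lp_def)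

lemma Lp_sum: "(!!i. i : I ==> Lp p (f i)) ==> p > 0 ==> Lp p (%x. \<Sum>i\<in>I. f i x)"
 by (induction I rule: infinite_finite_induct) (auto intro: Lp_add)

lemma Lp_scaleR_bounded:
 assumes "Lp p u" "a : BL" "!!x. abs (a x) <= B" "p > 0"
 shows "Lp p (%x. a x *R u x)"
proof (rule Lp_bound[OF _ assms(1)])
 show "AEL x. norm (a x *R u x) <= abs B * norm (u x)" by (rule AE_I2) (simp add: mult_right_mono[OF order_trans[OF assms(3) abs_ge_self]])
qed (use assms in "auto simp: Lp_def")

lemma Lp_mult_bounded:
 fixes u :: "real^'d => real"
 assumes "Lp p u" "a : BL" "!!x. abs (a x) <= B" "p > 0"
 shows "Lp p (%x. a x * u x)" using Lp_scaleR_bounded[OF assms] by simp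

lemma Lp_componentwise:
 fixes u :: "real^'d => 'v::euclidean_space"
 assumes "!!b. b : Basis ==> Lp p (%x. u x \<bullet> b)" "p > 0" shows "Lp p u"
proof -
 have "Lp p (%x. \<Sum>b\<in>Basis. (u x \<bullet> b) *R b)"
 proof (intro Lp_sum assms)
  fix b :: 'v assume b: "b : Basis"
  show "Lp p (%x. (u x \<bullet> b) *R b)"
   by (rule Lp_bound[OF _ assms(1)[OF b], of _ 1]) (use assms(1)[OF b] b assms(2) in "auto simp: Lp_def")
 qed
 thus ?thesis by (simp add: euclidean_representation)
qed

lemma measurable_vec_nth:
 fixes u :: "'x => 'v::euclidean_space^'n"
 shows "u : borel_measurable M ==> (%x. u x $ i) : borel_measurable M"
 by (rule borel_measurable_continuous_on[of "%v. v $ i" u M]) (auto intro: continuous_intros)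

lemma Lp_vec_nth:
 fixes u :: "real^'d => 'v::euclidean_space^'n"
 shows "Lp p u ==> p > 0 ==> Lp p (%x. u x $ i)"
 by (rule Lp_bound[of "%x. u x $ i" p u 1]) (auto intro: measurable_vec_nth Lp_measurable intro!: AE_I2 Finite_Cartesian_Product.norm_nth_le)

text \<open>On the bounded set where \<open>a\<close> lives, the bound |u| <= 1 + |u|^p
  suffices.\<close>

lemma integrable_Lp_test:
 fixes u :: "real^'d => real"
 assumes u: "Lp p u" and p: "p >= 1" and a: "a : BL" "!!x. abs (a x) <= B" and supp: "!!x. norm x > N ==> a x = 0"
 shows "integ (%x. u x * a x)"
proof (rule Bochner_Integration.integrable_bound[of _ "%x. B * (ind (cball 0 N) x + norm (u x) powr p)"])
 have B: "B >= 0" using a(2)[of 0] by linarith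
 show "integ (%x. B * (ind (cball 0 N) x + norm (u x) powr p))" using u lmeasurable_cball[of "0::real^'d" N]
  by (intro integrable_mult_right Bochner_Integration.integrable_add) (auto simp: Lp_integrable fmeasurable_def integrable_indicator_iff)
 show "AEL x. norm (u x * a x) <= norm (B * (ind (cball 0 N) x + norm (u x) powr p))"
 proof (rule AE_I2)
  fix x
  show "norm (u x * a x) <= norm (B * (ind (cball 0 N) x + norm (u x) powr p))"
  proof (cases "norm x > N")
   case True thus ?thesis using supp by simp
  next
   case False
   have "abs (u x) <= 1 + abs (u x) powr p"
   proof (cases "abs (u x) <= 1")
    case False
    hence "abs (u x) powr 1 <= abs (u x) powr p" using p by (intro powr_mono) auto
    thus ?thesis using False by simp
   qed (simp add: add_increasing2)
   hence "abs (a x) * abs (u x) <= B * (1 + abs (u x) powr p)" using a(2)[of x] B by (intro mult_mono) auto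
   thus ?thesis using False B by (simp add: abs_mult mult.commute)
  qed
 qed
qed (use u a in "auto simp: Lp_def")

lemma test_fun_bounded_support:
 assumes "test_fun D phi" obtains N where "!!x. norm x > N ==> phi x = 0"
proof -
 obtain K where K: "compact K" "!!x. x ~: K ==> phi x = 0" using assms by (rule test_funE) blast
 obtain N where "!!x. x : K ==> norm x <= N" using compact_imp_bounded[OF K(1)] by (auto simp: bounded_iff)
 thus ?thesis using K(2) that[of N] by (meson not_le)
qed

lemma test_fun_measurable: "test_fun D phi ==> phi : BL" by (intro measurable_lebesgue_borelI smooth_fun_borel test_fun_smooth)

lemma integrable_Lp_test_fun:
 fixes u :: "real^'d => real"
 assumes "Lp p u" "p >= 1" "test_fun D phi"
 shows "integ (%x. u x * phi x)"
proof -
 obtain B where B: "!!x. abs (phi x) <= B" by (rule test_fun_bounded[OF assms(3)]) (rule that)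
 obtain N where N: "!!x. norm x > N ==> phi x = 0" by (rule test_fun_bounded_support[OF assms(3)]) (rule that)
 show ?thesis by (rule integrable_Lp_test[OF assms(1,2) test_fun_measurable[OF assms(3)] B N])
qed

lemma Lp_indicator: assumes "A : lmeasurable" shows "Lp p (ind A)"
proof -
 have "(%x. norm (ind A x) powr p) = ind A" by (auto simp: indicator_def fun_eq_iff)
 moreover have "integ (ind A)" by (rule integrable_real_indicator) (use assms in "auto simp: fmeasurable_def")
 ultimately show ?thesis by (simp add: Lp_integrable borel_measurable_integrable)
qed

lemma test_fun_Lp: assumes "test_fun D phi" "p > 0" shows "Lp p phi"
proof -
 obtain B where B: "!!x. abs (phi x) <= B" by (rule test_fun_bounded[OF assms(1)]) (rule that)
 obtain N where N: "!!x. norm x > N ==> phi x = 0" by (rule test_fun_bounded_support[OF assms(1)]) (rule that)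
 have "Lp p (ind (cball (0::real^'a) N))" by (rule Lp_indicator) simp
 thus ?thesis by (rule Lp_bound[OF test_fun_measurable[OF assms(1)], of _ _ "max B 0"])
   (use assms(2) B N in "auto simp: indicator_def not_le intro!: order_trans[OF B]")
qed

subsection \<open>Weak derivatives\<close>

text \<open>The weak partial derivative of one scalar component. The identity carries no
  integrability; \<open>Lp\<close> hypotheses are added where integrals have to be split.\<close>

definition wder :: "(real^'d) set => (real^'d => real) => 'd => (real^'d => real) => bool" where
 "wder D u j g \<longleftrightarrow> (ALL phi. test_fun D phi --> (LI x. u x * pdv j phi x) = - (LI x. g x * phi x))"

lemma weak_grad_wder: "weak_grad D u G \<longleftrightarrow> (ALL i j. wder D (%x. ext D u x $ i) j (%x. ext D G x $ i $ j))"
 unfolding weak_grad_def wder_def set_lebesgue_integral_def ext_def by (auto simp: mult.assoc)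

lemma wder_mono: "wder D u j g ==> D' <= D ==> wder D' u j g" unfolding wder_def using test_fun_mono by blast

lemma wder_cong:
 assumes "wder D u j g" "!!x. x : D ==> u x = u' x" "!!x. x : D ==> g x = g' x"
 shows "wder D u' j g'" unfolding wder_def
proof (intro allI impI)
 fix phi assume t: "test_fun D phi"
 have "(%x. u' x * pdv j phi x) = (%x. u x * pdv j phi x)" "(%x. g' x * phi x) = (%x. g x * phi x)"
  using test_fun_outside[OF t] test_fun_outside[OF test_fun_pdv[OF t]] assms(2,3) by (auto simp: fun_eq_iff) metis+
 thus "(LI x. u' x * pdv j phi x) = - (LI x. g' x * phi x)" using assms(1) t unfolding wder_def by simp
qed

lemma wder_add:
 assumes "wder D u j g" "wder D v j h" "Lp p u" "Lp p v" "Lp p g" "Lp p h" "p >= 1"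
 shows "wder D (%x. u x + v x) j (%x. g x + h x)" unfolding wder_def
proof (intro allI impI)
 fix phi assume t: "test_fun D phi"
 show "(LI x. (u x + v x) * pdv j phi x) = - (LI x. (g x + h x) * phi x)"
  using assms(1,2) t integrable_Lp_test_fun[OF _ assms(7) t] integrable_Lp_test_fun[OF _ assms(7) test_fun_pdv[OF t]] assms(3-6)
  unfolding wder_def by (simp add: distrib_right)
qed

lemma wder_scale:
 assumes "wder D u j g" shows "wder D (%x. c * u x) j (%x. c * g x)" using assms unfolding wder_def by (simp add: mult.assoc)

text \<open>The assumption \<open>test\<close> permits the domain to grow: if \<open>a\<close> is a
  test function of \<open>D\<close> and \<open>D'\<close> is the whole space, a product cut off
  inside \<open>D\<close> becomes weakly differentiable everywhere.\<close>

lemma wder_mult: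
 assumes "wder D u j g" "Lp p u" "Lp p g" "p >= 1" and a: "smooth_fun a"
  and test: "!!phi. test_fun D' phi ==> test_fun D (%x. a x * phi x)"
 shows "wder D' (%x. a x * u x) j (%x. a x * g x + pdv j a x * u x)" unfolding wder_def
proof (intro allI impI)
 fix phi assume t: "test_fun D' phi"
 note ta = test[OF t]
 have pd: "pdv j (%x. a x * phi x) x = a x * pdv j phi x + pdv j a x * phi x" for x
  by (rule pdv_mult) (intro smooth_fun_differentiable a test_fun_smooth[OF t])+
 have t2: "test_fun D' (%x. pdv j a x * phi x)" by (rule test_fun_mult[OF smooth_fun_pdv[OF a] t])
 have t3: "test_fun D' (%x. a x * pdv j phi x)" by (rule test_fun_mult[OF a test_fun_pdv[OF t]])
 note i1 = integrable_Lp_test_fun[OF assms(2) assms(4) t3]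
 note i2 = integrable_Lp_test_fun[OF assms(2) assms(4) t2]
 note i3 = integrable_Lp_test_fun[OF assms(3) assms(4) ta]
 have "(LI x. u x * pdv j (%x. a x * phi x) x) = - (LI x. g x * (a x * phi x))" using assms(1) ta unfolding wder_def by blast
 moreover have "(LI x. u x * pdv j (%x. a x * phi x) x) = (LI x. u x * (a x * pdv j phi x)) + (LI x. u x * (pdv j a x * phi x))"
  unfolding pd distrib_left by (rule Bochner_Integration.integral_add[OF i1 i2])
 moreover have "(LI x. (a x * g x + pdv j a x * u x) * phi x) = (LI x. g x * (a x * phi x)) + (LI x. u x * (pdv j a x * phi x))"
  unfolding Bochner_Integration.integral_add[OF i3 i2, symmetric] by (rule Bochner_Integration.integral_cong) (auto simp: algebra_simps)
 moreover have "(LI x. a x * u x * pdv j phi x) = (LI x. u x * (a x * pdv j phi x))" by (rule Bochner_Integration.integral_cong) (auto simp: algebra_simps)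
 ultimately show "(LI x. a x * u x * pdv j phi x) = - (LI x. (a x * g x + pdv j a x * u x) * phi x)" by linarith
qed

text \<open>Convolving with the indicator of a large ball gives, near the origin, the constant
  function with value the integral of \<open>psi\<close>. Its derivative at 0 vanishes, and it is
  also the integral of the derivative of \<open>psi\<close>.\<close>

lemma integral_pdv_test_fun:
 fixes psi :: "real^'d => real"
 assumes t: "test_fun D psi" shows "(LI x. pdv j psi x) = 0"
proof -
 obtain N where N: "!!x. norm x > N ==> psi x = 0" by (rule test_fun_bounded_support[OF t]) (rule that)
 have o: "open {x::real^'d. norm x > N}" by (intro open_Collect_less continuous_intros)
 have N': "pdv j psi x = 0" if "norm x > N" for x by (rule pdv_locally_const[OF o]) (use that N in auto)
 define u where "u = ind (cball (0::real^'d) (N + 1))"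
 have ui: "integ u" unfolding u_def using emeasure_lborel_cball_finite by (intro integrable_real_indicator) auto
 have c: "conv u chi x = (LI y. chi y)" if chi: "smooth_fun chi" "!!x. norm x > N ==> chi x = 0" and x: "norm x < 1" for chi x
 proof -
  have [measurable]: "chi : borel_measurable borel" by (rule smooth_fun_borel[OF chi(1)])
  have e: "u y * chi (x - y) = chi (x + (-1) *R y)" for y using chi(2)[of "x - y"] x norm_triangle_ineq2[of y x] by (auto simp: u_def indicator_def norm_minus_commute)
  show ?thesis unfolding conv_def e using lborel_integral_affine[of chi "-1" x] by (simp add: integral_completion)
 qed
 have s: "smooth_fun psi" "smooth_fun (pdv j psi)" using test_fun_smooth t test_fun_pdv by blast+
 have "(LI x. pdv j psi x) = conv u (pdv j psi) 0" by (rule c[OF s(2) N', symmetric]) simp_all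
 also have "... = pdv j (conv u psi) 0" by (rule fun_cong[OF conv_pdv[OF ui t, symmetric]])
 also have "... = 0" by (rule pdv_locally_const[OF open_ball[of 0 1]]) (use c[OF s(1) N] in auto)
 finally show ?thesis .
qed

lemma wder_test_fun:
 assumes "test_fun UNIV v" shows "wder D v j (pdv j v)" unfolding wder_def
proof (intro allI impI)
 fix phi assume t: "test_fun D phi"
 note v = test_fun_smooth[OF assms]
 have pd: "pdv j (%x. v x * phi x) x = v x * pdv j phi x + pdv j v x * phi x" for x
  by (rule pdv_mult) (intro smooth_fun_differentiable v test_fun_smooth[OF t])+
 have "(LI x. v x * pdv j phi x + pdv j v x * phi x) = 0" using integral_pdv_test_fun[OF test_fun_mult[OF v t], of j] unfolding pd .
 moreover have "integ (%x. v x * pdv j phi x)" "integ (%x. pdv j v x * phi x)"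
  by (rule test_fun_integrable[OF test_fun_mult[OF v test_fun_pdv[OF t]]] test_fun_integrable[OF test_fun_mult[OF smooth_fun_pdv[OF v] t]])+
 ultimately show "(LI x. v x * pdv j phi x) = - (LI x. pdv j v x * phi x)" by simp
qed

section \<open>The fundamental lemma and uniqueness of weak derivatives\<close>

lemma open_countable_cutoffs:
 fixes D :: "(real^'d) set"
 assumes "open D"
 obtains phi where "!!n::nat. test_fun D (phi n)" "!!x. x : D ==> EX n. phi n x = 1"
proof -
 obtain C :: "nat => (real^'d) set" where C: "!!n. compact (C n)" "!!n. C n <= D" "\<Union> (range C) = D"
  using open_Union_compact_subsets[OF assms] by metis
 have "ALL n. EX phi. test_fun D phi & (ALL x:C n. phi x = 1)" using ex_cutoff[OF C(1) assms C(2)] by (metis subsetD)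
 then obtain phi where "!!n. test_fun D (phi n)" "!!n x. x : C n ==> phi n x = 1" by metis
 thus ?thesis using C(3) that[of phi] by blast
qed

text \<open>Each mollification of \<open>h * phi\<close> vanishes identically, because a reflected
  mollifier times \<open>phi\<close> is again a test function of \<open>D\<close>. Convergence in
  L^1 gives \<open>h * phi = 0\<close> almost everywhere, and countably many cut-offs
  \<open>phi\<close> reach every point of \<open>D\<close>.\<close>

lemma fundamental_lemma:
 fixes h :: "real^'d => real"
 assumes "Lp p h" "p >= 1" "open D" and z: "!!phi. test_fun D phi ==> (LI x. h x * phi x) = 0"
 shows "AEL x. x : D --> h x = 0"
proof -
 have 1: "AEL x. h x * phi x = 0" if t: "test_fun D phi" for phi
 proof -
  have i: "integ (%x. h x * phi x)" by (rule integrable_Lp_test_fun[OF assms(1,2) t])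
  have c0: "conv (%x. h x * phi x) (moll eps) x = 0" for eps x
  proof -
   have "test_fun D (%y. moll eps (x - y) * phi y)" by (intro test_fun_mult smooth_fun_reflect moll_smooth t)
   from z[OF this] show ?thesis unfolding conv_def by (simp add: mult_ac)
  qed
  have fin: "(np 1 (%x. h x * phi x)) < \<infinity>" using i by (auto simp: integrable_iff_bounded)
  have "((%eps. (np 1 (%x. h x * phi x))) \<longlongrightarrow> 0) (at_right (0::real))"
   using mollification_tendsto[OF i fin] unfolding c0 by simp
  hence "(np 1 (%x. h x * phi x)) = 0" by (simp add: tendsto_const_iff)
  hence "AEL x. ennreal (abs (h x * phi x) powr 1) = 0" using i by (subst (asm) nn_integral_0_iff_AE) auto
  thus ?thesis by eventually_elim (simp add: ennreal_eq_0_iff)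
 qed
 obtain phi where phi: "!!n::nat. test_fun D (phi n)" "!!x. x : D ==> EX n. phi n x = 1"
  by (rule open_countable_cutoffs[OF assms(3)]) (rule that)
 have "AEL x. ALL n. h x * phi n x = 0" unfolding AE_all_countable using 1 phi(1) by blast
 thus ?thesis
 proof eventually_elim
  case (elim x)
  show ?case using phi(2)[of x] elim by (metis mult_cancel_left1 mult_eq_0_iff zero_neq_one)
 qed
qed

lemma wder_unique:
 assumes "wder D u j g" "wder D u j h" "Lp p g" "Lp p h" "p >= 1" "open D"
 shows "AEL x. x : D --> g x = h x"
proof -
 have "AEL x. x : D --> g x - h x = 0"
 proof (rule fundamental_lemma[OF Lp_diff[OF assms(3,4)]])
  fix phi assume t: "test_fun D phi"
  show "(LI x. (g x - h x) * phi x) = 0" using assms(1,2) t integrable_Lp_test_fun[OF assms(3,5) t] integrable_Lp_test_fun[OF assms(4,5) t]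
   unfolding wder_def by (simp add: left_diff_distrib)
 qed (use assms in auto)
 thus ?thesis by eventually_elim simp
qed

lemma conv_wder:
 fixes u :: "real^'d => real"
 assumes "wder UNIV u j g" "integ u" "eps > 0"
 shows "pdv j (conv u (moll eps)) = conv g (moll eps)"
proof
 fix x :: "real^'d"
 have sm: "smooth_fun (moll eps :: real^'d => real)" by (rule moll_smooth)
 have "test_fun UNIV (%y. moll eps (x - y))"
 proof (rule test_funI[OF smooth_fun_reflect[OF sm] compact_cball[of x eps]])
  show "moll eps (x - y) = 0" if "y ~: cball x eps" for y by (rule moll_outside[OF assms(3)]) (use that in "simp add: dist_norm")
 qed auto
 hence "(LI y. u y * pdv j (%y. moll eps (x - y)) y) = - (LI y. g y * moll eps (x - y))" using assms(1) unfolding wder_def by blast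
 moreover have "pdv j (conv u (moll eps)) x = (LI y. u y * pdv j (moll eps) (x - y))"
  using fun_cong[OF conv_pdv[OF assms(2) moll_test_fun[OF assms(3)], of j], of x] by (rule trans) (rule conv_def)
 ultimately show "pdv j (conv u (moll eps)) x = conv g (moll eps) x" unfolding pdv_reflect[OF sm] conv_def by simp
qed

lemma conv_test_fun:
 fixes u :: "real^'d => real"
 assumes "integ u" "eps > 0" and supp: "!!x. norm x > N ==> u x = 0"
 shows "test_fun UNIV (conv u (moll eps))" "norm x > N + eps ==> conv u (moll eps) x = 0"
proof -
 show 0: "conv u (moll eps) x = 0" if "norm x > N + eps" for x
 proof -
  have "u y * moll eps (x - y) = 0" for y
  proof (cases "norm y > N")
   case False
   hence "norm (x - y) >= eps" using that norm_triangle_ineq2[of x y] by linarith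
   thus ?thesis using moll_outside[OF assms(2), of "x - y"] by simp
  qed (simp add: supp)
  thus ?thesis unfolding conv_def by (simp only: Bochner_Integration.integral_zero)
 qed
 show "test_fun UNIV (conv u (moll eps))" by (rule test_funI[OF conv_smooth[OF assms(1) moll_test_fun[OF assms(2)]] compact_cball[of 0 "N + eps"]])
   (auto intro: 0)
qed

subsection \<open>Sobolev functions\<close>

lemma norm_vec_le_sum: "norm (x :: 'v::real_normed_vector^'n) <= (\<Sum>i\<in>UNIV. norm (x $ i))" unfolding norm_vec_def by (rule L2_set_le_sum) simp

lemma norm_vec_powr_le:
 fixes x :: "'v::real_normed_vector^'n"
 assumes "p >= 0"
 shows "norm x powr p <= real CARD('n) powr p * (\<Sum>i\<in>UNIV. norm (x $ i) powr p)"
 using order_trans[OF powr_mono2[OF assms _ norm_vec_le_sum] powr_sum_le[of UNIV "%i. norm (x $ i)" p]] assms by simp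

lemma norm_matrix_powr_le:
 fixes x :: "real^'d^'m"
 assumes "p >= 0"
 shows "norm x powr p <= (real CARD('m) powr p * real CARD('d) powr p) * (\<Sum>i\<in>UNIV. \<Sum>j\<in>UNIV. abs (x $ i $ j) powr p)"
proof -
 have "(\<Sum>i\<in>UNIV. norm (x $ i) powr p) <= (\<Sum>i\<in>UNIV. real CARD('d) powr p * (\<Sum>j\<in>UNIV. abs (x $ i $ j) powr p))"
  by (rule sum_mono) (use norm_vec_powr_le[OF assms, of "x $ i" for i] in simp)
 hence "real CARD('m) powr p * (\<Sum>i\<in>UNIV. norm (x $ i) powr p)
  <= real CARD('m) powr p * (\<Sum>i\<in>UNIV. real CARD('d) powr p * (\<Sum>j\<in>UNIV. abs (x $ i $ j) powr p))" by (intro mult_left_mono) auto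
 thus ?thesis using norm_vec_powr_le[OF assms, of x] by (simp add: sum_distrib_left mult.assoc)
qed

text \<open>The gradient is an argument here, whereas \<open>sgrad\<close> is a choice determined
  only almost everywhere. Constructions produce a pair in this relation and pass to
  \<open>sgrad\<close> through \<open>sgrad_unique\<close>.\<close>

definition sob :: "real => (real^'d) set => (real^'d => real^'m) => (real^'d => real^'d^'m) => bool" where
 "sob p D u G \<longleftrightarrow> Lp_on p D u & Lp_on p D G & weak_grad D u G"

lemma sob_sobolev: "sob p D u G ==> sobolev p D u" by (auto simp: sob_def sobolev_def)

lemma sob_sgrad: "sobolev p D u ==> sob p D u (sgrad p D u)" unfolding sob_def sobolev_def sgrad_def by (metis (mono_tags, lifting) someI_ex)

lemma sob_wder:
 "sob p D u G \<longleftrightarrow> Lp p (ext D u) & Lp p (ext D G) & (ALL i j. wder D (%x. ext D u x $ i) j (%x. ext D G x $ i $ j))"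
 by (simp add: sob_def Lp_on_ext weak_grad_wder)

lemma ext_UNIV [simp]: "ext UNIV u = u" by (auto simp: ext_def)

lemma sob_unique:
 assumes "sob p D u G" "sob p D u H" "p >= 1" "open D"
 shows "AEL x. x : D --> G x = H x"
proof -
 have "AEL x. x : D --> ext D G x $ i $ j = ext D H x $ i $ j" for i j
  using assms Lp_vec_nth[of p "%x. ext D G x $ i" j] Lp_vec_nth[of p "ext D G" i]
   Lp_vec_nth[of p "%x. ext D H x $ i" j] Lp_vec_nth[of p "ext D H" i] unfolding sob_wder by (intro wder_unique) auto
 hence "AEL x. ALL i:UNIV. ALL j:UNIV. x : D --> ext D G x $ i $ j = ext D H x $ i $ j" by (intro AE_finite_allI) auto
 thus ?thesis by eventually_elim (auto simp: vec_eq_iff ext_simps)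
qed

lemma sgrad_unique:
 assumes "sob p D u G" "p >= 1" "open D"
 shows "AEL x. x : D --> sgrad p D u x = G x" by (rule sob_unique[OF sob_sgrad[OF sob_sobolev[OF assms(1)]] assms])

lemma ext_add: "ext D (%x. u x + v x) = (%x. ext D u x + ext D v x)"
 and ext_diff: "ext D (%x. u x - v x) = (%x. ext D u x - ext D v x)"
 and ext_scaleR: "ext D (%x. c *R u x) = (%x. c *R ext D u x)" by (auto simp: ext_def fun_eq_iff scaleR_add_right scaleR_diff_right)

lemma sob_add:
 assumes "sob p D u G" "sob p D v H" "p >= 1"
 shows "sob p D (%x. u x + v x) (%x. G x + H x)"
proof -
 have n: "Lp p (%x. f x $ i)" "Lp p (%x. F x $ i $ j)" if "Lp p f" "Lp p F" for f :: "real^'a => real^'b" and F :: "real^'a => real^'a^'b" and i j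
  using Lp_vec_nth[OF that(1)] Lp_vec_nth[OF Lp_vec_nth[OF that(2)]] assms(3) by auto
 show ?thesis using assms unfolding sob_wder ext_add by (auto intro!: Lp_add wder_add[where p=p] n)
qed

lemma sob_scaleR:
 assumes "sob p D u G" "p >= 1" shows "sob p D (%x. c *R u x) (%x. c *R G x)" using assms unfolding sob_wder ext_scaleR
 by (auto intro!: Lp_scaleR_bounded[where B="abs c" and a="%x. c"] wder_scale)

lemma sob_diff:
 assumes "sob p D u G" "sob p D v H" "p >= 1"
 shows "sob p D (%x. u x - v x) (%x. G x - H x)" using sob_add[OF assms(1) sob_scaleR[OF assms(2,3), of "-1"] assms(3)] by simp

lemma Lp_on_subset:
 assumes "Lp_on p D u" "D' <= D" "D' : sets lebesgue" "p > 0"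
 shows "Lp_on p D' u"
proof -
 have "ext D' u = (%x. ind D' x *R ext D u x)" using assms(2) by (auto simp: ext_def fun_eq_iff indicator_def)
 moreover have "Lp p (%x. ind D' x *R ext D u x)" by (rule Lp_scaleR_bounded[where B=1]) (use assms in "auto simp: Lp_on_ext")
 ultimately show ?thesis by (simp add: Lp_on_ext)
qed

lemma sob_subset:
 assumes "sob p D u G" "D' <= D" "open D'" "p >= 1" shows "sob p D' u G"
proof -
 have "D' : sets lebesgue" using assms(3) by auto
 hence "Lp_on p D' u" "Lp_on p D' G" using Lp_on_subset[of p D _ D'] assms unfolding sob_def by auto
 moreover have "wder D' (%x. ext D' u x $ i) j (%x. ext D' G x $ i $ j)" for i j
 proof (rule wder_cong)
  show "wder D' (%x. ext D u x $ i) j (%x. ext D G x $ i $ j)" using assms(1,2) wder_mono unfolding sob_wder by blast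
 qed (use assms(2) in "auto simp: ext_simps subsetD")
 ultimately show ?thesis by (simp add: sob_def weak_grad_wder)
qed

section \<open>Products of Sobolev functions with cut-off functions\<close>

definition gradient :: "(real^'d => real) => real^'d => real^'d" where "gradient phi x = (\<chi> j. pdv j phi x)"

definition outer :: "real^'m => real^'d => real^'d^'m" where "outer a b = (\<chi> i j. a $ i * b $ j)"

lemma outer_0 [simp]: "outer a 0 = 0" "outer 0 b = 0" by (auto simp: outer_def vec_eq_iff)

lemma norm_outer: "norm (outer a b) <= norm a * norm b"
proof -
 have "norm (outer a b $ i) = norm (a $ i *R b)" for i by (simp add: outer_def scaleR_vec_def)
 hence "norm (outer a b) = L2_set (%i. norm (a $ i) * norm b) UNIV" by (subst norm_vec_def) simp
 also have "... = norm a * norm b" by (simp add: L2_set_right_distrib[symmetric] norm_vec_def mult.commute L2_set_left_distrib[symmetric])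
 finally show ?thesis by simp
qed

lemma measurable_matrixI:
 fixes F :: "'x => real^'d^'m"
 assumes "!!i j. (%x. F x $ i $ j) : borel_measurable M" shows "F : borel_measurable M"
proof -
 have "(%x. F x \<bullet> b) : borel_measurable M" if b: "b : Basis" for b :: "real^'d^'m"
 proof -
  obtain i j where "b = axis i (axis j 1)" using b by (auto simp: Basis_vec_def)
  thus ?thesis using assms by (simp add: inner_axis)
 qed
 thus ?thesis by (subst borel_measurable_euclidean_space) blast
qed

lemma test_fun_gradient_bounded:
 fixes phi :: "real^'d => real"
 assumes "test_fun D phi" obtains B where "B >= 0" "!!x. norm (gradient phi x) <= B"
proof -
 have "EX B>=0. ALL x. abs (pdv i phi x) <= B" for i using test_fun_bounded[OF test_fun_pdv[OF assms, of i]] by metis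
 then obtain B where B: "!!i. B i >= 0" "!!i x. abs (pdv i phi x) <= B i" by metis
 have "norm (gradient phi x) <= sum B UNIV" for x
 proof -
  have "norm (gradient phi x) <= (\<Sum>j\<in>UNIV. norm (gradient phi x $ j))" by (rule norm_vec_le_sum)
  also have "... <= sum B UNIV" by (rule sum_mono) (use B in "simp add: gradient_def")
  finally show ?thesis .
 qed
 thus ?thesis using that[of "sum B UNIV"] B by (simp add: sum_nonneg)
qed

lemma gradient_measurable: "test_fun D phi ==> (%x. gradient phi x $ j) : BL"
 unfolding gradient_def by (simp add: test_fun_measurable[OF test_fun_pdv])

lemma Lp_outer_gradient:
 fixes u :: "real^'d => real^'m"
 assumes "Lp p u" "test_fun D phi" "p > 0" shows "Lp p (%x. outer (u x) (gradient phi x))"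
proof -
 obtain B where B: "B >= 0" "!!x. norm (gradient phi x) <= B" by (rule test_fun_gradient_bounded[OF assms(2)]) (rule that)
 show ?thesis
 proof (rule Lp_bound[OF _ assms(1)])
  show "(%x. outer (u x) (gradient phi x)) : BL" by (rule measurable_matrixI)
    (use gradient_measurable[OF assms(2)] measurable_vec_nth[OF Lp_measurable[OF assms(1)]] in "simp add: outer_def")
  show "AEL x. norm (outer (u x) (gradient phi x)) <= B * norm (u x)"
   by (rule AE_I2) (use B in "auto intro!: order_trans[OF norm_outer] simp: mult.commute[of B] mult_left_mono")
 qed (use B assms in auto)
qed

lemma sob_cutoff:
 assumes s: "sob p D u G" and t: "test_fun D phi" and p: "p >= 1"
 shows "sob p UNIV (%x. phi x *R ext D u x) (%x. phi x *R ext D G x + outer (ext D u x) (gradient phi x))"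
proof -
 obtain B where B: "!!x. abs (phi x) <= B" by (rule test_fun_bounded[OF t]) (rule that)
 have L: "Lp p (ext D u)" "Lp p (ext D G)" using s by (auto simp: sob_wder)
 have "wder UNIV (%x. (phi x *R ext D u x) $ i) j (%x. (phi x *R ext D G x + outer (ext D u x) (gradient phi x)) $ i $ j)" for i j
 proof -
  have "wder UNIV (%x. phi x * ext D u x $ i) j (%x. phi x * ext D G x $ i $ j + pdv j phi x * ext D u x $ i)"
  proof (rule wder_mult[where D=D and p=p])
   show "wder D (%x. ext D u x $ i) j (%x. ext D G x $ i $ j)" using s by (simp add: sob_wder)
   show "test_fun D (%x. phi x * psi x)" if "test_fun UNIV psi" for psi using test_fun_mult[OF test_fun_smooth[OF that] t] by (simp add: mult.commute)
  qed (use Lp_vec_nth[OF L(1)] Lp_vec_nth[OF Lp_vec_nth[OF L(2)]] p test_fun_smooth[OF t] in auto)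
  thus ?thesis by (simp add: outer_def gradient_def mult.commute)
 qed
 moreover have "Lp p (%x. phi x *R ext D u x)" "Lp p (%x. phi x *R ext D G x)"
  by (rule Lp_scaleR_bounded[OF _ test_fun_measurable[OF t] B]; use L p in simp)+
 ultimately show ?thesis using Lp_outer_gradient[OF L(1) t] p by (auto simp: sob_wder intro!: Lp_add)
qed

lemma cgrad_nth: "cgrad v x $ i $ j = pdv j (%y. v y $ i) x" by (simp add: cgrad_def)

lemma test_fun_vec_Lp:
 assumes "test_fun_vec D v" "p > 0"
 shows "Lp p v" "Lp p (cgrad v)"
proof -
 have t: "test_fun D (%x. v x $ i)" for i using assms by (simp add: test_fun_vec_def)
 show "Lp p v"
 proof (rule Lp_componentwise[OF _ assms(2)])
  fix b :: "real^'b" assume "b : Basis"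
  then obtain i where "b = axis i 1" by (auto simp: Basis_vec_def)
  thus "Lp p (%x. v x \<bullet> b)" using test_fun_Lp[OF t[of i] assms(2)] by (simp add: inner_axis)
 qed
 show "Lp p (cgrad v)"
 proof (rule Lp_componentwise[OF _ assms(2)])
  fix b :: "real^'a^'b" assume "b : Basis"
  then obtain i j where "b = axis i (axis j 1)" by (auto simp: Basis_vec_def)
  thus "Lp p (%x. cgrad v x \<bullet> b)" using test_fun_Lp[OF test_fun_pdv[OF t[of i], of j] assms(2)] by (simp add: inner_axis cgrad_nth)
 qed
qed

lemma sob_test_fun:
 assumes "test_fun_vec UNIV v" "p >= 1" shows "sob p UNIV v (cgrad v)"
proof -
 have "test_fun UNIV (%x. v x $ i)" for i using assms by (simp add: test_fun_vec_def)
 thus ?thesis using test_fun_vec_Lp[OF assms(1), of p] assms(2) by (simp add: sob_wder cgrad_nth wder_test_fun)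
qed

section \<open>Approximation of Sobolev functions by test functions\<close>

lemma nn_integral_sum_le:
 fixes f :: "'i => 'x => real"
 assumes "finite I" "!!i x. i : I ==> f i x >= 0" "!!i. i : I ==> f i : borel_measurable M" "C >= 0"
  "!!x. g x <= C * (\<Sum>i\<in>I. f i x)" "!!i. i : I ==> (\<integral>\<^sup>+x. ennreal (f i x) \<partial>M) <= ennreal e" "e >= 0"
 shows "(\<integral>\<^sup>+x. ennreal (g x) \<partial>M) <= ennreal (C * real (card I) * e)"
proof -
 have "(\<integral>\<^sup>+x. ennreal (g x) \<partial>M) <= (\<integral>\<^sup>+x. ennreal C * (\<Sum>i\<in>I. ennreal (f i x)) \<partial>M)"
  by (rule nn_integral_mono) (use assms in "simp add: sum_ennreal ennreal_mult[symmetric] sum_nonneg ennreal_leI")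
 also have "... = ennreal C * (\<Sum>i\<in>I. \<integral>\<^sup>+x. ennreal (f i x) \<partial>M)"
 proof (subst nn_integral_cmult)
  show "(%x. \<Sum>i\<in>I. ennreal (f i x)) : borel_measurable M" using assms(3) by (intro borel_measurable_sum) auto
  show "ennreal C * (\<integral>\<^sup>+x. (\<Sum>i\<in>I. ennreal (f i x)) \<partial>M) = ennreal C * (\<Sum>i\<in>I. \<integral>\<^sup>+x. ennreal (f i x) \<partial>M)"
   using assms(3) by (subst nn_integral_sum) auto
 qed
 also have "... <= ennreal C * (\<Sum>i\<in>I. ennreal e)" by (intro mult_left_mono sum_mono assms) auto
 also have "... = ennreal (C * real (card I) * e)" using assms by (simp add: ennreal_mult mult.assoc ennreal_of_nat_eq_real_of_nat)
 finally show ?thesis .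
qed

text \<open>Mollify every component: on the whole space the weak derivative commutes with the
  convolution, and bounded support makes the Lp functions integrable, as the results on convolutions
  require.\<close>

lemma sob_approx:
 fixes u :: "real^'d => real^'m"
 assumes s: "sob p UNIV u G" and supp: "!!x. norm x > N ==> u x = 0" and p: "p >= 1" and e: "e > 0"
 obtains v where "test_fun_vec UNIV v" "!!x. norm x > N + 1 ==> v x = 0" "(nq p (%x. v x - u x)) <= ennreal e"
  "(nq p (%x. cgrad v x - G x)) <= ennreal e"
proof -
 have L: "Lp p u" "Lp p G" and wd: "!!i j. wder UNIV (%x. u x $ i) j (%x. G x $ i $ j)" using s by (auto simp: sob_wder)
 have Lc: "Lp p (%x. u x $ i)" "Lp p (%x. G x $ i $ j)" for i j using Lp_vec_nth[OF L(1)] Lp_vec_nth[OF Lp_vec_nth[OF L(2)]] p by auto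
 have AE0: "AEL x. norm x > N --> G x $ i $ j = 0" for i j
 proof -
  have o: "open {x::real^'d. norm x > N}" by (intro open_Collect_less continuous_intros)
  have "wder {x. norm x > N} (%x. u x $ i) j (%x. 0)" unfolding wder_def
  proof (intro allI impI)
   fix phi assume t: "test_fun {x::real^'d. norm x > N} phi"
   have "u x $ i * pdv j phi x = 0" for x using supp[of x] test_fun_outside[OF test_fun_pdv[OF t], of x j] by (cases "norm x > N") auto
   thus "(LI x. u x $ i * pdv j phi x) = - (LI x. 0 * phi x)" by (simp only: Bochner_Integration.integral_zero mult_zero_left minus_zero)
  qed
  from wder_unique[OF wder_mono[OF wd subset_UNIV] this Lc(2) Lp_0 p o] show ?thesis by simp
 qed
 \<comment> \<open>\<open>G\<close> vanishes outside the ball only almost everywhere;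
   \<open>H\<close> is its representative with bounded support.\<close>
 define H where "H i j x = ind (cball 0 N) x * G x $ i $ j" for i j x
 have HG: "AEL x. H i j x = G x $ i $ j" for i j using AE0[of i j] by eventually_elim (auto simp: H_def indicator_def)
 have ib: "ind (cball (0::real^'d) N) : BL" by (rule borel_measurable_indicator) simp
 have Hm: "H i j : BL" for i j unfolding H_def by (intro borel_measurable_times Lp_measurable[OF Lc(2)] ib)
 have Lw: "Lp p (H i j)" for i j unfolding H_def by (rule Lp_mult_bounded[OF Lc(2) ib, where B=1]) (use p in auto)
 have wH: "wder UNIV (%x. u x $ i) j (H i j)" for i j
 proof -
  have "(LI x. H i j x * phi x) = (LI x. G x $ i $ j * phi x)" if t: "test_fun UNIV phi" for phi
   by (rule integral_cong_AE) (use HG[of i j] Hm test_fun_measurable[OF t] Lp_measurable[OF Lc(2)] in auto)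
  thus ?thesis using wd[of i j] by (simp add: wder_def)
 qed
 have ind: "(%x. w x * ind (cball 0 N) x) = w" if "!!x. norm x > N ==> w x = 0" for w :: "real^'d => real"
  using that by (auto simp: indicator_def fun_eq_iff)
 have ui: "integ (%x. u x $ i)" for i using integrable_Lp_test[OF Lc(1) p ib, of 1 N i] ind[of "%x. u x $ i"] supp by simp
 have Hi: "integ (H i j)" for i j using integrable_Lp_test[OF Lw p ib, of 1 N i j] ind[of "H i j"] by (simp add: H_def)
 define C where "C = real CARD('m) powr p * real CARD('d) powr p"
 have C: "C > 0" by (simp add: C_def)
 define C' where "C' = real CARD('m) powr p"
 have C': "C' > 0" by (simp add: C'_def)
 define e1 where "e1 = min (e / (C * real (card (UNIV :: ('m \<times> 'd) set)))) (e / (C' * real CARD('m)))"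
 have e1: "e1 > 0" using e C C' by (simp add: e1_def)
 have fu: "\<forall>\<^sub>F eps in at_right 0. ALL i:UNIV. (np p (%x. conv (%x. u x $ i) (moll eps) x - u x $ i)) < ennreal e1"
  by (intro eventually_ball_finite ballI finite_UNIV order_tendstoD(2)[OF mollification_tendsto[OF ui _ p]]) (use Lc(1) e1 in "auto simp: Lp_def")
 have fG: "\<forall>\<^sub>F eps in at_right 0. ALL k:(UNIV :: ('m \<times> 'd) set). (np p (%x. conv (H (fst k) (snd k)) (moll eps) x - H (fst k) (snd k) x)) < ennreal e1"
  by (intro eventually_ball_finite ballI finite_UNIV order_tendstoD(2)[OF mollification_tendsto[OF Hi _ p]]) (use Lw e1 in "auto simp: Lp_def")
 have "\<forall>\<^sub>F eps::real in at_right 0. 0 < eps & eps < 1" by (auto simp: eventually_at_right_field intro: exI[of _ 1])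
 from eventually_happens'[OF _ eventually_conj[OF fu eventually_conj[OF fG this]]]
 obtain eps where eps: "0 < eps" "eps < 1" and fu: "!!i. (np p (%x. conv (%x. u x $ i) (moll eps) x - u x $ i)) < ennreal e1"
  and fG: "!!k. (np p (%x. conv (H (fst k) (snd k)) (moll eps) x - H (fst k) (snd k) x)) < ennreal e1" by auto
 define v where "v x = (\<chi> i. conv (%x. u x $ i) (moll eps) x)" for x
 have vi: "(%x. v x $ i) = conv (%x. u x $ i) (moll eps)" for i by (auto simp: v_def)
 have cg: "cgrad v x $ i $ j = conv (H i j) (moll eps) x" for x i j unfolding cgrad_nth vi by (rule fun_cong[OF conv_wder[OF wH ui eps(1)]])
 have t: "test_fun_vec UNIV v" unfolding test_fun_vec_def vi by (intro allI conv_test_fun(1)[where N=N, OF ui eps(1)]) (use supp in auto)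
 have 0: "v x = 0" if "norm x > N + 1" for x unfolding v_def vec_eq_iff using conv_test_fun(2)[where N=N and x=x, OF ui eps(1)] supp that eps by simp
 have [measurable]: "(%x. v x $ i) : BL" "(%x. cgrad v x $ i $ j) : BL" for i j
  unfolding vi cg by (intro measurable_lebesgue_borelI conv_borel[OF ui moll_test_fun[OF eps(1)]] conv_borel[OF Hi moll_test_fun[OF eps(1)]])+
 have [measurable]: "(%x. u x $ i) : BL" "(%x. G x $ i $ j) : BL" for i j using Lc by (auto simp: Lp_def)
 have "(nq p (%x. v x - u x)) <= ennreal (C' * real CARD('m) * e1)"
 proof (rule nn_integral_sum_le[where f="%i x. abs (v x $ i - u x $ i) powr p"])
  show "norm (v x - u x) powr p <= C' * (\<Sum>i\<in>UNIV. abs (v x $ i - u x $ i) powr p)" for x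
   using norm_vec_powr_le[of p "v x - u x"] p by (simp add: C'_def)
  show "(np p (%x. v x $ i - u x $ i)) <= ennreal e1" for i using fu[of i] by (simp add: v_def)
 qed (use C' e1 in auto)
 also have "... <= ennreal e"
 proof (rule ennreal_leI)
  have "e1 <= e / (C' * real CARD('m))" by (simp add: e1_def)
  thus "C' * real CARD('m) * e1 <= e" using C' by (simp add: field_simps)
 qed
 finally have 1: "(nq p (%x. v x - u x)) <= ennreal e" .
 have "(nq p (%x. cgrad v x - G x)) <= ennreal (C * real (card (UNIV :: ('m \<times> 'd) set)) * e1)"
 proof (rule nn_integral_sum_le[where f="%k x. abs (cgrad v x $ fst k $ snd k - G x $ fst k $ snd k) powr p"])
  show "norm (cgrad v x - G x) powr p <= C * (\<Sum>k\<in>UNIV. abs (cgrad v x $ fst k $ snd k - G x $ fst k $ snd k) powr p)" for x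
   using norm_matrix_powr_le[of p "cgrad v x - G x"] p
   by (simp add: C_def sum.cartesian_product case_prod_unfold UNIV_Times_UNIV[symmetric] del: UNIV_Times_UNIV)
  show "(np p (%x. cgrad v x $ fst k $ snd k - G x $ fst k $ snd k)) <= ennreal e1" for k
  proof -
   have "(np p (%x. cgrad v x $ fst k $ snd k - G x $ fst k $ snd k))
    = (np p (%x. conv (H (fst k) (snd k)) (moll eps) x - H (fst k) (snd k) x))"
    by (rule nn_integral_cong_AE) (use HG[of "fst k" "snd k"] in "auto simp: cg")
   thus ?thesis using fG[of k] by simp
  qed
 qed (use C e1 in auto)
 also have "... <= ennreal e"
 proof (rule ennreal_leI)
  have "e1 <= e / (C * real (card (UNIV :: ('m \<times> 'd) set)))" by (simp add: e1_def)
  thus "C * real (card (UNIV :: ('m \<times> 'd) set)) * e1 <= e" using C by (simp add: field_simps)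
 qed
 finally have 2: "(nq p (%x. cgrad v x - G x)) <= ennreal e" .
 show ?thesis by (rule that[OF t 0 1 2])
qed

subsection \<open>Quasiconvex functions are locally Lipschitz\<close>

lemma sum_Basis_nth [simp]: "(\<Sum>b\<in>(Basis :: (real^'d) set). b $ l) = 1"
 using inner_sum_left_Basis[of "axis l 1 :: real^'d" "%_. 1"] by (simp add: cart_eq_inner_axis inner_sum_left axis_in_Basis_iff)

text \<open>Take the distance \<open>g\<close> to the complement of the cube, rescale it by
  \<open>k\<close>, clip it to a function with Lipschitz constant 1/k and mollify at scale k/2. The
  result keeps this Lipschitz constant, vanishes where g < k/2 and is 1 where g > 3k, in particular
  on the cube inset by 4k.\<close>

lemma ex_box_cutoff:
 fixes k :: real
 assumes k: "k > 0"
 shows "EX theta :: real^'d => real. test_fun (box 0 One) theta & (ALL x. abs (theta x) <= 1) & (ALL x i. abs (pdv i theta x) <= 1 / k) &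
  (ALL x:cbox (\<chi> i. 4 * k) (\<chi> i. 1 - 4 * k). theta x = 1 & (ALL i. pdv i theta x = 0))"
proof -
 define g where "g x = infdist x (- box 0 One)" for x :: "real^'d"
 have gl: "abs (g x - g y) <= norm (x - y)" for x y unfolding g_def using infdist_triangle_abs[of x _ y] by (simp add: dist_norm)
 have gc: "continuous_on S g" for S unfolding g_def by (intro continuous_intros)
 have g0: "x : box 0 One" if "g x > 0" for x using that infdist_zero[of x "- box 0 One"] by (cases "x : box 0 One") (auto simp: g_def)
 define u where "u x = max 0 (min 1 (g x / k - 1))" for x
 have ul: "abs (u x - u y) <= 1 / k * dist x y" for x y
 proof -
  have "abs (u x - u y) <= abs (g x / k - g y / k)" unfolding u_def by (simp add: max_def min_def)
  also have "... <= 1 / k * dist x y" using divide_right_mono[OF gl[of x y], of k] k by (simp add: dist_norm diff_divide_distrib[symmetric])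
  finally show ?thesis .
 qed
 have ui: "integrable lborel u"
 proof (rule Bochner_Integration.integrable_bound)
  show "integrable lborel (ind (box 0 (One :: real^'d)))" by (simp add: integrable_indicator_iff)
  show "u : borel_measurable lborel" unfolding u_def[abs_def] using borel_measurable_continuous_onI[OF gc] by measurable
  have "u x = 0" if "x ~: box 0 One" for x using g0[of x] that infdist_nonneg[of x "- box 0 One"] by (force simp: u_def g_def)
  moreover have "abs (u x) <= 1" for x by (simp add: u_def)
  ultimately show "AE x in lborel. norm (u x) <= norm (ind (box 0 One) x)" by (intro AE_I2) (auto simp: indicator_def)
 qed
 define theta where "theta = conv u (moll (k / 2))"
 have k2: "k / 2 > 0" using k by simp
 note c = conv_lborel(2)[OF ui moll_test_fun[OF k2]]
 have sm: "smooth_fun theta" unfolding theta_def using integrable_completion[of u lborel] ui by (intro conv_smooth[OF _ moll_test_fun[OF k2]]) simp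
 have val: "theta x = (LINT y|lborel. a * moll (k / 2) (x - y))" if "!!y. norm (x - y) < k / 2 ==> u y = a" for x a
 proof -
  have "u y * moll (k / 2) (x - y) = a * moll (k / 2) (x - y)" for y using that[of y] moll_outside[OF k2, of "x - y"] by (cases "norm (x - y) < k / 2") auto
  thus ?thesis by (simp only: theta_def c)
 qed
 have t0: "theta x = 0" if "g x < k / 2" for x
 proof -
  have "u y = 0" if "norm (x - y) < k / 2" for y
  proof -
   have "g y / k <= 1" using gl[of x y] that \<open>g x < k / 2\<close> k by (simp add: pos_divide_le_eq)
   thus ?thesis by (simp add: u_def)
  qed
  thus ?thesis using val[of x 0] by simp
 qed
 have t1: "theta x = 1" if "g x > 3 * k" for x
 proof -
  have "u y = 1" if "norm (x - y) < k / 2" for y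
  proof -
   have "2 <= g y / k" using gl[of x y] that \<open>g x > 3 * k\<close> k by (simp add: pos_le_divide_eq)
   thus ?thesis by (simp add: u_def)
  qed
  thus ?thesis using val[of x 1] moll_reflect_integral(2)[OF k2] by simp
 qed
 have "test_fun (box 0 One) theta"
 proof (rule test_funI[OF sm])
  have "closed {x. k / 2 <= g x}" by (intro closed_Collect_le gc continuous_on_const)
  moreover show "{x. k / 2 <= g x} <= box 0 One" using g0 k by force
  ultimately show "compact {x. k / 2 <= g x}" using bounded_subset[OF bounded_box] by (auto simp: compact_eq_bounded_closed)
 qed (use t0 in force)
 moreover have "abs (theta x) <= 1" for x unfolding theta_def by (rule conv_abs_bound[OF ui k2]) (simp add: u_def)
 moreover have "abs (pdv i theta x) <= 1 / k" for x i
  by (rule pdv_lipschitz_bound[OF smooth_fun_differentiable[OF sm]]) (use conv_lipschitz[OF ui k2 ul] in "simp add: theta_def")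
 moreover have "theta x = 1 & (ALL i. pdv i theta x = 0)" if x: "x : cbox (\<chi> i. 4 * k) (\<chi> i. 1 - 4 * k)" for x
 proof -
  have "4 * k <= dist x z" if z: "z : - box 0 One" for z
  proof -
   obtain i where "z $ i <= 0 | 1 <= z $ i" using z by (auto simp: mem_box_cart not_less)
   moreover have "4 * k <= x $ i" "x $ i <= 1 - 4 * k" using x by (auto simp: mem_box_cart)
   ultimately show ?thesis using component_le_norm_cart[of "x - z" i] by (auto simp: dist_norm)
  qed
  moreover have "0 : - box 0 (One :: real^'d)" by (simp add: mem_box_cart)
  ultimately have "4 * k <= g x" unfolding g_def infdist_def by (auto intro!: cINF_greatest)
  hence gx: "g x > 3 * k" using k by linarith
  have "open {x. 3 * k < g x}" by (intro open_Collect_less gc continuous_on_const)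
  from pdv_locally_const[OF this, of x theta 1] show ?thesis using t1 gx by auto
 qed
 ultimately show ?thesis by blast
qed

lemma norm_matrix_vector_le: "norm (A *v x) <= norm A * norm x" for A :: "real^'d^'m"
proof -
 have "norm (A *v x) <= L2_set (%i. norm (A $ i) * norm x) UNIV" unfolding norm_vec_def[of "A *v x"]
  by (rule L2_set_mono) (auto simp: matrix_vector_mul_component Cauchy_Schwarz_ineq2)
 also have "... = norm A * norm x" unfolding norm_vec_def[of A] by (simp add: L2_set_left_distrib)
 finally show ?thesis .
qed

lemma linear_cutoff:
 fixes A :: "real^'d^'m"
 assumes "test_fun D theta"
 defines "phi \<equiv> %x. theta x *R (A *v x)"
 shows "test_fun_vec D phi" "cgrad phi x = theta x *R A + outer (A *v x) (gradient theta x)"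
proof -
 have sm: "smooth_fun (%x. (A *v x) $ i)" for i unfolding matrix_vector_mult_def
  by (simp, intro smooth_fun_sum smooth_fun_mult smooth_fun_const smooth_fun_nth)
 show "test_fun_vec D phi" using test_fun_mult[OF sm assms(1)] by (simp add: test_fun_vec_def phi_def mult.commute)
 have "((%x. (A *v x) $ i) has_derivative (%h. (A *v h) $ i)) (at x)" for i
  by (intro bounded_linear.has_derivative[OF bounded_linear_compose[OF bounded_linear_vec_nth matrix_vector_mul_bounded_linear]] has_derivative_ident)
 from pdv_eqI[OF this] have "pdv j (%x. (A *v x) $ i) x = A $ i $ j" for i j by (simp add: matrix_vector_mult_basis column_def)
 thus "cgrad phi x = theta x *R A + outer (A *v x) (gradient theta x)"
  by (simp add: vec_eq_iff cgrad_nth phi_def outer_def gradient_def pdv_mult smooth_fun_differentiable[OF sm] smooth_fun_differentiable[OF test_fun_smooth[OF assms(1)]])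
qed

text \<open>\<open>2 + 8 * d ^ 2\<close> is the factor by which the gradients in the boundary layer
  below may exceed \<open>R\<close>, and \<open>\<beta> * (1 + ...)\<close> is the growth bound at
  that size. The leading \<open>d\<close> comes from the volume of the layer, by Bernoulli's
  inequality at most \<open>8 * k * d\<close>.\<close>

definition lip_const :: "real => real => real => real" where "lip_const p \<beta> d = d * (\<beta> * (1 + (2 + 8 * d ^ 2) powr p))"

text \<open>The test function equals the linear map \<^term>\<open>eta - \<xi>\<close> except in a boundary layer of the cube, whose width is
 chosen proportional to \<^term>\<open>norm (eta - \<xi>)\<close>; then the gradients in the layer stay of the order of \<^term>\<open>R\<close>.\<close>

lemma quasiconvex_upper:
 fixes q :: "real^'d^'m => real" and \<xi> eta :: "real^'d^'m"
 assumes qc: "quasiconvex q" and q0: "!!eta. 0 <= q eta" and b: "!!eta. q eta <= \<beta> * (1 + norm eta powr p)" and p: "p >= 1" and \<beta>: "\<beta> >= 0"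
 defines "R \<equiv> 1 + norm \<xi> + norm eta"
 shows "q \<xi> <= q eta + lip_const p \<beta> (real CARD('d)) * R powr (p - 1) * norm (eta - \<xi>)"
proof (cases "eta = \<xi>")
 case False
 define A where "A = eta - \<xi>"
 define d where "d = real CARD('d)"
 have R: "R >= 1" "norm A <= R" "norm \<xi> <= R" unfolding R_def A_def using norm_triangle_ineq4[of eta \<xi>] by auto
 \<comment> \<open>The factor 8 ensures \<open>8 * k <= 1\<close>, so the cube inset by
   \<open>4 * k\<close> is nonempty. The layer then has volume at most
   \<open>d * norm A / R\<close>, which lowers the power of \<open>R\<close> from \<open>p\<close>
   to \<open>p - 1\<close>.\<close>
 define k where "k = norm A / (8 * R)"
 have k: "k > 0" "8 * k <= 1" "norm A / k = 8 * R" using False R by (auto simp: k_def A_def)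
 obtain theta :: "real^'d => real" where th: "test_fun (box 0 One) theta" "!!x. abs (theta x) <= 1" "!!x i. abs (pdv i theta x) <= 1 / k"
  "!!x. x : cbox (\<chi> i. 4 * k) (\<chi> i. 1 - 4 * k) ==> theta x = 1 & (ALL i. pdv i theta x = 0)" using ex_box_cutoff[OF k(1)] by blast
 define phi where "phi x = theta x *R (A *v x)" for x
 note tv = linear_cutoff(1)[OF th(1), of A, folded phi_def[abs_def]] and cg = linear_cutoff(2)[OF th(1), of A, folded phi_def[abs_def]]
 define M where "M = \<beta> * (1 + ((2 + 8 * d ^ 2) * R) powr p)"
 have qM: "q (\<xi> + cgrad phi x) <= M" if x: "x : box 0 One" for x
 proof -
  have "norm x <= (\<Sum>i\<in>(UNIV::'d set). 1)"
   by (rule order_trans[OF norm_le_l1_cart sum_mono]) (use x in "auto simp: mem_box_cart less_imp_le abs_of_pos")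
  moreover have "norm (gradient theta x) <= (\<Sum>i\<in>(UNIV::'d set). 1 / k)"
   by (rule order_trans[OF norm_le_l1_cart sum_mono]) (use th(3) in "auto simp: gradient_def")
  ultimately have "norm (A *v x) * norm (gradient theta x) <= (norm A * d) * (d / k)"
   by (intro mult_mono order_trans[OF norm_matrix_vector_le]) (auto simp: d_def mult_left_mono)
  also have "... = norm A / k * d ^ 2" by (simp add: power2_eq_square)
  finally have "norm (outer (A *v x) (gradient theta x)) <= 8 * R * d ^ 2" unfolding k(3) by (rule order_trans[OF norm_outer])
  moreover have "norm (theta x *R A) <= R" using mult_right_mono[OF th(2)[of x], of "norm A"] R by simp
  moreover have "norm (\<xi> + cgrad phi x) <= norm \<xi> + (norm (theta x *R A) + norm (outer (A *v x) (gradient theta x)))"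
   unfolding cg by (intro norm_triangle_le add_left_mono norm_triangle_ineq)
  ultimately have "norm (\<xi> + cgrad phi x) <= (2 + 8 * d ^ 2) * R" using R(3) by (simp add: algebra_simps)
  hence "norm (\<xi> + cgrad phi x) powr p <= ((2 + 8 * d ^ 2) * R) powr p" using p by (intro powr_mono2) auto
  hence "\<beta> * (1 + norm (\<xi> + cgrad phi x) powr p) <= M" unfolding M_def using \<beta> by (intro mult_left_mono) auto
  thus ?thesis using b order_trans by blast
 qed
 have M0: "M >= 0" using \<beta> by (simp add: M_def)
 define C :: "(real^'d) set" where "C = cbox (\<chi> i. 4 * k) (\<chi> i. 1 - 4 * k)"
 have CB: "C <= box 0 One" 
 proof
  fix x assume "x : C"
  hence "4 * k <= x $ i" "x $ i <= 1 - 4 * k" for i by (auto simp: C_def mem_box_cart)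
  with k(1) have "0 < x $ i & x $ i < 1" for i by (smt (verit))
  thus "x : box 0 One" by (simp add: mem_box_cart)
 qed
 define t where "t = (1 - 8 * k) ^ CARD('d)"
 have vC: "vol C = t" unfolding C_def t_def measure_completion[OF borel_closed[OF closed_cbox, folded sets_lborel]]
  using k by (subst content_cbox_cart) (auto simp: interval_eq_empty_cart not_less)
 have ii: "integ (ind C)" "integ (ind (box 0 (One :: real^'d)))" unfolding C_def using emeasure_lborel_cbox_finite by (auto simp: integrable_indicator_iff)
 have "q \<xi> <= (LINT x:box 0 One|lebesgue. q (\<xi> + cgrad phi x))" using qc tv unfolding quasiconvex_def by blast
 also have "... <= (LI x. M * (ind (box 0 One) x - ind C x) + q eta * ind C x)" unfolding set_lebesgue_integral_def
 proof (rule integral_mono')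
  show "integ (%x. M * (ind (box 0 (One :: real^'d)) x - ind C x) + q eta * ind C x)" using ii by auto
  show "ind (box 0 One) x *R q (\<xi> + cgrad phi x) <= M * (ind (box 0 One) x - ind C x) + q eta * ind C x" for x
  proof (cases "x : C")
   case True
   hence "cgrad phi x = A" using th(4)[of x] by (simp add: cg C_def gradient_def outer_def vec_eq_iff)
   thus ?thesis using True CB by (auto simp: A_def)
  qed (use qM in "auto simp: indicator_def")
  show "0 <= M * (ind (box 0 One) x - ind C x) + q eta * ind C x" for x using CB M0 q0 by (auto simp: indicator_def)
 qed
 also have "... = M * (1 - t) + q eta * t"
  using ii by (simp add: vC measure_completion)
 also have "... <= M * (8 * k * d) + q eta"
 proof (intro add_mono mult_left_mono M0)
  show "1 - t <= 8 * k * d" using Bernoulli_inequality[of "- (8 * k)" "CARD('d)"] k by (simp add: t_def d_def mult.commute)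
  have "t <= 1" unfolding t_def using k by (intro power_le_one) auto
  thus "q eta * t <= q eta" using q0 by (simp add: mult_left_le)
 qed
 also have "M * (8 * k * d) <= lip_const p \<beta> d * R powr (p - 1) * norm A"
 proof -
  have "1 <= R powr p" using R p by (simp add: ge_one_powr_ge_zero)
  moreover have "((2 + 8 * d ^ 2) * R) powr p = (2 + 8 * d ^ 2) powr p * R powr p" using R by (simp add: powr_mult)
  ultimately have "M <= \<beta> * ((1 + (2 + 8 * d ^ 2) powr p) * R powr p)" unfolding M_def using \<beta>
   by (intro mult_left_mono) (auto simp only: distrib_right mult_1)
  hence "M * (8 * k * d) <= \<beta> * ((1 + (2 + 8 * d ^ 2) powr p) * R powr p) * (8 * k * d)" using k by (intro mult_right_mono) (auto simp: d_def)
  also have "... = lip_const p \<beta> d * R powr (p - 1) * norm A" using R by (simp add: k_def lip_const_def powr_diff)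
  finally show ?thesis .
 qed
 finally show ?thesis by (simp add: A_def d_def)
qed simp

lemma quasiconvex_lipschitz:
 fixes q :: "real^'d^'m => real"
 assumes "quasiconvex q" "!!eta. 0 <= q eta" "!!eta. q eta <= \<beta> * (1 + norm eta powr p)" "p >= 1" "\<beta> >= 0"
 shows "\<bar>q eta - q \<xi>\<bar> <= lip_const p \<beta> (real CARD('d)) * (1 + norm \<xi> + norm eta) powr (p - 1) * norm (eta - \<xi>)"
 using quasiconvex_upper[OF assms, of \<xi> eta] quasiconvex_upper[OF assms, of eta \<xi>] by (simp add: norm_minus_commute add.commute add.left_commute)

subsection \<open>Energies\<close>

definition pint :: "real => (real^'d) set => (real^'d => 'v::euclidean_space) => real" where
 "pint p V H = (LINT x:V|lebesgue. norm (H x) powr p)"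

definition energy :: "(real^'d => 'v::euclidean_space => real) => (real^'d) set => (real^'d => 'v) => real" where
 "energy f V H = (LINT x:V|lebesgue. f x (H x))"

lemma Lp_set_integrable: "Lp p H ==> V : sets lebesgue ==> set_integrable lebesgue V (%x. norm (H x) powr p)"
 unfolding set_integrable_def using integrable_mult_indicator[of V lebesgue "%x. norm (H x) powr p"] by (simp add: Lp_integrable)

lemma pint_nonneg [simp]: "0 <= pint p V H" unfolding pint_def set_lebesgue_integral_def by (intro Bochner_Integration.integral_nonneg) auto

lemma pint_nn:
 assumes "Lp p H" "V : sets lebesgue"
 shows "ennreal (pint p V H) = (nns V (%x. ennreal (norm (H x) powr p)))"
proof -
 have "(NN x. ennreal (ind V x *R norm (H x) powr p)) = ennreal (pint p V H)" unfolding pint_def set_lebesgue_integral_def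
  by (rule nn_integral_eq_integral) (use Lp_set_integrable[OF assms] in "auto simp: set_integrable_def")
 moreover have "(NN x. ennreal (ind V x *R norm (H x) powr p)) = (nns V (%x. ennreal (norm (H x) powr p)))"
  by (rule nn_integral_cong) (simp add: indicator_def)
 ultimately show ?thesis by simp
qed

lemma set_integral_mono_AE:
 fixes a b :: "real^'d => real"
 assumes "set_integrable lebesgue V a" "set_integrable lebesgue V b" "AEL x. x : V --> a x <= b x"
 shows "(LINT x:V|lebesgue. a x) <= (LINT x:V|lebesgue. b x)" unfolding set_lebesgue_integral_def
 by (rule integral_mono_AE) (use assms in "auto simp: set_integrable_def indicator_def elim!: eventually_mono")

lemma set_integrable_const:
 fixes V :: "(real^'d) set"
 shows "V : lmeasurable ==> set_integrable lebesgue V (%x. c::real)"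
 unfolding set_integrable_def by (intro integrable_scaleR_left integrable_real_indicator) (auto simp: fmeasurable_def)

lemma set_integral_const: "V : lmeasurable ==> (LINT x:V|lebesgue. c::real) = c * vol V" unfolding set_lebesgue_integral_def by simp

lemma pint_mono_bound:
 assumes "Lp p u" "Lp p v" "V : sets lebesgue" "AEL x. x : V --> norm (u x) <= norm (v x)" "p >= 0"
 shows "pint p V u <= pint p V v" unfolding pint_def
 by (rule set_integral_mono_AE) (use assms Lp_set_integrable in "auto intro: powr_mono2 elim!: eventually_mono")

lemma pint_cong_AE:
 assumes "AEL x. x : V --> u x = v x" "Lp p u" "Lp p v" "V : sets lebesgue"
 shows "pint p V u = pint p V v" unfolding pint_def set_lebesgue_integral_def by (rule integral_cong_AE)
   (use assms in "auto simp: Lp_def indicator_def intro!: borel_measurable_scaleR elim!: eventually_mono")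

lemma pint_subset:
 assumes "Lp p u" "V <= V'" "V : sets lebesgue" "V' : sets lebesgue"
 shows "pint p V u <= pint p V' u" unfolding pint_def set_lebesgue_integral_def by (rule integral_mono)
  (use assms Lp_set_integrable[of p u] in "auto simp: set_integrable_def indicator_def")

lemma pint_Un:
 assumes "Lp p u" "V : sets lebesgue" "V' : sets lebesgue" "V \<inter> V' = {}"
 shows "pint p (V \<union> V') u = pint p V u + pint p V' u" unfolding pint_def by (rule set_integral_Un) (use assms Lp_set_integrable in auto)

lemma pint_add:
 assumes "Lp p u" "Lp p v" "V : sets lebesgue" "p > 0"
 shows "pint p V (%x. u x + v x) <= 2 powr p * (pint p V u + pint p V v)"
proof -
 note i = Lp_set_integrable[OF _ assms(3)]
 have "pint p V (%x. u x + v x) <= (LINT x:V|lebesgue. 2 powr p * (norm (u x) powr p + norm (v x) powr p))" unfolding pint_def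
  by (rule set_integral_mono_AE)
   (use i[OF Lp_add[OF assms(1,2,4)]] i[OF assms(1)] i[OF assms(2)] assms(4) in "auto intro!: set_integral_add AE_I2 norm_add_powr_le")
 also have "... = 2 powr p * (pint p V u + pint p V v)" unfolding pint_def using set_integral_add[OF i[OF assms(1)] i[OF assms(2)]] by simp
 finally show ?thesis .
qed

lemma pint_diff:
 assumes "Lp p u" "Lp p v" "V : sets lebesgue" "p > 0"
 shows "pint p V (%x. u x - v x) <= 2 powr p * (pint p V u + pint p V v)"
 using pint_add[OF assms(1) Lp_uminus[OF assms(2)] assms(3,4)] by (simp add: pint_def)

lemma pint_le:
 assumes "Lp p u" "(nq p u) <= ennreal e" "e >= 0" "V : sets lebesgue"
 shows "pint p V u <= e"
proof -
 have "ennreal (pint p V u) <= (nq p u)" unfolding pint_nn[OF assms(1,4)] by (rule nn_integral_mono) (auto simp: indicator_def)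
 from order_trans[OF this assms(2)] show ?thesis using assms(3) by simp
qed

text \<open>If \<open>t <= eps * s\<close>, the first term on the right suffices, otherwise the
  second. This inequality does the work of Hoelder's, both for increments of energies and for the
  pairing of dual exponents.\<close>

lemma young_eps:
 fixes s t eps p :: real
 assumes "s >= 0" "t >= 0" "eps > 0" "p > 1"
 shows "s powr (p - 1) * t <= eps * s powr p + (1 / eps) powr (p - 1) * t powr p"
proof (cases "s = 0 | t = 0")
 case False
 hence st: "s > 0" "t > 0" using assms by auto
 have e: "s powr p = s powr (p - 1) * s" "t powr p = t powr (p - 1) * t" using st by (simp_all add: powr_diff)
 show ?thesis
 proof (cases "t <= eps * s")
  case True
  hence "s powr (p - 1) * t <= s powr (p - 1) * (eps * s)" by (intro mult_left_mono) auto
  also have "... = eps * s powr p" by (simp add: e)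
  finally show ?thesis by (simp add: add_increasing2)
 next
  case False
  hence "s <= 1 / eps * t" using assms by (simp add: field_simps)
  hence "s powr (p - 1) <= (1 / eps * t) powr (p - 1)" using assms by (intro powr_mono2) auto
  hence "s powr (p - 1) * t <= (1 / eps * t) powr (p - 1) * t" using assms by (intro mult_right_mono)
  also have "... = (1 / eps) powr (p - 1) * t powr p" using assms st by (simp add: e powr_mult mult.assoc powr_divide)
  finally show ?thesis using assms by (simp add: add_increasing)
 qed
qed (use assms in auto)

section \<open>Energies of integrands with growth of order p\<close>

locale growth =
 fixes D :: "(real^'d) set" and p \<alpha> \<beta> :: real
 assumes D: "open D" and p: "p > 1" and \<alpha>: "0 < \<alpha>" and \<beta>: "\<alpha> <= \<beta>"
begin

lemma nums: "p > 0" "p >= 1" "p >= 0" "\<beta> >= 0" using p \<alpha> \<beta> by auto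

abbreviation F_cl :: "(real^'d => real^'d^'m => real) => bool" where "F_cl \<equiv> F_class p \<alpha> \<beta> D"

lemma F_class_measurable:
 assumes "F_cl f" "H : BL"
 shows "(%x. ind D x * f x (H x)) : BL"
proof -
 have f: "(%z. f (fst z) (snd z)) : borel_measurable (restrict_space borel (D \<times> UNIV))" using assms by (simp add: F_class_def)
 have "(%x. (x, H x)) : restrict_space lebesgue D \<rightarrow>\<^sub>M restrict_space borel (D \<times> UNIV)"
 proof (rule measurable_restrict_space2)
  have "(%x. x) : restrict_space lebesgue D \<rightarrow>\<^sub>M borel" by (intro measurable_restrict_space1 measurable_completion) simp
  moreover have "H : restrict_space lebesgue D \<rightarrow>\<^sub>M borel" by (rule measurable_restrict_space1[OF assms(2)])
  ultimately show "(%x. (x, H x)) : restrict_space lebesgue D \<rightarrow>\<^sub>M borel" by (rule borel_measurable_Pair)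
 qed (auto simp: space_restrict_space)
 from measurable_compose[OF this f] have "(%x. f x (H x)) : borel_measurable (restrict_space lebesgue D)" by simp
 moreover have "D : sets lebesgue" using D by auto
 ultimately show ?thesis by (subst (asm) borel_measurable_restrict_space_iff) auto
qed

lemma F_class_measurable_on:
 assumes "F_cl f" "H : BL" "V <= D" "V : sets lebesgue"
 shows "(%x. ind V x * f x (H x)) : BL"
proof -
 have "(%x. ind V x * (ind D x * f x (H x))) : BL"
  by (intro borel_measurable_times F_class_measurable assms borel_measurable_indicator)
 moreover have "(%x. ind V x * (ind D x * f x (H x))) = (%x. ind V x * f x (H x))" using assms(3) by (auto simp: indicator_def fun_eq_iff)
 ultimately show ?thesis by simp
qed

text \<open>All pointwise bounds outside one null set. Quasiconvexity enters the argument through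
  this Lipschitz estimate only.\<close>

lemma F_class_AE:
 fixes f :: "real^'d => real^'d^'m => real"
 assumes f: "F_cl f"
 shows "AEL x. x : D --> (ALL \<xi>. 0 <= f x \<xi> & \<alpha> * norm \<xi> powr p <= f x \<xi> & f x \<xi> <= \<beta> * (1 + norm \<xi> powr p))
  & (ALL \<xi> eta. \<bar>f x eta - f x \<xi>\<bar> <= lip_const p \<beta> (real CARD('d)) * (1 + norm \<xi> + norm eta) powr (p - 1) * norm (eta - \<xi>))"
proof -
 have "AEL x. x : D -->
   (ALL \<xi>. \<alpha> * norm \<xi> powr p <= f x \<xi> & f x \<xi> <= \<beta> * (1 + norm \<xi> powr p)) & quasiconvex (f x)"
  using f by (simp add: F_class_def)
 thus ?thesis
 proof eventually_elim
  case (elim x)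
  show ?case
  proof
   assume x: "x : D"
   have n: "0 <= f x \<xi>" for \<xi> using f x by (simp add: F_class_def)
   have "\<bar>f x eta - f x \<xi>\<bar> <= lip_const p \<beta> (real CARD('d)) * (1 + norm \<xi> + norm eta) powr (p - 1) * norm (eta - \<xi>)" for \<xi> eta
    by (rule quasiconvex_lipschitz[OF _ n _ nums(2,4)]) (use elim x in auto)
   thus "(ALL \<xi>. 0 <= f x \<xi> & \<alpha> * norm \<xi> powr p <= f x \<xi> & f x \<xi> <= \<beta> * (1 + norm \<xi> powr p))
    & (ALL \<xi> eta. \<bar>f x eta - f x \<xi>\<bar> <= lip_const p \<beta> (real CARD('d)) * (1 + norm \<xi> + norm eta) powr (p - 1) * norm (eta - \<xi>))"
    using elim x n by auto
  qed
 qed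
qed

lemma energy_integrable:
 assumes f: "F_cl f" and H: "Lp p H" and VD: "V <= D" and V: "V : lmeasurable"
 shows "set_integrable lebesgue V (%x. f x (H x))" unfolding set_integrable_def
proof (rule Bochner_Integration.integrable_bound)
 show "integ (%x. \<beta> * (ind V x *R 1 + ind V x *R norm (H x) powr p))"
  using Lp_set_integrable[OF H, of V] set_integrable_const[OF V, of 1] V unfolding set_integrable_def
  by (intro integrable_mult_right Bochner_Integration.integrable_add) auto
 show "(%x. ind V x *R f x (H x)) : BL" using F_class_measurable_on[OF f Lp_measurable[OF H] VD] V by auto
 show "AEL x. norm (ind V x *R f x (H x)) <= norm (\<beta> * (ind V x *R 1 + ind V x *R norm (H x) powr p))" using F_class_AE[OF f]
 proof eventually_elim
  case (elim x)
  thus ?case using VD nums by (auto simp: indicator_def subset_iff)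
 qed
qed

lemma energy_nonneg:
 assumes "F_cl f" "V <= D" shows "0 <= energy f V H" unfolding energy_def set_lebesgue_integral_def
 using assms by (intro Bochner_Integration.integral_nonneg) (auto simp: F_class_def indicator_def subset_iff)

lemma energy_upper:
 assumes f: "F_cl f" and H: "Lp p H" and VD: "V <= D" and V: "V : lmeasurable"
 shows "energy f V H <= \<beta> * (vol V + pint p V H)"
proof -
 have Vs: "V : sets lebesgue" using V by auto
 note i = Lp_set_integrable[OF H Vs] set_integrable_const[OF V, of 1]
 have "energy f V H <= (LINT x:V|lebesgue. \<beta> * (1 + norm (H x) powr p))" unfolding energy_def
  by (rule set_integral_mono_AE[OF energy_integrable[OF assms]]) (use i F_class_AE[OF f] VD in "auto simp: subset_iff elim!: eventually_mono")
 also have "... = \<beta> * (vol V + pint p V H)" using i set_integral_const[OF V, of 1] by (simp add: pint_def)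
 finally show ?thesis .
qed

lemma energy_lower:
 assumes f: "F_cl f" and H: "Lp p H" and VD: "V <= D" and V: "V : lmeasurable"
 shows "\<alpha> * pint p V H <= energy f V H"
proof -
 have Vs: "V : sets lebesgue" using V by auto
 have "(LINT x:V|lebesgue. \<alpha> * norm (H x) powr p) <= energy f V H" unfolding energy_def
  by (rule set_integral_mono_AE[OF _ energy_integrable[OF assms]])
   (use Lp_set_integrable[OF H Vs] F_class_AE[OF f] VD in "auto simp: subset_iff elim!: eventually_mono")
 thus ?thesis by (simp add: pint_def)
qed

lemma energy_Un:
 assumes "F_cl f" "Lp p H" "V <= D" "V' <= D" "V : lmeasurable" "V' : lmeasurable" "V \<inter> V' = {}"
 shows "energy f (V \<union> V') H = energy f V H + energy f V' H" unfolding energy_def by (rule set_integral_Un) (use assms energy_integrable in auto)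

lemma energy_cong_AE:
 assumes "AEL x. x : V --> H x = H' x" and f: "F_cl f" and "H : BL" "H' : BL" "V <= D" "V : sets lebesgue"
 shows "energy f V H = energy f V H'" unfolding energy_def set_lebesgue_integral_def
proof (rule integral_cong_AE)
 show "(%x. ind V x *R f x (H x)) : BL" using F_class_measurable_on[OF f assms(3,5,6)] by simp
 show "(%x. ind V x *R f x (H' x)) : BL" using F_class_measurable_on[OF f assms(4-6)] by simp
 show "AEL x. ind V x *R f x (H x) = ind V x *R f x (H' x)" using assms(1) by eventually_elim (auto simp: indicator_def)
qed

text \<open>\<open>delta\<close> depends on \<open>eps\<close> and \<open>M\<close> alone, neither
  on the integrand nor on the set: it has to serve for all indices at once. The Lipschitz bound is
  split by \<open>young_eps\<close> into a small multiple of the bounded p-th powers and a large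
  multiple of the p-th power of the difference.\<close>

lemma energy_uniformly_continuous:
 assumes e: "eps > 0"
 shows "EX delta>0. ALL f V (H :: real^'d => real^'d^'m) H'. F_cl f --> V <= D --> V : lmeasurable -->
   vol V <= M --> Lp p H --> Lp p H' --> pint p V H <= M --> pint p V H' <= M -->
   pint p V (%x. H x - H' x) <= delta --> abs (energy f V H - energy f V H') <= eps"
proof -
 define L where "L = lip_const p \<beta> (real CARD('d))"
 have L: "L >= 0" using nums by (simp add: L_def lip_const_def)
 define M' where "M' = max M 0"
 \<comment> \<open>\<open>4 powr p\<close> comes from two uses of \<open>powr_add_le\<close> on a
   sum of three terms, and \<open>3 * M' + 1\<close> bounds the measure of \<open>V\<close> plus the
   two integrals. \<open>l\<close> and \<open>delta\<close> each account for half of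
   \<open>eps\<close>.\<close>
 define l where "l = eps / (2 * (L + 1) * (4 powr p * (3 * M' + 1)))"
 have l: "l > 0" using e L by (simp add: l_def M'_def)
 define C where "C = (1 / l) powr (p - 1)"
 have C: "C >= 0" by (simp add: C_def)
 define delta where "delta = eps / (2 * (L + 1) * (C + 1))"
 have d: "delta > 0" using e L C by (simp add: delta_def)
 have "abs (energy f V H - energy f V H') <= eps"
  if f: "F_cl f" and VD: "V <= D" and V: "V : lmeasurable" "vol V <= M"
   and H: "Lp p H" "Lp p H'" "pint p V H <= M" "pint p V H' <= M" "pint p V (%x. H x - H' x) <= delta"
  for f V and H H' :: "real^'d => real^'d^'m"
 proof -
  have Vs: "V : sets lebesgue" using V by auto
  note fi = energy_integrable[OF f H(1) VD V(1)] energy_integrable[OF f H(2) VD V(1)]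
  have Hd: "Lp p (%x. H x - H' x)" using Lp_diff[OF H(1,2)] p by simp
  note i = Lp_set_integrable[OF H(1) Vs] Lp_set_integrable[OF H(2) Vs] Lp_set_integrable[OF Hd Vs] set_integrable_const[OF V(1), of 1]
  have "abs (energy f V H - energy f V H') = abs (LINT x:V|lebesgue. f x (H x) - f x (H' x))"
   unfolding energy_def using fi by (simp add: set_integral_diff)
  also have "... <= (LINT x:V|lebesgue. abs (f x (H x) - f x (H' x)))" using set_integral_norm_bound[OF set_integral_diff(1)[OF fi]] by simp
  also have "... <= (LINT x:V|lebesgue. L * (l * (4 powr p * (1 + norm (H' x) powr p + norm (H x) powr p)) + C * norm (H x - H' x) powr p))"
  proof (rule set_integral_mono_AE)
   show "set_integrable lebesgue V (%x. abs (f x (H x) - f x (H' x)))" using set_integrable_abs[OF set_integral_diff(1)[OF fi]] .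
   show "AEL x. x : V --> abs (f x (H x) - f x (H' x))
     <= L * (l * (4 powr p * (1 + norm (H' x) powr p + norm (H x) powr p)) + C * norm (H x - H' x) powr p)" using F_class_AE[OF f]
   proof eventually_elim
    case (elim x)
    show ?case
    proof
     assume "x : V"
     define s where "s = 1 + norm (H' x) + norm (H x)"
     have "abs (f x (H x) - f x (H' x)) <= L * (s powr (p - 1) * norm (H x - H' x))"
      using elim \<open>x : V\<close> VD by (auto simp: L_def s_def mult.assoc)
     also have "... <= L * (l * s powr p + C * norm (H x - H' x) powr p)" unfolding C_def using L p l by (intro mult_left_mono young_eps) (auto simp: s_def)
     also have "... <= L * (l * (4 powr p * (1 + norm (H' x) powr p + norm (H x) powr p)) + C * norm (H x - H' x) powr p)"
     proof -
      have "s powr p <= 2 powr p * (1 powr p + (norm (H' x) + norm (H x)) powr p)" unfolding s_def add.assoc using p by (intro powr_add_le) auto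
      also have "... <= 2 powr p * (1 powr p + 2 powr p * (norm (H' x) powr p + norm (H x) powr p))"
       using p by (intro mult_left_mono add_left_mono powr_add_le) auto
      also have "... <= 2 powr p * (2 powr p * 1 + 2 powr p * (norm (H' x) powr p + norm (H x) powr p))"
       using p by (intro mult_left_mono add_right_mono) (auto simp: ge_one_powr_ge_zero)
      also have "... = 4 powr p * (1 + norm (H' x) powr p + norm (H x) powr p)" using powr_mult[of 2 2 p] by (simp add: algebra_simps)
      finally show ?thesis using L l by (intro mult_left_mono add_right_mono) auto
     qed
     finally show "abs (f x (H x) - f x (H' x))
       <= L * (l * (4 powr p * (1 + norm (H' x) powr p + norm (H x) powr p)) + C * norm (H x - H' x) powr p)" .
    qed
   qed
  qed (use i in auto)
  also have "... = L * (l * (4 powr p * (vol V + pint p V H' + pint p V H)) + C * pint p V (%x. H x - H' x))"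
   using i set_integral_const[OF V(1), of 1] by (simp add: pint_def set_integral_add)
  also have "... <= L * (l * (4 powr p * (3 * M' + 1)) + C * delta)"
  proof -
   have "vol V + pint p V H' + pint p V H <= 3 * M' + 1" using V(2) H(3,4) by (simp add: M'_def)
   hence "l * (4 powr p * (vol V + pint p V H' + pint p V H)) <= l * (4 powr p * (3 * M' + 1))" using l by (intro mult_left_mono) auto
   moreover have "C * pint p V (%x. H x - H' x) <= C * delta" using H(5) C by (intro mult_left_mono)
   ultimately show ?thesis using L by (intro mult_left_mono[OF add_mono])
  qed
  also have "... <= eps"
  proof -
   have aux: "a * (eps / (2 * a * b) * b) = eps / 2" if "a > 0" "b > 0" for a b :: real using that by (simp add: field_simps)
   have "(L + 1) * (l * (4 powr p * (3 * M' + 1))) = eps / 2" unfolding l_def by (rule aux) (use L in "auto simp: M'_def")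
   moreover have "L * (l * (4 powr p * (3 * M' + 1))) <= (L + 1) * (l * (4 powr p * (3 * M' + 1)))" using l by (intro mult_right_mono) (auto simp: M'_def)
   moreover have "(L + 1) * ((C + 1) * delta) = eps / 2" unfolding delta_def mult.commute[of "C + 1"] by (rule aux) (use L C in auto)
   moreover have "L * (C * delta) <= (L + 1) * ((C + 1) * delta)" using L C d by (intro mult_mono) auto
   ultimately show ?thesis by (simp add: distrib_left)
  qed
  finally show ?thesis .
 qed
 thus ?thesis using d by blast
qed

text \<open>Up to height \<open>T\<close> the truncation changes nothing. Above it,
  \<open>T >= 1\<close> absorbs the constant in the growth bound, so \<open>f\<close> is at most
  \<open>2 * \<beta>\<close> times the p-th power, and the value of \<open>g\<close> is dropped as
  nonnegative.\<close>

lemma energy_truncated_comparison: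
 fixes f g :: "real^'d => real^'d^'m => real" and T :: real
 assumes f: "F_cl f" and g: "F_cl g" and VD: "V <= D" and V: "V : lmeasurable" and H: "Lp p H" and T: "T >= 1" defines "HT \<equiv> (%x. if norm (H x) <= T then H x else 0)"
 shows "energy f V H <= energy g V H + (LINT x:V|lebesgue. abs (f x (HT x) - g x (HT x))) + 2 * \<beta> * pint p {x. norm (H x) > T} H"
  and "HT : BL" "!!x. norm (HT x) <= T"
proof -
 have Hm [measurable]: "H : BL" using H by (auto simp: Lp_def)
 have Vs: "V : sets lebesgue" using V by auto
 show HTm: "HT : BL" unfolding HT_def by measurable
 show HTb: "norm (HT x) <= T" for x using T by (simp add: HT_def)
 have LHT: "Lp p HT" by (rule Lp_bound[OF HTm H, of 1]) (use p in "auto simp: HT_def")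
 have B: "{x. norm (H x) > T} : sets lebesgue"
 proof -
  have "{x : space lebesgue. norm (H x) > T} : sets lebesgue" by measurable
  thus ?thesis by simp
 qed
 note i = energy_integrable[OF f H VD V] energy_integrable[OF g H VD V] energy_integrable[OF f LHT VD V] energy_integrable[OF g LHT VD V]
 have ip: "integ (%x. ind {x. norm (H x) > T} x * norm (H x) powr p)" using Lp_set_integrable[OF H B] by (simp add: set_integrable_def)
 have ipV: "set_integrable lebesgue V (%x. ind {x. norm (H x) > T} x * norm (H x) powr p)"
  unfolding set_integrable_def by (rule integrable_mult_indicator[OF Vs ip])
 have "energy f V H <= (LINT x:V|lebesgue. g x (H x) + abs (f x (HT x) - g x (HT x))
   + 2 * \<beta> * (ind {x. norm (H x) > T} x * norm (H x) powr p))" unfolding energy_def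
 proof (rule set_integral_mono_AE[OF i(1)])
  show "set_integrable lebesgue V (%x. g x (H x) + abs (f x (HT x) - g x (HT x))
   + 2 * \<beta> * (ind {x. norm (H x) > T} x * norm (H x) powr p))" using i ipV by (auto intro!: set_integral_add set_integrable_abs set_integral_diff)
  show "AEL x. x : V --> f x (H x) <= g x (H x) + abs (f x (HT x) - g x (HT x))
   + 2 * \<beta> * (ind {x. norm (H x) > T} x * norm (H x) powr p)" using F_class_AE[OF f] F_class_AE[OF g]
  proof eventually_elim
   case (elim x)
   show ?case
   proof
    assume "x : V"
    hence fx: "f x (H x) <= \<beta> * (1 + norm (H x) powr p)" and gx: "0 <= g x (H x)" using elim VD by auto
    show "f x (H x) <= g x (H x) + abs (f x (HT x) - g x (HT x))
      + 2 * \<beta> * (ind {x. norm (H x) > T} x * norm (H x) powr p)"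
    proof (cases "norm (H x) > T")
     case True
     have "1 <= norm (H x) powr p" using True T p by (intro ge_one_powr_ge_zero) auto
     hence "\<beta> * (1 + norm (H x) powr p) <= \<beta> * (2 * norm (H x) powr p)" using nums by (intro mult_left_mono) auto
     thus ?thesis using True fx gx by simp
    next
     case False
     thus ?thesis by (simp add: HT_def)
    qed
   qed
  qed
 qed
 also have "... = energy g V H + (LINT x:V|lebesgue. abs (f x (HT x) - g x (HT x)))
   + 2 * \<beta> * (LINT x:V|lebesgue. ind {x. norm (H x) > T} x * norm (H x) powr p)"
  using i ipV set_integrable_abs[OF set_integral_diff(1)[OF i(3,4)]] by (simp add: energy_def set_integral_add)
 also have "(LINT x:V|lebesgue. ind {x. norm (H x) > T} x * norm (H x) powr p) <= pint p {x. norm (H x) > T} H" unfolding pint_def set_lebesgue_integral_def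
  by (rule integral_mono) (use ip ipV in "auto simp: set_integrable_def indicator_def")
 finally show "energy f V H <= energy g V H + (LINT x:V|lebesgue. abs (f x (HT x) - g x (HT x))) + 2 * \<beta> * pint p {x. norm (H x) > T} H"
  using nums by (simp add: mult_left_mono)
qed


end

subsection \<open>The maximal function\<close>

text \<open>The set where the centred Hardy-Littlewood maximal function of \<open>g\<close> exceeds
  \<open>s\<close>. Working with the set itself avoids a supremum that may be infinite.\<close>

definition maximal_set :: "('a::euclidean_space => real) => real => 'a set" where
 "maximal_set g s = {x. EX r>0. s * vol (ball x r) < (LINT z:ball x r|lebesgue. g z)}"

lemma measure_ball_scale:
 fixes x :: "'a::euclidean_space"
 assumes "r >= 0"
 shows "vol (ball x r) = r ^ DIM('a) * vol (ball (0::'a) 1)" using content_ball_conv_unit_ball[OF assms, of x] by simp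

lemma measure_ball_pos: "r > 0 ==> 0 < vol (ball (x::'a::euclidean_space) r)" using content_ball_pos[of r x] by simp

lemma set_integrable_subset_lebesgue:
 fixes g :: "'a::euclidean_space => real"
 assumes "integ g" "A : sets lebesgue" shows "set_integrable lebesgue A g" unfolding set_integrable_def by (rule integrable_mult_indicator[OF assms(2,1)])

lemma set_integral_mono_set:
 fixes g :: "'a::euclidean_space => real"
 assumes "integ g" "A : sets lebesgue" "B : sets lebesgue" "A <= B" "!!x. g x >= 0"
 shows "(LINT z:A|lebesgue. g z) <= (LINT z:B|lebesgue. g z)" unfolding set_lebesgue_integral_def by (rule integral_mono)
  (use assms set_integrable_subset_lebesgue[OF assms(1)] in "auto simp: set_integrable_def indicator_def")

lemma maximal_set_open:
 fixes g :: "'a::euclidean_space => real"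
 assumes g: "integ g" "!!x. g x >= 0"
 shows "open (maximal_set g s)" unfolding open_dist
proof
 fix x assume "x : maximal_set g s"
 then obtain r where r: "r > 0" "s * vol (ball x r) < (LINT z:ball x r|lebesgue. g z)" by (auto simp: maximal_set_def)
 define c where "c = vol (ball (0::'a) 1)"
 have "((%delta. s * ((r + delta) ^ DIM('a) * c)) \<longlongrightarrow> s * ((r + 0) ^ DIM('a) * c)) (at_right 0)" by (intro tendsto_intros)
 moreover have "s * ((r + 0) ^ DIM('a) * c) < (LINT z:ball x r|lebesgue. g z)" using r measure_ball_scale[of r x] by (simp add: c_def)
 ultimately have "\<forall>\<^sub>F delta in at_right 0. s * ((r + delta) ^ DIM('a) * c) < (LINT z:ball x r|lebesgue. g z)" by (rule order_tendstoD)
 then obtain delta0 where d0: "delta0 > 0" "!!delta. 0 < delta ==> delta < delta0 ==> s * ((r + delta) ^ DIM('a) * c) < (LINT z:ball x r|lebesgue. g z)"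
  unfolding eventually_at_right_field by blast
 define delta where "delta = delta0 / 2"
 have d: "delta > 0" "s * ((r + delta) ^ DIM('a) * c) < (LINT z:ball x r|lebesgue. g z)" using d0 by (auto simp: delta_def)
 have "y : maximal_set g s" if y: "dist y x < delta" for y
 proof -
  have "ball x r <= ball y (r + delta)"
  proof
   fix z assume "z : ball x r"
   thus "z : ball y (r + delta)" using dist_triangle[of y z x] y by simp
  qed
  hence "(LINT z:ball x r|lebesgue. g z) <= (LINT z:ball y (r + delta)|lebesgue. g z)" by (intro set_integral_mono_set g) auto
  hence "s * vol (ball y (r + delta)) < (LINT z:ball y (r + delta)|lebesgue. g z)" using d r measure_ball_scale[of "r + delta" y] by (simp add: c_def)
  thus ?thesis unfolding maximal_set_def using r d by (intro CollectI exI[of _ "r + delta"]) auto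
 qed
 thus "EX e>0. ALL y. dist y x < e --> y : maximal_set g s" using d by blast
qed

text \<open>The integral over a ball never exceeds the total integral, which bounds the volume of a
  ball with large mean. Both the covering lemma and the boundedness of the maximal set rest on
  this.\<close>

lemma maximal_radius_bound:
 fixes g :: "'a::euclidean_space => real"
 assumes g: "integ g" "!!x. g x >= 0" and s: "s > 0"
 shows "EX R>0. ALL x r. 0 < r & s * vol (ball x r) < (LINT z:ball x r|lebesgue. g z) --> r <= R"
proof -
 define c where "c = vol (ball (0::'a) 1)"
 have c: "c > 0" by (simp add: c_def measure_ball_pos)
 define I where "I = (LI z. g z)"
 have I: "I >= 0" using g by (simp add: I_def)
 have "r <= max 1 (I / (s * c))" if r: "0 < r" "s * vol (ball x r) < (LINT z:ball x r|lebesgue. g z)" for x r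
 proof (cases "r <= 1")
  case False
  have "(LINT z:ball x r|lebesgue. g z) <= (LINT z:UNIV|lebesgue. g z)" by (intro set_integral_mono_set g) auto
  hence "s * (r ^ DIM('a) * c) <= I" using r measure_ball_scale[of r x] by (simp add: c_def I_def set_lebesgue_integral_def)
  moreover have "r ^ 1 <= r ^ DIM('a)" using False by (intro power_increasing) (auto simp: Suc_le_eq)
  hence "s * (r * c) <= s * (r ^ DIM('a) * c)" using s c by simp
  ultimately have "r * (s * c) <= I" by (simp add: mult_ac)
  thus ?thesis using s c by (simp add: pos_le_divide_eq le_max_iff_disj)
 qed simp
 thus ?thesis by (intro exI[of _ "max 1 (I / (s * c))"]) auto
qed

text \<open>The weak estimate of type (1,1): Vitali's lemma selects disjoint balls whose fivefold
  enlargements cover the set, and each selected ball has volume below 1/s times the integral of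
  \<open>g\<close> over it.\<close>

lemma maximal_set_measure:
 fixes g :: "'a::euclidean_space => real"
 assumes g: "integ g" "!!x. g x >= 0" and s: "s > 0"
 shows "maximal_set g s : lmeasurable" "vol (maximal_set g s) <= 5 ^ DIM('a) / s * (LI z. g z)"
proof -
 define A where "A = maximal_set g s"
 have op: "open A" unfolding A_def by (rule maximal_set_open[OF g])
 define K where "K = {(x, r). 0 < r & s * vol (ball x r) < (LINT z:ball x r|lebesgue. g z)}"
 obtain R where R: "!!x r. (x, r) : K ==> r <= R" using maximal_radius_bound[OF g s] unfolding K_def by blast
 have cov: "A <= (\<Union>i\<in>K. ball (fst i) (snd i))" unfolding A_def maximal_set_def K_def by force
 have rK: "0 < snd i & snd i <= R" if "i : K" for i using that R[of "fst i" "snd i"] by (auto simp: K_def)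
 obtain C where C: "countable C" "C <= K" "pairwise (%i j. disjnt (ball (fst i) (snd i)) (ball (fst j) (snd j))) C"
  "A <= (\<Union>i\<in>C. ball (fst i) (5 * snd i))" by (rule Vitali_covering_lemma_balls[OF cov]) (erule rK, rule that)
 define I where "I = (LI z. g z)"
 have I: "I >= 0" using g by (simp add: I_def)
 have bnd: "vol (\<Union>i\<in>F. ball (fst i) (5 * snd i)) <= 5 ^ DIM('a) / s * I" if F: "F <= C" "finite F" for F
 proof -
  have "vol (\<Union>i\<in>F. ball (fst i) (5 * snd i)) <= (\<Sum>i\<in>F. vol (ball (fst i) (5 * snd i)))" by (rule measure_UNION_le[OF F(2)]) auto
  also have "... <= (\<Sum>i\<in>F. 5 ^ DIM('a) / s * (LINT z:ball (fst i) (snd i)|lebesgue. g z))"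
  proof (rule sum_mono)
   fix i assume "i : F"
   hence i: "0 < snd i" "s * vol (ball (fst i) (snd i)) < (LINT z:ball (fst i) (snd i)|lebesgue. g z)" using F C(2) by (auto simp: K_def)
   have "vol (ball (fst i) (5 * snd i)) = 5 ^ DIM('a) * vol (ball (fst i) (snd i))"
    using i measure_ball_scale[of "5 * snd i" "fst i"] measure_ball_scale[of "snd i" "fst i"] by (simp add: power_mult_distrib)
   also have "... <= 5 ^ DIM('a) * ((LINT z:ball (fst i) (snd i)|lebesgue. g z) / s)" using i s by (intro mult_left_mono) (auto simp: field_simps)
   finally show "vol (ball (fst i) (5 * snd i)) <= 5 ^ DIM('a) / s * (LINT z:ball (fst i) (snd i)|lebesgue. g z)" by simp
  qed
  also have "... = 5 ^ DIM('a) / s * (\<Sum>i\<in>F. (LINT z:ball (fst i) (snd i)|lebesgue. g z))" by (rule sum_distrib_left[symmetric])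
  also have "(\<Sum>i\<in>F. (LINT z:ball (fst i) (snd i)|lebesgue. g z)) = (LINT z:(\<Union>i\<in>F. ball (fst i) (snd i))|lebesgue. g z)"
  proof (rule set_integral_finite_Union[symmetric, OF F(2)])
   show "disjoint_family_on (%i. ball (fst i) (snd i)) F" using C(3) F(1) unfolding disjoint_family_on_def pairwise_def disjnt_def by blast
  qed (use set_integrable_subset_lebesgue[OF g(1)] in auto)
  also have "5 ^ DIM('a) / s * ... <= 5 ^ DIM('a) / s * I"
  proof (rule mult_left_mono)
   have "(LINT z:(\<Union>i\<in>F. ball (fst i) (snd i))|lebesgue. g z) <= (LINT z:UNIV|lebesgue. g z)"
    by (intro set_integral_mono_set g sets.finite_UN F) auto
   thus "(LINT z:(\<Union>i\<in>F. ball (fst i) (snd i))|lebesgue. g z) <= I" by (simp add: I_def set_lebesgue_integral_def)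
  qed (use s in auto)
  finally show ?thesis .
 qed
 have f: "(\<Union>i\<in>C. ball (fst i) (5 * snd i)) : lmeasurable" by (rule fmeasurable_UN_bound[OF C(1) _ bnd]) auto
 have m: "vol (\<Union>i\<in>C. ball (fst i) (5 * snd i)) <= 5 ^ DIM('a) / s * I" by (rule measure_UN_bound[OF C(1) _ bnd]) auto
 show lm: "maximal_set g s : lmeasurable" by (rule fmeasurableI2[OF f C(4)[unfolded A_def]]) (use op in "auto simp: A_def")
 show "vol (maximal_set g s) <= 5 ^ DIM('a) / s * (LI z. g z)"
  using measure_mono_fmeasurable[OF C(4)[unfolded A_def] _ f] m lm by (auto simp: I_def fmeasurableD)
qed

section \<open>Increments of smooth functions off the maximal set\<close>

text \<open>\<open>gg\<close> may be any continuous majorant of the gradient, so that one majorant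
  can serve all components of a vector field.\<close>

lemma segment_increment_bound:
 fixes v :: "real^'d => real"
 assumes v: "smooth_fun v" and gc: "continuous_on UNIV gg" and g0: "!!y. gg y >= 0"
  and gg: "!!y h. abs (frechet_derivative v (at y) h) <= gg y * norm h"
 shows "ennreal (abs (v z - v x)) <= (NB s. indicator {0..1} s * ennreal (gg (x + s *R (z - x)) * norm (z - x)))"
proof -
 define phi where "phi s = v (x + s *R (z - x))" for s
 define phi' where "phi' s = (\<Sum>i\<in>UNIV. (z - x) $ i * pdv i v (x + s *R (z - x)))" for s
 have fd: "frechet_derivative v (at y) h = (\<Sum>i\<in>UNIV. h $ i * pdv i v y)" for y h by (rule frechet_derivative_pdv[OF smooth_fun_differentiable[OF v]])
 have der: "(phi has_real_derivative phi' s) (at s)" for s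
 proof -
  have "((%s. x + s *R (z - x)) has_derivative (%t. t *R (z - x))) (at s)" by (auto intro!: derivative_eq_intros)
  from diff_chain_at[OF this smooth_fun_has_derivative[OF v]]
  have "(phi has_derivative (%t. frechet_derivative v (at (x + s *R (z - x))) (t *R (z - x)))) (at s)" by (simp add: phi_def[abs_def] o_def)
  moreover have "frechet_derivative v (at (x + s *R (z - x))) (t *R (z - x)) = phi' s * t" for t
   using fd[of "x + s *R (z - x)" "t *R (z - x)"] by (simp only: phi'_def) (simp add: sum_distrib_left mult_ac)
  ultimately have "(phi has_derivative (%t. phi' s * t)) (at s)" by (simp only:)
  thus ?thesis unfolding has_field_derivative_def .
 qed
 have cont: "continuous_on UNIV phi'" unfolding phi'_def
  by (intro continuous_intros continuous_on_compose2[OF smooth_fun_continuous[OF smooth_fun_pdv[OF v]]]) auto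
 have cg: "continuous_on UNIV (%s. gg (x + s *R (z - x)))" by (intro continuous_on_compose2[OF gc] continuous_intros) auto
 have i1: "integrable lborel (%s. ind {0..1} s *R phi' s)" by (rule borel_integrable_compact[OF compact_Icc continuous_on_subset[OF cont subset_UNIV]])
 have i2: "integrable lborel (%s. ind {0..1} s *R (gg (x + s *R (z - x)) * norm (z - x)))"
  by (rule borel_integrable_compact[OF compact_Icc]) (intro continuous_intros continuous_on_subset[OF cg subset_UNIV])
 have "(LINT s|lborel. ind {0..1} s *R phi' s) = phi 1 - phi 0" by (rule integral_FTC_Icc[of 0 1 phi phi'])
   (auto intro!: has_vector_derivative_at_within continuous_on_subset[OF cont]
     simp: has_real_derivative_iff_has_vector_derivative[symmetric] has_field_derivative_at_within[OF der])
 hence e: "v z - v x = (LINT s|lborel. ind {0..1} s *R phi' s)" by (simp add: phi_def)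
 have p: "abs (ind {0..1} s *R phi' s) <= ind {0..1} s *R (gg (x + s *R (z - x)) * norm (z - x))" for s
 proof -
  have "abs (phi' s) <= gg (x + s *R (z - x)) * norm (z - x)" using gg[of "x + s *R (z - x)" "z - x"] fd[of "x + s *R (z - x)" "z - x"] by (simp only: phi'_def)
  thus ?thesis by (simp add: indicator_def)
 qed
 have "abs (v z - v x) <= (LINT s|lborel. ind {0..1} s *R (gg (x + s *R (z - x)) * norm (z - x)))"
  unfolding e by (rule order_trans[OF integral_abs_bound integral_mono[OF integrable_abs[OF i1] i2 p]])
 hence 1: "ennreal (abs (v z - v x)) <= ennreal (LINT s|lborel. ind {0..1} s *R (gg (x + s *R (z - x)) * norm (z - x)))" by (rule ennreal_leI)
 have 2: "ennreal (LINT s|lborel. ind {0..1} s *R (gg (x + s *R (z - x)) * norm (z - x)))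
  = (NB s. ennreal (ind {0..1} s *R (gg (x + s *R (z - x)) * norm (z - x))))" by (rule nn_integral_eq_integral[symmetric, OF i2]) (simp add: g0)
 have 3: "(NB s. ennreal (ind {0..1} s *R (gg (x + s *R (z - x)) * norm (z - x))))
  = (NB s. indicator {0..1} s * ennreal (gg (x + s *R (z - x)) * norm (z - x)))" by (rule nn_integral_cong) (simp add: indicator_def)
 show ?thesis by (rule order_trans[OF 1 eq_refl[OF trans[OF 2 3]]])
qed

text \<open>The increment from \<open>x\<close> to \<open>z\<close> is bounded by the integral of
  \<open>gg\<close> along the segment. After Tonelli, for each parameter \<open>s\<close> the points
  of the segments fill the ball of radius \<open>s * r\<close> about \<open>x\<close>, over which
  the mean of \<open>gg\<close> is at most \<open>K\<close>.\<close>

lemma ball_average_bound: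
 fixes v :: "real^'d => real"
 assumes v: "smooth_fun v" and gc: "continuous_on UNIV gg" and g0: "!!y. gg y >= 0" and gi: "integ gg"
  and gg: "!!y h. abs (frechet_derivative v (at y) h) <= gg y * norm h" and x: "x ~: maximal_set gg K" and r: "r > 0" and K: "K >= 0"
 shows "(\<integral>\<^sup>+z\<in>ball x r. ennreal (abs (v z - v x)) \<partial>lborel) <= ennreal (r * K * vol (ball x r))"
proof -
 have [measurable]: "gg : borel_measurable borel" by (rule borel_measurable_continuous_onI[OF gc])
 have av: "(\<integral>\<^sup>+y\<in>ball x t. ennreal (gg y) \<partial>lborel) <= ennreal (K * vol (ball x t))" if "t > 0" for t
 proof -
  have "(LINT z:ball x t|lebesgue. gg z) <= K * vol (ball x t)"
  proof (rule ccontr)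
   assume "~ (LINT z:ball x t|lebesgue. gg z) <= K * vol (ball x t)"
   hence "x : maximal_set gg K" unfolding maximal_set_def using that by (intro CollectI exI[of _ t] conjI) linarith+
   thus False using x by simp
  qed
  moreover have "(\<integral>\<^sup>+y\<in>ball x t. ennreal (gg y) \<partial>lborel) = ennreal (LINT z:ball x t|lebesgue. gg z)"
  proof -
   have "(\<integral>\<^sup>+y\<in>ball x t. ennreal (gg y) \<partial>lborel) = (NN y. ennreal (ind (ball x t) y *R gg y))"
    unfolding nn_integral_completion by (rule nn_integral_cong) (simp add: indicator_def)
   also have "... = ennreal (LINT z:ball x t|lebesgue. gg z)" unfolding set_lebesgue_integral_def
    by (rule nn_integral_eq_integral) (use integrable_mult_indicator[OF _ gi, of "ball x t"] g0 in auto)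
   finally show ?thesis .
  qed
  ultimately show ?thesis by (simp add: ennreal_leI)
 qed
 have [measurable]: "ball x r : sets borel" by simp
 define B where "B = vol (ball x r)"
 \<comment> \<open>The substitution y = x + s (z - x) carries the ball of radius \<open>r\<close>
   onto that of radius \<open>s * r\<close>; the Jacobian cancels against the ratio of the
   volumes.\<close>
 have inner: "(\<integral>\<^sup>+z\<in>ball x r. ennreal (gg (x + s *R (z - x))) \<partial>lborel) <= ennreal (K * B)" if s: "0 < s" for s
 proof -
  have 1: "(\<integral>\<^sup>+y\<in>ball x (s * r). ennreal (gg y) \<partial>lborel)
   = ennreal (abs s ^ DIM(real^'d)) * (NB z. ennreal (gg ((x - s *R x) + s *R z)) * indicator (ball x (s * r)) ((x - s *R x) + s *R z))"
  proof (rule nn_integral_lborel_affine)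
   show "(%y. ennreal (gg y) * indicator (ball x (s * r)) y) : borel_measurable borel"
    by (intro borel_measurable_times_ennreal borel_measurable_indicator) simp_all
  qed (use s in auto)
  have 2: "(NB z. ennreal (gg ((x - s *R x) + s *R z)) * indicator (ball x (s * r)) ((x - s *R x) + s *R z))
   = (\<integral>\<^sup>+z\<in>ball x r. ennreal (gg (x + s *R (z - x))) \<partial>lborel)"
  proof (rule nn_integral_cong)
   fix z
   have e: "(x - s *R x) + s *R z = x + s *R (z - x)" by (simp add: algebra_simps)
   have "dist x (x + s *R (z - x)) = s * dist x z" using s by (simp add: dist_norm norm_minus_commute)
   hence "x + s *R (z - x) : ball x (s * r) \<longleftrightarrow> z : ball x r" using s by simp
   thus "ennreal (gg ((x - s *R x) + s *R z)) * indicator (ball x (s * r)) ((x - s *R x) + s *R z)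
    = ennreal (gg (x + s *R (z - x))) * indicator (ball x r) z" unfolding e by (simp add: indicator_def)
  qed
  have 3: "K * vol (ball x (s * r)) = abs s ^ DIM(real^'d) * (K * B)"
   unfolding B_def using measure_ball_scale[of "s * r" x] measure_ball_scale[of r x] s r by (simp add: power_mult_distrib)
  have 4: "ennreal (abs s ^ DIM(real^'d) * (K * B)) = ennreal (abs s ^ DIM(real^'d)) * ennreal (K * B)"
   using K by (intro ennreal_mult) (auto simp: B_def)
  have "ennreal (abs s ^ DIM(real^'d)) * (\<integral>\<^sup>+z\<in>ball x r. ennreal (gg (x + s *R (z - x))) \<partial>lborel)
    <= ennreal (abs s ^ DIM(real^'d)) * ennreal (K * B)" using av[of "s * r"] s r by (simp only: 1 2 3 4 mult_pos_pos)
  thus ?thesis using s by (subst (asm) ennreal_mult_le_mult_iff) auto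
 qed
 have 1: "(\<integral>\<^sup>+z\<in>ball x r. ennreal (abs (v z - v x)) \<partial>lborel)
   <= (NB z. (NB s. ennreal r * (indicator {0..1} s * (ennreal (gg (x + s *R (z - x))) * indicator (ball x r) z))))"
 proof (rule nn_integral_mono)
  fix z
  show "ennreal (abs (v z - v x)) * indicator (ball x r) z
    <= (NB s. ennreal r * (indicator {0..1} s * (ennreal (gg (x + s *R (z - x))) * indicator (ball x r) z)))"
  proof (cases "z : ball x r")
   case True
   have "ennreal (abs (v z - v x)) <= (NB s. indicator {0..1} s * ennreal (gg (x + s *R (z - x)) * norm (z - x)))"
    by (rule segment_increment_bound[OF v gc g0 gg])
   also have "... <= (NB s. ennreal r * (indicator {0..1} s * (ennreal (gg (x + s *R (z - x))) * indicator (ball x r) z)))"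
   proof (rule nn_integral_mono)
    fix s
    have "gg (x + s *R (z - x)) * norm (z - x) <= r * gg (x + s *R (z - x))"
     using True g0[of "x + s *R (z - x)"] by (simp add: dist_norm norm_minus_commute mult.commute[of r] mult_left_mono)
    hence "ennreal (gg (x + s *R (z - x)) * norm (z - x)) <= ennreal r * ennreal (gg (x + s *R (z - x)))"
     using r g0 by (simp add: ennreal_mult[symmetric] ennreal_leI)
    thus "indicator {0..1} s * ennreal (gg (x + s *R (z - x)) * norm (z - x))
     <= ennreal r * (indicator {0..1} s * (ennreal (gg (x + s *R (z - x))) * indicator (ball x r) z))" using True by (simp add: indicator_def)
   qed
   finally show ?thesis using True by simp
  qed simp
 qed
 have 2: "(NB z. (NB s. ennreal r * (indicator {0..1} s * (ennreal (gg (x + s *R (z - x))) * indicator (ball x r) z))))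
  = (NB s. (NB z. ennreal r * (indicator {0..1} s * (ennreal (gg (x + s *R (z - x))) * indicator (ball x r) z))))" by (rule lborel_pair.Fubini') measurable
 have 3: "(NB s. (NB z. ennreal r * (indicator {0..1} s * (ennreal (gg (x + s *R (z - x))) * indicator (ball x r) z))))
  <= (NB s. ennreal (r * K * B) * indicator {0..1::real} s)"
 proof (rule nn_integral_mono_AE)
  have "AE s::real in lborel. s ~= 0" by (rule AE_lborel_singleton)
  thus "AE s::real in lborel. (NB z. ennreal r * (indicator {0..1} s * (ennreal (gg (x + s *R (z - x))) * indicator (ball x r) z)))
    <= ennreal (r * K * B) * indicator {0..1} s"
  proof eventually_elim
   case (elim s)
   show ?case
   proof (cases "s : {0..1}")
    case True
    hence "(NB z. ennreal r * (indicator {0..1} s * (ennreal (gg (x + s *R (z - x))) * indicator (ball x r) z)))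
     = (NB z. ennreal r * (ennreal (gg (x + s *R (z - x))) * indicator (ball x r) z))" by simp
    moreover have "(NB z. ennreal r * (ennreal (gg (x + s *R (z - x))) * indicator (ball x r) z))
     = ennreal r * (\<integral>\<^sup>+z\<in>ball x r. ennreal (gg (x + s *R (z - x))) \<partial>lborel)" by (rule nn_integral_cmult) measurable
    moreover have "ennreal r * (\<integral>\<^sup>+z\<in>ball x r. ennreal (gg (x + s *R (z - x))) \<partial>lborel) <= ennreal r * ennreal (K * B)"
     using True elim by (intro mult_left_mono inner) auto
    moreover have "ennreal r * ennreal (K * B) = ennreal (r * K * B) * indicator {0..1} s"
     using r K True by (subst ennreal_mult[symmetric]) (auto simp: B_def mult.assoc)
    ultimately show ?thesis by (simp only:)
   qed simp
  qed
 qed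
 have 4: "(NB s. ennreal (r * K * B) * indicator {0..1::real} s) = ennreal (r * K * B)" by (subst nn_integral_cmult_indicator) auto
 show ?thesis using order_trans[OF 1 order_trans[OF eq_refl[OF 2] order_trans[OF 3 eq_refl[OF 4]]]] unfolding B_def .
qed

text \<open>Both values are compared with \<open>v z\<close> for \<open>z\<close> in the ball of
  radius \<open>rho / 2\<close> about the midpoint, which lies in both balls of radius
  \<open>rho\<close>. The ratio of the volumes gives \<open>2 ^ CARD('d)\<close>, the two
  comparisons the factor 2.\<close>

lemma lipschitz_off_maximal_set:
 fixes v :: "real^'d => real"
 assumes v: "smooth_fun v" and gc: "continuous_on UNIV gg" and g0: "!!y. gg y >= 0" and gi: "integ gg"
  and gg: "!!y h. abs (frechet_derivative v (at y) h) <= gg y * norm h" and K: "K >= 0"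
  and xy: "x ~: maximal_set gg K" "y ~: maximal_set gg K"
 shows "abs (v x - v y) <= 2 * 2 ^ CARD('d) * K * norm (x - y)"
proof (cases "x = y")
 case False
 define rho where "rho = norm (x - y)"
 have rho: "rho > 0" using False by (simp add: rho_def)
 define m where "m = midpoint x y"
 have sub: "ball m (rho / 2) <= ball x rho" "ball m (rho / 2) <= ball y rho"
 proof -
  have d: "dist x m = rho / 2" "dist y m = rho / 2" unfolding m_def rho_def dist_norm[symmetric] by (rule dist_midpoint)+
  have "dist x z < rho" "dist y z < rho" if "dist m z < rho / 2" for z using d that dist_triangle[of x z m] dist_triangle[of y z m] by linarith+
  thus "ball m (rho / 2) <= ball x rho" "ball m (rho / 2) <= ball y rho" by auto
 qed
 have [measurable]: "v : borel_measurable borel" by (rule smooth_fun_borel[OF v])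
 define c where "c = vol (ball (0::real^'d) 1)"
 have c: "c > 0" by (simp add: c_def measure_ball_pos)
 have mb: "vol (ball z r) = r ^ CARD('d) * c" if "r >= 0" for z :: "real^'d" and r using measure_ball_scale[OF that, of z] by (simp add: c_def)
 have "ennreal (abs (v x - v y) * vol (ball m (rho / 2))) = (\<integral>\<^sup>+z\<in>ball m (rho / 2). ennreal (abs (v x - v y)) \<partial>lborel)"
 proof -
  have "emeasure lborel (ball m (rho / 2)) = ennreal (measure lborel (ball m (rho / 2)))"
   by (rule emeasure_eq_ennreal_measure) (use emeasure_lborel_ball_finite[of m "rho / 2"] in auto)
  thus ?thesis by (subst nn_integral_cmult_indicator) (auto simp: ennreal_mult)
 qed
 also have "... <= (NB z. (ennreal (abs (v z - v x)) * indicator (ball x rho) z + ennreal (abs (v z - v y)) * indicator (ball y rho) z))"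
 proof (rule nn_integral_mono)
  fix z
  show "ennreal (abs (v x - v y)) * indicator (ball m (rho / 2)) z
   <= ennreal (abs (v z - v x)) * indicator (ball x rho) z + ennreal (abs (v z - v y)) * indicator (ball y rho) z"
  proof (cases "z : ball m (rho / 2)")
   case True
   hence "z : ball x rho" "z : ball y rho" using sub by auto
   moreover have "ennreal (abs (v x - v y)) <= ennreal (abs (v z - v x) + abs (v z - v y))" by (rule ennreal_leI) linarith
   ultimately show ?thesis using True by (simp del: mem_ball)
  qed simp
 qed
 also have "... = (\<integral>\<^sup>+z\<in>ball x rho. ennreal (abs (v z - v x)) \<partial>lborel) + (\<integral>\<^sup>+z\<in>ball y rho. ennreal (abs (v z - v y)) \<partial>lborel)"
  by (rule nn_integral_add; intro borel_measurable_times_ennreal borel_measurable_indicator; simp)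
 also have "... <= ennreal (rho * K * vol (ball x rho)) + ennreal (rho * K * vol (ball y rho))"
  by (intro add_mono ball_average_bound[OF v gc g0 gi gg] xy rho K)
 also have "... = ennreal (2 * (rho * K * (rho ^ CARD('d) * c)))"
  unfolding mb[OF less_imp_le[OF rho]] using rho K c by (simp add: ennreal_plus[symmetric] del: ennreal_plus)
 finally have "abs (v x - v y) * vol (ball m (rho / 2)) <= 2 * (rho * K * (rho ^ CARD('d) * c))"
  using rho K c by (subst (asm) ennreal_le_iff) auto
 hence "abs (v x - v y) * (rho ^ CARD('d) * c / 2 ^ CARD('d)) <= 2 * (rho * K * (rho ^ CARD('d) * c))"
  using rho mb[of "rho / 2" m] by (simp add: power_divide)
 hence "abs (v x - v y) * (rho ^ CARD('d) * c) <= (2 * 2 ^ CARD('d) * K * rho) * (rho ^ CARD('d) * c)" by (simp add: field_simps)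
 thus ?thesis using rho c by (simp add: rho_def)
qed simp

lemma mcshane_extension:
 fixes f :: "'a::metric_space => real"
 assumes S: "S ~= {}" and L: "L >= 0" and lip: "!!x y. x : S ==> y : S ==> abs (f x - f y) <= L * dist x y"
 shows "EX h. (ALL x:S. h x = f x) & (ALL x y. abs (h x - h y) <= L * dist x y)"
proof -
 define h where "h x = (INF y\<in>S. f y + L * dist x y)" for x
 have bd: "bdd_below ((%y. f y + L * dist x y) ` S)" for x
 proof -
  obtain y0 where y0: "y0 : S" using S by auto
  have "f y0 - L * dist x y0 <= f y + L * dist x y" if "y : S" for y
  proof -
   have "f y0 - f y <= L * dist y0 y" using lip[OF y0 that] by linarith
   also have "... <= L * (dist x y0 + dist x y)" using L by (intro mult_left_mono dist_triangle3) auto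
   finally show ?thesis by (simp add: distrib_left)
  qed
  thus ?thesis by (intro bdd_belowI2)
 qed
 have "h x = f x" if x: "x : S" for x
 proof (rule antisym)
  show "h x <= f x" unfolding h_def using cINF_lower[OF bd x, of x] by simp
  show "f x <= h x" unfolding h_def
  proof (rule cINF_greatest[OF S])
   fix y assume "y : S" thus "f x <= f y + L * dist x y" using lip[OF x, of y] by linarith
  qed
 qed
 moreover have hl: "h x - h y <= L * dist x y" for x y
 proof -
  have "h x - L * dist x y <= h y" unfolding h_def[of y]
  proof (rule cINF_greatest[OF S])
   fix z assume z: "z : S"
   have "h x <= f z + L * dist x z" unfolding h_def by (rule cINF_lower[OF bd z])
   also have "... <= f z + L * (dist x y + dist y z)" using L by (intro add_left_mono mult_left_mono dist_triangle) auto
   finally show "h x - L * dist x y <= f z + L * dist y z" by (simp add: distrib_left)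
  qed
  thus ?thesis by linarith
 qed
 moreover have "abs (h x - h y) <= L * dist x y" for x y using hl[of x y] hl[of y x] by (simp add: dist_commute abs_le_iff)
 ultimately show ?thesis by blast
qed

subsection \<open>Lipschitz truncation\<close>

lemma mollifier_kernel_test_fun: "test_fun UNIV mollifier_kernel"
 by (rule test_funI[OF mollifier_kernel(1) compact_cball[of 0 1]]) (auto intro: mollifier_kernel)

lemma pdv_moll: "pdv j (moll eps) h = inverse eps ^ CARD('d) * inverse eps * pdv j mollifier_kernel (inverse eps *R (h :: real^'d))"
 using affine_pdv(2)[of mollifier_kernel "inverse eps" h 0 "inverse eps ^ CARD('d)" j]
  smooth_fun_differentiable[OF mollifier_kernel(1)[where 'd='d]] by (simp add: moll_def[abs_def])

text \<open>The kernel on the left has the size and the support of a mollifier of scale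
  \<open>eps\<close>. A mollifier of scale \<open>K * eps\<close> is bounded below on that support,
  since the kernel is positive at the origin; \<open>K\<close> does not depend on
  \<open>eps\<close>.\<close>

lemma pdv_moll_bound:
 "EX C K. C >= 0 & K > 0 & (ALL eps j (h :: real^'d). eps > 0 --> norm h * abs (pdv j (moll eps) h) <= C * moll (K * eps) h)"
proof -
 have "EX B>=0. ALL x::real^'d. abs (pdv i mollifier_kernel x) <= B" for i
  using test_fun_bounded[OF test_fun_pdv[OF mollifier_kernel_test_fun, of i]] by metis
 then obtain B0 where B0: "!!i. B0 i >= 0" "!!i (x::real^'d). abs (pdv i mollifier_kernel x) <= B0 i" by metis
 define B where "B = sum B0 UNIV"
 have "B0 i <= B" for i unfolding B_def by (rule member_le_sum) (use B0 in auto)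
 hence B: "abs (pdv i mollifier_kernel x) <= B" for i and x :: "real^'d" using B0(2) order_trans by blast
 have B1: "B >= 0" unfolding B_def by (rule sum_nonneg) (use B0 in auto)
 define c0 where "c0 = mollifier_kernel (0::real^'d) / 2"
 have c0: "c0 > 0" using mollifier_kernel(5)[where 'd='d] by (simp add: c0_def)
 have "isCont mollifier_kernel (0::real^'d)"
  using smooth_fun_continuous[OF mollifier_kernel(1)[where 'd='d], of UNIV] by (simp add: continuous_on_eq_continuous_at)
 hence "\<forall>\<^sub>F h in at 0. c0 < mollifier_kernel (h::real^'d)"
  unfolding isCont_def by (rule order_tendstoD(1)) (use mollifier_kernel(5)[where 'd='d] in "simp add: c0_def")
 then obtain delta where d: "delta > 0" "!!h::real^'d. h ~= 0 ==> norm h < delta ==> c0 < mollifier_kernel h"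
  unfolding eventually_at by (auto simp: dist_norm)
 have k: "c0 <= mollifier_kernel h" if "norm h < delta" for h :: "real^'d"
  using d(2)[OF _ that] mollifier_kernel(5)[where 'd='d] by (cases "h = 0") (auto simp: c0_def)
 define K where "K = 2 / delta"
 have K: "K > 0" using d by (simp add: K_def)
 define C where "C = B * K ^ CARD('d) / c0"
 have C: "C >= 0" using B1 K c0 by (simp add: C_def)
 have "norm h * abs (pdv j (moll eps) h) <= C * moll (K * eps) h" if e: "eps > 0" for eps j and h :: "real^'d"
 proof (cases "norm h <= eps")
  case True
  have "norm (inverse (K * eps) *R h) <= inverse K" using True e K by (simp add: field_simps)
  also have "... < delta" using d by (simp add: K_def)
  finally have "c0 <= mollifier_kernel (inverse (K * eps) *R h)" by (rule k)
  hence "C * (inverse (K * eps) ^ CARD('d) * c0) <= C * moll (K * eps) h" unfolding moll_def using C K e by (intro mult_left_mono) auto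
  moreover have "C * (inverse (K * eps) ^ CARD('d) * c0) = B * inverse eps ^ CARD('d)" using K c0 e by (simp add: C_def power_mult_distrib field_simps)
  moreover have "norm h * abs (pdv j (moll eps) h) <= eps * (inverse eps ^ CARD('d) * inverse eps * B)"
   unfolding pdv_moll abs_mult using True e B by (intro mult_mono) auto
  moreover have "eps * (inverse eps ^ CARD('d) * inverse eps * B) = B * inverse eps ^ CARD('d)" using e by simp
  ultimately show ?thesis by linarith
 next
  case False
  have "pdv j (moll eps) h = 0" by (rule pdv_locally_const[of "{h. norm h > eps}"])
    (use False e in "auto intro!: moll_outside open_Collect_less continuous_intros")
  thus ?thesis using C moll_nonneg[of "K * eps" h] K e by simp
 qed
 thus ?thesis using C K by blast
qed

lemma tendsto_ennreal_zero_bound: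
 fixes f h :: "'a => ennreal" and c :: real
 assumes "(h \<longlongrightarrow> 0) F" "\<forall>\<^sub>F x in F. f x <= ennreal c * h x" shows "(f \<longlongrightarrow> 0) F"
proof -
 have "((%x. ennreal c * h x) \<longlongrightarrow> ennreal c * 0) F" by (rule ennreal_tendsto_cmult[OF _ assms(1)]) auto
 hence "((%x. ennreal c * h x) \<longlongrightarrow> 0) F" by simp
 thus ?thesis by (rule tendsto_sandwich[OF _ assms(2) tendsto_const, rotated]) auto
qed

text \<open>For \<open>x\<close> off \<open>A\<close> the Lipschitz function
  \<open>z = u - v\<close> satisfies |z y| <= (L + Lv) |x - y|, and z vanishes off \<open>A\<close>.
  By \<open>pdv_moll_bound\<close> the gradient of its mollification is at most a multiple of the
  mollified indicator of \<open>A\<close>, which tends in Lp to the indicator, hence to 0 off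
  \<open>A\<close>. This takes the place of differentiating Lipschitz functions at almost every
  point.\<close>

lemma mollified_gradient_on_contact_set:
 fixes u v :: "real^'d => real"
 assumes v: "test_fun UNIV v" and ui: "integ u" and L: "L >= 0" "!!x y. abs (u x - u y) <= L * dist x y"
  and A: "open A" "A : lmeasurable" and eq: "!!x. x ~: A ==> u x = v x" and p: "p >= 1"
 shows "((%eps. (nns (-A) (%x. ennreal (abs (pdv j (conv u (moll eps)) x - pdv j v x) powr p)))) \<longlongrightarrow> 0) (at_right 0)"
proof -
 obtain Lv where Lv: "Lv >= 0" "!!x y. abs (v x - v y) <= Lv * norm (x - y)" by (rule test_fun_lipschitz[OF v]) (rule that)
 define z where "z x = u x - v x" for x
 note vi = test_fun_integrable[OF v]
 have zi: "integ z" unfolding z_def by (rule Bochner_Integration.integrable_diff[OF ui vi])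
 have zl: "abs (z y) <= (L + Lv) * norm (x - y) * ind A y" if "x ~: A" for x y
 proof (cases "y : A")
  case True
  have "abs (z y) = abs ((u y - u x) - (v y - v x))" using eq[OF that] by (simp add: z_def)
  also have "... <= L * norm (x - y) + Lv * norm (x - y)" using L(2)[of y x] Lv(2)[of y x] by (simp add: dist_norm norm_minus_commute)
  finally show ?thesis using True by (simp add: distrib_right)
 qed (simp add: z_def eq)
 obtain C K where CK: "C >= 0" "K > 0" "!!eps j (h :: real^'d). eps > 0 ==> norm h * abs (pdv j (moll eps) h) <= C * moll (K * eps) h"
  using pdv_moll_bound[where 'd='d] by metis
 define C1 where "C1 = (L + Lv) * C"
 have C1: "C1 >= 0" using L Lv CK by (simp add: C1_def)
 have Ai: "integ (ind A)" by (rule integrable_real_indicator) (use A in "auto simp: fmeasurable_def")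
 have As: "- A : sets lebesgue" using A by auto
 have key: "abs (pdv j (conv z (moll eps)) x) <= C1 * abs (conv (ind A) (moll (K * eps)) x - ind A x)"
  if e: "eps > 0" and x: "x ~: A" for eps x
 proof -
  have Ke: "K * eps > 0" using CK e by simp
  note t = test_fun_pdv[OF moll_test_fun[OF e], of j]
  note i1 = conv_integrable[OF zi t, of x] and i2 = conv_integrable[OF Ai moll_test_fun[OF Ke], of x]
  have "pdv j (conv z (moll eps)) x = conv z (pdv j (moll eps)) x" by (rule fun_cong[OF conv_pdv[OF zi moll_test_fun[OF e]]])
  hence "abs (pdv j (conv z (moll eps)) x) <= (LI y. abs (z y * pdv j (moll eps) (x - y)))"
   by (simp only: conv_def[of z]) (rule integral_abs_bound)
  moreover have "(LI y. abs (z y * pdv j (moll eps) (x - y))) <= (LI y. C1 * (ind A y * moll (K * eps) (x - y)))"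
  proof (rule integral_mono[OF integrable_abs[OF i1] integrable_mult_right[OF i2]])
   fix y
   have "abs (z y * pdv j (moll eps) (x - y)) <= (L + Lv) * norm (x - y) * ind A y * abs (pdv j (moll eps) (x - y))"
    unfolding abs_mult by (rule mult_right_mono[OF zl[OF x]]) simp
   also have "... = (L + Lv) * ind A y * (norm (x - y) * abs (pdv j (moll eps) (x - y)))" by simp
   also have "... <= (L + Lv) * ind A y * (C * moll (K * eps) (x - y))" using CK(3)[OF e] L Lv by (intro mult_left_mono) auto
   finally show "abs (z y * pdv j (moll eps) (x - y)) <= C1 * (ind A y * moll (K * eps) (x - y))" by (simp add: C1_def mult_ac)
  qed
  moreover have "(LI y. C1 * (ind A y * moll (K * eps) (x - y))) = C1 * conv (ind A) (moll (K * eps)) x" by (simp add: conv_def)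
  moreover have "conv (ind A) (moll (K * eps)) x <= abs (conv (ind A) (moll (K * eps)) x - ind A x)" using x by simp
  ultimately show ?thesis using mult_left_mono[OF _ C1] by (smt (verit, best))
 qed
 have lim1: "((%eps. (np p (%x. conv (ind A) (moll (K * eps)) x - ind A x))) \<longlongrightarrow> 0) (at_right 0)"
 proof -
  have "(np p (%x. ind A x)) < \<infinity>" using Lp_indicator[OF A(2), of p] by (simp add: Lp_def)
  note m = mollification_tendsto[OF Ai this p]
  have "filterlim (%eps. K * eps) (at_right 0) (at_right 0)" unfolding filterlim_at using CK(2)
   by (auto simp: eventually_at_right_field intro!: tendsto_eq_intros exI[of _ 1])
  from filterlim_compose[OF m this] show ?thesis .
 qed
 have lim2: "((%eps. (np p (%x. conv (pdv j v) (moll eps) x - pdv j v x))) \<longlongrightarrow> 0) (at_right 0)"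
  by (rule mollification_tendsto[OF test_fun_integrable[OF test_fun_pdv[OF v]] _ p])
   (use test_fun_Lp[OF test_fun_pdv[OF v], of p j] p in "simp add: Lp_def")
 show ?thesis
 proof (rule tendsto_ennreal_zero_bound[where c="2 powr p"])
  have "((%eps. ennreal (C1 powr p) * (np p (%x. conv (ind A) (moll (K * eps)) x - ind A x))
   + (np p (%x. conv (pdv j v) (moll eps) x - pdv j v x))) \<longlongrightarrow> ennreal (C1 powr p) * 0 + 0) (at_right 0)"
   by (intro tendsto_add lim2 ennreal_tendsto_cmult lim1) auto
  thus "((%eps. ennreal (C1 powr p) * (np p (%x. conv (ind A) (moll (K * eps)) x - ind A x))
   + (np p (%x. conv (pdv j v) (moll eps) x - pdv j v x))) \<longlongrightarrow> 0) (at_right 0)" by simp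
  show "\<forall>\<^sub>F eps in at_right 0. (nns (-A) (%x. ennreal (abs (pdv j (conv u (moll eps)) x - pdv j v x) powr p)))
   <= ennreal (2 powr p) * (ennreal (C1 powr p) * (np p (%x. conv (ind A) (moll (K * eps)) x - ind A x))
   + (np p (%x. conv (pdv j v) (moll eps) x - pdv j v x)))" unfolding eventually_at_right_field
  proof (intro exI[of _ 1] conjI allI impI)
   fix eps :: real assume e: "0 < eps"
   have Ke: "K * eps > 0" using CK e by simp
   define a where "a x = C1 powr p * abs (conv (ind A) (moll (K * eps)) x - ind A x) powr p" for x
   define b where "b x = abs (conv (pdv j v) (moll eps) x - pdv j v x) powr p" for x
   have m1: "conv (ind A) (moll (K * eps)) : BL" by (intro measurable_lebesgue_borelI conv_borel[OF Ai moll_test_fun[OF Ke]])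
   have m2: "conv (pdv j v) (moll eps) : BL"
    by (intro measurable_lebesgue_borelI conv_borel[OF test_fun_integrable[OF test_fun_pdv[OF v]] moll_test_fun[OF e]])
   have m3: "pdv j v : BL" by (rule test_fun_measurable[OF test_fun_pdv[OF v]])
   have m4: "ind A : BL" using Ai by auto
   have am: "a : BL" unfolding a_def using m1 m4 by measurable
   have bm: "b : BL" unfolding b_def using m2 m3 by measurable
   have ab: "abs (pdv j (conv u (moll eps)) x - pdv j v x) powr p <= 2 powr p * (a x + b x)" if x: "x ~: A" for x
   proof -
    have s1: "conv u (pdv j (moll eps)) x = conv z (pdv j (moll eps)) x + conv v (pdv j (moll eps)) x" unfolding conv_def z_def
     using conv_integrable[OF ui test_fun_pdv[OF moll_test_fun[OF e]], of x j] conv_integrable[OF vi test_fun_pdv[OF moll_test_fun[OF e]], of x j]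
     by (simp add: left_diff_distrib)
    have s2: "pdv j (conv w (moll eps)) x = conv w (pdv j (moll eps)) x" if "integ w" for w by (rule fun_cong[OF conv_pdv[OF that moll_test_fun[OF e]]])
    have s3: "pdv j (conv v (moll eps)) x = conv (pdv j v) (moll eps) x" by (rule fun_cong[OF conv_wder[OF wder_test_fun[OF v] vi e]])
    have "pdv j (conv u (moll eps)) x - pdv j v x = pdv j (conv z (moll eps)) x + (conv (pdv j v) (moll eps) x - pdv j v x)"
     unfolding s2[OF ui] s2[OF zi] s3[symmetric] s2[OF vi] s1 by simp
    hence "abs (pdv j (conv u (moll eps)) x - pdv j v x) powr p
     <= 2 powr p * (abs (pdv j (conv z (moll eps)) x) powr p + abs (conv (pdv j v) (moll eps) x - pdv j v x) powr p)"
     using norm_add_powr_le[OF order_trans[OF zero_le_one p], of "pdv j (conv z (moll eps)) x" "conv (pdv j v) (moll eps) x - pdv j v x"]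
     by (simp only: real_norm_def)
    moreover have "abs (pdv j (conv z (moll eps)) x) powr p <= a x"
     unfolding a_def using powr_mono2[OF _ _ key[OF e x], of p] p C1 by (simp add: powr_mult)
    ultimately show ?thesis unfolding b_def[symmetric] by (meson add_right_mono mult_left_mono order_trans powr_ge_zero)
   qed
   have "(nns (-A) (%x. ennreal (abs (pdv j (conv u (moll eps)) x - pdv j v x) powr p)))
    <= (NN x. ennreal (2 powr p) * (ennreal (a x) + ennreal (b x)))"
   proof (rule nn_integral_mono)
    fix x
    have nn: "a x >= 0" "b x >= 0" by (auto simp: a_def b_def)
    show "ennreal (abs (pdv j (conv u (moll eps)) x - pdv j v x) powr p) * indicator (- A) x <= ennreal (2 powr p) * (ennreal (a x) + ennreal (b x))"
     using ennreal_leI[OF ab[of x]] nn by (cases "x : A") (auto simp: ennreal_mult ennreal_plus[symmetric] simp del: ennreal_plus)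
   qed
   moreover have "(NN x. ennreal (2 powr p) * (ennreal (a x) + ennreal (b x))) = ennreal (2 powr p) * ((NN x. ennreal (a x)) + (NN x. ennreal (b x)))"
    using am bm by (simp add: nn_integral_cmult nn_integral_add)
   moreover have "(NN x. ennreal (a x)) = ennreal (C1 powr p) * (np p (%x. conv (ind A) (moll (K * eps)) x - ind A x))"
    unfolding a_def using m1 m4 by (subst nn_integral_cmult[symmetric]) (auto simp: ennreal_mult)
   ultimately show "(nns (-A) (%x. ennreal (abs (pdv j (conv u (moll eps)) x - pdv j v x) powr p)))
   <= ennreal (2 powr p) * (ennreal (C1 powr p) * (np p (%x. conv (ind A) (moll (K * eps)) x - ind A x))
   + (np p (%x. conv (pdv j v) (moll eps) x - pdv j v x)))" unfolding b_def by (simp only:)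
  qed simp
 qed
qed

lemma maximal_set_ge:
 fixes g :: "'a::euclidean_space => real"
 assumes g: "continuous_on UNIV g" "integ g" and x: "x ~: maximal_set g s" shows "g x <= s"
proof (rule ccontr)
 assume "~ g x <= s"
 define eta where "eta = (g x - s) / 2"
 have eta: "eta > 0" using \<open>~ g x <= s\<close> by (simp add: eta_def)
 have "isCont g x" using g(1) by (simp add: continuous_on_eq_continuous_at)
 then obtain r where r: "r > 0" "!!y. dist y x < r ==> dist (g y) (g x) < eta" using eta unfolding continuous_at_eps_delta by blast
 have lb: "s + eta <= g y" if "y : ball x r" for y
 proof -
  have "dist (g y) (g x) < eta" using r(2)[of y] that by (simp add: dist_commute)
  moreover have "2 * eta = g x - s" by (simp add: eta_def)
  ultimately show ?thesis unfolding dist_real_def abs_less_iff by linarith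
 qed
 have m: "vol (ball x r) > 0" using r(1) by (rule measure_ball_pos)
 have "(s + eta) * vol (ball x r) = (LINT y:ball x r|lebesgue. s + eta)" by (simp add: set_lebesgue_integral_def)
 also have "(LINT y:ball x r|lebesgue. s + eta) <= (LINT y:ball x r|lebesgue. g y)" unfolding set_lebesgue_integral_def
 proof (rule integral_mono)
  show "integ (%y. ind (ball x r) y *R (s + eta))"
   by (intro integrable_scaleR_left integrable_real_indicator) (use emeasure_lborel_ball_finite[of x r] in auto)
  show "integ (%y. ind (ball x r) y *R g y)" by (rule integrable_mult_indicator[OF _ g(2)]) simp
  show "ind (ball x r) y *R (s + eta) <= ind (ball x r) y *R g y" for y using lb[of y] by (cases "y : ball x r") (simp_all del: mem_ball)
 qed
 finally have "s * vol (ball x r) + eta * vol (ball x r) <= (LINT y:ball x r|lebesgue. g y)" by (simp only: distrib_right)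
 moreover have "eta * vol (ball x r) > 0" using eta m by (rule mult_pos_pos)
 ultimately have "s * vol (ball x r) < (LINT y:ball x r|lebesgue. g y)" by linarith
 hence "x : maximal_set g s" unfolding maximal_set_def using r(1) by (intro CollectI exI[of _ r] conjI)
 thus False using x by simp
qed

text \<open>The part of \<open>g\<close> below height \<open>t\<close> contributes at most
  \<open>t\<close> to any mean. Thus the weak estimate at height \<open>2 * t\<close> involves only
  the part of \<open>g\<close> above \<open>t\<close>.\<close>

lemma maximal_set_truncate:
 fixes g :: "'a::euclidean_space => real"
 assumes g: "integ g" "!!x. g x >= 0" and t: "t > 0"
 shows "maximal_set g (2 * t) <= maximal_set (%x. ind {x. g x > t} x * g x) t" "integ (%x. ind {x. g x > t} x * g x)"
proof -
 have [measurable]: "g : BL" using g by auto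
 have B: "{x. g x > t} : sets lebesgue"
 proof -
  have "{x : space lebesgue. g x > t} : sets lebesgue" by measurable
  thus ?thesis by simp
 qed
 show i: "integ (%x. ind {x. g x > t} x * g x)" using integrable_mult_indicator[OF B g(1)] by simp
 show "maximal_set g (2 * t) <= maximal_set (%x. ind {x. g x > t} x * g x) t"
 proof
  fix x assume "x : maximal_set g (2 * t)"
  then obtain r where r: "r > 0" "2 * t * vol (ball x r) < (LINT y:ball x r|lebesgue. g y)" by (auto simp: maximal_set_def)
  have bi: "integ (ind (ball x r))" by (rule integrable_real_indicator) (use emeasure_lborel_ball_finite[of x r] in auto)
  have i2: "integ (%y. ind (ball x r) y * (ind {x. g x > t} y * g y))" using integrable_mult_indicator[OF _ i, of "ball x r"] by simp
  have "(LINT y:ball x r|lebesgue. g y) <= (LI y. ind (ball x r) y * (ind {x. g x > t} y * g y) + t * ind (ball x r) y)" unfolding set_lebesgue_integral_def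
  proof (rule integral_mono)
   show "integ (%y. ind (ball x r) y *R g y)" by (rule integrable_mult_indicator[OF _ g(1)]) simp
   show "ind (ball x r) y *R g y <= ind (ball x r) y * (ind {x. g x > t} y * g y) + t * ind (ball x r) y" for y using t by (auto simp: indicator_def)
  qed (use bi i2 in auto)
  also have "... = (LINT y:ball x r|lebesgue. ind {x. g x > t} y * g y) + t * vol (ball x r)" using i2 bi by (simp add: set_lebesgue_integral_def)
  finally show "x : maximal_set (%x. ind {x. g x > t} x * g x) t" unfolding maximal_set_def using r by (intro CollectI exI[of _ r] conjI) linarith+
 qed
qed

text \<open>Far from the support of \<open>g\<close> no ball of admissible radius meets it. This
  gives the truncated function compact support and keeps the complement of the maximal set
  nonempty.\<close>

lemma maximal_set_bounded:
 fixes g :: "'a::euclidean_space => real"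
 assumes g: "integ g" "!!x. g x >= 0" and s: "s > 0" and supp: "!!x. norm x > N ==> g x = 0"
 shows "EX N'>=N. ALL x. norm x > N' --> x ~: maximal_set g s"
proof -
 obtain R where R: "R > 0" "!!x r. 0 < r ==> s * vol (ball x r) < (LINT z:ball x r|lebesgue. g z) ==> r <= R"
  using maximal_radius_bound[OF g s] by metis
 have "x ~: maximal_set g s" if x: "norm x > N + R" for x
 proof
  assume "x : maximal_set g s"
  then obtain r where r: "r > 0" "s * vol (ball x r) < (LINT z:ball x r|lebesgue. g z)" by (auto simp: maximal_set_def)
  have "r <= R" using R(2) r by blast
  have z: "ind (ball x r) y *R g y = 0" for y
  proof (cases "y : ball x r")
   case True
   hence "norm (x - y) < R" using \<open>r <= R\<close> by (simp add: dist_norm)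
   hence "norm y > N" using norm_triangle_ineq2[of x y] x by linarith
   thus ?thesis by (simp add: supp)
  qed simp
  have "(LINT z:ball x r|lebesgue. g z) = 0" unfolding set_lebesgue_integral_def z by simp
  moreover have "s * vol (ball x r) > 0" using s measure_ball_pos[OF r(1)] by (rule mult_pos_pos)
  ultimately show False using r(2) by linarith
 qed
 thus ?thesis using R by (intro exI[of _ "N + R"]) auto
qed

section \<open>Truncation of test functions\<close>

text \<open>One function measures both \<open>v\<close> and its gradient, so that truncation along
  its maximal function bounds both.\<close>

definition size_grad :: "(real^'d => real^'m) => real^'d => real" where "size_grad v x = norm (v x) + norm (cgrad v x)"

lemma test_fun_vec_nth: "test_fun_vec D v ==> test_fun D (%x. v x $ i)" by (simp add: test_fun_vec_def)

lemma test_fun_vec_continuous: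
 fixes v :: "real^'d => real^'m"
 assumes "test_fun_vec D v"
 shows "continuous_on UNIV v" "continuous_on UNIV (cgrad v)"
proof -
 have c: "continuous_on UNIV (%x. v x $ i)" "continuous_on UNIV (pdv j (%x. v x $ i))" for i j
  using test_fun_vec_nth[OF assms, of i] by (auto intro!: smooth_fun_continuous test_fun_smooth test_fun_pdv)
 have "continuous_on UNIV (%x. \<chi> i. v x $ i)" by (rule continuous_on_vec_lambda[OF c(1)])
 thus "continuous_on UNIV v" by simp
 show "continuous_on UNIV (cgrad v)" unfolding cgrad_def by (intro continuous_on_vec_lambda c(2))
qed

lemma test_fun_vec_bounded_support:
 fixes v :: "real^'d => real^'m"
 assumes "test_fun_vec D v"
 shows "EX N. ALL x. norm x > N --> v x = 0 & cgrad v x = 0"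
proof -
 have "EX N. ALL x. norm x > N --> v x $ i = 0" for i using test_fun_bounded_support[OF test_fun_vec_nth[OF assms, of i]] by metis
 then obtain N where N: "!!i x. norm x > N i ==> v x $ i = 0" by metis
 define M where "M = (\<Sum>i\<in>UNIV. abs (N i))"
 have M: "N i <= M" for i using member_le_sum[of i UNIV "%i. abs (N i)"] by (simp add: M_def)
 have z: "v x $ i = 0" if "norm x > M" for x i using N[of i x] M[of i] that by simp
 have "cgrad v x = 0" if "norm x > M" for x unfolding vec_eq_iff cgrad_nth
 proof (intro allI)
  fix i j show "pdv j (%y. v y $ i) x = (0 :: real^'d^'m) $ i $ j"
   by (subst pdv_locally_const[of "{x. norm x > M}"]) (use that z in "auto intro!: open_Collect_less continuous_intros")
 qed
 thus ?thesis using z by (intro exI[of _ M]) (auto simp: vec_eq_iff)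
qed

lemma continuous_compact_support_integrable:
 fixes g :: "real^'d => real"
 assumes c: "continuous_on UNIV g" and out: "!!x. norm x > N ==> g x = 0"
 shows "integrable lborel g" "integ g"
proof -
 have "set_integrable lborel (cball 0 N) g" unfolding set_integrable_def by (rule borel_integrable_compact) (auto intro: continuous_on_subset[OF c])
 moreover have "(%x. ind (cball 0 N) x *R g x) = g" using out by (auto simp: fun_eq_iff indicator_def not_le)
 ultimately show ci: "integrable lborel g" by (simp add: set_integrable_def)
 show "integ g" by (rule integrable_completion[THEN iffD2, OF _ ci]) (use ci in auto)
qed

lemma size_grad_props:
 fixes v :: "real^'d => real^'m"
 assumes "test_fun_vec D v"
 shows "continuous_on UNIV (size_grad v)" "integ (size_grad v)" "size_grad v x >= 0" "EX N. ALL x. norm x > N --> size_grad v x = 0"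
proof -
 show c: "continuous_on UNIV (size_grad v)" unfolding size_grad_def by (intro continuous_intros test_fun_vec_continuous[OF assms])
 show s: "EX N. ALL x. norm x > N --> size_grad v x = 0"
 proof -
  obtain N where "!!x. norm x > N ==> v x = 0 & cgrad v x = 0" using test_fun_vec_bounded_support[OF assms] by blast
  thus ?thesis by (intro exI[of _ N]) (simp add: size_grad_def)
 qed
 obtain N where "!!x. norm x > N ==> size_grad v x = 0" using s by blast
 thus "integ (size_grad v)" by (rule continuous_compact_support_integrable(2)[OF c])
 show "size_grad v x >= 0" by (simp add: size_grad_def)
qed

text \<open>The number of matrix entries times 2 * 2^d * 2, the Lipschitz constant per unit of
  \<open>t\<close> of one component off the maximal set at height \<open>2 * t\<close>. The type
  arguments only carry the dimensions.\<close>

definition trunc_const :: "'d::finite itself => 'm::finite itself => real" where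
 "trunc_const _ _ = real (CARD('m) * CARD('d)) * (4 * 2 ^ CARD('d))"

lemma ennreal_eq_le_imp:
 assumes "ennreal a = X" "X <= ennreal b" "b <= e" "0 <= e" shows "a <= e"
 using assms ennreal_leI[OF assms(3)] ennreal_le_iff[OF assms(4), of a] order_trans by metis

text \<open>Off \<open>A\<close> the components are Lipschitz; they are extended to the whole space,
  clipped and mollified. The last operation makes \<open>w\<close> a test function, at the price
  that off \<open>A\<close> it agrees with \<open>v\<close> only up to \<open>e\<close>.\<close>

lemma lipschitz_truncation:
 fixes v :: "real^'d => real^'m"
 assumes v: "test_fun_vec UNIV v" and t: "t > 0" and e: "e > 0" and p: "p >= 1"
 shows "EX w A. test_fun_vec UNIV w & A : lmeasurable &
  vol A <= 5 ^ CARD('d) / t * (LI x. ind {x. size_grad v x > t} x * size_grad v x) &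
  (ALL x. norm (w x) <= trunc_const TYPE('d) TYPE('m) * t) & (ALL x. norm (cgrad w x) <= trunc_const TYPE('d) TYPE('m) * t) &
  (ALL x. x ~: A --> size_grad v x <= 2 * t) &
  pint p (- A) (%x. w x - v x) <= e & pint p (- A) (%x. cgrad w x - cgrad v x) <= e"
proof -
 define g where "g = size_grad v"
 have gc: "continuous_on UNIV g" and gi: "integ g" and g0: "!!x. g x >= 0" using size_grad_props[OF v] by (auto simp: g_def)
 define A where "A = maximal_set g (2 * t)"
 note tr = maximal_set_truncate[OF gi g0 t]
 have Ao: "open A" unfolding A_def by (rule maximal_set_open[OF gi g0])
 note ms = maximal_set_measure[OF tr(2) _ t]
 have Am: "A : lmeasurable" "vol A <= 5 ^ CARD('d) / t * (LI x. ind {x. g x > t} x * g x)"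
 proof -
  have f: "maximal_set (%x. ind {x. g x > t} x * g x) t : lmeasurable" by (rule ms(1)) (simp add: g0)
  have sub: "A <= maximal_set (%x. ind {x. g x > t} x * g x) t" using tr(1) by (simp only: A_def)
  show lm: "A : lmeasurable" by (rule fmeasurableI2[OF f sub]) (use Ao in auto)
  have "vol A <= vol (maximal_set (%x. ind {x. g x > t} x * g x) t)" by (rule measure_mono_fmeasurable[OF sub fmeasurableD[OF lm] f])
  also have "... <= 5 ^ DIM(real^'d) / t * (LI x. ind {x. g x > t} x * g x)" by (rule ms(2)) (simp add: g0)
  finally show "vol A <= 5 ^ CARD('d) / t * (LI x. ind {x. g x > t} x * g x)" by simp
 qed
 obtain N0 where N0: "!!x. norm x > N0 ==> g x = 0" using size_grad_props(4)[OF v] by (auto simp: g_def)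
 obtain N where N: "N >= N0" "!!x. norm x > N ==> x ~: A"
  using maximal_set_bounded[OF gi g0 _ N0, of "2 * t"] t unfolding A_def by (metis mult_pos_pos zero_less_numeral)
 have g2: "g x <= 2 * t" if "x ~: A" for x by (rule maximal_set_ge[OF gc gi]) (use that in "simp add: A_def")
 define L where "L = 2 * 2 ^ CARD('d) * (2 * t)"
 have L: "L >= 0" using t by (simp add: L_def)
 have tv: "test_fun UNIV (%x. v x $ i)" for i by (rule test_fun_vec_nth[OF v])
 have lipS: "abs (v x $ i - v y $ i) <= L * dist x y" if "x ~: A" "y ~: A" for x y i unfolding L_def dist_norm
 proof (rule lipschitz_off_maximal_set[OF test_fun_smooth[OF tv] gc g0 gi])
  fix y h
  have "frechet_derivative (%x. v x $ i) (at y) h = (\<Sum>j\<in>UNIV. h $ j * pdv j (%x. v x $ i) y)"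
   by (rule frechet_derivative_pdv[OF smooth_fun_differentiable[OF test_fun_smooth[OF tv]]])
  also have "... = h \<bullet> (cgrad v y $ i)" by (simp add: inner_vec_def cgrad_nth)
  finally have "abs (frechet_derivative (%x. v x $ i) (at y) h) <= norm h * norm (cgrad v y $ i)"
   using Cauchy_Schwarz_ineq2[of h "cgrad v y $ i"] by (simp only:)
  also have "... <= norm h * g y"
   using Finite_Cartesian_Product.norm_nth_le[of "cgrad v y" i] by (intro mult_left_mono) (auto simp: g_def size_grad_def add_increasing)
  finally show "abs (frechet_derivative (%x. v x $ i) (at y) h) <= g y * norm h" by (simp add: mult.commute)
 qed (use that t in "auto simp: A_def")
 have vS: "abs (v x $ i) <= 2 * t" if "x ~: A" for x i
  using g2[OF that] component_le_norm_cart[of "v x" i] norm_ge_zero[of "cgrad v x"] unfolding g_def size_grad_def by linarith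
 have "EX u. (ALL x. x ~: A --> u x = v x $ i) & (ALL x y. abs (u x - u y) <= L * dist x y) & (ALL x. abs (u x) <= 2 * t)" for i
 proof -
  have "- A ~= {}"
  proof
   assume "- A = {}"
   obtain x :: "real^'d" where "norm x > N" using vector_choose_size[of "max 0 N + 1"] by (metis (no_types) less_add_one max.strict_coboundedI2 max.cobounded1 add_nonneg_nonneg zero_le_one max_less_iff_conj)
   thus False using N(2) \<open>- A = {}\<close> by blast
  qed
  from mcshane_extension[OF this L, of "%x. v x $ i"] lipS
  have "EX h. (ALL x:-A. h x = v x $ i) & (ALL x y. abs (h x - h y) <= L * dist x y)" by auto
  then obtain h where h: "!!x. x ~: A ==> h x = v x $ i" "!!x y. abs (h x - h y) <= L * dist x y" by blast
  \<comment> \<open>Clipping preserves the Lipschitz constant and, since |v| is at most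
    \<open>size_grad v\<close>, hence at most \<open>2 * t\<close> off \<open>A\<close>, also the
    values there.\<close>
  define u where "u x = max (- (2 * t)) (min (2 * t) (h x))" for x
  have "u x = v x $ i" if "x ~: A" for x using h(1)[OF that] vS[OF that, of i] by (simp add: u_def abs_le_iff)
  moreover have "abs (u x - u y) <= L * dist x y" for x y
  proof -
   have "abs (u x - u y) <= abs (h x - h y)" unfolding u_def by (simp add: max_def min_def)
   thus ?thesis using h(2)[of x y] by linarith
  qed
  moreover have "abs (u x) <= 2 * t" for x using t by (simp add: u_def)
  ultimately show ?thesis by blast
 qed
 then obtain u where u: "!!i x. x ~: A ==> u i x = v x $ i" "!!i x y. abs (u i x - u i y) <= L * dist x y" "!!i x. abs (u i x) <= 2 * t"
  by metis
 have uc: "continuous_on UNIV (u i)" for i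
  by (rule lipschitz_on_continuous_on[of L]) (use u(2) L in "auto intro!: lipschitz_onI simp: dist_real_def")
 have u0: "u i x = 0" if "norm x > N" for i x
 proof -
  have "g x = 0" using N0[of x] N(1) that by simp
  hence "v x = 0" by (simp add: g_def size_grad_def add_nonneg_eq_0_iff)
  thus ?thesis using u(1)[OF N(2)[OF that], of i] by simp
 qed
 have ui: "integrable lborel (u i)" "integ (u i)" for i by (rule continuous_compact_support_integrable[OF uc, of N i]; rule u0; assumption)+
 have uLp: "(np p (%x. u i x)) < \<infinity>" for i
 proof -
  have "Lp p (u i)"
  proof (rule Lp_bound[OF _ Lp_indicator[OF lmeasurable_cball]])
   show "AEL x. norm (u i x) <= 2 * t * norm (ind (cball 0 N) x)" by (rule AE_I2) (use u(3) u0 in "auto simp: indicator_def not_le")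
  qed (use ui(2) p t in auto)
  thus ?thesis by (simp add: Lp_def)
 qed
 have As: "- A : sets lebesgue" using Ao by auto
 define C where "C = real CARD('m) powr p * real CARD('d) powr p"
 have C: "C > 0" by (simp add: C_def)
 define C' where "C' = real CARD('m) powr p"
 have C': "C' > 0" by (simp add: C'_def)
 define e1 where "e1 = min (e / (C * real (card (UNIV :: ('m \<times> 'd) set)))) (e / (C' * real CARD('m)))"
 have e1: "e1 > 0" using e C C' by (simp add: e1_def)
 have fu: "\<forall>\<^sub>F eps in at_right 0. ALL i:UNIV. (np p (%x. conv (u i) (moll eps) x - u i x)) < ennreal e1"
  by (intro eventually_ball_finite ballI finite_UNIV order_tendstoD(2)[OF mollification_tendsto[OF ui(2) uLp p]]) (use e1 in auto)
 have fG: "\<forall>\<^sub>F eps in at_right 0. ALL k:(UNIV :: ('m \<times> 'd) set). (nns (-A) (%x. ennreal (abs (pdv (snd k) (conv (u (fst k)) (moll eps)) x - pdv (snd k) (%x. v x $ fst k) x) powr p))) < ennreal e1"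
  by (intro eventually_ball_finite ballI finite_UNIV order_tendstoD(2)[OF mollified_gradient_on_contact_set[OF tv ui(2) L u(2) Ao Am(1) u(1) p]])
    (use e1 in auto)
 have "\<forall>\<^sub>F eps::real in at_right 0. 0 < eps" by (auto simp: eventually_at_right_field intro: exI[of _ 1])
 from eventually_happens'[OF _ eventually_conj[OF fu eventually_conj[OF fG this]]]
 obtain eps where eps: "0 < eps" and fu: "!!i. (np p (%x. conv (u i) (moll eps) x - u i x)) < ennreal e1"
  and fG: "!!k. (nns (-A) (%x. ennreal (abs (pdv (snd k) (conv (u (fst k)) (moll eps)) x - pdv (snd k) (%x. v x $ fst k) x) powr p))) < ennreal e1"
  by auto
 define w where "w x = (\<chi> i. conv (u i) (moll eps) x)" for x
 have wi: "(%x. w x $ i) = conv (u i) (moll eps)" for i by (auto simp: w_def)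
 have tw: "test_fun_vec UNIV w" unfolding test_fun_vec_def wi by (intro allI conv_test_fun(1)[where N=N, OF ui(2) eps]) (rule u0)
 have cT: "trunc_const TYPE('d) TYPE('m) * t = real (CARD('m) * CARD('d)) * L" by (simp add: trunc_const_def L_def)
 have wb: "norm (w x) <= trunc_const TYPE('d) TYPE('m) * t" for x
 proof -
  have "norm (w x) <= (\<Sum>i\<in>UNIV. norm (w x $ i))" by (rule norm_vec_le_sum)
  also have "... <= (\<Sum>i\<in>(UNIV::'m set). 2 * t)" by (rule sum_mono) (use conv_abs_bound[OF ui(1) eps u(3)] in "simp add: w_def")
  also have "... = real CARD('m) * (2 * t)" by simp
  also have "... <= (real CARD('m) * real CARD('d)) * L"
  proof (rule mult_mono)
   have "1 <= CARD('d)" using zero_less_card_finite[where 'a='d] by simp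
   thus "real CARD('m) <= real CARD('m) * real CARD('d)" by (simp add: mult_le_cancel_left1)
   have "1 <= (2::real) ^ CARD('d)" by (rule one_le_power) simp
   hence "1 * (2 * t) <= 2 * 2 ^ CARD('d) * (2 * t)" using t by (intro mult_right_mono) linarith+
   thus "2 * t <= L" by (simp add: L_def)
  qed (use t in auto)
  finally show ?thesis by (simp add: cT)
 qed
 have cwb: "norm (cgrad w x) <= trunc_const TYPE('d) TYPE('m) * t" for x
 proof -
  have c: "abs (cgrad w x $ i $ j) <= L" for i j unfolding cgrad_nth wi
  proof (rule pdv_lipschitz_bound)
   show "conv (u i) (moll eps) differentiable at x" by (rule smooth_fun_differentiable[OF conv_smooth[OF ui(2) moll_test_fun[OF eps]]])
   show "abs (conv (u i) (moll eps) y - conv (u i) (moll eps) x) <= L * dist y x" for y by (rule conv_lipschitz[OF ui(1) eps u(2)])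
  qed
  have "norm (cgrad w x) <= (\<Sum>i\<in>UNIV. norm (cgrad w x $ i))" by (rule norm_vec_le_sum)
  also have "... <= (\<Sum>i\<in>(UNIV::'m set). \<Sum>j\<in>(UNIV::'d set). norm (cgrad w x $ i $ j))" by (intro sum_mono norm_vec_le_sum)
  also have "... <= (\<Sum>i\<in>(UNIV::'m set). \<Sum>j\<in>(UNIV::'d set). L)" by (intro sum_mono) (simp add: c)
  also have "... = trunc_const TYPE('d) TYPE('m) * t" by (simp add: cT)
  finally show ?thesis .
 qed
 have Lw: "Lp p (%x. w x - v x)" "Lp p (%x. cgrad w x - cgrad v x)"
  using test_fun_vec_Lp[OF tw, of p] test_fun_vec_Lp[OF v, of p] p by (auto intro!: Lp_diff)
 have Lc: "Lp p (%x. w x $ i - v x $ i)" "Lp p (%x. cgrad w x $ i $ j - cgrad v x $ i $ j)" for i j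
  using Lp_vec_nth[OF Lw(1), of i] Lp_vec_nth[OF Lp_vec_nth[OF Lw(2), of i], of j] p by simp_all
 have ms: "(%x. f x * ind (- A) x) : BL" if "f : BL" for f by (intro borel_measurable_times that borel_measurable_indicator As)
 have mp: "(%x. abs (h x) powr p) : BL" if "Lp p h" for h :: "real^'d => real"
 proof -
  have [measurable]: "h : BL" using that by (simp add: Lp_def)
  show ?thesis by measurable
 qed
 have "ennreal (pint p (- A) (%x. w x - v x)) = (NN x. ennreal (norm (w x - v x) powr p * ind (- A) x))"
  unfolding pint_nn[OF Lw(1) As] by (rule nn_integral_cong) (simp add: indicator_def)
 moreover have "(NN x. ennreal (norm (w x - v x) powr p * ind (- A) x)) <= ennreal (C' * real CARD('m) * e1)"
 proof (rule nn_integral_sum_le[where f="%i x. abs (w x $ i - v x $ i) powr p * ind (- A) x"])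
  show "norm (w x - v x) powr p * ind (- A) x <= C' * (\<Sum>i\<in>UNIV. abs (w x $ i - v x $ i) powr p * ind (- A) x)" for x
   using norm_vec_powr_le[of p "w x - v x"] p by (simp add: C'_def indicator_def)
  show "(NN x. ennreal (abs (w x $ i - v x $ i) powr p * ind (- A) x)) <= ennreal e1" for i
  proof -
   have "(NN x. ennreal (abs (w x $ i - v x $ i) powr p * ind (- A) x)) <= (np p (%x. conv (u i) (moll eps) x - u i x))"
    by (rule nn_integral_mono) (simp add: indicator_def w_def u(1))
   thus ?thesis using fu[of i] by simp
  qed
  show "(%x. abs (w x $ i - v x $ i) powr p * ind (- A) x) : BL" for i by (rule ms[OF mp[OF Lc(1)]])
 qed (use C' e1 in auto)
 moreover have "C' * real CARD('m) * e1 <= e"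
 proof -
  have "e1 <= e / (C' * real CARD('m))" by (simp add: e1_def)
  thus ?thesis using C' by (simp add: field_simps)
 qed
 ultimately have 1: "pint p (- A) (%x. w x - v x) <= e" by (rule ennreal_eq_le_imp) (use e in simp)
 have "ennreal (pint p (- A) (%x. cgrad w x - cgrad v x)) = (NN x. ennreal (norm (cgrad w x - cgrad v x) powr p * ind (- A) x))"
  unfolding pint_nn[OF Lw(2) As] by (rule nn_integral_cong) (simp add: indicator_def)
 moreover have "(NN x. ennreal (norm (cgrad w x - cgrad v x) powr p * ind (- A) x)) <= ennreal (C * real (card (UNIV :: ('m \<times> 'd) set)) * e1)"
 proof (rule nn_integral_sum_le[where f="%k x. abs (cgrad w x $ fst k $ snd k - cgrad v x $ fst k $ snd k) powr p * ind (- A) x"])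
  show "norm (cgrad w x - cgrad v x) powr p * ind (- A) x
   <= C * (\<Sum>k\<in>UNIV. abs (cgrad w x $ fst k $ snd k - cgrad v x $ fst k $ snd k) powr p * ind (- A) x)" for x
   using norm_matrix_powr_le[of p "cgrad w x - cgrad v x"] p
   by (cases "x : A") (simp_all add: C_def sum.cartesian_product case_prod_unfold UNIV_Times_UNIV[symmetric] del: UNIV_Times_UNIV)
  show "(NN x. ennreal (abs (cgrad w x $ fst k $ snd k - cgrad v x $ fst k $ snd k) powr p * ind (- A) x)) <= ennreal e1" for k
  proof -
   have "(NN x. ennreal (abs (cgrad w x $ fst k $ snd k - cgrad v x $ fst k $ snd k) powr p * ind (- A) x))
    = (nns (-A) (%x. ennreal (abs (pdv (snd k) (conv (u (fst k)) (moll eps)) x - pdv (snd k) (%x. v x $ fst k) x) powr p)))"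
    unfolding cgrad_nth wi by (rule nn_integral_cong) (simp add: indicator_def)
   thus ?thesis using fG[of k] by simp
  qed
  show "(%x. abs (cgrad w x $ fst k $ snd k - cgrad v x $ fst k $ snd k) powr p * ind (- A) x) : BL" for k by (rule ms[OF mp[OF Lc(2)]])
 qed (use C e1 in auto)
 moreover have "C * real (card (UNIV :: ('m \<times> 'd) set)) * e1 <= e"
 proof -
  have "e1 <= e / (C * real (card (UNIV :: ('m \<times> 'd) set)))" by (simp add: e1_def)
  thus ?thesis using C by (simp add: field_simps)
 qed
 ultimately have 2: "pint p (- A) (%x. cgrad w x - cgrad v x) <= e" by (rule ennreal_eq_le_imp) (use e in simp)
 show ?thesis using tw Am wb cwb g2 1 2 unfolding g_def by (intro exI[of _ w] exI[of _ A]) auto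
qed

subsection \<open>Removing concentrations of gradients\<close>

lemma diagonal_choice:
 assumes "!!l. eventually (P l) sequentially" shows "EX s :: nat => nat. strict_mono s & (ALL l. P l (s l))"
proof -
 have "EX s. ALL l. P l (s l) & s l < s (Suc l)"
 proof (rule dependent_nat_choice)
  show "EX x. P 0 x" using assms[of 0] by (auto simp: eventually_sequentially)
  fix x l
  have "EV y. P (Suc l) y & x < y" by (intro eventually_conj assms eventually_gt_at_top)
  thus "EX y. P (Suc l) y & x < y" by (auto simp: eventually_sequentially)
 qed
 thus ?thesis by (auto simp: strict_mono_Suc_iff)
qed

lemma bounded_family_convergent_subsequence:
 fixes f :: "nat => nat => real"
 assumes b: "!!n i. abs (f n i) <= M"
 shows "EX k. strict_mono k & (ALL i. convergent (%n. f (k n) i))"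
proof -
 interpret subseqs "%i s. convergent (%n. f (s n) i)"
 proof
  fix i and s :: "nat => nat" assume "strict_mono s"
  have "bounded (range (%n. f (s n) i))" using b by (auto intro!: boundedI[of _ M])
  then obtain l r where "strict_mono r" "((%n. f (s n) i) \<circ> r) ----> l" using bounded_imp_convergent_subsequence by blast
  thus "EX r. strict_mono r & convergent (%n. f ((s \<circ> r) n) i)" by (auto simp: convergent_def o_def)
 qed
 have "convergent (%n. f (diagseq (n + Suc i)) i)" for i
 proof -
  have "convergent (%n. f ((diagseq \<circ> (+) (Suc i)) n) i)"
  proof (rule diagseq_holds)
   fix r s :: "nat => nat" and n assume "strict_mono r" "convergent (%k. f (s k) n)"
   thus "convergent (%k. f ((s \<circ> r) k) n)" using convergent_subseq_convergent[of "%k. f (s k) n" r] by (simp add: o_def)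
  qed
  thus ?thesis by (simp add: add.commute)
 qed
 hence "convergent (%n. f (diagseq n) i)" for i by (rule convergentD[THEN exE]) (rule convergentI, rule LIMSEQ_offset, assumption)
 thus ?thesis using subseq_diagseq by blast
qed

section \<open>Dyadic levels and the selection of truncation heights\<close>

text \<open>This is g^p up to height \<open>t\<close> and linear with slope t^(p-1) beyond. Its
  increase when \<open>t\<close> is doubled controls t^(p-1) times the part of \<open>g\<close>
  above the upper height, which is the quantity in the weak estimate, while its integral stays below
  that of g^p.\<close>

definition capped :: "real => real => real => real" where "capped p t g = g * min g t powr (p - 1)"

text \<open>The reciprocal of the relative gain 1 - 2^-(p-1) of t^(p-1) when the height is doubled;
  it is positive because p > 1.\<close>

definition level_const :: "real => real" where "level_const p = 1 / (1 - 2 powr - (p - 1))"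

lemma level_const_pos: assumes "p > 1" shows "level_const p > 0"
proof -
 have "(2::real) powr - (p - 1) < 2 powr 0" by (rule powr_less_mono) (use assms in auto)
 thus ?thesis by (simp add: level_const_def)
qed

lemma capped_bounds:
 assumes "g >= 0" "t > 0" "p > 1"
 shows "0 <= capped p t g" "capped p t g <= g powr p" "s <= t ==> 0 <= s ==> capped p s g <= capped p t g"
proof -
 show "0 <= capped p t g" using assms by (simp add: capped_def)
 have "g powr p = g * g powr (p - 1)" using assms powr_add[of g 1 "p - 1"] by (cases "g = 0") auto
 thus "capped p t g <= g powr p" using assms by (auto simp: capped_def intro!: mult_left_mono powr_mono2)
 show "s <= t ==> 0 <= s ==> capped p s g <= capped p t g" using assms by (auto simp: capped_def intro!: mult_left_mono powr_mono2)
qed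

lemma half_powr: "0 <= a ==> (a / 2) powr q = a powr q * (2::real) powr - q" by (simp add: powr_divide powr_minus_divide)

lemma capped_above:
 assumes "g > t" "t > 0" "p > 1" shows "t powr (p - 1) * g = level_const p * (capped p t g - capped p (t / 2) g)"
proof -
 have "(t / 2) powr (p - 1) = t powr (p - 1) * 2 powr - (p - 1)" by (rule half_powr) (use assms in simp)
 hence "capped p t g - capped p (t / 2) g = t powr (p - 1) * g * (1 - 2 powr - (p - 1))" using assms by (simp add: capped_def min_def algebra_simps)
 thus ?thesis using level_const_pos[OF assms(3)] assms by (simp add: level_const_def)
qed

lemma capped_between:
 assumes "s < g" "g <= t" "s > 0" "p > 1" shows "g powr p <= level_const p * (capped p t g - capped p (s / 2) g)"
proof -
 have "(s / 2) powr (p - 1) <= (g / 2) powr (p - 1)" using assms by (intro powr_mono2) auto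
 also have "(g / 2) powr (p - 1) = g powr (p - 1) * 2 powr - (p - 1)" by (rule half_powr) (use assms in simp)
 finally have 1: "g * (s / 2) powr (p - 1) <= g * (g powr (p - 1) * 2 powr - (p - 1))" using assms by (intro mult_left_mono) auto
 have gp: "g powr p = g * g powr (p - 1)" using assms powr_add[of g 1 "p - 1"] by auto
 have "g powr p * (1 - 2 powr - (p - 1)) <= capped p t g - capped p (s / 2) g" using 1 assms unfolding gp by (simp add: capped_def min_def algebra_simps)
 hence "level_const p * (g powr p * (1 - 2 powr - (p - 1))) <= level_const p * (capped p t g - capped p (s / 2) g)"
  using level_const_pos[OF assms(4)] by (intro mult_left_mono) auto
 thus ?thesis using level_const_pos[OF assms(4)] assms by (simp add: level_const_def)
qed

lemma capped_integral:
 fixes g :: "real^'d => real"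
 assumes g: "integ g" "!!x. g x >= 0" and t: "t > 0" and p: "p > 1"
 shows "integ (%x. capped p t (g x))" "t powr (p - 1) * (LI x. ind {x. g x > t} x * g x)
    <= level_const p * ((LI x. capped p t (g x)) - (LI x. capped p (t / 2) (g x)))"
  "0 < s ==> s <= t ==> integ (%x. if s < g x & g x <= t then g x powr p else 0) &
   (LI x. (if s < g x & g x <= t then g x powr p else 0)) <= level_const p * ((LI x. capped p t (g x)) - (LI x. capped p (s / 2) (g x)))"
proof -
 have [measurable]: "g : BL" using g by auto
 have i: "integ (%x. capped p t (g x))" if "t > 0" for t unfolding capped_def by (rule integrable_mult_bounded[OF g(1), where B="t powr (p - 1)"])
   (use that g p in "auto intro!: powr_mono2")
 show "integ (%x. capped p t (g x))" by (rule i[OF t])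
 have i2: "integ (%x. level_const p * (capped p t (g x) - capped p (s / 2) (g x)))" if "s > 0" for s using i[OF t] i[of "s / 2"] that by auto
 note lc = less_imp_le[OF level_const_pos[OF p]]
 have nn: "0 <= level_const p * (capped p t (g x) - capped p (s / 2) (g x))" if "0 < s" "s <= t" for s x
  using capped_bounds(3)[OF g(2) t p, of "s / 2"] that lc by auto
 have e: "(LI x. level_const p * (capped p t (g x) - capped p (s / 2) (g x)))
  = level_const p * ((LI x. capped p t (g x)) - (LI x. capped p (s / 2) (g x)))" if "s > 0" for s using i[OF t] i[of "s / 2"] that by simp
 have "(LI x. t powr (p - 1) * (ind {x. g x > t} x * g x)) <= (LI x. level_const p * (capped p t (g x) - capped p (t / 2) (g x)))"
 proof (rule integral_mono[OF integrable_mult_right[OF maximal_set_truncate(2)[OF g t]] i2[OF t]])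
  fix x show "t powr (p - 1) * (ind {x. g x > t} x * g x) <= level_const p * (capped p t (g x) - capped p (t / 2) (g x))"
   using capped_above[of t "g x" p] nn[of t x] t p by (cases "g x > t") auto
 qed
 thus "t powr (p - 1) * (LI x. ind {x. g x > t} x * g x) <= level_const p * ((LI x. capped p t (g x)) - (LI x. capped p (t / 2) (g x)))"
  unfolding e[OF t] by simp
 assume s: "0 < s" "s <= t"
 have le: "(if s < g x & g x <= t then g x powr p else 0) <= level_const p * (capped p t (g x) - capped p (s / 2) (g x))" for x
  using capped_between[of s "g x" t p] nn[OF s, of x] s p by auto
 have i3: "integ (%x. if s < g x & g x <= t then g x powr p else 0)"
  by (rule Bochner_Integration.integrable_bound[OF i2[OF s(1)]]) (use le nn[OF s] in "auto intro!: AE_I2 simp: abs_of_nonneg")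
 show "integ (%x. if s < g x & g x <= t then g x powr p else 0) & (LI x. (if s < g x & g x <= t then g x powr p else 0))
    <= level_const p * ((LI x. capped p t (g x)) - (LI x. capped p (s / 2) (g x)))"
  using integral_mono[OF i3 i2[OF s(1)] le] i3 unfolding e[OF s(1)] by blast
qed

lemma pint_bounded:
 assumes "Lp p u" "V : lmeasurable" "!!x. norm (u x) <= B" "p >= 0" "B >= 0"
 shows "pint p V u <= B powr p * vol V"
proof -
 have "pint p V u <= (LINT x:V|lebesgue. B powr p)" unfolding pint_def by (rule set_integral_mono_AE[OF Lp_set_integrable set_integrable_const])
   (use assms in "auto intro!: AE_I2 powr_mono2")
 thus ?thesis using set_integral_const[OF assms(2)] by simp
qed

lemma Lp_size_grad:
 assumes v: "test_fun_vec UNIV v" and p: "p > 0"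
 shows "Lp p (size_grad v)" "pint p UNIV (size_grad v) <= 2 powr p * (pint p UNIV v + pint p UNIV (cgrad v))"
proof -
 note L = test_fun_vec_Lp[OF v p]
 have n: "Lp p (%x. norm (v x))" "Lp p (%x. norm (cgrad v x))" using L by (auto simp: Lp_def)
 show "Lp p (size_grad v)" using Lp_add[OF n p] by (simp add: size_grad_def[abs_def])
 show "pint p UNIV (size_grad v) <= 2 powr p * (pint p UNIV v + pint p UNIV (cgrad v))"
  using pint_add[OF n _ p, of UNIV] by (simp add: size_grad_def[abs_def] pint_def)
qed

text \<open>Truncating at height \<open>2 ^ Suc l\<close> costs at most the amount of \<open>I l = \<integral> capped p (2 ^ l) (size_grad v)\<close>
 gained between the levels \<open>l\<close> and \<open>Suc l\<close>, which is small for most \<open>l\<close>.\<close>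

lemma truncation_level:
 fixes v :: "real^'d => real^'m" and p e :: real and l :: nat
 assumes v: "test_fun_vec UNIV v" and p: "p > 1" and e: "e > 0" defines "I \<equiv> %i::nat. LI x. capped p (2 ^ i) (size_grad v x)"
  and "c \<equiv> trunc_const TYPE('d) TYPE('m)" and "C \<equiv> trunc_const TYPE('d) TYPE('m) powr p * (5 ^ CARD('d) * level_const p)"
 shows "EX w A. test_fun_vec UNIV w & A : lmeasurable & vol A <= 5 ^ CARD('d) * level_const p * (I (Suc l) - I l) &
  (ALL x. norm (cgrad w x) <= c * 2 ^ Suc l) & pint p A w <= C * (I (Suc l) - I l) & pint p A (cgrad w) <= C * (I (Suc l) - I l) &
  pint p (- A) (%x. w x - v x) <= e & pint p (- A) (%x. cgrad w x - cgrad v x) <= e &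
  (ALL s T. s <= Suc l --> T >= 2 * 2 ^ Suc s --> pint p {x. norm (cgrad w x) > T} (cgrad w)
   <= C * (I (Suc l) - I l) + 2 powr p * (e + level_const p * (I (Suc (Suc l)) - I s)))"
proof -
 define g where "g = size_grad v"
 define t where "t = (2::real) ^ Suc l"
 have t: "t >= 1" "t > 0" unfolding t_def by (rule one_le_power) auto
 have p0: "p > 0" "p >= 1" "p >= 0" using p by auto
 obtain w A where w: "test_fun_vec UNIV w" and A: "A : lmeasurable" and mA: "vol A <= 5 ^ CARD('d) / t * (LI x. ind {x. g x > t} x * g x)"
  and wb: "!!x. norm (w x) <= c * t" and gb: "!!x. norm (cgrad w x) <= c * t" and g2: "!!x. x ~: A ==> g x <= 2 * t"
  and e1: "pint p (- A) (%x. w x - v x) <= e" and e2: "pint p (- A) (%x. cgrad w x - cgrad v x) <= e"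
  using lipschitz_truncation[OF v t(2) e p0(2)] unfolding g_def c_def by blast
 have c0: "c >= 0" by (simp add: c_def trunc_const_def)
 have gi: "integ g" and g0: "g x >= 0" for x using size_grad_props[OF v] by (auto simp: g_def)
 define b where "b = level_const p * (I (Suc l) - I l)"
 note ci = capped_integral[OF gi g0 t(2) p]
 have a: "t powr (p - 1) * (LI x. ind {x. g x > t} x * g x) <= b" using ci(2) by (simp add: b_def I_def g_def t_def)
 have int0: "0 <= (LI x. ind {x. g x > t} x * g x)" by (rule integral_nonneg_AE) (use g0 in auto)
 have m: "t powr p * vol A <= 5 ^ CARD('d) * b"
 proof -
  have "t powr p * vol A <= t powr p * (5 ^ CARD('d) / t * (LI x. ind {x. g x > t} x * g x))" using mA by (rule mult_left_mono) simp
  also have "... = 5 ^ CARD('d) * (t powr (p - 1) * (LI x. ind {x. g x > t} x * g x))" using t by (simp add: powr_diff)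
  also have "... <= 5 ^ CARD('d) * b" using a by (intro mult_left_mono) auto
  finally show ?thesis .
 qed
 have m1: "vol A <= 5 ^ CARD('d) * level_const p * (I (Suc l) - I l)"
 proof -
  have "1 * vol A <= t powr p * vol A" using ge_one_powr_ge_zero[OF t(1) p0(3)] by (intro mult_right_mono) auto
  thus ?thesis using m by (simp add: b_def mult_ac)
 qed
 note Lw = test_fun_vec_Lp[OF w p0(1)] and Lv = test_fun_vec_Lp[OF v p0(1)]
 have m2: "(c * t) powr p * vol A <= C * (I (Suc l) - I l)" using mult_left_mono[OF m, of "c powr p"] c0 t by (simp add: powr_mult C_def c_def b_def mult_ac)
 have wA: "pint p A w <= C * (I (Suc l) - I l)" "pint p A (cgrad w) <= C * (I (Suc l) - I l)"
  using pint_bounded[OF Lw(1) A wb p0(3)] pint_bounded[OF Lw(2) A gb p0(3)] m2 c0 t by auto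
 have S: "{x. norm (cgrad w x) > T} : sets lebesgue" for T
 proof -
  have [measurable]: "cgrad w : BL" using Lw by (simp add: Lp_def)
  have "{x : space lebesgue. norm (cgrad w x) > T} : sets lebesgue" by measurable
  thus ?thesis by simp
 qed
 have "pint p {x. norm (cgrad w x) > T} (cgrad w) <= C * (I (Suc l) - I l) + 2 powr p * (e + level_const p * (I (Suc (Suc l)) - I s))"
  if s: "s <= Suc l" and T: "T >= 2 * 2 ^ Suc s" for s T
 proof -
  define S where "S = {x. norm (cgrad w x) > T}"
  have Sm: "S : sets lebesgue" "A : sets lebesgue" unfolding S_def using S A by auto
  define h where "h x = (if 2 ^ Suc s < g x & g x <= 2 * t then g x powr p else 0)" for x
  have "(2::real) ^ Suc s <= 2 ^ Suc (Suc l)" using s by (intro power_increasing) auto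
  hence hi: "integ h" "(LI x. h x) <= level_const p * (I (Suc (Suc l)) - I s)"
   using capped_integral(3)[OF gi g0 _ p, of "2 * t" "2 ^ Suc s"] t by (simp_all add: h_def[abs_def] I_def g_def t_def)
  have h0: "h x >= 0" for x by (simp add: h_def)
  have sp: "S = (S \<inter> A) \<union> (S \<inter> - A)" by auto
  have "pint p S (cgrad w) = pint p (S \<inter> A) (cgrad w) + pint p (S \<inter> - A) (cgrad w)"
   by (subst sp, rule pint_Un[OF Lw(2)]) (use Sm in "auto simp: Diff_eq[symmetric]")
  moreover have "pint p (S \<inter> A) (cgrad w) <= pint p A (cgrad w)" by (rule pint_subset[OF Lw(2)]) (use Sm in auto)
  moreover have "pint p (S \<inter> - A) (cgrad w) <= 2 powr p * (pint p (- A) (%x. cgrad w x - cgrad v x) + (LI x. h x))"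
  proof -
   have si: "set_integrable lebesgue (- A) (%x. norm (cgrad w x - cgrad v x) powr p)"
    by (rule Lp_set_integrable[OF Lp_diff[OF Lw(2) Lv(2) p0(1)]]) (use sets.compl_sets[OF Sm(2)] in "simp add: Compl_eq_Diff_UNIV")
   have si': "integ (%x. 2 powr p * (ind (- A) x * norm (cgrad w x - cgrad v x) powr p + h x))" using si hi by (simp add: set_integrable_def)
   have "pint p (S \<inter> - A) (cgrad w) <= (LI x. 2 powr p * (ind (- A) x * norm (cgrad w x - cgrad v x) powr p + h x))"
    unfolding pint_def set_lebesgue_integral_def
   proof (rule integral_mono[OF _ si'])
    show "integ (%x. ind (S \<inter> - A) x *R norm (cgrad w x) powr p)"
     using Lp_set_integrable[OF Lw(2), of "S \<inter> - A"] Sm by (simp add: set_integrable_def)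
    fix x
    show "ind (S \<inter> - A) x *R norm (cgrad w x) powr p <= 2 powr p * (ind (- A) x * norm (cgrad w x - cgrad v x) powr p + h x)"
    proof (cases "x : S \<inter> - A")
     case True
     define a where "a = norm (cgrad w x - cgrad v x)"
     have tri: "norm (cgrad w x) <= a + norm (cgrad v x)" using norm_triangle_sub[of "cgrad w x" "cgrad v x"] by (simp add: a_def)
     have gv: "norm (cgrad v x) <= g x" by (simp add: g_def size_grad_def)
     have "norm (cgrad w x) powr p <= 2 powr p * (a powr p + h x)"
     \<comment> \<open>Either the deviation \<open>a\<close> makes up half of the gradient of
       \<open>w\<close>, or the gradient of \<open>v\<close> does. In the second case
       \<open>T\<close> forces \<open>g\<close> above \<open>2 ^ Suc s\<close>, and
       \<open>g <= 2 * t\<close> off \<open>A\<close> places the point among the levels counted by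
       \<open>h\<close>.\<close>
     proof (cases "norm (cgrad w x) <= 2 * a")
      case True
      have "norm (cgrad w x) powr p <= (2 * a) powr p" using True p by (intro powr_mono2) auto
      hence "norm (cgrad w x) powr p <= 2 powr p * a powr p" by (simp add: powr_mult a_def)
      moreover have "2 powr p * a powr p <= 2 powr p * (a powr p + h x)" using h0[of x] by (intro mult_left_mono) auto
      ultimately show ?thesis by linarith
     next
      case False
      have "norm (cgrad w x) > T" using True by (simp add: S_def)
      hence g1: "2 ^ Suc s < g x" "norm (cgrad w x) <= 2 * g x" using False tri gv T by linarith+
      have "norm (cgrad w x) powr p <= (2 * g x) powr p" using g1 p by (intro powr_mono2) auto
      moreover have "h x = g x powr p" using g1(1) g2[of x] True by (simp add: h_def)
      moreover have "(2 * g x) powr p = 2 powr p * g x powr p" using g0[of x] by (simp add: powr_mult)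
      moreover have "2 powr p * g x powr p <= 2 powr p * (a powr p + g x powr p)" by (intro mult_left_mono) auto
      ultimately show ?thesis by (simp only:)
     qed
     thus ?thesis using True by (simp add: a_def)
    qed (simp add: h0)
   qed
   also have "... = 2 powr p * (pint p (- A) (%x. cgrad w x - cgrad v x) + (LI x. h x))"
    using si hi by (simp add: set_integrable_def pint_def set_lebesgue_integral_def)
   finally show ?thesis .
  qed
  moreover have "2 powr p * (pint p (- A) (%x. cgrad w x - cgrad v x) + (LI x. h x)) <= 2 powr p * (e + level_const p * (I (Suc (Suc l)) - I s))"
   using e2 hi(2) by (intro mult_left_mono) auto
  ultimately show ?thesis using wA(2) unfolding S_def by linarith
 qed
 thus ?thesis using w A m1 wA e1 e2 gb unfolding t_def by blast
qed

text \<open>The last clause is p-equiintegrability, expressed through tails uniform in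
  \<open>l\<close>. On \<open>A l\<close> nothing is claimed about \<open>Z (r l)\<close>: the
  energy concentrated there is discarded, and the gradient of \<open>w l\<close> tends to 0
  instead.\<close>

definition equiintegrable_gradients ::
 "real => (nat => real^'d => real^'d^'m) => (nat => nat) => (nat => real^'d => real^'m) => (nat => (real^'d) set) => real => bool" where
 "equiintegrable_gradients p Z r w A M' \<longleftrightarrow> strict_mono (r :: nat => nat) & (ALL l. test_fun_vec UNIV (w l) & A l : lmeasurable & pint p UNIV (cgrad (w l)) <= M') &
  (%l. vol (A l)) ----> 0 & (%l. pint p UNIV (w l)) ----> 0 &
  (%l. pint p (A l) (cgrad (w l))) ----> 0 & (%l. pint p (- A l) (%x. cgrad (w l) x - Z (r l) x)) ----> 0 &
  (ALL eps>0. EX T. ALL l. pint p {x. norm (cgrad (w l) x) > T} (cgrad (w l)) <= eps)"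

text \<open>The integrals \<open>I n i\<close> increase in the level \<open>i\<close> and are
  bounded, so along a subsequence they converge to an increasing bounded sequence \<open>J\<close>.
  Truncating the \<open>l\<close>-th member at level \<open>Suc l\<close> costs about
  \<open>J (Suc l) - J l\<close>, which tends to 0, and the part above level \<open>s\<close> that
  survives is about \<open>S - J s\<close>, small uniformly in \<open>l\<close>.\<close>

lemma remove_concentrations:
 fixes z :: "nat => real^'d => real^'m" and Z :: "nat => real^'d => real^'d^'m"
 assumes s: "!!n. sob p UNIV (z n) (Z n)" and supp: "!!n x. norm x > N ==> z n x = 0"
  and M: "!!n. pint p UNIV (Z n) <= M" and z0: "(%n. pint p UNIV (z n)) ----> 0" and p: "p > 1"
 shows "EX r w A M'. equiintegrable_gradients p Z r w A M'"
proof -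
 have p0: "p > 0" "p >= 1" "p >= 0" using p by auto
 have L: "Lp p (z n)" "Lp p (Z n)" for n using s[of n] unfolding sob_wder by auto
 have "EX v. test_fun_vec UNIV v & pint p UNIV (%x. v x - z n x) <= 1 / (real n + 1) &
  pint p UNIV (%x. cgrad v x - Z n x) <= 1 / (real n + 1)" for n
 proof -
  obtain v where v: "test_fun_vec UNIV v" "(nq p (%x. v x - z n x)) <= ennreal (1 / (real n + 1))"
   "(nq p (%x. cgrad v x - Z n x)) <= ennreal (1 / (real n + 1))"
   by (rule sob_approx[OF s[of n] supp p0(2), where e="1 / (real n + 1)"]) (auto intro: that)
  note Lv = test_fun_vec_Lp[OF v(1) p0(1)]
  show ?thesis by (intro exI[of _ v] conjI v(1) pint_le[OF Lp_diff[OF Lv(1) L(1) p0(1)] v(2)] pint_le[OF Lp_diff[OF Lv(2) L(2) p0(1)] v(3)]) auto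
 qed
 from choice[OF allI, OF this] obtain v where v: "ALL n. test_fun_vec UNIV (v n) & pint p UNIV (%x. v n x - z n x) <= 1 / (real n + 1) &
  pint p UNIV (%x. cgrad (v n) x - Z n x) <= 1 / (real n + 1)" by (rule exE) (rule that)
 have v: "test_fun_vec UNIV (v n)" "pint p UNIV (%x. v n x - z n x) <= 1 / (real n + 1)"
  "pint p UNIV (%x. cgrad (v n) x - Z n x) <= 1 / (real n + 1)" for n using v[rule_format, of n] by blast+
 note Lv = test_fun_vec_Lp[OF v(1) p0(1)]
 have tri: "pint p V a <= 2 powr p * (pint p V (%x. a x - b x) + pint p V b)" if "Lp p a" "Lp p b" "V : sets lebesgue"
  for V and a b :: "real^'d => 'v::euclidean_space" using pint_add[OF Lp_diff[OF that(1,2) p0(1)] that(2,3) p0(1)] by simp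
 have n1: "1 / (real n + 1) <= 1" for n by simp
 have vz: "pint p UNIV (v n) <= 2 powr p * (1 / (real n + 1) + pint p UNIV (z n))" for n
  by (rule order_trans[OF tri[OF Lv(1) L(1)[of n]]]) (auto intro!: mult_left_mono v(2))
 have conv_bound: "EX B. ALL n. f n <= B" if "f ----> a" for f :: "nat => real" and a
  using convergent_imp_Bseq[OF convergentI[OF that]] unfolding Bseq_def real_norm_def abs_le_iff by blast
 obtain Bz where Bz: "!!n. pint p UNIV (z n) <= Bz" using conv_bound[OF z0] by blast
 define M1 where "M1 = 2 powr p * (2 powr p * (1 + Bz) + 2 powr p * (1 + M))"
 have M1: "pint p UNIV (size_grad (v n)) <= M1" for n
 proof -
  have "pint p UNIV (cgrad (v n)) <= 2 powr p * (pint p UNIV (%x. cgrad (v n) x - Z n x) + pint p UNIV (Z n))" by (rule tri[OF Lv(2) L(2)]) simp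
  also have "... <= 2 powr p * (1 + M)" by (intro mult_left_mono add_mono order_trans[OF v(3) n1] M) auto
  finally have a: "pint p UNIV (cgrad (v n)) <= 2 powr p * (1 + M)" .
  have "2 powr p * (1 / (real n + 1) + pint p UNIV (z n)) <= 2 powr p * (1 + Bz)" by (intro mult_left_mono add_mono n1 Bz) auto
  hence b: "pint p UNIV (v n) <= 2 powr p * (1 + Bz)" using vz[of n] by linarith
  have "2 powr p * (pint p UNIV (v n) + pint p UNIV (cgrad (v n))) <= M1" unfolding M1_def by (intro mult_left_mono add_mono a b) auto
  thus ?thesis using Lp_size_grad(2)[OF v(1) p0(1), of n] by linarith
 qed
 define I where "I n i = (LI x. capped p (2 ^ i) (size_grad (v n) x))" for n and i :: nat
 note sg = size_grad_props[OF v(1)]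
 have ci: "integ (%x. capped p (2 ^ i) (size_grad (v n) x))" for n and i :: nat by (rule capped_integral(1)[OF sg(2,3) _ p]) simp
 have Imono: "I n i <= I n j" if "i <= j" for n i j
  unfolding I_def by (rule integral_mono[OF ci ci]) (use that in "auto intro!: capped_bounds(3) sg p power_increasing")
 have Ib: "abs (I n i) <= M1" for n i
 proof -
  have "I n i <= pint p UNIV (size_grad (v n))" using Lp_size_grad(1)[OF v(1) p0(1), of n] unfolding I_def pint_def set_lebesgue_integral_def
   by (intro integral_mono[OF ci]) (auto simp: Lp_integrable sg(3) intro!: capped_bounds p order_trans[OF capped_bounds(2)])
  moreover have "0 <= I n i" unfolding I_def by (rule integral_nonneg_AE) (auto intro!: AE_I2 capped_bounds(1) sg p)
  ultimately show ?thesis using M1[of n] by linarith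
 qed
 obtain k where k: "strict_mono k" "!!i. convergent (%n. I (k n) i)" using bounded_family_convergent_subsequence[of I, OF Ib] by auto
 define J where "J i = lim (%n. I (k n) i)" for i
 have kJ: "(%n. I (k n) i) ----> J i" for i using k(2) by (simp add: J_def convergent_LIMSEQ_iff)
 have Jm: "incseq J" by (intro incseq_SucI LIMSEQ_le[OF kJ kJ] exI[of _ 0] allI impI Imono) simp
 have Jb: "J i <= M1" for i using kJ Ib by (intro LIMSEQ_le_const2[OF kJ]) (auto simp: abs_le_iff)
 obtain S where S: "J ----> S" "!!i. J i <= S" using incseq_convergent[OF Jm, of M1] Jb by auto
 \<comment> \<open>The range extends to \<open>l + 2\<close> because the tail estimate for a
   truncation at level \<open>Suc l\<close> involves \<open>I\<close> at level
   \<open>Suc (Suc l)\<close>.\<close>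
 obtain q where q: "strict_mono q" "!!l i. i <= l + 2 ==> abs (I (k (q l)) i - J i) < 1 / (real l + 1)"
 proof -
  have "EV n. ALL i:{..l+2}. abs (I (k n) i - J i) < 1 / (real l + 1)" for l
  proof (intro eventually_ball_finite ballI)
   fix i show "EV n. abs (I (k n) i - J i) < 1 / (real l + 1)" using tendstoD[OF kJ, of "1 / (real l + 1)" i] by (simp add: dist_real_def)
  qed simp
  from diagonal_choice[of "%l n. ALL i:{..l+2}. abs (I (k n) i - J i) < 1 / (real l + 1)", OF this] that show ?thesis by auto
 qed
 define r where "r l = k (q l)" for l
 have r: "strict_mono r" unfolding r_def using k(1) q(1) by (simp add: strict_mono_def)
 have rI: "abs (I (r l) i - J i) < 1 / (real l + 1)" if "i <= l + 2" for l i using q(2)[OF that] by (simp add: r_def)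
 define e where "e l = 1 / (real l + 1)" for l
 have e: "e l > 0" "e ----> 0" for l unfolding e_def by (simp, real_asymp)
 define b where "b l = I (r l) (Suc l) - I (r l) l" for l
 define c where "c = trunc_const TYPE('d) TYPE('m)"
 define c1 where "c1 = 5 ^ CARD('d) * level_const p"
 define C where "C = c powr p * c1"
 have "ALL l. EX w A. test_fun_vec UNIV w & A : lmeasurable & vol A <= c1 * b l &
  (ALL x. norm (cgrad w x) <= c * 2 ^ Suc l) & pint p A w <= C * b l & pint p A (cgrad w) <= C * b l &
  pint p (- A) (%x. w x - v (r l) x) <= e l & pint p (- A) (%x. cgrad w x - cgrad (v (r l)) x) <= e l &
  (ALL s T. s <= Suc l --> T >= 2 * 2 ^ Suc s --> pint p {x. norm (cgrad w x) > T} (cgrad w)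
   <= C * b l + 2 powr p * (e l + level_const p * (I (r l) (Suc (Suc l)) - I (r l) s)))"
  using truncation_level[OF v(1) p e(1)] unfolding b_def c_def C_def c1_def I_def by blast
 from this[unfolded choice_iff] obtain w A where W: "ALL l. test_fun_vec UNIV (w l) & A l : lmeasurable & vol (A l) <= c1 * b l &
  (ALL x. norm (cgrad (w l) x) <= c * 2 ^ Suc l) & pint p (A l) (w l) <= C * b l & pint p (A l) (cgrad (w l)) <= C * b l &
  pint p (- A l) (%x. w l x - v (r l) x) <= e l & pint p (- A l) (%x. cgrad (w l) x - cgrad (v (r l)) x) <= e l &
  (ALL s T. s <= Suc l --> T >= 2 * 2 ^ Suc s --> pint p {x. norm (cgrad (w l) x) > T} (cgrad (w l))
   <= C * b l + 2 powr p * (e l + level_const p * (I (r l) (Suc (Suc l)) - I (r l) s)))" by (elim exE) (rule that)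
 have w: "test_fun_vec UNIV (w l)" and A: "A l : lmeasurable" and mA: "vol (A l) <= c1 * b l"
  and gb: "norm (cgrad (w l) x) <= c * 2 ^ Suc l" and wA: "pint p (A l) (w l) <= C * b l" "pint p (A l) (cgrad (w l)) <= C * b l"
  and wv: "pint p (- A l) (%x. w l x - v (r l) x) <= e l" "pint p (- A l) (%x. cgrad (w l) x - cgrad (v (r l)) x) <= e l"
  and tail: "s <= Suc l ==> T >= 2 * 2 ^ Suc s ==> pint p {x. norm (cgrad (w l) x) > T} (cgrad (w l))
   <= C * b l + 2 powr p * (e l + level_const p * (I (r l) (Suc (Suc l)) - I (r l) s))" for l x s T using W[rule_format, of l] by blast+
 note Lw = test_fun_vec_Lp[OF w p0(1)]
 have As: "A l : sets lebesgue" "- A l : sets lebesgue" for l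
 proof -
  show "A l : sets lebesgue" using A[of l] by auto
  thus "- A l : sets lebesgue" using sets.compl_sets[of "A l" lebesgue] by (simp add: Compl_eq_Diff_UNIV)
 qed
 have b0: "b ----> 0"
 proof (rule tendsto_sandwich[OF _ _ tendsto_const])
  show "EV l. 0 <= b l" by (intro always_eventually allI) (simp add: b_def Imono)
  show "EV l. b l <= J (Suc l) - J l + 2 * e l"
  proof (intro always_eventually allI)
   fix l show "b l <= J (Suc l) - J l + 2 * e l" using rI[of "Suc l" l] rI[of l l] unfolding b_def e_def by (simp add: abs_less_iff)
  qed
  show "(%l. J (Suc l) - J l + 2 * e l) ----> 0"
   using tendsto_add[OF tendsto_diff[OF LIMSEQ_Suc[OF S(1)] S(1)] tendsto_mult_left[OF e(2), of 2]] by simp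
 qed
 have bC: "(%l. K * b l) ----> 0" for K using tendsto_mult_left[OF b0, of K] by simp
 have er: "1 / (real (r l) + 1) <= e l" for l using strict_mono_imp_increasing[OF r, of l] by (simp add: e_def frac_le)
 have sq: "f ----> 0" if "h ----> 0" "!!l. f l <= h l" "!!l. 0 <= f l" for f h :: "nat => real"
  by (rule tendsto_sandwich[OF _ _ tendsto_const that(1)]) (use that in auto)
 have split: "pint p UNIV u = pint p (A l) u + pint p (- A l) u" if "Lp p u" for u :: "real^'d => 'v::euclidean_space" and l
  using pint_Un[OF that As(1)[of l] As(2)[of l]] by simp
 have "pint p UNIV (w l) <= C * b l + 2 powr p * (e l + 2 powr p * (e l + pint p UNIV (z (r l))))" for l
 proof -
  have "pint p (- A l) (v (r l)) <= pint p UNIV (v (r l))" by (rule pint_subset[OF Lv(1)]) (use As in auto)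
  moreover have "2 powr p * (1 / (real (r l) + 1) + pint p UNIV (z (r l))) <= 2 powr p * (e l + pint p UNIV (z (r l)))"
   using er[of l] by (intro mult_left_mono) auto
  ultimately have "2 powr p * (pint p (- A l) (%x. w l x - v (r l) x) + pint p (- A l) (v (r l)))
   <= 2 powr p * (e l + 2 powr p * (e l + pint p UNIV (z (r l))))" using vz[of "r l"] by (intro mult_left_mono add_mono wv) (linarith, simp)
  thus ?thesis using split[OF Lw(1), of l l] wA(1)[of l] tri[OF Lw(1) Lv(1) As(2), of l l "r l"] by linarith
 qed
 moreover have "(%l. C * b l + 2 powr p * (e l + 2 powr p * (e l + pint p UNIV (z (r l))))) ----> 0 + 2 powr p * (0 + 2 powr p * (0 + 0))"
  by (intro tendsto_add tendsto_mult_left bC e LIMSEQ_subseq_LIMSEQ[OF z0 r, unfolded o_def])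
 ultimately have W0: "(%l. pint p UNIV (w l)) ----> 0" using sq[of "%l. C * b l + 2 powr p * (e l + 2 powr p * (e l + pint p UNIV (z (r l))))"] by simp
 have gz: "pint p (- A l) (%x. cgrad (w l) x - Z (r l) x) <= 2 powr p * (e l + e l)" for l
 proof -
  have "pint p (- A l) (%x. cgrad (v (r l)) x - Z (r l) x) <= pint p UNIV (%x. cgrad (v (r l)) x - Z (r l) x)"
   by (rule pint_subset[OF Lp_diff[OF Lv(2) L(2) p0(1)]]) (use As in auto)
  hence "2 powr p * (pint p (- A l) (%x. cgrad (w l) x - cgrad (v (r l)) x) + pint p (- A l) (%x. cgrad (v (r l)) x - Z (r l) x))
   <= 2 powr p * (e l + e l)" using v(3)[of "r l"] er[of l] wv(2)[of l] by (intro mult_left_mono add_mono) auto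
  moreover have "pint p (- A l) (%x. cgrad (w l) x - Z (r l) x) <= 2 powr p * (pint p (- A l) (%x. cgrad (w l) x - cgrad (v (r l)) x) + pint p (- A l) (%x. cgrad (v (r l)) x - Z (r l) x))"
   using pint_add[OF Lp_diff[OF Lw(2)[of l] Lv(2)[of "r l"] p0(1)] Lp_diff[OF Lv(2)[of "r l"] L(2)[of "r l"] p0(1)] As(2)[of l] p0(1)] by simp
  ultimately show ?thesis by (rule order_trans[rotated])
 qed
 have "(%l. 2 powr p * (e l + e l)) ----> 2 powr p * (0 + 0)" by (intro tendsto_add tendsto_mult_left e)
 hence G0: "(%l. pint p (- A l) (%x. cgrad (w l) x - Z (r l) x)) ----> 0" using sq[OF _ gz] by simp
 obtain Bb where Bb: "!!l. C * b l <= Bb" using conv_bound[OF bC[of C]] by blast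
 have Gb: "pint p UNIV (cgrad (w l)) <= Bb + 2 powr p * (2 powr p * 2 + M)" for l
 proof -
  have "pint p (- A l) (Z (r l)) <= M" using pint_subset[OF L(2), of "- A l" UNIV "r l"] M[of "r l"] As by fastforce
  moreover have "2 powr p * (e l + e l) <= 2 powr p * 2" using n1[of l] unfolding e_def[symmetric] by (intro mult_left_mono) auto
  ultimately have "2 powr p * (pint p (- A l) (%x. cgrad (w l) x - Z (r l) x) + pint p (- A l) (Z (r l))) <= 2 powr p * (2 powr p * 2 + M)"
   by (intro mult_left_mono add_mono order_trans[OF gz]) auto
  thus ?thesis using split[OF Lw(2), of l l] wA(2)[of l] Bb[of l] tri[OF Lw(2) L(2) As(2), of l l "r l"] by linarith
 qed
 have "EX T. ALL l. pint p {x. norm (cgrad (w l) x) > T} (cgrad (w l)) <= eps" if ep: "eps > 0" for eps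
 proof -
  have S': "{x. norm (cgrad (w l) x) > T} : sets lebesgue" for l T
  proof -
   have [measurable]: "cgrad (w l) : BL" using Lw by (simp add: Lp_def)
   have "{x : space lebesgue. norm (cgrad (w l) x) > T} : sets lebesgue" by measurable
   thus ?thesis by simp
  qed
  have lc: "level_const p > 0" by (rule level_const_pos[OF p])
  define eta where "eta = eps / (2 * (2 powr p * level_const p))"
  have "eta > 0" using ep lc by (simp add: eta_def)
  then obtain s where s: "S - J s < eta" using order_tendstoD(1)[OF S(1), of "S - eta"] by (auto simp: eventually_sequentially algebra_simps)
  have "(%l. C * b l + 2 powr p * (e l + level_const p * (S - J s + 2 * e l))) ----> 0 + 2 powr p * (0 + level_const p * (S - J s + 2 * 0))"
   by (intro tendsto_add tendsto_mult_left tendsto_const bC e)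
  moreover have "2 powr p * (level_const p * (S - J s)) < eps"
  proof -
   have "2 powr p * level_const p * (S - J s) <= 2 powr p * level_const p * eta" using s lc by (intro mult_left_mono) auto
   also have "... = eps / 2" using lc by (simp add: eta_def)
   finally show ?thesis using ep by simp
  qed
  ultimately have "EV l. C * b l + 2 powr p * (e l + level_const p * (S - J s + 2 * e l)) < eps" by (intro order_tendstoD(2)) auto
  then obtain l0 where l0: "!!l. l >= l0 ==> C * b l + 2 powr p * (e l + level_const p * (S - J s + 2 * e l)) < eps"
   by (auto simp: eventually_sequentially)
  define l1 where "l1 = max l0 s"
  \<comment> \<open>The first term serves the late indices. The finitely many earlier gradients are
    bounded by the second term, so their tails are empty.\<close>
  define T where "T = max (2 * 2 ^ Suc s) (c * 2 ^ Suc l1)"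
  have "pint p {x. norm (cgrad (w l) x) > T} (cgrad (w l)) <= eps" for l
  proof (cases "l >= l1")
   case True
   hence l: "s <= Suc l" "s <= l + 2" "l >= l0" by (auto simp: l1_def)
   have "I (r l) (Suc (Suc l)) - I (r l) s <= S - J s + 2 * e l"
    using rI[of "Suc (Suc l)" l] rI[OF l(2)] S(2)[of "Suc (Suc l)"] unfolding e_def by (simp add: abs_less_iff)
   hence "2 powr p * (e l + level_const p * (I (r l) (Suc (Suc l)) - I (r l) s)) <= 2 powr p * (e l + level_const p * (S - J s + 2 * e l))"
    using lc by (intro mult_left_mono add_left_mono) auto
   moreover have "T >= 2 * 2 ^ Suc s" by (simp add: T_def)
   ultimately show ?thesis using tail[OF l(1), of T] l0[OF l(3)] by linarith
  next
   case False
   have "c >= 0" by (simp add: c_def trunc_const_def)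
   hence "c * 2 ^ Suc l <= c * 2 ^ Suc l1" using False by (intro mult_left_mono power_increasing) auto
   hence "norm (cgrad (w l) x) <= T" for x using gb[of l x] unfolding T_def by linarith
   hence "{x. norm (cgrad (w l) x) > T} = {}" by (auto simp: not_less)
   thus ?thesis using ep by (simp add: pint_def set_lebesgue_integral_def)
  qed
  thus ?thesis by blast
 qed
 thus ?thesis
  using r w A Gb W0 G0 sq[OF bC mA] sq[OF bC wA(2)] unfolding equiintegrable_gradients_def by (intro exI[of _ r] exI[of _ w] exI[of _ A] exI[of _ "Bb + 2 powr p * (2 powr p * 2 + M)"]) auto
qed

subsection \<open>Local compactness and weak convergence\<close>

lemma gradient_props:
 fixes v :: "real^'d => real"
 assumes "test_fun D v"
 shows "continuous_on UNIV (gradient v)" "abs (frechet_derivative v (at y) h) <= norm (gradient v y) * norm h"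
proof -
 show "continuous_on UNIV (gradient v)" unfolding gradient_def
  by (intro continuous_on_vec_lambda smooth_fun_continuous test_fun_smooth[OF test_fun_pdv[OF assms]])
 have "frechet_derivative v (at y) h = h \<bullet> gradient v y"
  using frechet_derivative_pdv[OF smooth_fun_differentiable[OF test_fun_smooth[OF assms]], of y h] by (simp add: inner_vec_def gradient_def)
 thus "abs (frechet_derivative v (at y) h) <= norm (gradient v y) * norm h" using Cauchy_Schwarz_ineq2[of h "gradient v y"] by (simp add: mult.commute)
qed

text \<open>The increment is an integral along the segment. Jensen's inequality on the unit interval
  and Tonelli reduce the claim to translations of |grad v|^p by \<open>s * h\<close>, which keep
  \<open>K\<close> inside \<open>K'\<close>; only the gradient on \<open>K'\<close> counts.\<close>

lemma translation_estimate:
 fixes v :: "real^'d => real"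
 assumes v: "test_fun UNIV v" and p: "p >= 1" and e: "eps > 0" and h: "norm h <= eps"
  and K: "closed K" "closed K'" "!!x h. x : K ==> norm h <= eps ==> x + h : K'"
 shows "(\<integral>\<^sup>+x\<in>K. ennreal (abs (v (x + h) - v x) powr p) \<partial>lborel) <= ennreal (eps powr p) * (\<integral>\<^sup>+x\<in>K'. ennreal (norm (gradient v x) powr p) \<partial>lborel)"
proof -
 define g where "g x = norm (gradient v x)" for x
 have gc: "continuous_on UNIV g" unfolding g_def by (intro continuous_intros gradient_props(1)[OF v])
 have [measurable]: "g : borel_measurable borel" by (rule borel_measurable_continuous_onI[OF gc])
 have [measurable]: "K : sets borel" "K' : sets borel" using K by auto
 define R where "R = (\<integral>\<^sup>+x\<in>K'. ennreal (g x powr p) \<partial>lborel)"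
 have pw: "ennreal (abs (v (x + h) - v x) powr p) <= (NB s. indicator {0..1} s * ennreal ((g (x + s *R h) * norm h) powr p))" for x
 proof -
  define M where "M = restrict_space lborel {0..1::real}"
  define f where "f s = g (x + s *R h) * norm h" for s
  have fc: "continuous_on A f" for A unfolding f_def by (intro continuous_intros continuous_on_subset[OF gc] continuous_on_compose2[OF gc]) auto
  have fi: "integrable M f" unfolding M_def using borel_integrable_compact[of "{0..1}" f] fc
   by (subst integrable_restrict_space) (auto simp: set_integrable_def)
  have f0: "f s >= 0" for s by (simp add: f_def g_def)
  have nr: "(\<integral>\<^sup>+s. F s \<partial>M) = (NB s. indicator {0..1} s * F s)" for F
   unfolding M_def by (subst nn_integral_restrict_space) (auto simp: mult.commute)
  have "ennreal (abs (v (x + h) - v x)) <= (\<integral>\<^sup>+s. ennreal (f s) \<partial>M)"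
   using segment_increment_bound[OF test_fun_smooth[OF v] gc _ gradient_props(2)[OF v, folded g_def], of "x + h" x] unfolding nr by (simp add: f_def g_def)
  also have "... = ennreal (LINT s|M. f s)" by (rule nn_integral_eq_integral[OF fi]) (simp add: f0)
  finally have "abs (v (x + h) - v x) <= (LINT s|M. f s)" using ennreal_le_iff[of "LINT s|M. f s"] integral_nonneg_AE[where M=M and f=f] f0 by auto
  hence "ennreal (abs (v (x + h) - v x) powr p) <= ennreal ((LINT s|M. f s) powr p)" using p by (intro ennreal_leI powr_mono2) auto
  also have "... <= (\<integral>\<^sup>+s. ennreal (f s powr p) \<partial>M)" by (rule jensen_powr[OF _ fi f0 p]) (simp add: M_def emeasure_restrict_space)
  finally show ?thesis unfolding nr f_def .
 qed
 have inner: "(NB x. indicator K x * ennreal ((g (x + s *R h) * norm h) powr p)) <= ennreal (eps powr p) * R" if s: "s : {0..1}" for s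
 proof -
  have "norm (s *R h) <= eps" using s h mult_mono[of s 1 "norm h" eps] e by simp
  hence "indicator K x * ennreal ((g (x + s *R h) * norm h) powr p) <= ennreal (eps powr p) * (ennreal (g (s *R h + 1 *R x) powr p) * indicator K' (s *R h + 1 *R x))" for x
   using K(3)[of x "s *R h"] h p
   by (auto simp: indicator_def powr_mult ennreal_mult' mult.commute add.commute g_def intro!: mult_left_mono mult_right_mono ennreal_leI powr_mono2)
  hence "(NB x. indicator K x * ennreal ((g (x + s *R h) * norm h) powr p))
   <= (NB x. ennreal (eps powr p) * (ennreal (g (s *R h + 1 *R x) powr p) * indicator K' (s *R h + 1 *R x)))" by (rule nn_integral_mono)
  also have "... = ennreal (eps powr p) * R"
   using nn_integral_lborel_affine[of "%x. ennreal (g x powr p) * indicator K' x" 1 "s *R h"] by (subst nn_integral_cmult) (simp_all add: R_def)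
  finally show ?thesis .
 qed
 have "(\<integral>\<^sup>+x\<in>K. ennreal (abs (v (x + h) - v x) powr p) \<partial>lborel)
  <= (NB x. (NB s. indicator K x * (indicator {0..1} s * ennreal ((g (x + s *R h) * norm h) powr p))))"
  by (rule nn_integral_mono) (use pw in "auto simp: indicator_def")
 also have "... = (NB s. (NB x. indicator K x * (indicator {0..1} s * ennreal ((g (x + s *R h) * norm h) powr p))))" by (rule lborel_pair.Fubini') measurable
 also have "... <= (NB s. indicator {0..1::real} s * (ennreal (eps powr p) * R))"
  by (rule nn_integral_mono) (use inner in "auto simp: indicator_def")
 also have "... = ennreal (eps powr p) * R" by (simp add: nn_integral_multc)
 finally show ?thesis by (simp add: R_def g_def)
qed

text \<open>The difference from the mollification is a mean of increments with |h| <= eps, so the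
  translation estimate is averaged against the mollifier.\<close>

lemma mollification_estimate:
 fixes v :: "real^'d => real"
 assumes v: "test_fun UNIV v" and p: "p >= 1" and e: "eps > 0"
  and K: "closed K" "closed K'" "!!x h. x : K ==> norm h <= eps ==> x + h : K'"
 shows "(\<integral>\<^sup>+x\<in>K. ennreal (abs (conv v (moll eps) x - v x) powr p) \<partial>lborel) <= ennreal (eps powr p) * (\<integral>\<^sup>+x\<in>K'. ennreal (norm (gradient v x) powr p) \<partial>lborel)"
proof -
 have vc: "continuous_on UNIV v" by (rule smooth_fun_continuous[OF test_fun_smooth[OF v]])
 have [measurable]: "v : borel_measurable borel" by (rule borel_measurable_continuous_onI[OF vc])
 have [measurable]: "K : sets borel" using K by auto
 obtain N where "!!x. norm x > N ==> v x = 0" by (rule test_fun_bounded_support[OF v]) (rule that)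
 hence vi: "integrable lborel v" using continuous_compact_support_integrable(1)[OF vc, of N] by auto
 define R where "R = ennreal (eps powr p) * (\<integral>\<^sup>+x\<in>K'. ennreal (norm (gradient v x) powr p) \<partial>lborel)"
 have pw: "ennreal (abs (conv v (moll eps) x - v x) powr p) <= (NB h. ennreal (abs (v (x + h) - v x) powr p) * ennreal (moll eps (- h)))" for x
 proof -
  \<comment> \<open>The constant \<open>v x\<close> is not integrable over the whole space;
    restricting to \<open>cball x eps\<close> changes nothing for the mollifier.\<close>
  define u where "u y = (v y - v x) * ind (cball x eps) y" for y
  have ui: "integrable lborel u"
  proof -
   have "continuous_on (cball x eps) (%y. v y - v x)" by (intro continuous_intros continuous_on_subset[OF vc]) auto
   from borel_integrable_compact[OF compact_cball this] show ?thesis by (simp add: u_def[abs_def] mult.commute)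
  qed
  have um: "u y * moll eps (x - y) = v y * moll eps (x - y) - v x * moll eps (x - y)" for y
   using moll_outside[OF e, of "x - y"] by (auto simp: u_def indicator_def algebra_simps dist_norm)
  have "conv u (moll eps) x = conv v (moll eps) x - v x" unfolding conv_lborel(2)[OF ui moll_test_fun[OF e]] conv_lborel(2)[OF vi moll_test_fun[OF e]] um
   using conv_lborel(1)[OF vi moll_test_fun[OF e], where x=x] moll_reflect_integral(1,2)[OF e, where x=x] by simp
  hence "ennreal (abs (conv v (moll eps) x - v x) powr p) <= (NB y. ennreal (abs (u y) powr p) * ennreal (moll eps (x - y)))"
   using conv_powr_le[OF ui e p, of x] by simp
  also have "... <= (NB y. ennreal (abs (v y - v x) powr p) * ennreal (moll eps (x - y)))"
   by (intro nn_integral_mono mult_right_mono) (auto simp: u_def indicator_def)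
  also have "... = (NB h. ennreal (abs (v (x + h) - v x) powr p) * ennreal (moll eps (- h)))"
   using nn_integral_lborel_affine[of "%y. ennreal (abs (v y - v x) powr p) * ennreal (moll eps (x - y))" 1 x] by simp
  finally show ?thesis .
 qed
 have "(\<integral>\<^sup>+x\<in>K. ennreal (abs (conv v (moll eps) x - v x) powr p) \<partial>lborel)
  <= (NB x. (NB h. ennreal (moll eps (- h)) * (ennreal (abs (v (x + h) - v x) powr p) * indicator K x)))"
  by (rule nn_integral_mono) (use pw in "auto simp: indicator_def mult.commute")
 also have "... = (NB h. (NB x. ennreal (moll eps (- h)) * (ennreal (abs (v (x + h) - v x) powr p) * indicator K x)))"
  by (rule lborel_pair.Fubini') measurable
 also have "... = (NB h. ennreal (moll eps (- h)) * (\<integral>\<^sup>+x\<in>K. ennreal (abs (v (x + h) - v x) powr p) \<partial>lborel))"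
  by (intro nn_integral_cong nn_integral_cmult) measurable
 also have "... <= (NB h. ennreal (moll eps (- h :: real^'d)) * R)"
 proof (rule nn_integral_mono)
  fix h :: "real^'d"
  show "ennreal (moll eps (- h)) * (\<integral>\<^sup>+x\<in>K. ennreal (abs (v (x + h) - v x) powr p) \<partial>lborel) <= ennreal (moll eps (- h)) * R"
  proof (cases "norm h <= eps")
   case True thus ?thesis unfolding R_def by (intro mult_left_mono translation_estimate[OF v p e _ K]) auto
  next
   case False thus ?thesis using moll_outside[OF e, of "- h"] by simp
  qed
 qed
 also have "... = R" using moll_reflect_integral(3)[OF e, where x="0::real^'d"] by (subst nn_integral_multc) auto
 finally show ?thesis by (simp add: R_def)
qed

lemma conv_diff:
 assumes "integ a" "integ b" "eps > 0"
 shows "conv (%y. a y - b y) (moll eps) x = conv a (moll eps) x - conv b (moll eps) x"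
 unfolding conv_def using conv_integrable[OF assms(1) moll_test_fun[OF assms(3)], of x] conv_integrable[OF assms(2) moll_test_fun[OF assms(3)], of x]
 by (simp add: left_diff_distrib)

lemma Lp_bounded_support_integrable:
 fixes u :: "real^'d => real"
 assumes "Lp p u" "p >= 1" "!!x. norm x > N ==> u x = 0" shows "integ u"
proof -
 have "integ (%x. u x * ind (cball 0 N) x)"
 proof (rule integrable_Lp_test[OF assms(1,2), where B=1 and N=N])
  show "ind (cball 0 N) : BL" by (rule borel_measurable_indicator) simp
 qed (auto simp: indicator_def)
 moreover have "(%x. u x * ind (cball 0 N) x) = u" using assms(3) by (auto simp: fun_eq_iff indicator_def not_le)
 ultimately show ?thesis by simp
qed

text \<open>The approximating test function is chosen with an error of order eps^p, the order of the
  bound itself, so the approximation only affects the constant.\<close>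

lemma mollification_estimate_sob:
 fixes z :: "real^'d => real^'m"
 assumes s: "sob p UNIV z Z" and supp: "!!x. norm x > N ==> z x = 0" and p: "p >= 1" and e: "eps > 0"
  and K: "closed K" "closed K'" "!!x h. x : K ==> norm h <= eps ==> x + h : K'"
 shows "pint p K (%x. conv (%y. z y $ i) (moll eps) x - z x $ i) <= 3 * (2 powr p * 2 powr p) * (eps powr p * (1 + pint p K' Z))"
proof -
 have p0: "p > 0" "p >= 0" using p by auto
 have L: "Lp p z" "Lp p Z" using s unfolding sob_wder by auto
 have Ks: "K : sets lebesgue" "K' : sets lebesgue" using K by auto
 have ep: "eps powr p > 0" using e by simp
 obtain v where v: "test_fun_vec UNIV v" "!!x. norm x > N + 1 ==> v x = 0" "(nq p (%x. v x - z x)) <= ennreal (min 1 (eps powr p))"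
  "(nq p (%x. cgrad v x - Z x)) <= ennreal (min 1 (eps powr p))"
  by (rule sob_approx[OF s supp p, where e="min 1 (eps powr p)"]) (use ep in "auto intro: that")
 note Lv = test_fun_vec_Lp[OF v(1) p0(1)]
 define a where "a y = z y $ i" for y
 define b where "b y = v y $ i" for y
 have tb: "test_fun UNIV b" unfolding b_def by (rule test_fun_vec_nth[OF v(1)])
 have La: "Lp p a" "Lp p b" unfolding a_def b_def by (intro Lp_vec_nth L Lv p0)+
 have ai: "integ a" by (rule Lp_bounded_support_integrable[OF La(1) p, of N]) (simp add: a_def supp)
 have bi: "integ b" by (rule test_fun_integrable[OF tb])
 define c where "c y = b y - a y" for y
 have ci: "integ c" and Lc: "Lp p c" unfolding c_def using ai bi by (auto intro: Lp_diff La p0)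
 have cn: "(np p c) <= ennreal (eps powr p)"
 proof -
  have "(np p c) <= (nq p (%x. v x - z x))" using component_le_norm_cart[of "v _ - z _" i] p0
   by (intro nn_integral_mono ennreal_leI powr_mono2) (auto simp: c_def a_def b_def)
  also have "... <= ennreal (min 1 (eps powr p))" by (rule v(3))
  also have "... <= ennreal (eps powr p)" by (intro ennreal_leI) simp
  finally show ?thesis .
 qed
 have Lcv: "Lp p (conv w (moll eps))" if "integ w" "Lp p w" for w :: "real^'d => real" unfolding Lp_def
  using order_le_less_trans[OF conv_nn_integral_le[OF that(1) e p]] that(2) measurable_lebesgue_borelI[OF conv_borel[OF that(1) moll_test_fun[OF e]]]
  by (simp add: Lp_def)
 have "norm (gradient b x) <= norm (cgrad v x)" for x
 proof -
  have "gradient b x = cgrad v x $ i" by (simp add: vec_eq_iff gradient_def cgrad_nth b_def[abs_def])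
  thus ?thesis using Finite_Cartesian_Product.norm_nth_le[of "cgrad v x" i] by simp
 qed
 hence gr: "(\<integral>\<^sup>+x\<in>K'. ennreal (norm (gradient b x) powr p) \<partial>lborel) <= (\<integral>\<^sup>+x\<in>K'. ennreal (norm (cgrad v x) powr p) \<partial>lborel)"
  using p0 by (intro nn_integral_mono mult_right_mono ennreal_leI powr_mono2) auto
 have G: "pint p K' (cgrad v) <= 2 powr p * (1 + pint p K' Z)"
 proof -
  have "pint p K' (%x. cgrad v x - Z x) <= min 1 (eps powr p)" by (rule pint_le[OF Lp_diff[OF Lv(2) L(2) p0(1)] v(4) _ Ks(2)]) (use ep in simp)
  hence "2 powr p * (pint p K' (%x. cgrad v x - Z x) + pint p K' Z) <= 2 powr p * (1 + pint p K' Z)" by (intro mult_left_mono) auto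
  moreover have "pint p K' (cgrad v) <= 2 powr p * (pint p K' (%x. cgrad v x - Z x) + pint p K' Z)"
   using pint_add[OF Lp_diff[OF Lv(2) L(2) p0(1)] L(2) Ks(2) p0(1)] by simp
  ultimately show ?thesis by linarith
 qed
 have B: "pint p K (%x. conv b (moll eps) x - b x) <= eps powr p * (2 powr p * (1 + pint p K' Z))"
 proof (rule ennreal_eq_le_imp)
  show "ennreal (pint p K (%x. conv b (moll eps) x - b x)) = (nns K (%x. ennreal (abs (conv b (moll eps) x - b x) powr p)))"
   using pint_nn[OF Lp_diff[OF Lcv[OF bi La(2)] La(2) p0(1)] Ks(1)] by simp
  have "(nns K (%x. ennreal (abs (conv b (moll eps) x - b x) powr p))) <= ennreal (eps powr p) * (\<integral>\<^sup>+x\<in>K'. ennreal (norm (cgrad v x) powr p) \<partial>lborel)"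
   unfolding nn_integral_completion by (rule order_trans[OF mollification_estimate[OF tb p e K] mult_left_mono[OF gr]]) auto
  also have "... = ennreal (eps powr p * pint p K' (cgrad v))" using pint_nn[OF Lv(2) Ks(2)] by (simp add: ennreal_mult' nn_integral_completion)
  finally show "(nns K (%x. ennreal (abs (conv b (moll eps) x - b x) powr p))) <= ennreal (eps powr p * pint p K' (cgrad v))" .
  show "eps powr p * pint p K' (cgrad v) <= eps powr p * (2 powr p * (1 + pint p K' Z))" by (intro mult_left_mono G) auto
 qed (simp add: add_nonneg_nonneg)
 have C: "pint p K c <= eps powr p" by (rule pint_le[OF Lc _ _ Ks(1)]) (use cn in auto)
 have C': "pint p K (conv c (moll eps)) <= eps powr p"
  by (rule pint_le[OF Lcv[OF ci Lc] _ _ Ks(1)]) (use order_trans[OF conv_nn_integral_le[OF ci e p] cn] in auto)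
 define bb where "bb x = conv b (moll eps) x - b x" for x
 define cc where "cc x = c x - conv c (moll eps) x" for x
 have Lb: "Lp p bb" "Lp p cc" unfolding bb_def cc_def by (intro Lp_diff Lcv bi ci La Lc p0)+
 have eq: "(%x. conv (%y. z y $ i) (moll eps) x - z x $ i) = (%x. bb x + cc x)"
  using conv_diff[OF bi ai e] by (auto simp: bb_def cc_def c_def[abs_def] a_def[abs_def] fun_eq_iff)
 have cc: "pint p K cc <= 2 powr p * (eps powr p + eps powr p)"
  unfolding cc_def by (rule order_trans[OF pint_diff[OF Lc Lcv[OF ci Lc] Ks(1) p0(1)]]) (intro mult_left_mono add_mono C C', simp)
 have "pint p K (%x. bb x + cc x) <= 2 powr p * (eps powr p * (2 powr p * (1 + pint p K' Z)) + 2 powr p * (eps powr p + eps powr p))"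
  by (rule order_trans[OF pint_add[OF Lb Ks(1) p0(1)]]) (intro mult_left_mono add_mono cc B[folded bb_def], simp)
 also have "... <= 3 * (2 powr p * 2 powr p) * (eps powr p * (1 + pint p K' Z))" by (simp add: algebra_simps)
 finally show ?thesis unfolding eq .
qed

lemma small_powr:
 fixes A e p :: real
 assumes "A >= 0" "e > 0" "delta > 0" "p > 0" shows "EX eps. 0 < eps & eps <= delta & A * eps powr p < e"
proof (intro exI conjI)
 define eps where "eps = min delta ((e / (A + 1)) powr (1 / p))"
 show "0 < min delta ((e / (A + 1)) powr (1 / p))" "min delta ((e / (A + 1)) powr (1 / p)) <= delta" using assms by auto
 have "eps powr p <= ((e / (A + 1)) powr (1 / p)) powr p" using assms by (intro powr_mono2) (auto simp: eps_def)
 also have "... = e / (A + 1)" using assms by (simp add: powr_powr)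
 finally have "A * eps powr p <= A * (e / (A + 1))" using assms by (intro mult_left_mono) auto
 also have "... < e" using assms by (simp add: field_simps)
 finally show "A * min delta ((e / (A + 1)) powr (1 / p)) powr p < e" by (simp add: eps_def)
qed

text \<open>Weak convergence makes the mollifications converge pointwise; they are Lipschitz near \<open>K\<close> uniformly in \<open>k\<close>.\<close>

lemma mollifications_uniform:
 fixes a :: "nat => real^'d => real"
 assumes ai: "!!k. integ (a k)" and e: "eps > 0" and K: "compact K" and delta: "delta > 0" and lim: "!!x. (%k. conv (a k) (moll eps) x) ----> 0"
  and lip: "!!k j x w. x : K ==> w : ball x delta ==> abs (pdv j (conv (a k) (moll eps)) w) <= B" and B: "B >= 0" and t: "tau > 0"
 shows "EV k. ALL x:K. abs (conv (a k) (moll eps) x) <= tau"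
proof -
 define L where "L = real CARD('d) * B"
 have L: "L >= 0" using B by (simp add: L_def)
 define rho where "rho = min delta (tau / (2 * (L + 1)))"
 have rho: "rho > 0" "rho <= delta" using delta t L by (auto simp: rho_def)
 obtain F where F: "finite F" "F <= K" "K <= (\<Union>x\<in>F. ball x rho)"
  by (rule compactE_image[OF K, of K "%x. ball x rho"]) (use rho in "auto intro: that")
 have "EV k. ALL x:F. abs (conv (a k) (moll eps) x) < tau / 2"
  using tendstoD[OF lim, of "tau / 2"] t by (intro eventually_ball_finite F ballI) (simp add: dist_real_def)
 thus ?thesis
 proof (rule eventually_mono, intro ballI)
  fix k x assume k: "ALL x:F. abs (conv (a k) (moll eps) x) < tau / 2" and "x : K"
  then obtain c where c: "c : F" "x : ball c rho" using F by auto
  have "abs (conv (a k) (moll eps) x - conv (a k) (moll eps) c) <= real CARD('d) * B * norm (x - c)"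
  proof (rule differentiable_lipschitz[where S="ball c delta", OF _ _ B])
   show "conv (a k) (moll eps) differentiable (at y)" for y by (rule smooth_fun_differentiable[OF conv_smooth[OF ai moll_test_fun[OF e]]])
  qed (use c F rho delta lip in auto)
  also have "... <= L * (tau / (2 * (L + 1)))"
   unfolding L_def[symmetric] using c L by (intro mult_left_mono) (auto simp: rho_def dist_norm norm_minus_commute)
  also have "... <= tau / 2" using L t by (simp add: field_simps)
  finally show "abs (conv (a k) (moll eps) x) <= tau" using bspec[OF k c(1)] by linarith
 qed
qed

text \<open>The distance of the cut-off functions from their mollifications is controlled on
  \<open>K\<close> by eps^p and the gradients on \<open>K'\<close>; for fixed \<open>eps\<close> the
  mollifications tend to 0 uniformly on \<open>K\<close>. The gradient bound is used on
  \<open>K'\<close> alone, where the cut-off is 1: elsewhere \<open>Z k\<close> contains the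
  gradient of the cut-off times \<open>y k\<close>, which is not yet controlled.\<close>

lemma rellich:
 fixes y :: "nat => real^'d => real^'m"
 assumes U: "open U" "U <= D" and p: "p > 1" and s: "!!k. sob p D (y k) (Y k)"
  and weak: "!!psi i. test_fun D psi ==> (%k. LI x. ext D (y k) x $ i * psi x) ----> 0"
  and M: "!!k. pint p U (ext D (Y k)) <= M" and K: "compact K" "K <= U"
 shows "(%k. pint p K (ext D (y k))) ----> 0"
proof -
 have p0: "p > 0" "p >= 1" "p >= 0" using p by auto
 obtain d2 where d2: "d2 > 0" "(\<Union>x\<in>K. cball x d2) <= U" using compact_subset_open_imp_cball_epsilon_subset[OF K(1) U(1) K(2)] by auto
 define delta where "delta = d2 / 2"
 have delta: "delta > 0" using d2 by (simp add: delta_def)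
 define K' where "K' = (\<Union>x\<in>K. cball x d2)"
 have K': "compact K'" "K' <= U" unfolding K'_def using d2 compact_minkowski_sum_cball[OF K(1)] by auto
 have KK: "K <= K'" unfolding K'_def using d2(1) by auto
 have mK: "K : lmeasurable" "K' : lmeasurable" using K K' by (auto intro: lmeasurable_compact)
 have mU: "U : sets lebesgue" using U by auto
 obtain phi W where ph: "test_fun U phi" "open W" "K' <= W" "!!x. x : W ==> phi x = 1" "!!x. 0 <= phi x" "!!x. phi x <= 1"
  by (rule ex_cutoff[OF K'(1) U(1) K'(2)]) (rule that)
 have phD: "test_fun D phi" by (rule test_fun_mono[OF ph(1) U(2)])
 have g0: "gradient phi x = 0" if "x : W" for x using pdv_locally_const[OF ph(2) that ph(4)] by (simp add: gradient_def vec_eq_iff)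
 define z where "z k x = phi x *R ext D (y k) x" for k x
 define Z where "Z k x = phi x *R ext D (Y k) x + outer (ext D (y k) x) (gradient phi x)" for k x
 have sz: "sob p UNIV (z k) (Z k)" for k unfolding z_def[abs_def] Z_def[abs_def] by (rule sob_cutoff[OF s phD p0(2)])
 have L: "Lp p (z k)" "Lp p (Z k)" "Lp p (ext D (y k))" "Lp p (ext D (Y k))" for k using sz[of k] s[of k] unfolding sob_wder by auto
 obtain N where N: "!!x. norm x > N ==> phi x = 0" by (rule test_fun_bounded_support[OF ph(1)]) (rule that)
 have z0: "z k x = 0" if "norm x > N" for k x using N[OF that] by (simp add: z_def)
 have ZY: "Z k x = ext D (Y k) x" if "x : K'" for k x using ph(3,4) g0 that by (auto simp: Z_def)
 have MZ: "pint p K' (Z k) <= M" for k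
 proof -
  have "pint p K' (Z k) = pint p K' (ext D (Y k))" by (rule pint_cong_AE) (use ZY L mK in auto)
  also have "... <= pint p U (ext D (Y k))" by (rule pint_subset[OF L(4) K'(2)]) (use mK mU in auto)
  finally show ?thesis using M[of k] by linarith
 qed
 have M0: "M >= 0" using order_trans[OF pint_nonneg M[of 0]] .
 define a where "a i k x = z k x $ i" for i k x
 have La: "Lp p (a i k)" for i k unfolding a_def by (rule Lp_vec_nth[OF L(1) p0(1)])
 have ai: "integ (a i k)" for i k by (rule Lp_bounded_support_integrable[OF La p0(2), of N]) (simp add: a_def z0)
 have wd: "wder UNIV (a i k) j (%x. Z k x $ i $ j)" for i j k using sz[of k] unfolding sob_wder a_def by simp
 have main: "(%k. pint p K (a i k)) ----> 0" for i
 proof (rule LIMSEQ_I)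
  fix e :: real assume e: "e > 0"
  define C where "C = 2 powr p * (3 * (2 powr p * 2 powr p) * (1 + M))"
  have C: "C >= 0" using M0 by (simp add: C_def)
  obtain eps where ep: "0 < eps" "eps <= delta" "C * eps powr p < e / 2" using small_powr[OF C _ delta p0(1), of "e / 2"] e by auto
  obtain tau where tau: "0 < tau" "2 powr p * vol K * tau powr p < e / 2" using small_powr[of "2 powr p * vol K" "e / 2" 1 p] e p0 by auto
  obtain B where B: "B >= 0" "!!x::real^'d. abs (moll eps x) <= B" by (rule test_fun_bounded[OF moll_test_fun[OF ep(1)]]) (rule that)
  define B' where "B' = B * (vol K' + M)"
  have B': "B' >= 0" using B M0 by (simp add: B'_def)
  have ev: "EV k. ALL x:K. abs (conv (a i k) (moll eps) x) <= tau"
  proof (rule mollifications_uniform[OF ai ep(1) K(1) delta _ _ B' tau(1)])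
   fix x
   have t: "test_fun D (%y. moll eps (x - y) * phi y)" by (rule test_fun_mult[OF smooth_fun_reflect[OF moll_smooth] phD])
   show "(%k. conv (a i k) (moll eps) x) ----> 0" using weak[OF t, of i] by (simp add: conv_def a_def z_def mult_ac)
  next
   fix k j x w assume x: "x : K" "w : ball x delta"
   have c: "pdv j (conv (a i k) (moll eps)) w = conv (%x. Z k x $ i $ j) (moll eps) w" by (rule fun_cong[OF conv_wder[OF wd ai ep(1)]])
   have i1: "set_integrable lebesgue K' (%x. 1 + norm (Z k x) powr p)"
    by (intro set_integral_add set_integrable_const mK Lp_set_integrable L) (use mK in auto)
   have Li: "Lp p (%x. Z k x $ i $ j)" by (intro Lp_vec_nth L p0)
   have "abs (conv (%x. Z k x $ i $ j) (moll eps) w) <= (LI y. abs (Z k y $ i $ j * moll eps (w - y)))"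
    unfolding conv_def by (rule integral_abs_bound)
   also have "... <= (LI y. B * (ind K' y *R (1 + norm (Z k y) powr p)))"
   proof (rule integral_mono_AE[OF _ integrable_mult_right[OF i1[unfolded set_integrable_def]]])
    have t: "test_fun UNIV (%y::real^'d. moll eps (w - y))" by (rule test_funI[OF smooth_fun_reflect[OF moll_smooth] compact_cball[of w eps]])
      (auto simp: dist_norm intro!: moll_outside[OF ep(1)])
    show "integ (%y. abs (Z k y $ i $ j * moll eps (w - y)))" by (intro integrable_abs integrable_Lp_test_fun[OF Li p0(2) t])
    show "AEL y. abs (Z k y $ i $ j * moll eps (w - y)) <= B * (ind K' y *R (1 + norm (Z k y) powr p))"
    proof (rule AE_I2)
     fix y
     show "abs (Z k y $ i $ j * moll eps (w - y)) <= B * (ind K' y *R (1 + norm (Z k y) powr p))"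
     proof (cases "norm (w - y) >= eps")
      case True thus ?thesis using moll_outside[OF ep(1) True] B(1) by simp
     next
      case False
      hence "dist x y <= d2" using x ep(2) dist_triangle[of x y w] by (simp add: dist_norm delta_def)
      hence y: "y : K'" using x by (auto simp: K'_def)
      have "abs (Z k y $ i $ j) <= norm (Z k y)"
       using component_le_norm_cart[of "Z k y $ i" j] Finite_Cartesian_Product.norm_nth_le[of "Z k y" i] by linarith
      also have "norm (Z k y) <= 1 + norm (Z k y) powr p"
      proof (cases "norm (Z k y) <= 1")
       case False
       hence "norm (Z k y) powr 1 <= norm (Z k y) powr p" using p by (intro powr_mono) auto
       thus ?thesis using False by simp
      qed (simp add: add_increasing2)
      finally show ?thesis using B y by (simp add: abs_mult mult.commute[of B] mult_mono)
     qed
    qed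
   qed
   also have "... = B * (vol K' + pint p K' (Z k))"
   proof -
    have "(LINT y:K'|lebesgue. 1 + norm (Z k y) powr p) = vol K' + pint p K' (Z k)"
     unfolding pint_def using set_integral_add(2)[OF set_integrable_const[OF mK(2), of 1] Lp_set_integrable[OF L(2), of K' k]] set_integral_const[OF mK(2), of 1] mK by auto
    thus ?thesis by (simp add: set_lebesgue_integral_def)
   qed
   also have "... <= B'" unfolding B'_def using MZ[of k] B by (intro mult_left_mono) auto
   finally show "abs (pdv j (conv (a i k) (moll eps)) w) <= B'" unfolding c .
  qed
  have "EV k. norm (pint p K (a i k) - 0) < e" using ev
  proof (rule eventually_mono)
   fix k assume k: "ALL x:K. abs (conv (a i k) (moll eps) x) <= tau"
   define b where "b x = ind K x * conv (a i k) (moll eps) x" for x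
   have bm: "conv (a i k) (moll eps) : BL" by (rule measurable_lebesgue_borelI[OF conv_borel[OF ai moll_test_fun[OF ep(1)]]])
   have Lb: "Lp p (conv (a i k) (moll eps))"
    unfolding Lp_def using order_le_less_trans[OF conv_nn_integral_le[OF ai ep(1) p0(2)]] La[of i k] bm by (simp add: Lp_def)
   have "pint p K (conv (a i k) (moll eps)) <= (LINT x:K|lebesgue. tau powr p)"
    unfolding pint_def by (rule set_integral_mono_AE[OF Lp_set_integrable[OF Lb] set_integrable_const[OF mK(1)]])
     (use k mK p0 in "auto intro!: AE_I2 powr_mono2")
   hence 1: "pint p K (conv (a i k) (moll eps)) <= tau powr p * vol K" using set_integral_const[OF mK(1)] by simp
   have 2: "pint p K (%x. conv (a i k) (moll eps) x - a i k x) <= 3 * (2 powr p * 2 powr p) * (eps powr p * (1 + M))"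
   proof -
    have "pint p K (%x. conv (a i k) (moll eps) x - a i k x) <= 3 * (2 powr p * 2 powr p) * (eps powr p * (1 + pint p K' (Z k)))" unfolding a_def
    proof (rule mollification_estimate_sob[OF sz z0 p0(2) ep(1)])
     show "x + h : K'" if "x : K" "norm h <= eps" for x h using that ep(2) d2(1) by (auto simp: K'_def delta_def dist_norm intro!: bexI[of _ x])
    qed (use K K' compact_imp_closed in auto)
    also have "... <= 3 * (2 powr p * 2 powr p) * (eps powr p * (1 + M))" by (intro mult_left_mono add_left_mono MZ) auto
    finally show ?thesis .
   qed
   have "pint p K (%x. conv (a i k) (moll eps) x - (conv (a i k) (moll eps) x - a i k x))
    <= 2 powr p * (tau powr p * vol K + 3 * (2 powr p * 2 powr p) * (eps powr p * (1 + M)))"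
    by (rule order_trans[OF pint_diff[OF Lb Lp_diff[OF Lb La p0(1)] _ p0(1)] mult_left_mono[OF add_mono[OF 1 2]]]) (use mK in auto)
   also have "... = 2 powr p * vol K * tau powr p + C * eps powr p" by (simp add: C_def algebra_simps)
   also have "... < e" using ep(3) tau(2) by linarith
   finally show "norm (pint p K (a i k) - 0) < e" by simp
  qed
  thus "EX no. ALL n>=no. norm (pint p K (a i n) - 0) < e" by (simp add: eventually_sequentially)
 qed
 have "pint p K (ext D (y k)) <= real CARD('m) powr p * (\<Sum>i\<in>UNIV. pint p K (a i k))" for k
 proof -
  have si: "set_integrable lebesgue K (%x. norm (a i k x) powr p)" for i by (rule Lp_set_integrable[OF La]) (use mK in auto)
  hence i: "set_integrable lebesgue K (%x. \<Sum>i\<in>UNIV. norm (a i k x) powr p)"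
   unfolding set_integrable_def scaleR_sum_right by (intro Bochner_Integration.integrable_sum)
  have "pint p K (ext D (y k)) <= (LINT x:K|lebesgue. real CARD('m) powr p * (\<Sum>i\<in>UNIV. norm (a i k x) powr p))" unfolding pint_def
  proof (rule set_integral_mono_AE[OF Lp_set_integrable[OF L(3)] set_integrable_mult_right[OF i]])
   show "AEL x. x : K --> norm (ext D (y k) x) powr p <= real CARD('m) powr p * (\<Sum>i\<in>UNIV. norm (a i k x) powr p)"
    using norm_vec_powr_le[OF p0(3), of "ext D (y k) _"] ph(3,4) KK by (intro AE_I2) (auto simp: a_def z_def)
  qed (use mK in auto)
  also have "... = real CARD('m) powr p * (\<Sum>i\<in>UNIV. pint p K (a i k))" using si unfolding pint_def set_lebesgue_integral_def set_integrable_def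
   by (simp add: mult.left_commute[of "ind K _"] sum_distrib_left Bochner_Integration.integral_sum)
  finally show ?thesis .
 qed
 moreover have "(%k. real CARD('m) powr p * (\<Sum>i\<in>UNIV. pint p K (a i k))) ----> 0" by (intro tendsto_mult_right_zero tendsto_null_sum main)
 ultimately show ?thesis by (intro tendsto_sandwich[OF always_eventually[OF allI[OF pint_nonneg]] always_eventually[OF allI] tendsto_const])
qed

section \<open>Pairing with the dual exponent and weak convergence\<close>

text \<open>A parametric form of Hoelder's inequality. It works with integrals of powers directly,
  so no roots of norms appear.\<close>

lemma young_inner:
 fixes a b :: "real^'d => 'v::euclidean_space"
 assumes a: "Lp p a" and b: "Lp (p / (p - 1)) b" and p: "p > 1" and e: "eps > 0"
 shows "integ (%x. a x \<bullet> b x)"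
  "abs (LI x. a x \<bullet> b x) <= eps * pint (p / (p - 1)) UNIV b + (1 / eps) powr (p - 1) * pint p UNIV a"
proof -
 have ia: "integ (%x. norm (a x) powr p)" "integ (%x. norm (b x) powr (p / (p - 1)))" using a b by (auto simp: Lp_integrable)
 have [measurable]: "a : BL" "b : BL" using a b by (auto simp: Lp_def)
 have i: "integ (%x. eps * norm (b x) powr (p / (p - 1)) + (1 / eps) powr (p - 1) * norm (a x) powr p)" using ia by auto
 have pw: "abs (a x \<bullet> b x) <= eps * norm (b x) powr (p / (p - 1)) + (1 / eps) powr (p - 1) * norm (a x) powr p" for x
 proof -
  have "abs (a x \<bullet> b x) <= (norm (b x) powr (1 / (p - 1))) powr (p - 1) * norm (a x)"
   using Cauchy_Schwarz_ineq2[of "a x" "b x"] p by (simp add: powr_powr mult.commute)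
  also have "... <= eps * (norm (b x) powr (1 / (p - 1))) powr p + (1 / eps) powr (p - 1) * norm (a x) powr p" by (rule young_eps) (use e p in auto)
  finally show ?thesis by (simp add: powr_powr)
 qed
 show ii: "integ (%x. a x \<bullet> b x)" by (rule Bochner_Integration.integrable_bound[OF i]) (auto intro!: AE_I2 order_trans[OF pw])
 have "abs (LI x. a x \<bullet> b x) <= (LI x. eps * norm (b x) powr (p / (p - 1)) + (1 / eps) powr (p - 1) * norm (a x) powr p)"
  by (rule order_trans[OF integral_abs_bound integral_mono[OF integrable_abs[OF ii] i pw]])
 thus "abs (LI x. a x \<bullet> b x) <= eps * pint (p / (p - 1)) UNIV b + (1 / eps) powr (p - 1) * pint p UNIV a"
  using ia by (simp add: pint_def set_lebesgue_integral_def)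
qed

lemma strong_inner_tendsto:
 fixes a :: "nat => real^'d => 'v::euclidean_space"
 assumes a: "!!k. Lp p (a k)" "(%k. pint p UNIV (a k)) ----> 0" and b: "Lp (p / (p - 1)) b" and p: "p > 1"
 shows "(%k. LI x. a k x \<bullet> b x) ----> 0"
proof (rule LIMSEQ_I)
 fix e :: real assume e: "e > 0"
 define eps where "eps = e / (2 * (pint (p / (p - 1)) UNIV b + 1))"
 have b1: "0 < pint (p / (p - 1)) UNIV b + 1" by (rule add_nonneg_pos) auto
 have eps: "eps > 0" using e b1 by (simp add: eps_def)
 have "eps * pint (p / (p - 1)) UNIV b <= eps * (pint (p / (p - 1)) UNIV b + 1)" using eps by simp
 also have "... = e / 2" using b1 by (simp add: eps_def field_simps)
 finally have 1: "eps * pint (p / (p - 1)) UNIV b <= e / 2" .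
 have "(%k. (1 / eps) powr (p - 1) * pint p UNIV (a k)) ----> 0" by (intro tendsto_mult_right_zero a)
 hence "EV k. (1 / eps) powr (p - 1) * pint p UNIV (a k) < e / 2" using e by (intro order_tendstoD) auto
 hence "EV k. norm ((LI x. a k x \<bullet> b x) - 0) < e"
 proof (rule eventually_mono)
  fix k assume "(1 / eps) powr (p - 1) * pint p UNIV (a k) < e / 2"
  hence "abs (LI x. a k x \<bullet> b x) < e" using young_inner(2)[OF a(1)[of k] b p eps] 1 by linarith
  thus "norm ((LI x. a k x \<bullet> b x) - 0) < e" by simp
 qed
 thus "EX no. ALL n>=no. norm ((LI x. a n x \<bullet> b x) - 0) < e" by (simp add: eventually_sequentially)
qed

lemma test_fun_dense:
 fixes V :: "real^'d => real"
 assumes V: "Lp q V" and q: "q >= 1" and e: "e > 0"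
 shows "EX psi. test_fun UNIV psi & pint q UNIV (%x. V x - psi x) <= e"
proof -
 have q0: "q > 0" using q by simp
 define e1 where "e1 = e / (2 powr q * 2)"
 have e1: "e1 > 0" using e by (simp add: e1_def)
 have V': "V : BL" "(np q V) < \<infinity>" using V by (auto simp: Lp_def)
 obtain c N where c: "continuous_on UNIV c" "!!x. norm x > N ==> c x = 0" "(np q (%x. V x - c x)) < ennreal e1"
  by (rule Lp_approx_continuous[OF V' q0 e1]) (rule that)
 have ci: "integ c" by (rule continuous_compact_support_integrable(2)[OF c(1), of N]) (rule c(2))
 have LVc: "Lp q (%x. V x - c x)" using V' ci c(3) by (auto simp: Lp_def intro: order_less_trans)
 have Lc: "Lp q c" using Lp_diff[OF V LVc q0] by simp
 have "(np q c) < \<infinity>" using Lc by (simp add: Lp_def)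
 from order_tendstoD(2)[OF mollification_tendsto[OF ci this q], where a="ennreal e1"] e1
 obtain eps where ep: "eps > 0" "(np q (%x. conv c (moll eps) x - c x)) < ennreal e1" unfolding eventually_at_right_field by (auto dest: dense)
 have t: "test_fun UNIV (conv c (moll eps))" by (rule conv_test_fun(1)[OF ci ep(1) c(2)])
 have Lt: "Lp q (%x. conv c (moll eps) x - c x)" by (rule Lp_diff[OF test_fun_Lp[OF t q0] Lc q0])
 have "pint q UNIV (%x. (V x - c x) - (conv c (moll eps) x - c x)) <= 2 powr q * (pint q UNIV (%x. V x - c x) + pint q UNIV (%x. conv c (moll eps) x - c x))"
  by (rule pint_diff[OF LVc Lt _ q0]) simp
 also have "... <= 2 powr q * (e1 + e1)" by (intro mult_left_mono add_mono pint_le LVc Lt) (use c(3) ep(2) e1 in auto)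
 finally show ?thesis using t by (intro exI[of _ "conv c (moll eps)"]) (simp add: e1_def)
qed

text \<open>Approximate \<open>V\<close> by a test function in the dual exponent. For the test
  function an integration by parts moves the derivative away from \<open>w k\<close>, which tends to
  0; the remainder is controlled by the bound on \<open>h k\<close>.\<close>

lemma weak_derivative_tendsto:
 fixes w h :: "nat => real^'d => real"
 assumes w: "!!k. Lp p (w k)" "(%k. pint p UNIV (w k)) ----> 0" and h: "!!k. Lp p (h k)" "!!k. pint p UNIV (h k) <= M"
  and d: "!!k. wder UNIV (w k) j (h k)" and V: "Lp (p / (p - 1)) V" and p: "p > 1"
 shows "(%k. LI x. h k x * V x) ----> 0"
proof (rule LIMSEQ_I)
 fix e :: real assume e: "e > 0"
 define q where "q = p / (p - 1)"
 have q: "q >= 1" "q > 0" using p by (auto simp: q_def field_simps)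
 have M0: "M >= 0" using order_trans[OF pint_nonneg h(2)] .
 \<comment> \<open>\<open>young_inner\<close> is applied with parameter 1/t. The bound
   \<open>M\<close> then carries the small factor t^(p-1), and the large factor 1/t on the other
   term is compensated by choosing \<open>psi\<close> afterwards with accuracy
   \<open>e / 3 * t\<close>.\<close>
 obtain t where t: "0 < t" "M * t powr (p - 1) < e / 3" using small_powr[OF M0, of "e / 3" 1 "p - 1"] e p by auto
 obtain psi where psi: "test_fun UNIV psi" "pint q UNIV (%x. V x - psi x) <= e / 3 * t"
  using test_fun_dense[OF V[folded q_def] q(1), of "e / 3 * t"] e t by auto
 have L1: "Lp (p / (p - 1)) psi" "Lp (p / (p - 1)) (pdv j psi)" using test_fun_Lp[OF psi(1) q(2)] test_fun_Lp[OF test_fun_pdv[OF psi(1)] q(2)] by (auto simp: q_def)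
 have L2: "Lp (p / (p - 1)) (%x. V x - psi x)" using Lp_diff[OF V L1(1)] q(2) by (simp add: q_def)
 have it: "1 / t > 0" using t by simp
 have i: "integ (%x. h k x * psi x)" "integ (%x. h k x * (V x - psi x))" for k
  using young_inner(1)[OF h(1) L1(1) p it] young_inner(1)[OF h(1) L2 p it] by auto
 have a: "abs (LI x. h k x * (V x - psi x)) <= 2 * (e / 3)" for k
 proof -
  have "(1 / t) * pint q UNIV (%x. V x - psi x) <= e / 3" using psi(2) t by (simp add: field_simps)
  moreover have "t powr (p - 1) * pint p UNIV (h k) <= t powr (p - 1) * M" by (intro mult_left_mono h) auto
  ultimately show ?thesis using young_inner(2)[OF h(1)[of k] L2 p it] t(2) by (simp add: q_def mult.commute)
 qed
 have "(%k. - (LI x. w k x * pdv j psi x)) ----> - 0" using tendsto_minus[OF strong_inner_tendsto[OF w L1(2) p]] by simp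
 moreover have "- (LI x. w k x * pdv j psi x) = (LI x. h k x * psi x)" for k using d[of k] psi(1) unfolding wder_def by auto
 ultimately have "(%k. LI x. h k x * psi x) ----> 0" by simp
 from tendstoD[OF this, of "e / 3"] e have "EV k. abs (LI x. h k x * psi x) < e / 3" by (simp add: dist_real_def)
 hence "EV k. norm ((LI x. h k x * V x) - 0) < e"
 proof (rule eventually_mono)
  fix k assume k: "abs (LI x. h k x * psi x) < e / 3"
  have "(LI x. h k x * V x) = (LI x. h k x * psi x) + (LI x. h k x * (V x - psi x))"
   using Bochner_Integration.integral_add[OF i(1)[of k] i(2)[of k]] by (simp add: algebra_simps)
  thus "norm ((LI x. h k x * V x) - 0) < e" using k a[of k] by simp
 qed
 thus "EX no. ALL n>=no. norm ((LI x. h n x * V x) - 0) < e" by (simp add: eventually_sequentially)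
qed

lemma set_inner_ext: "(LINT x:D|lebesgue. a x \<bullet> v x) = (LI x. ext D a x \<bullet> ext D v x)"
 unfolding set_lebesgue_integral_def by (rule Bochner_Integration.integral_cong) (auto simp: ext_def indicator_def)

text \<open>The sequences constructed below have the form \<open>u + w k\<close> with
  \<open>w k\<close> tending to 0 in Lp and bounded gradients; this criterion provides their weak
  convergence.\<close>

lemma weak_W1pI:
 fixes u :: "real^'d => real^'m"
 assumes D: "open D" and p: "p > 1" and u: "sobolev p D u" and w: "!!k. sob p UNIV (w k) (W k)"
  "(%k. pint p UNIV (w k)) ----> 0" "!!k. pint p UNIV (W k) <= M"
 shows "weak_W1p p D (%k x. u x + w k x) u" "sobolev p D (%x. u x + w k x)"
proof -
 have p0: "p > 0" "p >= 1" using p by auto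
 have su: "sob p D u (sgrad p D u)" using u by (rule sob_sgrad)
 have sw: "sob p D (%x. u x + w k x) (%x. sgrad p D u x + W k x)" for k by (rule sob_add[OF su sob_subset[OF w(1) _ D p0(2)] p0(2)]) simp
 thus "sobolev p D (%x. u x + w k x)" by (rule sob_sobolev)
 have L: "Lp p (ext D u)" "Lp p (ext D (sgrad p D u))" "Lp p (w k)" "Lp p (W k)" for k using su w(1)[of k] unfolding sob_wder by auto
 have Wc: "Lp p (%x. W k x $ i $ j)" "pint p UNIV (%x. W k x $ i $ j) <= M" "Lp p (%x. w k x $ i)"
  "pint p UNIV (%x. w k x $ i) <= pint p UNIV (w k)" for i j k
 proof -
  show 1: "Lp p (%x. W k x $ i $ j)" "Lp p (%x. w k x $ i)" by (intro Lp_vec_nth L p0)+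
  have "abs (W k x $ i $ j) <= norm (W k x)" for x
   using component_le_norm_cart[of "W k x $ i" j] Finite_Cartesian_Product.norm_nth_le[of "W k x" i] by linarith
  hence "pint p UNIV (%x. W k x $ i $ j) <= pint p UNIV (W k)" by (intro pint_mono_bound 1 L) (use p0 in auto)
  thus "pint p UNIV (%x. W k x $ i $ j) <= M" using w(3)[of k] by linarith
  show "pint p UNIV (%x. w k x $ i) <= pint p UNIV (w k)" by (intro pint_mono_bound 1 L) (use p0 component_le_norm_cart in auto)
 qed
 have w0: "(%k. pint p UNIV (%x. w k x $ i)) ----> 0" for i by (rule tendsto_sandwich[OF _ _ tendsto_const w(2)]) (use Wc(4) in auto)
 show "weak_W1p p D (%k x. u x + w k x) u" unfolding weak_W1p_def weak_Lp_def
 proof (intro conjI allI impI)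
  fix v :: "real^'d => real^'m" assume "Lp_on (p / (p - 1)) D v"
  hence V: "Lp (p / (p - 1)) (ext D v)" by (simp add: Lp_on_ext)
  have "(LINT x:D|lebesgue. (u x + w k x) \<bullet> v x) = (LI x. ext D u x \<bullet> ext D v x) + (LI x. w k x \<bullet> ext D v x)" for k
  proof -
   have "(LINT x:D|lebesgue. (u x + w k x) \<bullet> v x) = (LI x. ext D u x \<bullet> ext D v x + w k x \<bullet> ext D v x)"
    unfolding set_lebesgue_integral_def by (rule Bochner_Integration.integral_cong) (auto simp: ext_def indicator_def inner_add_left)
   thus ?thesis using young_inner(1)[OF L(1) V p zero_less_one] young_inner(1)[OF L(3)[of k] V p zero_less_one] by simp
  qed
  moreover have "(%k. (LI x. ext D u x \<bullet> ext D v x) + (LI x. w k x \<bullet> ext D v x)) ----> (LI x. ext D u x \<bullet> ext D v x) + 0"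
   by (intro tendsto_intros strong_inner_tendsto[OF L(3) w(2) V p])
  ultimately show "(%k. LINT x:D|lebesgue. (u x + w k x) \<bullet> v x) ----> (LINT x:D|lebesgue. u x \<bullet> v x)" by (simp add: set_inner_ext)
 next
  fix v :: "real^'d => real^'d^'m" assume "Lp_on (p / (p - 1)) D v"
  hence V: "Lp (p / (p - 1)) (ext D v)" by (simp add: Lp_on_ext)
  have q0: "p / (p - 1) > 0" using p by simp
  have eq: "(LINT x:D|lebesgue. sgrad p D (%x. u x + w k x) x \<bullet> v x) = (LI x. ext D (sgrad p D u) x \<bullet> ext D v x) + (LI x. W k x \<bullet> ext D v x)" for k
  proof -
   have [measurable]: "ext D (sgrad p D (%x. u x + w k x)) : BL" "ext D v : BL" "ext D (sgrad p D u) : BL" "W k : BL"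
    using sob_sgrad[OF sob_sobolev[OF sw[of k]]] V L unfolding sob_wder by (auto simp: Lp_def)
   have "(LINT x:D|lebesgue. sgrad p D (%x. u x + w k x) x \<bullet> v x) = (LI x. ext D (sgrad p D u) x \<bullet> ext D v x + W k x \<bullet> ext D v x)"
    unfolding set_inner_ext
   proof (rule integral_cong_AE)
    show "AEL x. ext D (sgrad p D (%x. u x + w k x)) x \<bullet> ext D v x = ext D (sgrad p D u) x \<bullet> ext D v x + W k x \<bullet> ext D v x"
     using sgrad_unique[OF sw p0(2) D, of k] by eventually_elim (auto simp: ext_def indicator_def inner_add_left)
   qed measurable
   thus ?thesis using young_inner(1)[OF L(2) V p zero_less_one] young_inner(1)[OF L(4)[of k] V p zero_less_one] by simp
  qed
  have "(LI x. W k x \<bullet> ext D v x) = (\<Sum>i\<in>UNIV. \<Sum>j\<in>UNIV. LI x. W k x $ i $ j * ext D v x $ i $ j)" for k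
  proof -
   have "integ (%x. W k x $ i $ j * ext D v x $ i $ j)" for i j
    using young_inner(1)[OF Wc(1)[of k i j] Lp_vec_nth[OF Lp_vec_nth[OF V q0] q0, of i j] p zero_less_one] by simp
   thus ?thesis by (simp add: inner_vec_def Bochner_Integration.integral_sum)
  qed
  moreover have "(%k. \<Sum>i\<in>UNIV. \<Sum>j\<in>UNIV. LI x. W k x $ i $ j * ext D v x $ i $ j) ----> 0"
  proof (intro tendsto_null_sum)
   fix i j
   have "wder UNIV (%x. w k x $ i) j (%x. W k x $ i $ j)" for k using w(1)[of k] unfolding sob_wder by simp
   thus "(%k. LI x. W k x $ i $ j * ext D v x $ i $ j) ----> 0"
    by (rule weak_derivative_tendsto[OF Wc(3) w0 Wc(1,2) _ Lp_vec_nth[OF Lp_vec_nth[OF V q0] q0] p])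
  qed
  ultimately have "(%k. (LI x. ext D (sgrad p D u) x \<bullet> ext D v x) + (LI x. W k x \<bullet> ext D v x)) ----> (LI x. ext D (sgrad p D u) x \<bullet> ext D v x) + 0"
   by (intro tendsto_intros) simp
  thus "(%k. LINT x:D|lebesgue. sgrad p D (%x. u x + w k x) x \<bullet> v x) ----> (LINT x:D|lebesgue. sgrad p D u x \<bullet> v x)"
   unfolding eq by (simp add: set_inner_ext)
 qed
qed

lemma weak_Lp_test_fun:
 fixes us :: "nat => real^'d => real^'m"
 assumes w: "weak_Lp p D us u" and L: "!!k. Lp_on p D (us k)" "Lp_on p D u" and t: "test_fun D psi" and p: "p > 1"
 shows "(%k. LI x. ext D (%x. us k x - u x) x $ i * psi x) ----> 0"
proof -
 define v where "v x = psi x *R (axis i 1 :: real^'m)" for x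
 have q0: "p / (p - 1) > 0" using p by simp
 have Lpsi: "Lp (p / (p - 1)) psi" by (rule test_fun_Lp[OF t q0])
 have ev: "ext D v = v" using test_fun_outside[OF t] by (auto simp: fun_eq_iff ext_def v_def indicator_def)
 have "Lp (p / (p - 1)) v"
 proof (rule Lp_bound[OF _ Lpsi, of v 1])
  show "v : BL" unfolding v_def using Lp_measurable[OF Lpsi] by measurable
 qed (use q0 in "auto simp: v_def")
 hence V: "Lp (p / (p - 1)) (ext D v)" by (simp add: ev)
 have "(%k. (LINT x:D|lebesgue. us k x \<bullet> v x) - (LINT x:D|lebesgue. u x \<bullet> v x)) ----> 0"
  using w V unfolding weak_Lp_def Lp_on_ext[symmetric] by (intro LIM_zero) auto
 moreover have "(LINT x:D|lebesgue. us k x \<bullet> v x) - (LINT x:D|lebesgue. u x \<bullet> v x) = (LI x. ext D (%x. us k x - u x) x $ i * psi x)" for k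
 proof -
  note i = young_inner(1)[OF L(1)[of k, unfolded Lp_on_ext] V p zero_less_one] young_inner(1)[OF L(2)[unfolded Lp_on_ext] V p zero_less_one]
  have "(LINT x:D|lebesgue. us k x \<bullet> v x) - (LINT x:D|lebesgue. u x \<bullet> v x) = (LI x. ext D (us k) x \<bullet> ext D v x - ext D u x \<bullet> ext D v x)"
   using i by (simp add: set_inner_ext)
  also have "... = (LI x. ext D (%x. us k x - u x) x $ i * psi x)"
   by (rule Bochner_Integration.integral_cong) (auto simp: ev v_def ext_diff inner_axis algebra_simps)
  finally show ?thesis .
 qed
 ultimately show ?thesis by simp
qed

subsection \<open>Recovery sequences\<close>

lemma real_liminf_iff: "ereal c <= liminf (%k. ereal (a k)) \<longleftrightarrow> (ALL eps>0. EV k. c - eps < a k)"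
proof
 assume c: "ereal c <= liminf (%k. ereal (a k))"
 show "ALL eps>0. EV k. c - eps < a k"
 proof (intro allI impI)
  fix eps :: real assume "eps > 0"
  hence "ereal (c - eps) < ereal c" by simp
  hence "ereal (c - eps) < liminf (%k. ereal (a k))" using c by (rule order_less_le_trans)
  from less_LiminfD[OF this] show "EV k. c - eps < a k" by simp
 qed
next
 assume e: "ALL eps>0. EV k. c - eps < a k"
 show "ereal c <= liminf (%k. ereal (a k))"
 proof (rule ereal_le_epsilon2)
  fix eps :: real assume "0 < eps"
  hence "EV k. ereal (c - eps) <= ereal (a k)" using e by (auto elim!: allE[of _ eps] eventually_mono)
  hence "ereal (c - eps) <= liminf (%k. ereal (a k))" by (rule Liminf_bounded)
  thus "ereal c <= liminf (%k. ereal (a k)) + ereal eps" using add_right_mono[of "ereal (c - eps)" _ "ereal eps"] by fastforce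
 qed
qed

lemma real_limsup_iff: "limsup (%k. ereal (a k)) <= ereal c \<longleftrightarrow> (ALL eps>0. EV k. a k < c + eps)"
proof -
 have "limsup (%k. ereal (a k)) = - liminf (%k. ereal (- a k))" using ereal_Limsup_uminus[of sequentially "%k. ereal (- a k)"] by simp
 hence "limsup (%k. ereal (a k)) <= ereal c \<longleftrightarrow> ereal (- c) <= liminf (%k. ereal (- a k))"
  by (metis ereal_uminus_le_reorder uminus_ereal.simps(1))
 also have "... \<longleftrightarrow> (ALL eps>0. EV k. - c - eps < - a k)" by (rule real_liminf_iff)
 also have "... \<longleftrightarrow> (ALL eps>0. EV k. a k < c + eps)" by (simp add: algebra_simps less_diff_eq)
 finally show ?thesis .
qed

text \<open>\<open>s k\<close> is the largest index \<open>n <= k\<close> whose property is known to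
  hold from \<open>k\<close> on.\<close>

lemma eventually_diagonal:
 assumes P: "!!n. eventually (P n) sequentially"
 shows "EX s. filterlim s at_top sequentially & (EV k. P (s k :: nat) (k :: nat))"
proof -
 obtain N where N: "!!n k. k >= N n ==> P n k" using P unfolding eventually_sequentially by metis
 define S where "S k = {n. n <= k & N n <= k}" for k
 have fS: "finite (S k)" for k unfolding S_def by auto
 define s where "s k = Max (S k)" for k
 have "s k >= n" if "k >= max n (N n)" for n k unfolding s_def by (rule Max_ge[OF fS]) (use that in "auto simp: S_def")
 hence "filterlim s at_top sequentially" unfolding filterlim_at_top eventually_sequentially by blast
 moreover have "P (s k) k" if "k >= max 0 (N 0)" for k
 proof -
  have "s k : S k" unfolding s_def by (rule Max_in[OF fS]) (use that in "auto simp: S_def")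
  thus ?thesis using N by (auto simp: S_def)
 qed
 ultimately show ?thesis unfolding eventually_sequentially by blast
qed

context growth
begin

definition grd :: "(real^'d => real^'m) => real^'d => real^'d^'m" where "grd u = ext D (sgrad p D u)"

lemma Lp_grd: "sobolev p D u ==> Lp p (grd u)" "sobolev p D u ==> Lp p (ext D u)"
 using sob_sgrad unfolding grd_def sob_wder by blast+

lemma adm: assumes "admissible D U" shows "U <= D" "U : lmeasurable" "open U" "U : sets lebesgue"
 using assms lmeasurable_open by (auto simp: admissible_def)

lemma intfun_grd: assumes "U <= D" shows "intfun p D f U u = energy f U (grd u)" unfolding intfun_def energy_def set_lebesgue_integral_def
 by (rule Bochner_Integration.integral_cong) (use assms in "auto simp: grd_def ext_simps indicator_def")

lemma intfun_add:
 assumes u: "sobolev p D u" and w: "sob p UNIV w W" and U: "admissible D U" and f: "F_cl f"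
 shows "intfun p D f U (%x. u x + w x) = energy f U (%x. grd u x + W x)"
proof -
 have s: "sob p D (%x. u x + w x) (%x. sgrad p D u x + W x)" by (rule sob_add[OF sob_sgrad[OF u] sob_subset[OF w _ D nums(2)] nums(2)]) simp
 have "energy f U (grd (%x. u x + w x)) = energy f U (%x. grd u x + W x)"
 proof (rule energy_cong_AE[OF _ f])
  show "AEL x. x : U --> grd (%x. u x + w x) x = grd u x + W x"
   using sgrad_unique[OF s nums(2) D] by eventually_elim (use adm(1)[OF U] in "auto simp: grd_def ext_simps")
  show "grd (%x. u x + w x) : BL" using Lp_grd[OF sob_sobolev[OF s]] by (simp add: Lp_def)
  show "(%x. grd u x + W x) : BL" using Lp_add[OF Lp_grd(1)[OF u] _ nums(1), of W] w by (simp add: Lp_def sob_wder)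
 qed (use D adm[OF U] in auto)
 thus ?thesis using adm[OF U] by (simp add: intfun_grd)
qed

abbreviation (input) "Gc \<equiv> gamma_conv {u. sobolev p D u} (weak_W1p p D)"

text \<open>Convergence is required on all admissible sets at once: gluing uses it on the pieces,
  and the fixing of boundary values uses it on inner sets.\<close>

definition Gconv :: "(nat => real^'d => real^'d^'m => real) => (real^'d => real^'d^'m => real) => bool" where
 "Gconv g h \<longleftrightarrow> (ALL k. F_cl (g k)) & F_cl h & (ALL U. admissible D U -->
   Gc (%k. intfun p D (g k) U) (intfun p D h U))"

text \<open>Energies up to \<open>c\<close> are reached along perturbations of \<open>u\<close> that are small in \<open>L^p\<close> and have bounded gradients.\<close>

definition reachable :: "(nat => real^'d => real^'d^'m => real) => (real^'d) set => (real^'d => real^'m) => real => bool" where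
 "reachable F U u c \<longleftrightarrow> (EX M. ALL eps>0. EV k. EX w W. sob p UNIV w W & pint p UNIV w <= eps & pint p UNIV W <= M &
   energy (F k) U (%x. grd u x + W x) <= c + eps)"

text \<open>Both \<open>w\<close> and its gradient vanish off \<open>U\<close>, so perturbations
  belonging to disjoint sets can be added without interaction. The gradient bound \<open>M\<close>
  is kept apart from \<open>c\<close> because it must not deteriorate as \<open>c\<close> tends to
  0.\<close>

abbreviation (input) "perturbable f h U u M c \<equiv> EX w W. sob p UNIV w W & (ALL x. x ~: U --> w x = 0 & W x = 0) &
 pint p UNIV w <= c & pint p UNIV W <= M & energy f U (%x. grd u x + W x) <= energy h U (grd u) + c"

lemma sob_0: "sob p UNIV (%x. 0 :: real^'m) (%x. 0)" unfolding sob_wder by (simp add: wder_def)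

text \<open>Perturbations for the accuracies 1/(n+1) are combined along a slowly growing
  \<open>s k\<close>. The common gradient bound \<open>M\<close> is what makes the result converge
  weakly.\<close>

lemma reachable_recovery:
 fixes u :: "real^'d => real^'m"
 assumes u: "sobolev p D u" and F: "!!k. F_cl (F k)" and U: "admissible D U" and r: "reachable F U u c"
 shows "EX us. (ALL k. sobolev p D (us k)) & weak_W1p p D us u & limsup (%k. ereal (intfun p D (F k) U (us k))) <= ereal c"
proof -
 obtain M where M: "!!eps. eps > 0 ==> EV k. EX w W. sob p UNIV w W & pint p UNIV w <= eps & pint p UNIV W <= M &
   energy (F k) U (%x. grd u x + W x) <= c + eps" using r unfolding reachable_def by blast
 define e where "e n = 1 / (real n + 1)" for n
 define P where "P n k w W \<longleftrightarrow> sob p UNIV w W & pint p UNIV w <= e n & pint p UNIV W <= M & energy (F k) U (%x. grd u x + W x) <= c + e n"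
  for n k and w :: "real^'d => real^'m" and W
 have "EV k. EX w W. P n k w W" for n unfolding P_def by (rule M) (simp add: e_def)
 from eventually_diagonal[of "%n k. EX w W. P n k w W", OF this] obtain s where s: "filterlim s at_top sequentially"
  and Ps: "EV k. EX w W. P (s k) k w W" by blast
 have "ALL k. EX w W. (EX w W. P (s k) k w W) --> P (s k) k w W" by blast
 from this[unfolded choice_iff] obtain w0 W0 where wW: "ALL k. (EX w W. P (s k) k w W) --> P (s k) k (w0 k) (W0 k)" by (elim exE) (rule that)
 define b where "b k \<longleftrightarrow> (EX w W. P (s k) k w W)" for k
 \<comment> \<open>For the finitely many indices at which no suitable perturbation exists, the zero
   perturbation is taken.\<close>
 define w where "w k = (if b k then w0 k else (%x. 0))" for k
 define W where "W k = (if b k then W0 k else (%x. 0))" for k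
 have Pk: "P (s k) k (w k) (W k)" if "b k" for k using wW that by (simp add: w_def W_def b_def)
 have M0: "M >= 0"
 proof -
  obtain k where "b k" using eventually_happens'[OF _ Ps] by (auto simp: b_def)
  thus ?thesis using Pk[of k] order_trans[OF pint_nonneg] by (auto simp: P_def)
 qed
 have z: "pint p UNIV (%x. 0 :: 'v::euclidean_space) = 0" using nums by (simp add: pint_def)
 have "sob p UNIV (w k) (W k) & pint p UNIV (W k) <= M" for k
 proof (cases "b k")
  case True thus ?thesis using Pk[of k] unfolding P_def by blast
 next
  case False thus ?thesis using sob_0 M0 unfolding w_def W_def by (simp add: z)
 qed
 hence sw: "sob p UNIV (w k) (W k)" "pint p UNIV (W k) <= M" for k by blast+
 have e0: "(%k. e (s k)) ----> 0"
 proof -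
  have "e ----> 0" unfolding e_def by real_asymp
  from filterlim_compose[OF this s] show ?thesis .
 qed
 have w0: "(%k. pint p UNIV (w k)) ----> 0" by (rule tendsto_sandwich[OF always_eventually[OF allI[OF pint_nonneg]] _ tendsto_const e0])
   (use Ps Pk in "auto elim!: eventually_mono simp: P_def b_def")
 have "limsup (%k. ereal (intfun p D (F k) U (%x. u x + w k x))) <= ereal c" unfolding real_limsup_iff
 proof (intro allI impI)
  fix eps :: real assume "eps > 0"
  from order_tendstoD(2)[OF e0 this] Ps show "EV k. intfun p D (F k) U (%x. u x + w k x) < c + eps"
   by eventually_elim (use Pk intfun_add[OF u sw(1) U F] in "fastforce simp: P_def b_def")
 qed
 thus ?thesis using weak_W1pI[OF D p u sw(1) w0 sw(2)] by (intro exI[of _ "%k x. u x + w k x"]) auto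
qed

section \<open>Cutting off near the boundary\<close>

lemma open_exhaust:
 fixes h :: "real^'d => real"
 assumes U: "open U" and h: "set_integrable lebesgue U h" and d: "delta > 0"
 shows "EX K V. compact K & open V & V <= K & K <= U & abs (LINT x:U-V|lebesgue. h x) < delta"
proof -
 obtain C where C: "!!n. compact (C n)" "!!n. C n <= U" "!!n. C n <= interior (C (Suc n))" "\<Union>(range C) = U"
  using open_Union_compact_subsets[OF U] by metis
 define V where "V n = interior (C n)" for n
 have V: "open (V n)" "V n <= C n" for n by (auto simp: V_def interior_subset)
 have Vm: "incseq V" unfolding V_def by (intro incseq_SucI interior_mono order_trans[OF C(3) interior_subset])
 have VU: "(\<Union>n. V n) = U" using C V unfolding V_def by (auto dest!: interior_subset[THEN subsetD]) blast
 have "(%n. LINT x:V n|lebesgue. h x) ----> (LINT x:(\<Union>n. V n)|lebesgue. h x)" by (rule set_integral_cont_up[OF _ Vm]) (use V VU h in auto)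
 hence "EV n. dist (LINT x:V n|lebesgue. h x) (LINT x:U|lebesgue. h x) < delta" unfolding VU using d by (rule tendstoD)
 then obtain n where n: "abs ((LINT x:V n|lebesgue. h x) - (LINT x:U|lebesgue. h x)) < delta" by (auto simp: eventually_sequentially dist_real_def)
 have hA: "set_integrable lebesgue A h" if "A : sets lebesgue" "A <= U" for A using set_integrable_subset[OF h that] .
 have s: "V n \<union> (U - V n) = U" using VU by auto
 have "(LINT x:U|lebesgue. h x) = (LINT x:V n|lebesgue. h x) + (LINT x:U - V n|lebesgue. h x)"
  by (subst (1) s[symmetric], rule set_integral_Un) (use hA[of "V n"] hA[of "U - V n"] V U VU in auto)
 hence "abs (LINT x:U - V n|lebesgue. h x) < delta" using n by linarith
 thus ?thesis using V C by (intro exI[of _ "C n"] exI[of _ "V n"]) auto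
qed

text \<open>The compact set between \<open>V\<close> and \<open>U\<close> leaves room for a cut-off
  that is 1 on \<open>V\<close>, while by the growth bound the strip \<open>U - V\<close> carries
  little energy of \<open>H\<close>.\<close>

lemma inner_exhaust:
 assumes U: "admissible D U" and H: "Lp p H" and d: "delta > 0"
 shows "EX K V. compact K & admissible D V & V <= K & K <= U & vol (U - V) + pint p (U - V) H < delta"
proof -
 note UU = adm[OF U]
 have i: "set_integrable lebesgue A (%x. 1::real)" "set_integrable lebesgue A (%x. norm (H x) powr p)" if "A : lmeasurable" for A
  using that by (auto intro!: set_integrable_const Lp_set_integrable[OF H])
 obtain K V where KV: "compact K" "open V" "V <= K" "K <= U" "abs (LINT x:U-V|lebesgue. 1 + norm (H x) powr p) < delta"
  using open_exhaust[OF UU(3) set_integral_add(1)[OF i[OF UU(2)]] d] by blast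
 have "V : lmeasurable" by (rule lmeasurable_open[OF bounded_subset[OF compact_imp_bounded[OF KV(1)] KV(3)] KV(2)])
 hence UV: "U - V : lmeasurable" using UU by (intro fmeasurable.Diff) auto
 have "(LINT x:U-V|lebesgue. 1 + norm (H x) powr p) = vol (U - V) + pint p (U - V) H"
  unfolding pint_def using set_integral_add(2)[OF i[OF UV]] set_integral_const[OF UV, of 1] by simp
 moreover have "admissible D V" using KV UU U by (auto simp: admissible_def intro: bounded_subset)
 ultimately show ?thesis using KV by (intro exI[of _ K] exI[of _ V]) auto
qed

lemma pint_gradient_outer:
 assumes t: "test_fun D phi" and z: "!!x. x ~: K ==> gradient phi x = 0" and K: "K : sets lebesgue"
 shows "EX B. ALL y :: real^'d => real^'m. Lp p y --> pint p UNIV (%x. outer (y x) (gradient phi x)) <= B * pint p K y"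
proof -
 obtain B where B: "B >= 0" "!!x. norm (gradient phi x) <= B" by (rule test_fun_gradient_bounded[OF t]) (rule that)
 have "pint p UNIV (%x. outer (y x) (gradient phi x)) <= B powr p * pint p K y" if y: "Lp p y" for y :: "real^'d => real^'m"
 proof -
  have i: "set_integrable lebesgue K (%x. norm (y x) powr p)" by (rule Lp_set_integrable[OF y K])
  have "pint p UNIV (%x. outer (y x) (gradient phi x)) <= (LI x. B powr p * (ind K x *R norm (y x) powr p))"
   unfolding pint_def set_lebesgue_integral_def
  proof (rule integral_mono')
   show "integ (%x. B powr p * (ind K x *R norm (y x) powr p))" using i by (simp add: set_integrable_def)
   fix x
   have "norm (outer (y x) (gradient phi x)) <= norm (y x) * B" using order_trans[OF norm_outer mult_left_mono[OF B(2)]] by auto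
   hence "norm (outer (y x) (gradient phi x)) powr p <= (norm (y x) * B) powr p" using nums by (intro powr_mono2) auto
   thus "ind UNIV x *R norm (outer (y x) (gradient phi x)) powr p <= B powr p * (ind K x *R norm (y x) powr p)"
    using z[of x] nums B(1) by (cases "x : K") (auto simp: powr_mult mult.commute)
  qed auto
  thus ?thesis by (simp add: pint_def set_lebesgue_integral_def)
 qed
 thus ?thesis by blast
qed

lemma weak_W1p_subseq: "weak_W1p p D us u ==> strict_mono s ==> weak_W1p p D (%n. us (s n)) u"
 using LIMSEQ_subseq_LIMSEQ[of "%k. LINT x:D|lebesgue. us k x \<bullet> v x" _ s for v]
  LIMSEQ_subseq_LIMSEQ[of "%k. LINT x:D|lebesgue. sgrad p D (us k) x \<bullet> v x" _ s for v] by (auto simp: weak_W1p_def weak_Lp_def o_def)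

text \<open>The perturbation is \<open>phi\<close> times \<open>us k - u\<close>, with a cut-off
  \<open>phi\<close> equal to 1 near \<open>C\<close>. Its gradient consists of a part bounded
  pointwise by the two gradients and of \<open>og\<close>, which contains the gradient of
  \<open>phi\<close> and tends to 0 by \<open>rellich\<close>. The gradient bound is asked on
  \<open>U\<close> only, since it comes from energies on \<open>U\<close>.\<close>

lemma cutoff_sequence:
 fixes u :: "real^'d => real^'m"
 assumes u: "sobolev p D u" and us: "!!k. sobolev p D (us k)" "weak_W1p p D us u"
  and U: "admissible D U" and b: "EV k. pint p U (grd (us k)) <= M0" and C: "compact C" "C <= U"
 shows "EX w W og. (%k. pint p UNIV (w k)) ----> 0 & (%k. pint p UNIV (og k)) ----> 0 &
  (ALL k. sob p UNIV (w k) (W k) & (ALL x. x ~: U --> w k x = 0 & W k x = 0) & (ALL x:C. grd u x + W k x = grd (us k) x) &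
   Lp p (og k) & (ALL x. norm (grd u x + W k x - og k x) <= norm (grd u x) + norm (grd (us k) x)) &
   pint p UNIV (W k) <= 2 powr p * (2 powr p * (pint p U (grd (us k)) + pint p U (grd u)) + pint p UNIV (og k)))"
proof -
 note UU = adm[OF U] and Lu = Lp_grd[OF u] and Lus = Lp_grd[OF us(1)]
 obtain phi W0 where ph: "test_fun U phi" "open W0" "C <= W0" "!!x. x : W0 ==> phi x = 1" "!!x. 0 <= phi x" "!!x. phi x <= 1"
  by (rule ex_cutoff[OF C(1) UU(3) C(2)]) (rule that)
 have phD: "test_fun D phi" by (rule test_fun_mono[OF ph(1) UU(1)])
 obtain K where K: "compact K" "K <= U" "!!x. x ~: K ==> phi x = 0" "!!x i. x ~: K ==> pdv i phi x = 0" by (rule test_funE[OF ph(1)]) (rule that)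
 have g0: "gradient phi x = 0" if "x ~: K | x : W0" for x
  using that pdv_locally_const[OF ph(2) _ ph(4)] K(4) by (auto simp: gradient_def vec_eq_iff)
 have Ks: "K : sets lebesgue" using K(1) by (auto dest: lmeasurable_compact)
 define y where "y k x = us k x - u x" for k x
 define Y where "Y k x = sgrad p D (us k) x - sgrad p D u x" for k x
 have sy: "sob p D (y k) (Y k)" for k unfolding y_def Y_def by (rule sob_diff[OF sob_sgrad[OF us(1)] sob_sgrad[OF u] nums(2)])
 have eY: "ext D (Y k) x = grd (us k) x - grd u x" for k x by (simp add: Y_def[abs_def] ext_diff grd_def)
 have Ly: "Lp p (ext D (y k))" "Lp p (ext D (Y k))" for k using sy[of k] by (auto simp: sob_wder)
 obtain B where B: "!!y :: real^'d => real^'m. Lp p y ==> pint p UNIV (%x. outer (y x) (gradient phi x)) <= B * pint p K y"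
  using pint_gradient_outer[OF phD _ Ks] g0 by metis
 define w where "w k x = phi x *R ext D (y k) x" for k x
 define og where "og k x = outer (ext D (y k) x) (gradient phi x)" for k x
 define b where "b k x = phi x *R ext D (Y k) x" for k x
 define W where "W k x = b k x + og k x" for k x
 have sw: "sob p UNIV (w k) (W k)" for k unfolding w_def W_def b_def og_def by (rule sob_cutoff[OF sy phD nums(2)])
 have Lw: "Lp p (w k)" "Lp p (W k)" for k using sw[of k] by (auto simp: sob_wder)
 have Lo: "Lp p (og k)" for k unfolding og_def by (rule Lp_outer_gradient[OF Ly(1) phD nums(1)])
 have Lb: "Lp p (b k)" for k using Lp_diff[OF Lw(2)[of k] Lo[of k] nums(1)] by (simp add: W_def)
 have yU: "pint p U (ext D (Y k)) <= 2 powr p * (pint p U (grd (us k)) + pint p U (grd u))" for k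
  unfolding eY by (rule pint_diff[OF Lus(1) Lu(1) UU(4) nums(1)])
 obtain k0 where k0: "!!k. k >= k0 ==> pint p U (grd (us k)) <= M0" using b unfolding eventually_sequentially by blast
 \<comment> \<open>The bound on the gradients holds only from \<open>k0\<close> on, so compactness
   is applied to the shifted sequence.\<close>
 have yK: "(%k. pint p K (ext D (y k))) ----> 0"
 proof (rule LIMSEQ_offset[where k=k0], rule rellich[OF UU(3,1) p sy _ _ K(1,2)])
  show "(%k. LI x. ext D (y (k + k0)) x $ i * psi x) ----> 0" if "test_fun D psi" for psi i
   unfolding y_def using us u by (intro LIMSEQ_ignore_initial_segment weak_Lp_test_fun[OF _ _ _ that p]) (auto simp: weak_W1p_def sobolev_def)
  show "pint p U (ext D (Y (k + k0))) <= 2 powr p * (M0 + pint p U (grd u))" for k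
   by (rule order_trans[OF yU]) (intro mult_left_mono add_right_mono k0, auto)
 qed
 have sK: "pint p UNIV v = pint p K v" if "!!x. x ~: K ==> v x = 0" for v :: "real^'d => 'v::euclidean_space"
  unfolding pint_def set_lebesgue_integral_def by (rule Bochner_Integration.integral_cong) (use that nums in "auto simp: indicator_def")
 have wK: "pint p UNIV (w k) <= pint p K (ext D (y k))" "pint p UNIV (b k) <= pint p K (ext D (Y k))" for k
  by (subst sK, simp add: w_def b_def K(3), rule pint_mono_bound[OF Lw(1) Ly(1) Ks] pint_mono_bound[OF Lb Ly(2) Ks];
   use ph(5,6) nums in "auto simp: w_def b_def mult_left_le_one_le")+
 have "(%k. pint p UNIV (w k)) ----> 0" by (rule tendsto_sandwich[OF _ _ tendsto_const yK]) (use wK in auto)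
 moreover have "(%k. pint p UNIV (og k)) ----> 0" by (rule tendsto_sandwich[OF _ _ tendsto_const tendsto_mult_right_zero[OF yK, of B]])
  (use B Ly(1) in "auto simp: og_def[abs_def]")
 moreover have "pint p UNIV (W k) <= 2 powr p * (2 powr p * (pint p U (grd (us k)) + pint p U (grd u)) + pint p UNIV (og k))" for k
 proof -
  have "pint p UNIV (b k) <= 2 powr p * (pint p U (grd (us k)) + pint p U (grd u))"
   using wK(2)[of k] yU[of k] pint_subset[OF Ly(2)[of k] K(2) Ks UU(4)] by linarith
  thus ?thesis unfolding W_def by (intro order_trans[OF pint_add[OF Lb Lo _ nums(1)]] mult_left_mono add_right_mono) auto
 qed
 moreover have "w k x = 0 & W k x = 0" if "x ~: U" for k x using K(2) K(3)[of x] g0[of x] that by (cases "x : K") (auto simp: w_def W_def b_def og_def)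
 moreover have "grd u x + W k x = grd (us k) x" if "x : C" for k x using that ph(3,4) g0[of x] by (auto simp: W_def b_def og_def eY)
 moreover have "norm (grd u x + W k x - og k x) <= norm (grd u x) + norm (grd (us k) x)" for k x
 proof -
  have "grd u x + W k x - og k x = (1 - phi x) *R grd u x + phi x *R grd (us k) x" by (simp add: W_def b_def eY algebra_simps)
  thus ?thesis using ph(5,6)[of x] by (auto intro!: order_trans[OF norm_triangle_ineq] add_mono mult_left_le_one_le)
 qed
 ultimately show ?thesis using sw Lo by (intro exI[of _ w] exI[of _ W] exI[of _ og]) blast
qed

text \<open>By the lower bound on \<open>V\<close> a recovery sequence on \<open>U\<close> has almost no energy on \<open>U - V\<close>, so it may be cut off there.
 The constant \<open>M\<close> depends only on \<open>u\<close> and \<open>U\<close>.\<close>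

lemma boundary_recovery:
 fixes u :: "real^'d => real^'m"
 assumes u: "sobolev p D u" and U: "admissible D U"
 shows "EX M. ALL eps>0. ALL g h. Gconv g h --> (EV k. perturbable (g k) h U u M eps)"
proof -
 note UU = adm[OF U] and Lu = Lp_grd[OF u]
 define P where "P = (2::real) powr p"
 have P: "P >= 1" unfolding P_def using nums by (intro ge_one_powr_ge_zero) auto
 \<comment> \<open>Coercivity: the energy of a recovery sequence is eventually at most that of
   \<open>u\<close> plus \<open>delta <= 1\<close>, and the growth bound for \<open>h\<close>
   replaces the energy of \<open>u\<close> by an expression free of \<open>h\<close>.\<close>
 define M0 where "M0 = (\<beta> * (vol U + pint p U (grd u)) + 1) / \<alpha>"
 define M where "M = P * (P * (M0 + pint p U (grd u)) + 1)"
 have "EV k. perturbable (g k) h U u M eps" if ep: "eps > 0" and G: "Gconv g h" for eps g h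
 proof -
  \<comment> \<open>The total excess of energy found below is exactly \<open>c * delta\<close>: one
    \<open>delta\<close> from the recovery sequence, the rest from the growth bound on the
    strip.\<close>
  define c where "c = 1 + \<beta> * (1 + P * (P * (1 + (2 + \<beta>) / \<alpha>) + 1))"
  have c: "c >= 1" using nums \<alpha> P by (simp add: c_def)
  define delta where "delta = min 1 (eps / c)"
  have d: "delta > 0" "delta <= 1" "c * delta <= eps" using ep c by (auto simp: delta_def min_def field_simps)
  obtain C V where V: "compact C" "admissible D V" "V <= C" "C <= U" and dV: "vol (U - V) + pint p (U - V) (grd u) < delta"
   using inner_exhaust[OF U Lu(1) d(1)] by blast
  note VV = adm[OF V(2)]
  have UVm: "U - V : lmeasurable" "U - V : sets lebesgue" using UU VV by (auto intro: fmeasurable.Diff)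
  have sp: "V \<union> (U - V) = U" using V by auto
  have gF: "F_cl (g k)" "F_cl h" for k using G by (auto simp: Gconv_def)
  have gc: "Gc (%k. intfun p D (g k) A) (intfun p D h A)" if "admissible D A" for A using G that by (auto simp: Gconv_def)
  obtain us where us: "!!k. sobolev p D (us k)" "weak_W1p p D us u"
   and ls: "limsup (%k. ereal (intfun p D (g k) U (us k))) <= ereal (intfun p D h U u)"
  proof -
   have "EX us. (ALL k. sobolev p D (us k)) & weak_W1p p D us u & limsup (%k. ereal (intfun p D (g k) U (us k))) <= ereal (intfun p D h U u)"
    using gc[OF U] u unfolding gamma_conv_def mem_Collect_eq by blast
   thus ?thesis by (elim exE conjE) (rule that, blast+)
  qed
  have li: "ereal (intfun p D h V u) <= liminf (%k. ereal (intfun p D (g k) V (us k)))" using gc[OF V(2)] u us unfolding gamma_conv_def by auto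
  note Lus = Lp_grd[OF us(1)]
  have ev1: "EV k. intfun p D (g k) U (us k) < intfun p D h U u + delta" using ls d unfolding real_limsup_iff by blast
  have ev2: "EV k. intfun p D h V u - delta < intfun p D (g k) V (us k)" using li d unfolding real_liminf_iff by blast
  have hU: "energy h U (grd u) <= \<beta> * (vol U + pint p U (grd u))" by (rule energy_upper[OF gF(2) Lu(1) UU(1,2)])
  have pU: "pint p U (grd (us k)) <= M0" if "intfun p D (g k) U (us k) < intfun p D h U u + delta" for k
  proof -
   have "\<alpha> * pint p U (grd (us k)) <= energy (g k) U (grd (us k))" by (rule energy_lower[OF gF(1) Lus(1) UU(1,2)])
   hence "\<alpha> * pint p U (grd (us k)) <= \<alpha> * M0" using that hU d(2) \<alpha> unfolding intfun_grd[OF UU(1)] by (simp add: M0_def)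
   thus ?thesis using \<alpha> by simp
  qed
  obtain w W og where w0: "(%k. pint p UNIV (w k)) ----> 0" "(%k. pint p UNIV (og k)) ----> 0"
   and w: "!!k. sob p UNIV (w k) (W k)" "!!k x. x ~: U ==> w k x = 0 & W k x = 0" "!!k x. x : C ==> grd u x + W k x = grd (us k) x" "!!k. Lp p (og k)"
    "!!k x. norm (grd u x + W k x - og k x) <= norm (grd u x) + norm (grd (us k) x)"
    "!!k. pint p UNIV (W k) <= P * (P * (pint p U (grd (us k)) + pint p U (grd u)) + pint p UNIV (og k))"
   using cutoff_sequence[OF u us U eventually_mono[OF ev1 pU] V(1,4)] unfolding P_def by blast
  show ?thesis using ev1 ev2 order_tendstoD(2)[OF w0(1) ep] order_tendstoD(2)[OF w0(2) d(1)]
  proof eventually_elim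
   fix k
   assume k: "intfun p D (g k) U (us k) < intfun p D h U u + delta" "intfun p D h V u - delta < intfun p D (g k) V (us k)"
    "pint p UNIV (w k) < eps" "pint p UNIV (og k) < delta"
   have "P * (P * (pint p U (grd (us k)) + pint p U (grd u)) + pint p UNIV (og k)) <= M"
    unfolding M_def using k(4) d P by (intro mult_left_mono add_mono pU k(1)) auto
   hence w2: "pint p UNIV (W k) <= M" using w(6)[of k] by linarith
   have tail: "energy h (U - V) (grd u) <= \<beta> * delta"
    using energy_upper[OF gF(2) Lu(1) _ UVm(1)] mult_left_mono[OF less_imp_le[OF dV], of \<beta>] UU nums by fastforce
   have eU: "energy f U H = energy f V H + energy f (U - V) H" if "F_cl f" "Lp p H" for f and H :: "real^'d => real^'d^'m"
    by (subst (1) sp[symmetric], rule energy_Un[OF that VV(1) _ VV(2) UVm(1)]) (use UU in auto)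
   have "\<alpha> * pint p (U - V) (grd (us k)) <= energy (g k) (U - V) (grd (us k))"
    by (rule energy_lower[OF gF(1) Lus(1) _ UVm(1)]) (use UU in auto)
   \<comment> \<open>The upper bound on \<open>U\<close> minus the lower bound on \<open>V\<close>
     leaves \<open>2 * delta\<close> and the energy of \<open>h\<close> on the strip, which is at
     most \<open>\<beta> * delta\<close>.\<close>
   also have "... <= (2 + \<beta>) * delta"
    using eU[OF gF(1) Lus(1), of k k] eU[OF gF(2) Lu(1)] k(1,2) tail unfolding intfun_grd[OF UU(1)] intfun_grd[OF VV(1)] by (simp add: distrib_right)
   finally have pt: "pint p (U - V) (grd (us k)) <= (2 + \<beta>) * delta / \<alpha>" using \<alpha> by (simp add: field_simps)
   define Q where "Q x = grd u x + W k x" for x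
   have LQ: "Lp p Q" unfolding Q_def using w(1)[of k] by (intro Lp_add[OF Lu(1) _ nums(1)]) (simp add: sob_wder)
   define b where "b x = Q x - og k x" for x
   have Lb: "Lp p b" unfolding b_def by (rule Lp_diff[OF LQ w(4) nums(1)])
   have n: "Lp p (%x. norm (grd u x))" "Lp p (%x. norm (grd (us k) x))" using Lu(1) Lus(1)[of k] by (auto simp: Lp_def)
   have "pint p (U - V) b <= pint p (U - V) (%x. norm (grd u x) + norm (grd (us k) x))"
    by (intro pint_mono_bound[OF Lb Lp_add[OF n nums(1)] UVm(2)]) (use nums w(5) in "auto simp: b_def Q_def")
   also have "... <= P * (pint p (U - V) (grd u) + pint p (U - V) (grd (us k)))" using pint_add[OF n UVm(2) nums(1)] unfolding P_def by (simp add: pint_def)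
   also have "... <= P * (delta + (2 + \<beta>) * delta / \<alpha>)"
    using dV pt P measure_nonneg[of lebesgue "U - V"] by (intro mult_left_mono add_mono) linarith+
   finally have 1: "P * (pint p (U - V) b + pint p (U - V) (og k)) <= P * (P * (delta + (2 + \<beta>) * delta / \<alpha>) + delta)"
    using P pint_subset[OF w(4)[of k] subset_UNIV UVm(2)] k(4) by (intro mult_left_mono add_mono) auto
   have "pint p (U - V) Q <= P * (pint p (U - V) b + pint p (U - V) (og k))"
    using pint_add[OF Lb w(4) UVm(2) nums(1), of k] by (simp add: P_def b_def)
   from order_trans[OF this 1] have pQ: "pint p (U - V) Q <= P * (P * (delta + (2 + \<beta>) * delta / \<alpha>) + delta)" .
   have "energy (g k) U Q = energy (g k) V Q + energy (g k) (U - V) Q" by (rule eU[OF gF(1) LQ])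
   moreover have "energy (g k) V Q = energy (g k) V (grd (us k))"
    unfolding energy_def set_lebesgue_integral_def by (rule Bochner_Integration.integral_cong) (use w(3) V(3) in "auto simp: Q_def indicator_def")
   moreover have "energy (g k) V (grd (us k)) <= energy (g k) U (grd (us k))"
    using eU[OF gF(1) Lus(1), of k k] energy_nonneg[OF gF(1), of "U - V" k "grd (us k)"] UU by auto
   moreover have "energy (g k) (U - V) Q <= \<beta> * (delta + P * (P * (delta + (2 + \<beta>) * delta / \<alpha>) + delta))"
   proof -
    have "energy (g k) (U - V) Q <= \<beta> * (vol (U - V) + pint p (U - V) Q)" by (rule energy_upper[OF gF(1) LQ _ UVm(1)]) (use UU in auto)
    also have "... <= \<beta> * (delta + P * (P * (delta + (2 + \<beta>) * delta / \<alpha>) + delta))"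
     using dV pQ nums pint_nonneg[of p "U - V" "grd u"] by (intro mult_left_mono add_mono) linarith+
    finally show ?thesis .
   qed
   moreover have "delta + \<beta> * (delta + P * (P * (delta + (2 + \<beta>) * delta / \<alpha>) + delta)) = c * delta" using \<alpha> by (simp add: c_def field_simps)
   ultimately have "energy (g k) U Q <= energy h U (grd u) + eps" using k(1) d(3) unfolding intfun_grd[OF UU(1)] by linarith
   thus "perturbable (g k) h U u M eps" using w(1,2) w2 k(3) less_imp_le unfolding Q_def by blast
  qed
 qed
 thus ?thesis by blast
qed

section \<open>Gluing across spheres\<close>

lemma F_class_glue:
 fixes f g :: "real^'d => real^'d^'m => real"
 assumes f: "F_cl f" and g: "F_cl g" and B: "B : sets borel" shows "F_cl (%x. if x : B then f x else g x)"
proof -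
 have [measurable]: "B : sets borel" "(%z. f (fst z) (snd z)) : borel_measurable (restrict_space borel (D \<times> UNIV))"
  "(%z. g (fst z) (snd z)) : borel_measurable (restrict_space borel (D \<times> UNIV))"
  "fst : measurable (restrict_space borel (D \<times> (UNIV :: (real^'d^'m) set))) borel"
  using f g B by (auto simp: F_class_def intro!: measurable_restrict_space1 borel_measurable_continuous_onI continuous_intros)
 have "(%z. (if fst z : B then f (fst z) else g (fst z)) (snd z)) = (%z. if fst z : B then f (fst z) (snd z) else g (fst z) (snd z))" by auto
 hence "(%z. (if fst z : B then f (fst z) else g (fst z)) (snd z)) : borel_measurable (restrict_space borel (D \<times> UNIV))" by simp
 thus ?thesis using f g unfolding F_class_def by (auto elim!: eventually_elim2)
qed

text \<open>The sphere is negligible, so the complement of the ball may be replaced by the open set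
  \<open>U - cball c r\<close>, on which Gamma-convergence is available.\<close>

lemma energy_glue:
 fixes f g :: "real^'d => real^'d^'m => real"
 assumes f: "F_cl f" and g: "F_cl g" and H: "Lp p H" and U: "admissible D U"
 shows "energy (%x. if x : ball c r then f x else g x) U H = energy f (U \<inter> ball c r) H + energy g (U - cball c r) H"
proof -
 define F where "F x = (if x : ball c r then f x else g x)" for x
 have F: "F_cl F" unfolding F_def by (rule F_class_glue[OF f g]) simp
 note UU = adm[OF U]
 have m: "U \<inter> ball c r : lmeasurable" "U - ball c r : lmeasurable" "U - cball c r : lmeasurable"
  using UU by (auto intro: fmeasurable.Diff fmeasurable.Int)
 have "energy F U H = energy F (U \<inter> ball c r) H + energy F (U - ball c r) H"
  using energy_Un[OF F H _ _ m(1,2)] UU(1) by (simp add: Int_Diff_Un Int_Diff_disjoint le_infI1 subset_iff)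
 moreover have "energy F (U \<inter> ball c r) H = energy f (U \<inter> ball c r) H" "energy F (U - ball c r) H = energy g (U - ball c r) H"
  unfolding energy_def set_lebesgue_integral_def by (rule Bochner_Integration.integral_cong; auto simp: F_def indicator_def)+
 moreover have "energy g (U - ball c r) H = energy g (U - cball c r) H" unfolding energy_def set_lebesgue_integral_def
 proof (rule integral_cong_AE)
  have "AEL x. x ~: sphere c r" by (rule AE_not_in) (simp add: negligible_iff_null_sets[symmetric] negligible_sphere)
  thus "AEL x. ind (U - ball c r) x *R g x (H x) = ind (U - cball c r) x *R g x (H x)" by eventually_elim (auto simp: indicator_def)
 qed (use F_class_measurable_on[OF g Lp_measurable[OF H], of "U - ball c r"] F_class_measurable_on[OF g Lp_measurable[OF H], of "U - cball c r"] UU m in auto)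
 ultimately show ?thesis by (simp add: F_def[abs_def])
qed

text \<open>The lower bound adds up over the two open pieces. For the upper bound, recovery
  sequences on the pieces are taken as perturbations vanishing off them, so that they match across
  the sphere.\<close>

lemma Gconv_glue:
 fixes g0 g1 :: "nat => real^'d => real^'d^'m => real"
 assumes G0: "Gconv g0 h0" and G1: "Gconv g1 h1"
 shows "Gconv (%k x. if x : ball c r then g1 k x else g0 k x) (%x. if x : ball c r then h1 x else h0 x)"
proof -
 define G where "G k x = (if x : ball c r then g1 k x else g0 k x)" for k x
 define H where "H x = (if x : ball c r then h1 x else h0 x)" for x
 have F: "F_cl (g0 k)" "F_cl (g1 k)" "F_cl h0" "F_cl h1" for k using G0 G1 by (auto simp: Gconv_def)
 have FG: "F_cl (G k)" "F_cl H" for k unfolding G_def H_def by (intro F_class_glue F; simp)+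
 have "Gc (%k. intfun p D (G k) U) (intfun p D H U)" if U: "admissible D U" for U
 proof -
  define U1 where "U1 = U \<inter> ball c r"
  define U0 where "U0 = U - cball c r"
  have U1: "admissible D U1" and U0: "admissible D U0" using U unfolding admissible_def U1_def U0_def by (auto intro: bounded_subset open_Diff)
  have eG: "energy (G k) U v = energy (g1 k) U1 v + energy (g0 k) U0 v" if "Lp p v" for k v
   unfolding G_def U1_def U0_def by (rule energy_glue[OF F(2,1) that U])
  have eH: "energy H U v = energy h1 U1 v + energy h0 U0 v" if "Lp p v" for v unfolding H_def[abs_def] U1_def U0_def by (rule energy_glue[OF F(4,3) that U])
  note ig = intfun_grd[OF adm(1)[OF U]] intfun_grd[OF adm(1)[OF U1]] intfun_grd[OF adm(1)[OF U0]]
  show ?thesis unfolding gamma_conv_def mem_Collect_eq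
  proof (intro conjI ballI allI impI; unfold mem_Collect_eq)
   fix u :: "real^'d => real^'m" and us assume u: "sobolev p D u" and us: "ALL k. sobolev p D (us k)" "weak_W1p p D us u"
   have l: "ereal (intfun p D h1 U1 u) <= liminf (%k. ereal (intfun p D (g1 k) U1 (us k)))"
    "ereal (intfun p D h0 U0 u) <= liminf (%k. ereal (intfun p D (g0 k) U0 (us k)))"
    using G0 G1 U0 U1 u us unfolding Gconv_def gamma_conv_def by auto
   show "ereal (intfun p D H U u) <= liminf (%k. ereal (intfun p D (G k) U (us k)))" unfolding real_liminf_iff
   proof (intro allI impI)
    fix eps :: real assume "eps > 0"
    hence "EV k. intfun p D h1 U1 u - eps / 2 < intfun p D (g1 k) U1 (us k)" "EV k. intfun p D h0 U0 u - eps / 2 < intfun p D (g0 k) U0 (us k)"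
     using l unfolding real_liminf_iff by (auto dest: spec[of _ "eps / 2"])
    thus "EV k. intfun p D H U u - eps < intfun p D (G k) U (us k)" by eventually_elim (use us(1) u in "auto simp: ig eG eH Lp_grd")
   qed
  next
   fix u :: "real^'d => real^'m" assume u: "sobolev p D u"
   obtain M1 where M1: "!!eps g h. eps > 0 ==> Gconv g h ==> EV k. perturbable (g k) h U1 u M1 eps" using boundary_recovery[OF u U1] by blast
   obtain M0 where M0: "!!eps g h. eps > 0 ==> Gconv g h ==> EV k. perturbable (g k) h U0 u M0 eps" using boundary_recovery[OF u U0] by blast
   have "reachable G U u (energy H U (grd u))" unfolding reachable_def
   proof (intro exI[of _ "2 powr p * (M1 + M0)"] allI impI)
    fix eps :: real assume ep: "eps > 0"
    have P: "(2::real) powr p >= 1" using nums by (intro ge_one_powr_ge_zero) auto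
    define delta where "delta = eps / (2 * 2 powr p)"
    have d: "delta > 0" "2 * delta <= eps" "2 powr p * (delta + delta) <= eps"
     using ep P mult_left_mono[OF P, of eps] by (auto simp: delta_def divide_le_eq)
    show "EV k. EX w W. sob p UNIV w W & pint p UNIV w <= eps & pint p UNIV W <= 2 powr p * (M1 + M0) &
     energy (G k) U (%x. grd u x + W x) <= energy H U (grd u) + eps" using M1[OF d(1) G1] M0[OF d(1) G0]
    proof eventually_elim
     fix k
     assume elim: "perturbable (g1 k) h1 U1 u M1 delta" "perturbable (g0 k) h0 U0 u M0 delta"
     obtain w1 W1 where w1: "sob p UNIV w1 W1" "!!x. x ~: U1 ==> W1 x = 0" "pint p UNIV w1 <= delta" "pint p UNIV W1 <= M1"
      "energy (g1 k) U1 (%x. grd u x + W1 x) <= energy h1 U1 (grd u) + delta" using elim(1) by blast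
     obtain w0 W0 where w0: "sob p UNIV w0 W0" "!!x. x ~: U0 ==> W0 x = 0" "pint p UNIV w0 <= delta" "pint p UNIV W0 <= M0"
      "energy (g0 k) U0 (%x. grd u x + W0 x) <= energy h0 U0 (grd u) + delta" using elim(2) by blast
     have L: "Lp p w1" "Lp p W1" "Lp p w0" "Lp p W0" using w1 w0 by (auto simp: sob_wder)
     have LL: "Lp p (%x. grd u x + (W1 x + W0 x))" by (intro Lp_add Lp_grd u L nums)
     have 1: "pint p UNIV (%x. w1 x + w0 x) <= eps"
      by (rule order_trans[OF pint_add[OF L(1,3) _ nums(1)] order_trans[OF mult_left_mono[OF add_mono[OF w1(3) w0(3)]] d(3)]]) auto
     have 2: "pint p UNIV (%x. W1 x + W0 x) <= 2 powr p * (M1 + M0)"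
      by (rule order_trans[OF pint_add[OF L(2,4) _ nums(1)] mult_left_mono[OF add_mono[OF w1(4) w0(4)]]]) auto
     have "x ~: U0" if "x : U1" for x using that by (auto simp: U1_def U0_def)
     hence "energy (g1 k) U1 (%x. grd u x + (W1 x + W0 x)) = energy (g1 k) U1 (%x. grd u x + W1 x)"
      unfolding energy_def set_lebesgue_integral_def by (intro Bochner_Integration.integral_cong) (auto simp: indicator_def w0(2))
     moreover have "x ~: U1" if "x : U0" for x using that by (auto simp: U1_def U0_def)
     hence "energy (g0 k) U0 (%x. grd u x + (W1 x + W0 x)) = energy (g0 k) U0 (%x. grd u x + W0 x)"
      unfolding energy_def set_lebesgue_integral_def by (intro Bochner_Integration.integral_cong) (auto simp: indicator_def w1(2))
     ultimately have "energy (G k) U (%x. grd u x + (W1 x + W0 x)) <= energy H U (grd u) + eps"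
      unfolding eG[OF LL] eH[OF Lp_grd(1)[OF u]] using w1(5) w0(5) d(2) by linarith
     thus "EX w W. sob p UNIV w W & pint p UNIV w <= eps & pint p UNIV W <= 2 powr p * (M1 + M0) &
      energy (G k) U (%x. grd u x + W x) <= energy H U (grd u) + eps" using sob_add[OF w1(1) w0(1) nums(2)] 1 2
      by (intro exI[of _ "%x. w1 x + w0 x"] exI[of _ "%x. W1 x + W0 x"]) auto
    qed
   qed
   from reachable_recovery[OF u FG(1) U this]
   show "EX us. (ALL k. sobolev p D (us k)) & weak_W1p p D us u & limsup (%k. ereal (intfun p D (G k) U (us k))) <= ereal (intfun p D H U u)"
    by (simp add: ig)
  qed
 qed
 thus ?thesis using FG unfolding Gconv_def G_def H_def by auto
qed

end

subsection \<open>Comparison of Gamma-limits\<close>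

text \<open>Meaningful for bounded sequences. The definition through \<open>ereal\<close> makes
  measurability in a parameter automatic.\<close>

definition real_limsup :: "(nat => real) => real" where "real_limsup v = real_of_ereal (limsup (%j. ereal (v j)))"

lemma real_limsup:
 assumes "!!j. 0 <= v j" "!!j. v j <= C"
 shows "0 <= real_limsup v" "real_limsup v <= C" "e > 0 ==> FQ j. real_limsup v - e < v j" "e > 0 ==> EV j. v j < real_limsup v + e"
proof -
 define a where "a = limsup (%j. ereal (v j))"
 have "0 <= a" unfolding a_def using assms(1) by (intro le_Limsup) auto
 moreover have "a <= ereal C" unfolding a_def using assms(2) by (intro Limsup_bounded) auto
 ultimately have a: "a = ereal (real_limsup v)" by (cases a) (auto simp: real_limsup_def a_def)
 show "0 <= real_limsup v" "real_limsup v <= C" using \<open>0 <= a\<close> \<open>a <= ereal C\<close> by (simp_all add: a)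
 show "EV j. v j < real_limsup v + e" if "e > 0"
  using Limsup_lessD[of sequentially "%j. ereal (v j)" "ereal (real_limsup v + e)"] that by (simp add: a[unfolded a_def])
 show "FQ j. real_limsup v - e < v j" if e: "e > 0"
 proof (rule ccontr)
  assume "~ (FQ j. real_limsup v - e < v j)"
  hence "EV j. ereal (v j) <= ereal (real_limsup v - e)" by (simp add: not_frequently not_less)
  hence "a <= ereal (real_limsup v - e)" unfolding a_def by (rule Limsup_bounded)
  thus False using e by (simp add: a)
 qed
qed

text \<open>The upper limit of C - v_j is C minus the lower limit of v_j, so the sum exceeds
  \<open>C\<close> by the gap between upper and lower limit.\<close>

lemma real_limsup_reflect:
 assumes v: "!!j. 0 <= v j" "!!j. v j <= C"
 shows "C <= real_limsup v + real_limsup (%j. C - v j)"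
  and "real_limsup v + real_limsup (%j. C - v j) <= C ==> v ----> real_limsup v"
proof -
 have c: "0 <= C - v j" "C - v j <= C" for j using v[of j] by auto
 have ev: "EV j. v j < real_limsup v + e & C - v j < real_limsup (%j. C - v j) + e" if "e > 0" for e
  using real_limsup(4)[OF v that] real_limsup(4)[OF c that] by eventually_elim auto
 show "C <= real_limsup v + real_limsup (%j. C - v j)"
 proof (rule field_le_epsilon)
  fix e :: real assume "e > 0"
  hence "e / 2 > 0" by simp
  from eventually_happens[OF ev[OF this]] show "C <= real_limsup v + real_limsup (%j. C - v j) + e" by force
 qed
 assume le: "real_limsup v + real_limsup (%j. C - v j) <= C"
 show "v ----> real_limsup v"
 proof (rule tendstoI)
  fix e :: real assume "e > 0"
  from ev[OF this] show "EV j. dist (v j) (real_limsup v) < e" by eventually_elim (use le in "auto simp: dist_real_def abs_less_iff")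
 qed
qed

lemma frequently_subsequence:
 assumes "FQ k. P k" shows "EX s :: nat => nat. strict_mono s & (ALL n. P (s n))"
proof -
 have "infinite {k. P k}" using assms by (simp add: frequently_cofinite[symmetric] cofinite_eq_sequentially)
 from infinite_enumerate[OF this] show ?thesis by auto
qed

section \<open>Tails of p-th powers and concentration on small sets\<close>

lemma tail_set_measurable: "H : BL ==> {x. norm (H x) > t} : sets lebesgue" for H :: "real^'d => 'v::euclidean_space"
proof -
 assume [measurable]: "H : BL"
 have "{x : space lebesgue. norm (H x) > t} : sets lebesgue" by measurable
 thus ?thesis by simp
qed

lemma Lp_tail:
 fixes H :: "real^'d => 'v::euclidean_space"
 assumes H: "Lp p H" and e: "eps > 0"
 shows "EX T. ALL t>=T. pint p {x. norm (H x) > t} H <= eps"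
proof -
 note m = tail_set_measurable[OF Lp_measurable[OF H]]
 have [measurable]: "H : BL" using H by (simp add: Lp_def)
 have i: "integ (%x. norm (H x) powr p)" using H by (simp add: Lp_integrable)
 have "(%n. LI x. ind {x. norm (H x) > real n} x *R norm (H x) powr p) ----> (LINT x:({}::(real^'d) set)|lebesgue. norm (H x) powr p)"
  unfolding set_lebesgue_integral_def
 proof (rule integral_dominated_convergence[OF _ _ i])
  show "AEL x. (%n. ind {x. norm (H x) > real n} x *R norm (H x) powr p) ----> ind {} x *R norm (H x) powr p"
  proof (rule AE_I2, rule tendsto_eventually)
   fix x
   obtain N where N: "norm (H x) <= real N" using real_arch_simple by blast
   show "EV n. ind {x. norm (H x) > real n} x *R norm (H x) powr p = ind {} x *R norm (H x) powr p"
    using eventually_ge_at_top[of N] by eventually_elim (use N in auto)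
  qed
 qed (use m in "auto simp: indicator_def")
 hence "(%n. pint p {x. norm (H x) > real n} H) ----> 0" by (simp add: pint_def set_lebesgue_integral_def)
 from order_tendstoD(2)[OF this e] obtain n where "pint p {x. norm (H x) > real n} H < eps" by (auto simp: eventually_sequentially)
 moreover have "pint p {x. norm (H x) > t} H <= pint p {x. norm (H x) > real n} H" if "t >= real n" for t
  by (rule pint_subset[OF H _ m m]) (use that in auto)
 ultimately show ?thesis by (intro exI[of _ "real n"]) fastforce
qed

text \<open>On \<open>A l\<close> the part of \<open>H\<close> below height \<open>T\<close>
  contributes at most T^p times the measure, and the part above is a tail, small uniformly in
  \<open>l\<close>.\<close>

lemma pint_small_sets:
 fixes H :: "real^'d => 'v::euclidean_space"
 assumes H: "Lp p H" and p: "p >= 0" and A: "!!l. A l : lmeasurable" "(%l. vol (A l)) ----> 0"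
 shows "(%l. pint p (A l) H) ----> 0"
proof (rule LIMSEQ_I)
 fix e :: real assume e: "e > 0"
 obtain T0 where T0: "!!t. t >= T0 ==> pint p {x. norm (H x) > t} H <= e / 2" using Lp_tail[OF H, of "e / 2"] e by auto
 define T where "T = max T0 0"
 have Hm: "{x. norm (H x) > T} : sets lebesgue" by (rule tail_set_measurable[OF Lp_measurable[OF H]])
 have T: "pint p {x. norm (H x) > T} H <= e / 2" by (rule T0) (simp add: T_def)
 have "(%l. T powr p * vol (A l)) ----> 0" by (intro tendsto_mult_right_zero A)
 hence "EV l. T powr p * vol (A l) < e / 2" using e by (intro order_tendstoD) auto
 hence "EV l. norm (pint p (A l) H - 0) < e"
 proof (rule eventually_mono)
  fix l assume l: "T powr p * vol (A l) < e / 2"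
  have As: "A l : sets lebesgue" using A(1)[of l] by auto
  have i: "integ (%x. ind {x. norm (H x) > T} x *R norm (H x) powr p)" "integ (%x. ind (A l) x *R T powr p)"
   using Lp_set_integrable[OF H Hm] set_integrable_const[OF A(1), of l "T powr p"] by (auto simp: set_integrable_def)
  have "pint p (A l) H <= (LI x. ind (A l) x *R T powr p + ind {x. norm (H x) > T} x *R norm (H x) powr p)" unfolding pint_def set_lebesgue_integral_def
  proof (rule integral_mono[OF _ Bochner_Integration.integrable_add[OF i(2,1)]])
   show "integ (%x. ind (A l) x *R norm (H x) powr p)" using Lp_set_integrable[OF H As] by (simp add: set_integrable_def)
   show "ind (A l) x *R norm (H x) powr p <= ind (A l) x *R T powr p + ind {x. norm (H x) > T} x *R norm (H x) powr p" for x
    using powr_mono2[of p "norm (H x)" T] p by (auto simp: indicator_def not_less)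
  qed
  also have "... = T powr p * vol (A l) + pint p {x. norm (H x) > T} H"
   using i set_integral_const[OF A(1), of l "T powr p"] by (simp add: pint_def set_lebesgue_integral_def)
  finally show "norm (pint p (A l) H - 0) < e" using l T by simp
 qed
 thus "EX no. ALL n>=no. norm (pint p (A n) H - 0) < e" by (simp add: eventually_sequentially)
qed

text \<open>Where the sum exceeds \<open>2 * T\<close>, the larger summand exceeds \<open>T\<close>
  and is at least half of the sum.\<close>

lemma pint_tail_add:
 assumes a: "Lp p a" and b: "Lp p b" and p: "p > 0" and T: "T >= 0"
 shows "pint p {x. norm (a x + b x) > 2 * T} (%x. a x + b x) <= 2 powr p * (pint p {x. norm (a x) > T} a + pint p {x. norm (b x) > T} b)"
proof -
 note m = tail_set_measurable[OF Lp_measurable]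
 have ab: "Lp p (%x. a x + b x)" by (rule Lp_add[OF a b p])
 have i: "integ (%x. ind {x. norm (a x) > T} x *R norm (a x) powr p)" "integ (%x. ind {x. norm (b x) > T} x *R norm (b x) powr p)"
  using Lp_set_integrable[OF a m[OF a]] Lp_set_integrable[OF b m[OF b]] by (auto simp: set_integrable_def)
 have "pint p {x. norm (a x + b x) > 2 * T} (%x. a x + b x)
  <= (LI x. 2 powr p * (ind {x. norm (a x) > T} x *R norm (a x) powr p + ind {x. norm (b x) > T} x *R norm (b x) powr p))"
  unfolding pint_def set_lebesgue_integral_def
 proof (rule integral_mono)
  show "integ (%x. ind {x. norm (a x + b x) > 2 * T} x *R norm (a x + b x) powr p)"
   using Lp_set_integrable[OF ab m[OF ab]] by (simp add: set_integrable_def)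
  fix x
  have n: "norm (a x + b x) <= norm (a x) + norm (b x)" by (rule norm_triangle_ineq)
  have k: "norm (a x + b x) powr p <= 2 powr p * c powr p" if "norm (a x + b x) <= 2 * c" "c >= 0" for c
   using powr_mono2[of p "norm (a x + b x)" "2 * c"] that p by (simp add: powr_mult)
  show "ind {x. norm (a x + b x) > 2 * T} x *R norm (a x + b x) powr p
   <= 2 powr p * (ind {x. norm (a x) > T} x *R norm (a x) powr p + ind {x. norm (b x) > T} x *R norm (b x) powr p)"
  proof (cases "norm (a x) <= norm (b x)")
   case True thus ?thesis using n k[of "norm (b x)"] by (auto simp: indicator_def distrib_left intro: add_increasing)
  next
   case False thus ?thesis using n k[of "norm (a x)"] by (auto simp: indicator_def distrib_left intro: add_increasing2)
  qed
 qed (use i in auto)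
 also have "... = 2 powr p * (pint p {x. norm (a x) > T} a + pint p {x. norm (b x) > T} b)" using i by (simp add: pint_def set_lebesgue_integral_def)
 finally show ?thesis .
qed

lemma integral_le_of_nn:
 assumes "!!x. f x >= 0" "(\<integral>\<^sup>+x. ennreal (f x) \<partial>M) <= ennreal e" "e >= 0" shows "(LINT x|M. f x) <= e"
proof (cases "integrable M f")
 case True
 have "ennreal (LINT x|M. f x) <= ennreal e" using nn_integral_eq_integral[OF True] assms by simp
 thus ?thesis using assms(3) by simp
qed (simp add: assms not_integrable_integral_eq)

context growth
begin

text \<open>Off \<open>A l\<close> the two gradients are close and the energies uniformly
  continuous; on \<open>A l\<close> the energy of the modified gradient is small by the growth
  bound. The estimate is one-sided because on \<open>A l\<close> the original energy is only known
  to be nonnegative. It is uniform in \<open>f\<close>, so it applies along any choice of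
  indices.\<close>

lemma concentration_comparison:
 fixes Z w :: "nat => real^'d => real^'d^'m"
 assumes H: "Lp p H" and V: "V <= D" "V : lmeasurable" and L: "!!l. Lp p (w l)" "!!l. Lp p (Z l)"
  and M: "!!l. pint p UNIV (w l) <= M" "!!l. pint p UNIV (Z l) <= M"
  and A: "!!l. A l : lmeasurable" "(%l. vol (A l)) ----> 0" and wA: "(%l. pint p (A l) (w l)) ----> 0"
  and wZ: "(%l. pint p (- A l) (%x. w l x - Z l x)) ----> 0" and e: "eps > 0"
 shows "EV l. ALL f. F_cl f --> energy f V (%x. H x + w l x) <= energy f V (%x. H x + Z l x) + eps"
proof -
 define M1 where "M1 = max (vol V) (2 powr p * (pint p UNIV H + M))"
 obtain delta where d: "delta > 0" "!!f W (a :: real^'d => real^'d^'m) b. F_cl f ==> W <= D ==> W : lmeasurable ==> vol W <= M1 ==> Lp p a ==> Lp p b ==>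
  pint p W a <= M1 ==> pint p W b <= M1 ==> pint p W (%x. a x - b x) <= delta ==> abs (energy f W a - energy f W b) <= eps / 2"
 proof -
  have "eps / 2 > 0" using e by simp
  from energy_uniformly_continuous[OF this, of M1, where 'm='m] show ?thesis by (elim exE conjE) (rule that, assumption, blast)
 qed
 have As: "A l : sets lebesgue" "- A l : sets lebesgue" for l using A(1)[of l] sets.compl_sets[of "A l" lebesgue] by (auto simp: Compl_eq_Diff_UNIV)
 have "(%l. \<beta> * (vol (A l) + 2 powr p * (pint p (A l) H + pint p (A l) (w l)))) ----> \<beta> * (0 + 2 powr p * (0 + 0))"
  by (intro tendsto_intros A(2) wA pint_small_sets[OF H nums(3) A])
 hence "EV l. \<beta> * (vol (A l) + 2 powr p * (pint p (A l) H + pint p (A l) (w l))) < eps / 2" using e by (intro order_tendstoD) auto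
 moreover have "EV l. pint p (- A l) (%x. w l x - Z l x) < delta" by (rule order_tendstoD(2)[OF wZ d(1)])
 ultimately show ?thesis
 proof eventually_elim
  fix l assume l: "\<beta> * (vol (A l) + 2 powr p * (pint p (A l) H + pint p (A l) (w l))) < eps / 2" "pint p (- A l) (%x. w l x - Z l x) < delta"
  show "ALL f. F_cl f --> energy f V (%x. H x + w l x) <= energy f V (%x. H x + Z l x) + eps"
  proof (intro allI impI)
   fix f assume f: "F_cl (f :: real^'d => real^'d^'m => real)"
   have LL: "Lp p (%x. H x + w l x)" "Lp p (%x. H x + Z l x)" by (intro Lp_add H L nums)+
   have VA: "V \<inter> A l : lmeasurable" "V - A l : lmeasurable" using V A(1)[of l] by (auto intro: fmeasurable.Diff fmeasurable.Int)
   have VD: "V \<inter> A l <= D" "V - A l <= D" using V by auto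
   have sp: "(V \<inter> A l) \<union> (V - A l) = V" "V \<inter> A l \<inter> (V - A l) = {}" by auto
   have eU: "energy f V h = energy f (V \<inter> A l) h + energy f (V - A l) h" if "Lp p h" for h
    using energy_Un[OF f that VD VA sp(2)] unfolding sp(1) .
   have pb: "pint p W (%x. H x + b x) <= 2 powr p * (pint p W' H + pint p W' b)" if "Lp p b" "W <= W'" "W : sets lebesgue" "W' : sets lebesgue" for b W W'
    by (rule order_trans[OF pint_add[OF H that(1,3) nums(1)]]) (intro mult_left_mono add_mono pint_subset that H, simp)
   have pM: "pint p (V - A l) (%x. H x + b x) <= M1" if "Lp p b" "pint p UNIV b <= M" for b
    by (rule order_trans[OF pb[OF that(1) subset_UNIV]]) (use VA that in "auto simp: M1_def intro!: max.coboundedI2 mult_left_mono")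
   have "energy f (V \<inter> A l) (%x. H x + w l x) <= \<beta> * (vol (V \<inter> A l) + pint p (V \<inter> A l) (%x. H x + w l x))"
    by (rule energy_upper[OF f LL(1) VD(1) VA(1)])
   also have "... <= \<beta> * (vol (A l) + 2 powr p * (pint p (A l) H + pint p (A l) (w l)))"
    by (intro mult_left_mono add_mono pb measure_mono_fmeasurable L nums A) (use VA As in auto)
   finally have 1: "energy f (V \<inter> A l) (%x. H x + w l x) < eps / 2" using l(1) by linarith
   have "abs (energy f (V - A l) (%x. H x + w l x) - energy f (V - A l) (%x. H x + Z l x)) <= eps / 2"
   proof (rule d(2)[OF f VD(2) VA(2) _ LL pM[OF L(1) M(1)] pM[OF L(2) M(2)]])
    show "vol (V - A l) <= M1" unfolding M1_def by (intro max.coboundedI1 measure_mono_fmeasurable) (use V VA in auto)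
    have "pint p (V - A l) (%x. w l x - Z l x) <= pint p (- A l) (%x. w l x - Z l x)"
     by (rule pint_subset[OF Lp_diff[OF L nums(1)]]) (use VA As in auto)
    thus "pint p (V - A l) (%x. (H x + w l x) - (H x + Z l x)) <= delta" using l(2) by simp
   qed
   thus "energy f V (%x. H x + w l x) <= energy f V (%x. H x + Z l x) + eps"
    using 1 eU[OF LL(1)] eU[OF LL(2)] energy_nonneg[OF f VD(1), of "%x. H x + Z l x"] by linarith
  qed
 qed
qed

section \<open>Closeness of integrands\<close>

text \<open>The supremum over |xi| <= T is tested through measurable fields \<open>H\<close>, for
  which the integrand is measurable.\<close>

abbreviation (input) "near f g U T c \<equiv> ALL H:BL. (ALL x. norm (H x) <= T) -->
 (nns U (%x. ennreal (abs (f x (H x) - g x (H x))))) <= ennreal c"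

text \<open>How late \<open>k\<close> has to be may depend on \<open>J\<close>, on the height
  \<open>T\<close> and on \<open>eps\<close>.\<close>

definition closeF :: "(nat => real^'d => real^'d^'m => real) => (nat => nat => real^'d => real^'d^'m => real) => (real^'d) set => bool" where
 "closeF F G U \<longleftrightarrow> (ALL T. ALL eps>0. EX J0. ALL J>=J0. EV k. near (F k) (G J k) U T eps)"

lemma energy_close:
 fixes f g :: "real^'d => real^'d^'m => real"
 assumes f: "F_cl f" "F_cl g" and V: "V <= U" "V <= D" "V : lmeasurable" and H: "Lp p H" and T: "T >= 1" and e: "eps >= 0"
  and c: "!!h. h : BL ==> (!!x. norm (h x) <= T) ==> (nns U (%x. ennreal (abs (f x (h x) - g x (h x))))) <= ennreal eps"
 shows "energy f V H <= energy g V H + eps + 2 * \<beta> * pint p {x. norm (H x) > T} H"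
  and "energy g V H <= energy f V H + eps + 2 * \<beta> * pint p {x. norm (H x) > T} H"
proof -
 note t = energy_truncated_comparison[OF f V(2,3) H T] and t' = energy_truncated_comparison[OF f(2,1) V(2,3) H T]
 define h where "h x = (if norm (H x) <= T then H x else 0)" for x
 have "(LINT x:V|lebesgue. abs (f x (h x) - g x (h x))) <= eps" unfolding set_lebesgue_integral_def
 proof (rule integral_le_of_nn[OF _ _ e])
  have "(NN x. ennreal (ind V x *R (abs (f x (h x) - g x (h x))))) <= (nns U (%x. ennreal (abs (f x (h x) - g x (h x)))))"
   by (rule nn_integral_mono) (use V(1) in "auto simp: indicator_def")
  also have "... <= ennreal eps" by (rule c) (use t(2,3) in "auto simp: h_def[abs_def]")
  finally show "(NN x. ennreal (ind V x *R (abs (f x (h x) - g x (h x))))) <= ennreal eps" .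
 qed simp
 moreover have "(LINT x:V|lebesgue. abs (g x (h x) - f x (h x))) = (LINT x:V|lebesgue. abs (f x (h x) - g x (h x)))" by (simp add: abs_minus_commute)
 ultimately show "energy f V H <= energy g V H + eps + 2 * \<beta> * pint p {x. norm (H x) > T} H"
  "energy g V H <= energy f V H + eps + 2 * \<beta> * pint p {x. norm (H x) > T} H" using t(1) t'(1) unfolding h_def by linarith+
qed

lemma common_tail:
 assumes H: "Lp p H" and w: "!!l::nat. Lp p (w l)" and t: "!!eps. eps > 0 ==> EX T. ALL l. pint p {x. norm (w l x) > T} (w l) <= eps" and e: "eps > 0"
 shows "EX T>=1. ALL l. 2 * \<beta> * pint p {x. norm (H x + w l x) > T} (%x. H x + w l x) <= eps"
proof -
 define c where "c = 2 * \<beta> * 2 powr p"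
 have c: "c > 0" using \<alpha> \<beta> by (simp add: c_def)
 define eta where "eta = eps / (2 * c)"
 have h: "eta > 0" using e c by (simp add: eta_def)
 obtain T1 where T1: "!!t. t >= T1 ==> pint p {x. norm (H x) > t} H <= eta" using Lp_tail[OF H h] by blast
 obtain T2 where T2: "!!l. pint p {x. norm (w l x) > T2} (w l) <= eta" using t[OF h] by blast
 define T where "T = max 1 (max T1 T2)"
 have "pint p {x. norm (w l x) > T} (w l) <= eta" for l
  by (rule order_trans[OF pint_subset[OF w] T2]) (use tail_set_measurable[OF Lp_measurable[OF w]] in "auto simp: T_def simp del: max_less_iff_conj")
 moreover have "pint p {x. norm (H x) > T} H <= eta" by (rule T1) (simp add: T_def)
 ultimately have "2 * \<beta> * (2 powr p * (pint p {x. norm (H x) > T} H + pint p {x. norm (w l x) > T} (w l))) <= 2 * \<beta> * (2 powr p * (eta + eta))" for l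
  using nums by (intro mult_left_mono add_mono) auto
 moreover have "2 * \<beta> * (2 powr p * (eta + eta)) = eps" using c \<alpha> \<beta> by (simp add: eta_def c_def field_simps)
 moreover have "2 * \<beta> * pint p {x. norm (H x + w l x) > 2 * T} (%x. H x + w l x) <= 2 * \<beta> * (2 powr p * (pint p {x. norm (H x) > T} H + pint p {x. norm (w l x) > T} (w l)))" for l
  using nums by (intro mult_left_mono pint_tail_add H w) (auto simp: T_def)
 ultimately have "2 * \<beta> * pint p {x. norm (H x + w l x) > 2 * T} (%x. H x + w l x) <= eps" for l using order_trans by fastforce
 thus ?thesis by (intro exI[of _ "2 * T"]) (auto simp: T_def)
qed

lemma pint_zero_fun: "pint p V (%x. 0 :: 'v::euclidean_space) = 0" using nums by (simp add: pint_def)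

lemma tendsto_fill:
 fixes a :: "nat => real"
 assumes s: "strict_mono s" and a: "a ----> 0"
 shows "(%k. if k : range s then a (inv s k) else 0) ----> 0"
proof (rule LIMSEQ_I)
 fix e :: real assume "e > 0"
 then obtain N where N: "!!l. l >= N ==> norm (a l) < e" using LIMSEQ_D[OF a] by fastforce
 have "norm ((if k : range s then a (inv s k) else 0) - 0) < e" if k: "k >= s N" for k
 proof (cases "k : range s")
  case True
  then obtain l where l: "k = s l" by auto
  hence "N <= l" using k s by (simp add: strict_mono_less_eq)
  thus ?thesis using N l strict_mono_imp_inj_on[OF s] by simp
 qed (use \<open>e > 0\<close> in simp)
 thus "EX no. ALL k>=no. norm ((if k : range s then a (inv s k) else 0) - 0) < e" by blast
qed

text \<open>The height \<open>T\<close> comes from the tails of the new gradients and is the same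
  for all \<open>f\<close>, \<open>g\<close> and \<open>l\<close>; closeness of integrands can
  therefore be invoked at this height afterwards. The final bound on the gradients depends on
  \<open>M\<close> alone.\<close>

lemma concentration_free:
 fixes z :: "nat => real^'d => real^'m"
 assumes H: "Lp p H" and z: "!!n. sob p UNIV (z n) (Z n)" "!!n x. x ~: U ==> z n x = 0" "!!n. pint p UNIV (Z n) <= M" "(%n. pint p UNIV (z n)) ----> 0"
  and U: "bounded U" and V: "V <= U" "V <= D" "V : lmeasurable" and d: "delta > 0"
 obtains r :: "nat => nat" and w M' T where "strict_mono r" "(%l. pint p UNIV (w l)) ----> 0"
  "!!l. sob p UNIV (w l) (cgrad (w l))" "!!l. pint p UNIV (cgrad (w l)) <= M'" "EV l. pint p UNIV (cgrad (w l)) <= 1 + 2 powr p * (1 + M)"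
  "EV l. ALL f. F_cl f --> energy f V (%x. H x + cgrad (w l) x) <= energy f V (%x. H x + Z (r l) x) + delta"
  "!!l f g c. F_cl f ==> F_cl g ==> near f g U T c ==> 0 <= c ==>
   abs (energy f V (%x. H x + cgrad (w l) x) - energy g V (%x. H x + cgrad (w l) x)) <= c + delta"
proof -
 obtain N where N: "!!x. x : U ==> norm x <= N" using U by (auto simp: bounded_iff)
 have "EX r w A M'. equiintegrable_gradients p Z r w A M'" by (rule remove_concentrations[where N=N, OF z(1) _ z(3,4) p]) (meson N z(2) not_le)
 then obtain r w A M' where RC: "equiintegrable_gradients p Z r w A M'" by blast
 have r: "strict_mono r" and w: "test_fun_vec UNIV (w l)" "A l : lmeasurable" "pint p UNIV (cgrad (w l)) <= M'"
  and lim: "(%l. vol (A l)) ----> 0" "(%l. pint p UNIV (w l)) ----> 0" "(%l. pint p (A l) (cgrad (w l))) ----> 0"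
   "(%l. pint p (- A l) (%x. cgrad (w l) x - Z (r l) x)) ----> 0"
  and tl: "eps > 0 ==> EX T. ALL l. pint p {x. norm (cgrad (w l) x) > T} (cgrad (w l)) <= eps" for l eps
  using RC unfolding equiintegrable_gradients_def by blast+
 note Lw = test_fun_vec_Lp[OF w(1) nums(1)]
 have LZ: "Lp p (Z n)" for n using z(1)[of n] by (simp add: sob_wder)
 have ev: "EV l. ALL f. F_cl f --> energy f V (%x. H x + cgrad (w l) x) <= energy f V (%x. H x + Z (r l) x) + delta"
  by (rule concentration_comparison[OF H V(2,3) Lw(2) LZ order_trans[OF w(3) max.cobounded1] order_trans[OF z(3) max.cobounded2] w(2) lim(1,3,4) d])
 obtain T where T: "T >= 1" "!!l. 2 * \<beta> * pint p {x. norm (H x + cgrad (w l) x) > T} (%x. H x + cgrad (w l) x) <= delta"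
  using common_tail[OF H Lw(2) tl d] by blast
 have cl: "abs (energy f V (%x. H x + cgrad (w l) x) - energy g V (%x. H x + cgrad (w l) x)) <= c + delta"
  if "F_cl f" "F_cl g" "near f g U T c" "0 <= c" for l f g c
  using energy_close[OF that(1,2) V Lp_add[OF H Lw(2) nums(1)] T(1) that(4), of l] that(3) T(2)[of l] by fastforce
 have "EV l. pint p (A l) (cgrad (w l)) < 1" "EV l. pint p (- A l) (%x. cgrad (w l) x - Z (r l) x) < 1"
  by (rule order_tendstoD(2)[OF lim(3)] order_tendstoD(2)[OF lim(4)]; simp)+
 hence "EV l. pint p UNIV (cgrad (w l)) <= 1 + 2 powr p * (1 + M)"
 proof eventually_elim
  case (elim l)
  have As: "A l : sets lebesgue" "- A l : sets lebesgue" using w(2)[of l] sets.compl_sets[of "A l" lebesgue] by (auto simp: Compl_eq_Diff_UNIV)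
  have "pint p UNIV (cgrad (w l)) = pint p (A l) (cgrad (w l)) + pint p (- A l) (cgrad (w l))" using pint_Un[OF Lw(2) As] by simp
  moreover have "pint p (- A l) (cgrad (w l)) <= 2 powr p * (pint p (- A l) (%x. cgrad (w l) x - Z (r l) x) + pint p (- A l) (Z (r l)))"
   using pint_add[OF Lp_diff[OF Lw(2)[of l] LZ[of "r l"] nums(1)] LZ[of "r l"] As(2) nums(1)] by simp
  moreover have "pint p (- A l) (Z (r l)) <= M" using pint_subset[OF LZ subset_UNIV As(2), of "r l"] z(3)[of "r l"] by simp
  hence "2 powr p * (pint p (- A l) (%x. cgrad (w l) x - Z (r l) x) + pint p (- A l) (Z (r l))) <= 2 powr p * (1 + M)"
   using elim by (intro mult_left_mono add_mono) auto
  ultimately show ?case using elim by linarith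
 qed
 thus thesis by (rule that[OF r lim(2) sob_test_fun[OF w(1) nums(2)] w(3) _ ev cl])
qed

text \<open>Cut the sequence off towards \<open>u\<close> outside \<open>V\<close>, remove its
  concentrations, pass from \<open>F\<close> to \<open>G J\<close> by closeness at the common
  height, and use the lower bound for \<open>G J\<close> on \<open>V\<close>. Each change raises the
  energy by at most a small amount, and the energy of \<open>u\<close> on \<open>U - V\<close> is
  small for all \<open>h J\<close> together.\<close>

lemma close_lower:
 fixes u :: "real^'d => real^'m" and s :: "nat => nat"
 assumes F: "!!k. F_cl (F k)" and G: "!!J. Gconv (G J) (h J)" and cl: "closeF F G U" and U: "admissible D U"
  and u: "sobolev p D u" and us: "!!k. sobolev p D (us k)" "weak_W1p p D us u" and s: "strict_mono s"
  and c: "!!n. intfun p D (F (s n)) U (us (s n)) <= c" and e: "eps > 0"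
 shows "EV J. energy (h J) U (grd u) <= c + eps"
proof -
 note UU = adm[OF U] and Lu = Lp_grd[OF u]
 have hF: "F_cl (h J)" "F_cl (G J k)" for J k using G by (auto simp: Gconv_def)
 define delta where "delta = eps / 6"
 have d: "delta > 0" using e by (simp add: delta_def)
 \<comment> \<open>With this measure of the strip the growth bound gives at most
   \<open>delta\<close> for the energy of \<open>u\<close> there, uniformly in
   \<open>J\<close>.\<close>
 have "delta / (\<beta> + 1) > 0" using d nums by simp
 from inner_exhaust[OF U Lu(1) this] obtain C V where V: "compact C" "admissible D V" "V <= C" "C <= U"
  and dV: "vol (U - V) + pint p (U - V) (grd u) < delta / (\<beta> + 1)" by blast
 note VV = adm[OF V(2)]
 have VU: "V <= U" using V by auto
 have UVm: "U - V : lmeasurable" using UU VV by (auto intro: fmeasurable.Diff)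
 have pU: "pint p U (grd (us (s n))) <= c / \<alpha>" for n
  using energy_lower[OF F Lp_grd(1)[OF us(1)] UU(1,2), of "s n" "s n"] c[of n] \<alpha> unfolding intfun_grd[OF UU(1)] by (simp add: field_simps)
 obtain z Z and og :: "nat => real^'d => real^'d^'m" where z0: "(%n. pint p UNIV (z n)) ----> 0" "(%n. pint p UNIV (og n)) ----> 0"
  and z: "!!n. sob p UNIV (z n) (Z n)" "!!n x. x ~: U ==> z n x = 0" "!!n x. x : C ==> grd u x + Z n x = grd (us (s n)) x"
   "!!n. pint p UNIV (Z n) <= 2 powr p * (2 powr p * (pint p U (grd (us (s n))) + pint p U (grd u)) + pint p UNIV (og n))"
  using cutoff_sequence[OF u us(1) weak_W1p_subseq[OF us(2) s] U always_eventually[OF allI[OF pU]] V(1,4)] by (elim exE conjE) (rule that, assumption, assumption, blast+)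
 obtain B where "!!n. pint p UNIV (og n) <= B"
  using convergent_imp_Bseq[OF convergentI[OF z0(2)]] unfolding Bseq_def real_norm_def abs_le_iff by blast
 hence "2 powr p * (2 powr p * (pint p U (grd (us (s n))) + pint p U (grd u)) + pint p UNIV (og n)) <= 2 powr p * (2 powr p * (c / \<alpha> + pint p U (grd u)) + B)" for n
  by (intro mult_left_mono add_mono add_right_mono pU) auto
 from order_trans[OF z(4) this] obtain M where M: "!!n. pint p UNIV (Z n) <= M" by blast
 have bU: "bounded U" using U by (simp add: admissible_def)
 obtain r w M' T where r: "strict_mono r" and w: "(%l. pint p UNIV (w l)) ----> 0" "!!l. sob p UNIV (w l) (cgrad (w l))" "!!l. pint p UNIV (cgrad (w l)) <= M'" "EV l. pint p UNIV (cgrad (w l)) <= 1 + 2 powr p * (1 + M)"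
  and ev0: "EV l. ALL f. F_cl f --> energy f V (%x. grd u x + cgrad (w l) x) <= energy f V (%x. grd u x + Z (r l) x) + delta"
  and T: "!!l f g c. F_cl f ==> F_cl g ==> near f g U T c ==> 0 <= c ==>
   abs (energy f V (%x. grd u x + cgrad (w l) x) - energy g V (%x. grd u x + cgrad (w l) x)) <= c + delta"
  by (rule concentration_free[OF Lu(1) z(1) _ M z0(1) bU VU VV(1,2) d]; rule z(2) that)
 obtain J0 where J0: "!!J. J >= J0 ==> EV k. near (F k) (G J k) U T delta" using cl d unfolding closeF_def by blast
 define q where "q l = s (r l)" for l
 have q: "strict_mono q" using s r by (simp add: q_def strict_mono_def)
 have qi: "inj q" using q by (rule strict_mono_imp_inj_on)
 \<comment> \<open>Gamma-convergence concerns full sequences. The perturbations are available along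
   \<open>q\<close> only and are filled up with zero.\<close>
 define v where "v k = (if k : range q then w (inv q k) else (%x. 0))" for k
 define v' where "v' k = (if k : range q then cgrad (w (inv q k)) else (%x. 0))" for k
 have vq: "v (q l) = w l" "v' (q l) = cgrad (w l)" for l using qi by (auto simp: v_def v'_def)
 have sv: "sob p UNIV (v k) (v' k)" for k using w(2) by (simp add: v_def v'_def sob_0)
 have v0: "(%k. pint p UNIV (v k)) ----> 0" using tendsto_fill[OF q w(1)] by (rule Lim_transform_eventually) (simp add: v_def pint_zero_fun)
 have vM: "pint p UNIV (v' k) <= max 0 M'" for k using w(3) by (auto simp: v'_def pint_zero_fun intro: max.coboundedI2)
 note W = weak_W1pI[OF D p u sv v0 vM]
 show ?thesis unfolding eventually_sequentially
 proof (intro exI[of _ J0] allI impI)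
  fix J assume J: "J >= J0"
  have "ereal (intfun p D (h J) V u) <= liminf (%k. ereal (intfun p D (G J k) V (%x. u x + v k x)))"
   using G[of J] V(2) u W unfolding Gconv_def gamma_conv_def by auto
  hence "EV k. intfun p D (h J) V u - delta < intfun p D (G J k) V (%x. u x + v k x)" using d unfolding real_liminf_iff by blast
  from eventually_conj[OF this J0[OF J]] have "EV l. intfun p D (h J) V u - delta < intfun p D (G J (q l)) V (%x. u x + v (q l) x) &
   (near (F (q l)) (G J (q l)) U T delta)" by (rule eventually_compose_filterlim[OF _ filterlim_subseq[OF q]])
  from eventually_happens'[OF _ eventually_conj[OF this ev0]] obtain l where
   l: "intfun p D (h J) V u - delta < intfun p D (G J (q l)) V (%x. u x + v (q l) x)" "near (F (q l)) (G J (q l)) U T delta"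
   "ALL f. F_cl f --> energy f V (%x. grd u x + cgrad (w l) x) <= energy f V (%x. grd u x + Z (r l) x) + delta" by auto
  have 1: "energy (h J) V (grd u) - delta < energy (G J (q l)) V (%x. grd u x + cgrad (w l) x)"
   using l(1)[unfolded intfun_add[OF u sv V(2) hF(2)], unfolded vq intfun_grd[OF VV(1)]] .
  have 2: "energy (G J (q l)) V (%x. grd u x + cgrad (w l) x) <= energy (F (q l)) V (%x. grd u x + cgrad (w l) x) + delta + delta"
   using T[OF F hF(2) l(2), of l] d by simp
  have 3: "energy (F (q l)) V (%x. grd u x + cgrad (w l) x) <= energy (F (q l)) V (%x. grd u x + Z (r l) x) + delta" using l(3) F by blast
  have 4: "energy (F (q l)) V (%x. grd u x + Z (r l) x) = energy (F (q l)) V (grd (us (q l)))" unfolding energy_def set_lebesgue_integral_def q_def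
   by (rule Bochner_Integration.integral_cong) (use z(3) V(3) in "auto simp: indicator_def")
  have sp: "V \<union> (U - V) = U" "V \<inter> (U - V) = {}" using VU by auto
  have UVD: "U - V <= D" using UU by auto
  have eU: "energy f U H = energy f V H + energy f (U - V) H" if "F_cl f" "Lp p H" for f and H :: "real^'d => real^'d^'m"
   using energy_Un[OF that VV(1) UVD VV(2) UVm sp(2)] unfolding sp(1) .
  have 5: "energy (F (q l)) V (grd (us (q l))) <= c"
   using eU[OF F Lp_grd(1)[OF us(1)], of "q l" "q l"] energy_nonneg[OF F UVD, of "q l"] c[of "r l"] unfolding intfun_grd[OF UU(1)] q_def by (smt (verit))
  have "energy (h J) (U - V) (grd u) <= \<beta> * (vol (U - V) + pint p (U - V) (grd u))" by (rule energy_upper[OF hF(1) Lu(1) UVD UVm])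
  also have "... <= \<beta> * (delta / (\<beta> + 1))" using dV nums by (intro mult_left_mono) auto
  also have "... <= delta" using d nums by (simp add: field_simps)
  finally have 6: "energy (h J) (U - V) (grd u) <= delta" .
  have "energy (h J) U (grd u) = energy (h J) V (grd u) + energy (h J) (U - V) (grd u)" by (rule eU[OF hF(1) Lu(1)])
  moreover have "6 * delta = eps" by (simp add: delta_def)
  ultimately show "energy (h J) U (grd u) <= c + eps" using 1 2 3 4 5 6 d by linarith
 qed
qed

text \<open>Recovery sequences of \<open>G J\<close> may concentrate, and concentrations can be
  removed only along subsequences. The claim is therefore proved by contradiction: infinitely many
  failing \<open>k\<close> are paired with ever later \<open>J\<close> and ever better closeness,
  and after removal of concentrations one of them does not fail.\<close>

lemma close_upper:
 fixes u :: "real^'d => real^'m"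
 assumes F: "!!k. F_cl (F k)" and G: "!!J. Gconv (G J) (h J)" and cl: "closeF F G U" and U: "admissible D U" and u: "sobolev p D u"
  and L: "!!eps. eps > 0 ==> FQ J. energy (h J) U (grd u) <= L + eps"
 shows "reachable F U u L"
proof -
 note UU = adm[OF U] and Lu = Lp_grd[OF u]
 have hF: "F_cl (h J)" "F_cl (G J k)" for J k using G by (auto simp: Gconv_def)
 obtain M where M: "!!eps g h. eps > 0 ==> Gconv g h ==> EV k. perturbable (g k) h U u M eps" using boundary_recovery[OF u U] by blast
 \<comment> \<open>The bound on the gradients that \<open>concentration_free\<close> guarantees
   eventually. It is fixed before \<open>eps\<close>, as \<open>reachable\<close> requires.\<close>
 define M' where "M' = 1 + 2 powr p * (1 + M)"
 define good where "good eps k \<longleftrightarrow> (EX w W. sob p UNIV w W & pint p UNIV w <= eps & pint p UNIV W <= M' & energy (F k) U (%x. grd u x + W x) <= L + eps)" for eps k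
 have "EV k. good eps k" if ep: "eps > 0" for eps
 proof (rule ccontr)
  assume "~ (EV k. good eps k)"
  hence bad: "FQ k. ~ good eps k" by (simp add: not_eventually)
  define e where "e n = 1 / (real n + 1)" for n
  have e0: "e n > 0" for n by (simp add: e_def)
  have elim: "e ----> 0" unfolding e_def by real_asymp
  have "ALL n. EX k J z Z. ~ good eps k & sob p UNIV z Z & (ALL x. x ~: U --> z x = 0) & pint p UNIV z <= e n & pint p UNIV Z <= M &
   energy (G J k) U (%x. grd u x + Z x) <= L + 2 * e n & (near (F k) (G J k) U (real n) (e n))"
  proof
   fix n
   obtain J0 where J0: "!!J. J >= J0 ==> EV k. near (F k) (G J k) U (real n) (e n)" using cl e0 unfolding closeF_def by blast
   obtain J where J: "J >= J0" "energy (h J) U (grd u) <= L + e n"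
    using frequently_eventually_frequently[OF L[OF e0] eventually_ge_at_top[of J0]] frequently_ex by blast
   obtain k where "~ good eps k" and k: "perturbable (G J k) (h J) U u M (e n)" "near (F k) (G J k) U (real n) (e n)"
    using frequently_eventually_frequently[OF bad eventually_conj[OF M[OF e0 G] J0[OF J(1)]]] frequently_ex by blast
   from k(1) obtain z Z where "sob p UNIV z Z" "ALL x. x ~: U --> z x = 0 & Z x = 0" "pint p UNIV z <= e n" "pint p UNIV Z <= M"
    "energy (G J k) U (%x. grd u x + Z x) <= energy (h J) U (grd u) + e n" by (elim exE conjE) (rule that)
   moreover from this(5) J(2) have "energy (G J k) U (%x. grd u x + Z x) <= L + 2 * e n" by linarith
   ultimately show "EX k J z Z. ~ good eps k & sob p UNIV z Z & (ALL x. x ~: U --> z x = 0) & pint p UNIV z <= e n & pint p UNIV Z <= M &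
    energy (G J k) U (%x. grd u x + Z x) <= L + 2 * e n & (near (F k) (G J k) U (real n) (e n))"
    using \<open>~ good eps k\<close> k(2) by (intro exI[of _ k] exI[of _ J] exI[of _ z] exI[of _ Z]) auto
  qed
  from this[unfolded choice_iff] obtain k J z Z where all: "ALL n. ~ good eps (k n) & sob p UNIV (z n) (Z n) & (ALL x. x ~: U --> z n x = 0) & pint p UNIV (z n) <= e n & pint p UNIV (Z n) <= M &
   energy (G (J n) (k n)) U (%x. grd u x + Z n x) <= L + 2 * e n & (near (F (k n)) (G (J n) (k n)) U (real n) (e n))" by (elim exE) (rule that)
  have kg: "~ good eps (k n)" and z: "sob p UNIV (z n) (Z n)" "x ~: U ==> z n x = 0" "pint p UNIV (z n) <= e n" "pint p UNIV (Z n) <= M"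
   and en: "energy (G (J n) (k n)) U (%x. grd u x + Z n x) <= L + 2 * e n"
   and cn: "near (F (k n)) (G (J n) (k n)) U (real n) (e n)" for n x using all by blast+
  have z0: "(%n. pint p UNIV (z n)) ----> 0" by (rule tendsto_sandwich[OF _ _ tendsto_const elim]) (use z(3) in auto)
  define delta where "delta = eps / 5"
  have d: "delta > 0" "5 * delta = eps" using ep by (auto simp: delta_def)
  have bU: "bounded U" using U by (simp add: admissible_def)
  obtain r w B T where r: "strict_mono r" and w: "(%l. pint p UNIV (w l)) ----> 0" "!!l. sob p UNIV (w l) (cgrad (w l))" "!!l. pint p UNIV (cgrad (w l)) <= B" "EV l. pint p UNIV (cgrad (w l)) <= M'"
   and ev0: "EV l. ALL f. F_cl f --> energy f U (%x. grd u x + cgrad (w l) x) <= energy f U (%x. grd u x + Z (r l) x) + delta"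
   and T: "!!l f g c. F_cl f ==> F_cl g ==> near f g U T c ==> 0 <= c ==>
    abs (energy f U (%x. grd u x + cgrad (w l) x) - energy g U (%x. grd u x + cgrad (w l) x)) <= c + delta"
   by (rule concentration_free[OF Lu(1) z(1) _ z(4) z0 bU order_refl UU(1,2) d(1), folded M'_def]; rule z(2) that)
  have er: "(%l. e (r l)) ----> 0" using LIMSEQ_subseq_LIMSEQ[OF elim r] by (simp add: o_def)
  \<comment> \<open>Closeness was imposed at the growing heights \<open>n\<close>, before the height
    \<open>T\<close> was known; it covers \<open>T\<close> from some index on.\<close>
  have "EV l. T <= real (r l)" using filterlim_compose[OF filterlim_real_sequentially filterlim_subseq[OF r]] unfolding filterlim_at_top by blast
  with order_tendstoD(2)[OF er d(1)] order_tendstoD(2)[OF w(1) ep] w(4) ev0 have "EV l. False"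
  proof eventually_elim
   fix l assume l: "e (r l) < delta" "pint p UNIV (w l) < eps" "pint p UNIV (cgrad (w l)) <= M'"
    "ALL f. F_cl f --> energy f U (%x. grd u x + cgrad (w l) x) <= energy f U (%x. grd u x + Z (r l) x) + delta" "T <= real (r l)"
   have "near (F (k (r l))) (G (J (r l)) (k (r l))) U T (e (r l))" using cn[of "r l"] l(5) order_trans by blast
   from T[OF F hF(2) this less_imp_le[OF e0], of l]
   have "energy (F (k (r l))) U (%x. grd u x + cgrad (w l) x) <= energy (G (J (r l)) (k (r l))) U (%x. grd u x + cgrad (w l) x) + e (r l) + delta" by linarith
   moreover have "energy (G (J (r l)) (k (r l))) U (%x. grd u x + cgrad (w l) x) <= energy (G (J (r l)) (k (r l))) U (%x. grd u x + Z (r l) x) + delta"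
    using l(4) hF(2) by blast
   ultimately have "energy (F (k (r l))) U (%x. grd u x + cgrad (w l) x) <= L + eps" using en[of "r l"] l(1) d by linarith
   hence "good eps (k (r l))" unfolding good_def using w(2) l(2,3) less_imp_le by blast
   thus False using kg by blast
  qed
  thus False by simp
 qed
 thus ?thesis unfolding reachable_def good_def by blast
qed

text \<open>If energies of infinitely many \<open>h J\<close> come within every \<open>eps\<close>
  of at most \<open>c\<close>, then \<open>F\<close> has a recovery sequence with limiting energy at
  most \<open>c\<close>, and the lower comparison turns it into a bound for all late
  \<open>J\<close>. Hence the upper limit of the energies does not exceed the lower one, and their
  limit is the Gamma-limit of \<open>F\<close>.\<close>

theorem gamma_limit_of_close_functionals:
 fixes F :: "nat => real^'d => real^'d^'m => real"
 assumes F: "!!k. F_cl (F k)" and G: "!!J. Gconv (G J) (h J)" and cl: "closeF F G U" and U: "admissible D U"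
 shows "EX L. (ALL u. sobolev p D u --> (%J. energy (h J) U (grd u)) ----> L u) & Gc (%k. intfun p D (F k) U) L"
proof -
 note UU = adm[OF U]
 have hF: "F_cl (h J)" for J using G by (auto simp: Gconv_def)
 have rec: "EX us. (ALL k. sobolev p D (us k)) & weak_W1p p D us u & limsup (%k. ereal (intfun p D (F k) U (us k))) <= ereal c"
  if "sobolev p D u" "!!eps. eps > 0 ==> FQ J. energy (h J) U (grd u) <= c + eps" for u c
  by (rule reachable_recovery[OF that(1) F U close_upper[OF F G cl U that]])
 have ev: "EV J. energy (h J) U (grd u) <= c + eps"
  if u: "sobolev p D u" and fr: "!!eps. eps > 0 ==> FQ J. energy (h J) U (grd u) <= c + eps" and e: "eps > 0" for u c eps
 proof -
  obtain us where us: "ALL k. sobolev p D (us k)" "weak_W1p p D us u" "limsup (%k. ereal (intfun p D (F k) U (us k))) <= ereal c"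
  proof -
   have "EX us. (ALL k. sobolev p D (us k)) & weak_W1p p D us u & limsup (%k. ereal (intfun p D (F k) U (us k))) <= ereal c"
    by (rule rec[OF u]) (rule fr)
   thus ?thesis by (elim exE conjE) (rule that)
  qed
  have "EV k. intfun p D (F k) U (us k) < c + eps / 2" using us(3) e unfolding real_limsup_iff by simp
  from frequently_subsequence[OF eventually_frequently[OF sequentially_bot this]]
  obtain s :: "nat => nat" where s: "strict_mono s" "ALL n. intfun p D (F (s n)) U (us (s n)) < c + eps / 2" by blast
  have "EV J. energy (h J) U (grd u) <= (c + eps / 2) + eps / 2"
   by (rule close_lower[OF F G cl U u us(1)[rule_format] us(2) s(1) s(2)[rule_format, THEN less_imp_le]]) (use e in simp)
  thus ?thesis by (simp add: add.commute)
 qed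
 have "EX L. (%J. energy (h J) U (grd u)) ----> L" if u: "sobolev p D u" for u
 proof -
  define C where "C = \<beta> * (vol U + pint p U (grd u))"
  \<comment> \<open>Reflection at the bound \<open>C\<close> expresses the lower limit of the
    energies through \<open>real_limsup\<close>.\<close>
  define v where "v J = C - energy (h J) U (grd u)" for J
  have e: "0 <= energy (h J) U (grd u)" "energy (h J) U (grd u) <= C" for J unfolding C_def
   by (rule energy_nonneg[OF hF UU(1)], rule energy_upper[OF hF Lp_grd(1)[OF u] UU(1,2)])
  have v: "0 <= v J" "v J <= C" for J using e[of J] by (auto simp: v_def)
  define c where "c = C - real_limsup v"
  have fr: "FQ J. energy (h J) U (grd u) <= c + eps" if "eps > 0" for eps
   using real_limsup(3)[of v, OF v that] by (rule frequently_elim1) (simp add: v_def c_def)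
  have "(%J. energy (h J) U (grd u)) ----> c"
  proof (rule tendstoI)
   fix e :: real assume e: "e > 0"
   hence "EV J. energy (h J) U (grd u) <= c + e / 2" by (intro ev[OF u fr]) auto
   with real_limsup(4)[of v, OF v e] show "EV J. dist (energy (h J) U (grd u)) c < e"
    by eventually_elim (use e in "auto simp: v_def c_def dist_real_def abs_less_iff")
  qed
  thus ?thesis by blast
 qed
 then obtain L where L: "!!u. sobolev p D u ==> (%J. energy (h J) U (grd u)) ----> L u" by metis
 have "Gc (%k. intfun p D (F k) U) L" unfolding gamma_conv_def
 proof (intro conjI ballI allI impI; simp only: mem_Collect_eq)
  fix u :: "real^'d => real^'m" and us assume u: "sobolev p D u" and us: "ALL k. sobolev p D (us k)" "weak_W1p p D us u"
  show "ereal (L u) <= liminf (%k. ereal (intfun p D (F k) U (us k)))"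
  proof (rule ccontr)
   assume "~ ereal (L u) <= liminf (%k. ereal (intfun p D (F k) U (us k)))"
   then obtain eps where e: "eps > 0" and fr: "FQ k. intfun p D (F k) U (us k) <= L u - eps"
    unfolding real_liminf_iff by (auto simp: not_eventually not_less)
   from frequently_subsequence[OF fr] obtain s :: "nat => nat" where "strict_mono s" "!!n. intfun p D (F (s n)) U (us (s n)) <= L u - eps" by auto
   from close_lower[OF F G cl U u _ us(2) this, of "eps / 2"] us(1) e
   have "EV J. energy (h J) U (grd u) <= L u - eps + eps / 2" by simp
   from tendsto_upperbound[OF L[OF u] this] e show False by simp
  qed
 next
  fix u :: "real^'d => real^'m" assume u: "sobolev p D u"
  show "EX us. (ALL k. sobolev p D (us k)) & weak_W1p p D us u & limsup (%k. ereal (intfun p D (F k) U (us k))) <= ereal (L u)"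
  proof (rule rec[OF u])
   fix eps :: real assume "eps > 0"
   hence "EV J. energy (h J) U (grd u) < L u + eps" by (intro order_tendstoD(2)[OF L[OF u]]) simp
   thus "FQ J. energy (h J) U (grd u) <= L u + eps" by (intro eventually_frequently) (auto elim: eventually_mono)
  qed
 qed
 thus ?thesis using L by blast
qed

end

subsection \<open>Piecewise combinations of the approximating integrands\<close>

lemma ball_lmeasurable: "ball x r : lmeasurable" for x :: "real^'d" by (rule lmeasurable_ball)

section \<open>Lebesgue points\<close>

text \<open>Only the lower half of the Lebesgue point property is kept. Approximate \<open>h\<close>
  by a continuous function; failure is then confined to the maximal set of the difference and to the
  set where the difference itself is large, and both have small measure.\<close>

lemma lebesgue_points:
 fixes h :: "real^'d => real"
 assumes h: "integ h"
 shows "AEL x. ALL e>0. \<forall>\<^sub>F r in at_right 0. (h x - e) * vol (ball x r) <= (LINT y:ball x r|lebesgue. h y)"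
proof -
 define N where "N e = {x. ~ (\<forall>\<^sub>F r in at_right 0. (h x - e) * vol (ball x r) <= (LINT y:ball x r|lebesgue. h y))}" for e
 have "negligible (N e)" if e: "e > 0" for e unfolding negligible_outer_le
 proof (intro allI impI)
  fix eta :: real assume eta: "eta > 0"
  \<comment> \<open>One third of \<open>e\<close> each for the difference of \<open>h\<close> and
    \<open>c\<close> at \<open>x\<close>, for the oscillation of \<open>c\<close> on the ball, and
    for the mean of \<open>g\<close>.\<close>
  define s where "s = e / 3"
  have s: "s > 0" using e by (simp add: s_def)
  define delta where "delta = eta / ((5 ^ CARD('d) + 1) / s)"
  have d: "delta > 0" using eta s by (simp add: delta_def add_pos_pos)
  have hm: "h : BL" "(np 1 h) < \<infinity>" using h by (auto simp: integrable_iff_bounded)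
  obtain c M where c: "continuous_on UNIV c" "!!x. norm x > M ==> c x = 0" "(np 1 (%x. h x - c x)) < ennreal delta"
   by (rule Lp_approx_continuous[OF hm zero_less_one d]) (rule that)
  have ci: "integ c" by (rule continuous_compact_support_integrable(2)[OF c(1), of M]) (rule c(2))
  define g where "g x = abs (h x - c x)" for x
  have gi: "integ g" unfolding g_def using h ci by auto
  have g0: "g x >= 0" for x by (simp add: g_def)
  have gd: "(LI x. g x) <= delta" by (rule integral_le_of_nn) (use c(3) d in "auto simp: g_def")
  define S where "S = {x : space lebesgue. g x >= s}"
  have Se: "emeasure lebesgue S <= ennreal ((1 / s) * (LI x. g x))" unfolding S_def by (rule integral_Markov_inequality[OF gi]) (use g0 s in auto)
  have Sm: "S : lmeasurable" "vol S <= delta / s"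
  proof -
   have "S : sets lebesgue" unfolding S_def using gi by measurable
   thus "S : lmeasurable" using Se by (auto simp: fmeasurable_def intro: order_le_less_trans)
   have "vol S <= (1 / s) * (LI x. g x)" unfolding measure_def
    by (rule enn2real_leI[OF _ Se]) (use s g0 in "auto intro!: divide_nonneg_pos integral_nonneg_AE")
   also have "... <= delta / s" using gd s by (simp add: divide_right_mono)
   finally show "vol S <= delta / s" .
  qed
  note mm = maximal_set_measure[OF gi g0 s]
  have "vol (maximal_set g s) <= 5 ^ CARD('d) / s * delta" using order_trans[OF mm(2) mult_left_mono[OF gd]] s by simp
  hence "vol (maximal_set g s \<union> S) <= 5 ^ CARD('d) / s * delta + delta / s"
   using measure_Un_le[of "maximal_set g s" lebesgue S] mm(1) Sm by (simp add: fmeasurableD)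
  also have "... = (5 ^ CARD('d) + 1) / s * delta" by (simp add: add_divide_distrib distrib_right)
  also have "... = eta" using s by (simp add: delta_def add_pos_pos less_imp_neq[THEN not_sym])
  finally have T: "vol (maximal_set g s \<union> S) <= eta" .
  have "x : maximal_set g s \<union> S" if "x : N e" for x
  proof (rule ccontr)
   assume x: "x ~: maximal_set g s \<union> S"
   have "isCont c x" using c(1) by (simp add: continuous_on_eq_continuous_at)
   then obtain r0 where r0: "r0 > 0" "!!y. dist y x < r0 ==> dist (c y) (c x) < s" using s unfolding continuous_at_eps_delta by blast
   have "(h x - e) * vol (ball x r) <= (LINT y:ball x r|lebesgue. h y)" if r: "0 < r" "r < r0" for r
   proof -
    have i: "set_integrable lebesgue (ball x r) f" if "integ f" for f :: "real^'d => real" by (rule set_integrable_subset_lebesgue[OF that]) simp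
    have ik: "set_integrable lebesgue (ball x r) (%x. k::real)" for k by (rule set_integrable_const[OF ball_lmeasurable])
    have "(LINT y:ball x r|lebesgue. (c x - s) - g y) <= (LINT y:ball x r|lebesgue. h y)"
    proof (rule set_integral_mono_AE[OF set_integral_diff(1)[OF ik i[OF gi]] i[OF h]], rule AE_I2, rule impI)
     fix y assume "y : ball x r"
     hence "abs (c y - c x) < s" using r0(2)[of y] r by (simp add: dist_commute dist_real_def)
     thus "(c x - s) - g y <= h y" unfolding g_def by linarith
    qed
    hence "(c x - s) * vol (ball x r) - (LINT y:ball x r|lebesgue. g y) <= (LINT y:ball x r|lebesgue. h y)"
     using set_integral_diff(2)[OF ik i[OF gi], of "c x - s"] set_integral_const[OF ball_lmeasurable, of x r "c x - s"] by simp
    moreover have "(LINT y:ball x r|lebesgue. g y) <= s * vol (ball x r)"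
    proof (rule ccontr)
     assume "~ (LINT y:ball x r|lebesgue. g y) <= s * vol (ball x r)"
     hence "x : maximal_set g s" unfolding maximal_set_def using r by (intro CollectI exI[of _ r] conjI) linarith+
     thus False using x by simp
    qed
    moreover have "(h x - e) * vol (ball x r) <= (c x - s - s) * vol (ball x r)"
    proof (rule mult_right_mono)
     have "abs (h x - c x) < s" using x by (auto simp: S_def g_def)
     thus "h x - e <= c x - s - s" unfolding s_def by linarith
    qed simp
    ultimately show ?thesis by (simp add: algebra_simps)
   qed
   hence "x ~: N e" unfolding N_def eventually_at_right_field using r0(1) by auto
   thus False using that by simp
  qed
  thus "EX T. N e <= T & T : lmeasurable & vol T <= eta"
   using T mm(1) Sm(1) by (intro exI[of _ "maximal_set g s \<union> S"]) auto
 qed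
 hence "AEL x. x ~: N (1 / (real n + 1))" for n by (intro AE_not_in) (simp add: negligible_iff_null_sets[symmetric])
 hence "AEL x. ALL n. x ~: N (1 / (real n + 1))" by (simp add: AE_all_countable)
 thus ?thesis
 proof eventually_elim
  fix x assume x: "ALL n. x ~: N (1 / (real n + 1))"
  show "ALL e>0. \<forall>\<^sub>F r in at_right 0. (h x - e) * vol (ball x r) <= (LINT y:ball x r|lebesgue. h y)"
  proof (intro allI impI)
   fix e :: real assume "e > 0"
   then obtain n where n: "1 / (real n + 1) < e" using reals_Archimedean[of e] by (auto simp: inverse_eq_divide add.commute)
   have "\<forall>\<^sub>F r in at_right 0. (h x - 1 / (real n + 1)) * vol (ball x r) <= (LINT y:ball x r|lebesgue. h y)" using x by (auto simp: N_def)
   thus "\<forall>\<^sub>F r in at_right 0. (h x - e) * vol (ball x r) <= (LINT y:ball x r|lebesgue. h y)"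
    by (rule eventually_mono) (rule order_trans[OF mult_right_mono], use n in auto)
  qed
 qed
qed

section \<open>Index functions constant on finitely many balls\<close>

text \<open>Overwriting one ball at a time mirrors \<open>Gconv_glue\<close>, so Gamma-convergence
  of a combination follows by induction.\<close>

inductive glued :: "(real^'d => nat) => bool" where const: "glued (%x. j)"
| update: "glued i ==> glued (%x. if x : ball c r then j else i x)"

lemma glued_integrable:
 assumes "glued i" "!!j. integ (phi j)" shows "integ (%x. phi (i x) x :: real)" using assms(1)
proof induction
 case (update i c r j)
 have "integ (%x. ind (ball c r) x *R phi j x + ind (- ball c r) x *R phi (i x) x)"
  by (intro Bochner_Integration.integrable_add integrable_mult_indicator assms update) (auto simp: borel_open[THEN sets.compl_sets, simplified] Compl_eq_Diff_UNIV)
 thus ?case by (rule Bochner_Integration.integrable_cong[THEN iffD1, rotated -1]) (auto simp: indicator_def)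
qed (rule assms)

lemma glued_exists:
 assumes "finite C" "!!s t. s : C ==> t : C ==> s ~= t ==> ball (fst s) (snd s) \<inter> ball (fst t) (snd t) = {}"
 shows "EX i. glued i & (ALL s:C. ALL x:ball (fst s) (snd s). i x = j s) & (ALL x. (ALL s:C. x ~: ball (fst s) (snd s)) --> i x = J)"
 using assms
proof (induction C)
 case empty thus ?case using glued.const by (intro exI[of _ "%x. J"]) auto
next
 case (insert t C)
 then obtain i where i: "glued i" "ALL s:C. ALL x:ball (fst s) (snd s). i x = j s" "ALL x. (ALL s:C. x ~: ball (fst s) (snd s)) --> i x = J" by auto
 have "ball (fst s) (snd s) \<inter> ball (fst t) (snd t) = {}" if "s : C" for s using insert.prems[of s t] insert.hyps(2) that by auto
 thus ?case using i by (intro exI[of _ "%x. if x : ball (fst t) (snd t) then j t else i x"] conjI glued.update) (auto simp del: mem_ball)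
qed

context growth
begin

lemma glued_Gconv:
 assumes "glued i" "!!j. Gconv (g j) (h j)" shows "Gconv (%k x. g (i x) k x) (%x. h (i x) x)" using assms(1)
proof induction
 case (update i c r j)
 have "(%k x. g (if x : ball c r then j else i x) k x) = (%k x. if x : ball c r then g j k x else g (i x) k x)"
  "(%x. h (if x : ball c r then j else i x) x) = (%x. if x : ball c r then h j x else h (i x) x)" by (auto simp: fun_eq_iff)
 thus ?case using Gconv_glue[OF update.IH assms(2)] by (simp only:)
qed (rule assms)

abbreviation osc :: "(real^'d => real^'d^'m => real) => (real^'d => real^'d^'m => real) => real => real^'d => ennreal" where
 "osc f g t y \<equiv> (SUP \<xi>\<in>cball 0 t. ennreal \<bar>f y \<xi> - g y \<xi>\<bar>)"

abbreviation (input) "osc_lim f g E x t j \<equiv> Limsup (at 0 within E) (%rho. limsup (%k. ennreal (1 / rho ^ CARD('d)) *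
 (nns (ball x rho) (%y. osc (f k) (g j k) t y))))"

abbreviation (input) "osc_small f g E \<equiv> AEL x. x : D --> (ALL t>0. (%j. osc_lim f g E x t j) ----> 0)"

text \<open>Around almost every point a late index is good on small balls; by Vitali's theorem finitely many disjoint balls suffice.\<close>

lemma combination:
 fixes f :: "nat => real^'d => real^'d^'m => real"
 assumes F: "!!k. F_cl (f k)" and G: "!!j. Gconv (g j) (h j)" and U: "admissible D U" and E: "E <= {0<..}" "0 : closure E"
  and osc: "osc_small f g E" and phi: "!!j. integ (phi j)" and b: "AEL x. x : U --> (ALL j. abs (phi j x) <= B)"
  and fr: "AEL x. x : U --> (ALL e>0. FQ j. - e < phi j x)" and B: "B >= 0" and ep: "eps > 0"
 shows "EX i. glued i & (ALL x. J <= i x) & - eps <= (LINT x:U|lebesgue. phi (i x) x) &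
  (EV k. near (f k) (%x. g (i x) k x) U (real J) eps)"
proof -
 note UU = adm[OF U]
 define om where "om = vol (ball (0::real^'d) 1)"
 have w: "om > 0" unfolding om_def by (rule measure_ball_pos) simp
 have mb: "vol (ball x r) = r ^ CARD('d) * om" if "r > 0" for x :: "real^'d" and r using measure_ball_scale[of r x] that by (simp add: om_def)
 define delta where "delta = eps / (2 * (2 * vol U + vol U / om + 1))"
 have mU: "vol U >= 0" "vol U / om >= 0" using w by auto
 have d: "delta > 0" using ep mU by (auto simp: delta_def intro!: divide_pos_pos add_nonneg_pos)
 have d2: "2 * delta * vol U <= eps / 2" "delta / om * vol U <= eps / 2"
 proof -
  have "delta * (2 * vol U + vol U / om + 1) = eps / 2" using mU by (simp add: delta_def add_nonneg_eq_0_iff field_simps)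
  moreover have "delta * (2 * vol U + vol U / om + 1) = 2 * delta * vol U + delta / om * vol U + delta" by (simp add: algebra_simps)
  moreover have "0 <= delta / om * vol U" "0 <= 2 * delta * vol U" using d w by (auto intro!: mult_nonneg_nonneg divide_nonneg_pos)
  ultimately show "2 * delta * vol U <= eps / 2" "delta / om * vol U <= eps / 2" using d by linarith+
 qed
 \<comment> \<open>A common bound on the uncovered part of \<open>U\<close>: for the difference of
   the integrands at arguments of norm at most \<open>J\<close>, and for \<open>phi\<close>.\<close>
 define c where "c = 2 * \<beta> * (1 + real J powr p) + B + 1"
 have c: "c > 0" using nums B by (auto simp: c_def intro!: add_nonneg_pos)
 define eta where "eta = eps / (2 * c)"
 have eta: "eta > 0" "c * eta = eps / 2" using ep c by (auto simp: eta_def)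
 \<comment> \<open>A ball with an index that is good in two respects: the mean of
   \<open>phi j\<close> over it is almost nonnegative, and the oscillation integral is eventually
   small relative to its volume. In this form the estimates can be summed over disjoint
   balls.\<close>
 define Q where "Q x rho j \<longleftrightarrow> rho > 0 & ball x rho <= U & j >= J & - (2 * delta) * vol (ball x rho) <= (LINT y:ball x rho|lebesgue. phi j y) &
  (EV k. (nns (ball x rho) (%y. osc (f k) (g j k) (real J + 1) y)) <= ennreal (delta * rho ^ CARD('d)))" for x rho j
 have E0: "at 0 within E ~= bot" using E by (auto simp: trivial_limit_within closure_def)
 have "AEL x. ALL j. ALL e>0. \<forall>\<^sub>F r in at_right 0. (phi j x - e) * vol (ball x r) <= (LINT y:ball x r|lebesgue. phi j y)"
  unfolding AE_all_countable using lebesgue_points[OF phi] by blast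
 with osc fr have "AEL x. x : U --> (ALL d>0. EX rho j. rho < d & Q x rho j)"
 proof eventually_elim
  fix x
  assume o: "x : D --> (ALL t>0. (%j. osc_lim f g E x t j) ----> 0)"
   and fx: "x : U --> (ALL e>0. FQ j. - e < phi j x)"
   and lp: "ALL j. ALL e>0. \<forall>\<^sub>F r in at_right 0. (phi j x - e) * vol (ball x r) <= (LINT y:ball x r|lebesgue. phi j y)"
  show "x : U --> (ALL d>0. EX rho j. rho < d & Q x rho j)"
  proof (intro impI allI)
   fix d0 :: real assume x: "x : U" and d0: "d0 > 0"
   \<comment> \<open>The height is \<open>real J + 1\<close> because the hypothesis concerns
     positive heights and \<open>J\<close> may be 0.\<close>
   have "(%j. osc_lim f g E x (real J + 1) j) ----> 0" using o x UU(1) by auto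
   moreover have "0 < ennreal delta" using d by simp
   ultimately have ev: "EV j. osc_lim f g E x (real J + 1) j < ennreal delta" by (rule order_tendstoD(2))
   have "FQ j. - delta < phi j x" using fx x d by blast
   \<comment> \<open>Infinitely many indices satisfy the condition on \<open>phi\<close>, all late
     ones the condition on the oscillation, so both can be met with \<open>J <= j\<close>.\<close>
   from frequently_ex[OF frequently_eventually_frequently[OF this eventually_conj[OF ev eventually_ge_at_top[of J]]]]
   obtain j where j: "osc_lim f g E x (real J + 1) j < ennreal delta" "- delta < phi j x" "J <= j" by (elim exE conjE) (rule that)
   have le: "at 0 within E <= at_right (0::real)" by (rule at_le[OF E(1)])
   obtain r0 where r0: "r0 > 0" "ball x r0 <= U" using openE[OF UU(3) x] by blast
   have "\<forall>\<^sub>F r in at_right 0. r < min d0 r0" unfolding eventually_at_right_field using d0 r0(1) by (intro exI[of _ "min d0 r0"]) auto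
   hence "\<forall>\<^sub>F r in at_right 0. (phi j x - delta) * vol (ball x r) <= (LINT y:ball x r|lebesgue. phi j y) & 0 < r & r < min d0 r0"
    using lp d by (intro eventually_conj eventually_at_right_less) auto
   from eventually_happens'[OF E0 eventually_conj[OF Limsup_lessD[OF j(1)] filter_leD[OF le this]]]
   obtain rho where r: "(phi j x - delta) * vol (ball x rho) <= (LINT y:ball x rho|lebesgue. phi j y)" "0 < rho" "rho < d0" "rho < r0"
    "limsup (%k. ennreal (1 / rho ^ CARD('d)) * (nns (ball x rho) (%y. osc (f k) (g j k) (real J + 1) y))) < ennreal delta"
    unfolding min_less_iff_conj by (elim exE conjE) (rule that)
   from Limsup_lessD[OF r(5)] have e1: "EV k. (nns (ball x rho) (%y. osc (f k) (g j k) (real J + 1) y)) <= ennreal (delta * rho ^ CARD('d))"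
   proof eventually_elim
    case (elim k)
    have "(nns (ball x rho) (%y. osc (f k) (g j k) (real J + 1) y)) =
     ennreal (rho ^ CARD('d)) * (ennreal (1 / rho ^ CARD('d)) * (nns (ball x rho) (%y. osc (f k) (g j k) (real J + 1) y)))"
     using r(2) by (simp add: mult.assoc[symmetric] ennreal_mult[symmetric])
    also have "... <= ennreal (rho ^ CARD('d)) * ennreal delta" by (intro mult_left_mono less_imp_le[OF elim]) simp
    finally show ?case using r(2) d by (simp add: ennreal_mult[symmetric] mult.commute)
   qed
   have e2: "- (2 * delta) * vol (ball x rho) <= (phi j x - delta) * vol (ball x rho)" using j(2) by (intro mult_right_mono) auto
   have e3: "ball x rho <= U" using r(4) r0(2) subset_ball[of rho r0 x] by auto
   have "Q x rho j" unfolding Q_def by (intro conjI r(2) e3 j(3) order_trans[OF e2 r(1)] e1)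
   thus "EX rho j. rho < d0 & Q x rho j" using r(3) by blast
  qed
 qed
 hence "EX N:null_sets lebesgue. ALL x:U - N. ALL d>0. EX rho j. rho < d & Q x rho j" by (elim AE_E3) (intro bexI, auto)
 then obtain N where N: "N : null_sets lebesgue" "!!x. x : U - N ==> ALL d>0. EX rho j. rho < d & Q x rho j" by metis
 define b where "b s = ball (fst s) (snd s)" for s :: "(real^'d) \<times> real"
 have "EX s. s : {s. EX j. Q (fst s) (snd s) j} & x : ball (fst s) (snd s) & snd s < t" if "x : U - N" "t > 0" for x t
 proof -
  obtain rho j where "rho < t" "Q x rho j" using N(2) \<open>x : U - N\<close> \<open>t > 0\<close> by blast
  thus ?thesis by (intro exI[of _ "(x, rho)"]) (auto simp: Q_def)
 qed
 from Vitali_covering_theorem_balls[OF this] obtain C where C: "C <= {s. EX j. Q (fst s) (snd s) j}"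
  "pairwise (%s t. disjnt (b s) (b t)) C" "negligible (U - N - (\<Union>s\<in>C. b s))" unfolding b_def by blast
 define W where "W = (\<Union>s\<in>C. b s)"
 have W: "open W" "W <= U" unfolding W_def using C(1) by (auto simp: b_def Q_def)
 have Ws: "W : sets lebesgue" using W(1) by auto
 \<comment> \<open>A compact set inside the union reduces the countable Vitali family to a finite
   one, at the cost of measure at most \<open>eta\<close>.\<close>
 obtain T where T: "closed T" "T <= W" "W - T : lmeasurable" "emeasure lebesgue (W - T) < ennreal eta"
  by (rule sets_lebesgue_inner_closed[OF Ws eta(1)])
 have "compact T" using T W U bounded_subset[of U T] by (auto simp: compact_eq_bounded_closed admissible_def)
 from compactE_image[OF this, of C b] obtain C' where C': "C' <= C" "finite C'" "T <= (\<Union>s\<in>C'. b s)"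
  using T(2) by (auto simp: W_def b_def)
 define V where "V = (\<Union>s\<in>C'. b s)"
 have V: "open V" "V <= U" using C'(1) W(2) by (auto simp: V_def W_def b_def)
 have Vs: "V : sets lebesgue" "U - V : lmeasurable" using V(1) UU(2) by (auto intro: fmeasurable_Diff)
 have "negligible (U - W)" by (rule negligible_subset[OF negligible_Un[OF C(3), of N]]) (use N(1) in "auto simp: W_def negligible_iff_null_sets")
 moreover have "vol (W - T) <= eta" unfolding measure_def using T(4) eta(1) by (intro enn2real_leI less_imp_le)
 moreover have "vol (U - V) <= vol ((U - W) \<union> (W - T))" using C'(3) T(3) Vs(2) UU(2) Ws
  by (intro measure_mono_fmeasurable) (auto simp: V_def intro!: fmeasurable.Un fmeasurable_Diff)
 ultimately have vZ: "vol (U - V) <= eta" using measure_Un_le[of "U - W" lebesgue "W - T"] T(3) UU(4) Ws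
  by (simp add: negligible_imp_measure0 fmeasurableD)
 have "ALL s:C'. EX j. Q (fst s) (snd s) j" using C(1) C'(1) by auto
 then obtain j where j: "!!s. s : C' ==> Q (fst s) (snd s) (j s)" unfolding bchoice_iff by blast
 have dj: "disjoint_family_on b C'" using C(2) C'(1) unfolding disjoint_family_on_def pairwise_def disjnt_def by blast
 have "b s \<inter> b t = {}" if "s : C'" "t : C'" "s ~= t" for s t using dj that by (auto simp: disjoint_family_on_def)
 from glued_exists[OF C'(2) this[unfolded b_def], of j J]
 have "EX i. glued i & (ALL s:C'. ALL x:b s. i x = j s) & (ALL x. x ~: V --> i x = J)" by (simp add: b_def V_def del: mem_ball)
 then obtain i where i: "glued i" "ALL s:C'. ALL x:b s. i x = j s" "ALL x. x ~: V --> i x = J" by (elim exE conjE) (rule that)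
 have iJ: "J <= i x" for x using i(2,3) j by (cases "x : V") (auto simp: V_def Q_def)
 have vb: "vol (b s) = snd s ^ CARD('d) * om" if "s : C'" for s unfolding b_def by (rule mb) (use j[OF that] in "simp add: Q_def")
 have vV: "(\<Sum>s\<in>C'. vol (b s)) <= vol U"
 proof -
  have "vol V = (\<Sum>s\<in>C'. vol (b s))" unfolding V_def by (rule measure_finite_Union[OF C'(2) _ dj]) (auto simp: b_def fmeasurableD2[OF ball_lmeasurable, simplified])
  thus ?thesis using measure_mono_fmeasurable[OF V(2) Vs(1) UU(2)] by simp
 qed
 have "- eps <= (LINT x:U|lebesgue. phi (i x) x)"
 proof -
  have si: "set_integrable lebesgue A (%x. phi (i x) x)" if "A : sets lebesgue" for A
   by (rule set_integrable_subset_lebesgue[OF glued_integrable[OF i(1) phi] that])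
  have "(LINT x:V|lebesgue. phi (i x) x) = (\<Sum>s\<in>C'. LINT x:b s|lebesgue. phi (i x) x)"
   unfolding V_def by (rule set_integral_finite_Union[OF C'(2) dj si]) (auto simp: b_def)
  moreover have "- (2 * delta) * vol (b s) <= (LINT x:b s|lebesgue. phi (i x) x)" if "s : C'" for s
  proof -
   have "(LINT x:b s|lebesgue. phi (i x) x) = (LINT x:b s|lebesgue. phi (j s) x)" unfolding set_lebesgue_integral_def
    by (rule Bochner_Integration.integral_cong) (use i(2) that in "auto simp: indicator_def")
   thus ?thesis using j[OF that] by (simp add: Q_def b_def)
  qed
  hence "(\<Sum>s\<in>C'. - (2 * delta) * vol (b s)) <= (\<Sum>s\<in>C'. LINT x:b s|lebesgue. phi (i x) x)" by (rule sum_mono)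
  moreover have "(\<Sum>s\<in>C'. - (2 * delta) * vol (b s)) >= - (eps / 2)"
   using order_trans[OF mult_left_mono[OF vV] d2(1)] d by (simp add: sum_distrib_left[symmetric] sum_negf)
  moreover have "(- B) * vol (U - V) <= (LINT x:U-V|lebesgue. phi (i x) x)" unfolding set_integral_const[OF Vs(2), symmetric]
   by (rule set_integral_mono_AE[OF set_integrable_const[OF Vs(2)] si[OF fmeasurableD[OF Vs(2)]]], rule eventually_mono[OF b]) (auto simp: abs_le_iff minus_le_iff)
  moreover have "B * vol (U - V) <= c * eta" using vZ B nums c by (intro mult_mono) (auto simp: c_def)
  moreover have "(LINT x:V \<union> (U - V)|lebesgue. phi (i x) x) = (LINT x:V|lebesgue. phi (i x) x) + (LINT x:U-V|lebesgue. phi (i x) x)"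
   by (rule set_integral_Un) (use si Vs in auto)
  moreover have "V \<union> (U - V) = U" using V(2) by auto
  ultimately show ?thesis using eta(2) by simp
 qed
 moreover have "EV k. ALL s:C'. (nns (b s) (%y. osc (f k) (g (j s) k) (real J + 1) y)) <= ennreal (delta * snd s ^ CARD('d))"
  using j by (intro eventually_ball_finite[OF C'(2)]) (auto simp: Q_def b_def)
 hence "EV k. near (f k) (%x. g (i x) k x) U (real J) eps"
 proof eventually_elim
  case (elim k)
  show ?case
  proof (intro ballI impI)
   fix H :: "real^'d => real^'d^'m" assume H: "H : BL" "ALL x. norm (H x) <= real J"
   have gF: "F_cl (g l k)" for l using G by (simp add: Gconv_def)
   define y where "y s x = abs (ind (b s) x * f k x (H x) - ind (b s) x * g (j s) k x (H x))" for s x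
   have bD: "b s <= D" if "s : C'" for s using V(2) UU(1) that by (auto simp: V_def)
   have ym: "(%x. ennreal (y s x)) : BL" if "s : C'" for s unfolding y_def
    using F_class_measurable_on[OF F H(1) bD[OF that]] F_class_measurable_on[OF gF H(1) bD[OF that]] by (simp add: b_def)
   have yi: "(NN x. ennreal (y s x)) <= ennreal (delta * snd s ^ CARD('d))" if "s : C'" for s
   proof (rule order_trans[OF nn_integral_mono elim[rule_format, OF that]])
    have "H x : cball 0 (real J + 1)" for x using H(2)[rule_format, of x] by simp
    thus "ennreal (y s x) <= osc (f k) (g (j s) k) (real J + 1) x * indicator (b s) x" for x
     by (auto simp: y_def indicator_def simp del: mem_cball intro: SUP_upper)
   qed
   have "AEL x. x : U --> (ALL l. abs (f k x (H x) - g l k x (H x)) <= c)"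
   proof -
    have "AEL x. ALL l. x : D --> 0 <= g l k x (H x) & g l k x (H x) <= \<beta> * (1 + norm (H x) powr p)"
     unfolding AE_all_countable by (intro allI eventually_mono[OF F_class_AE[OF gF]]) auto
    with F_class_AE[OF F[of k]] show ?thesis
    proof eventually_elim
     case (elim x)
     have "\<beta> * (1 + norm (H x) powr p) <= \<beta> * (1 + real J powr p)" using H(2) nums by (intro mult_left_mono add_left_mono powr_mono2) auto
     moreover have "\<beta> * (1 + real J powr p) <= c" using nums B by (simp add: c_def)
     moreover have "0 <= f k x (H x)" "f k x (H x) <= \<beta> * (1 + norm (H x) powr p)" "0 <= g l k x (H x)" "g l k x (H x) <= \<beta> * (1 + norm (H x) powr p)"
      if "x : U" for l using elim UU(1) that by blast+
     ultimately show ?case by (smt (verit))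
    qed
   qed
   hence "(nns U (%x. ennreal (abs (f k x (H x) - g (i x) k x (H x))))) <= (NN x. (\<Sum>s\<in>C'. ennreal (y s x)) + ennreal c * indicator (U - V) x)"
   proof (intro nn_integral_mono_AE, eventually_elim)
    case (elim x)
    show ?case
    proof (cases "x : V")
     case True
     then obtain s where s: "s : C'" "x : b s" by (auto simp: V_def)
     have "ennreal (y s x) <= (\<Sum>s\<in>C'. ennreal (y s x))" by (rule member_le_sum) (use s C' in auto)
     thus ?thesis using s i(2) True V(2) by (auto simp: y_def indicator_def)
    qed (use elim in "auto simp: indicator_def intro!: ennreal_leI add_increasing")
   qed
   also have "... = (\<Sum>s\<in>C'. NN x. ennreal (y s x)) + ennreal c * emeasure lebesgue (U - V)"
    using ym Vs(2) by (subst nn_integral_add) (auto simp: nn_integral_sum nn_integral_cmult_indicator fmeasurableD)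
   also have "... <= (\<Sum>s\<in>C'. ennreal (delta * snd s ^ CARD('d))) + ennreal c * ennreal eta"
    using vZ Vs(2) by (intro add_mono sum_mono yi mult_left_mono) (auto simp: emeasure_eq_measure2 ennreal_leI)
   also have "(\<Sum>s\<in>C'. ennreal (delta * snd s ^ CARD('d))) = ennreal (\<Sum>s\<in>C'. delta / om * vol (b s))"
   proof (subst sum_ennreal[symmetric])
    show "(\<Sum>s\<in>C'. ennreal (delta * snd s ^ CARD('d))) = (\<Sum>s\<in>C'. ennreal (delta / om * vol (b s)))"
     by (rule sum.cong[OF refl]) (subst vb, use w in auto)
   qed (use d w in auto)
   also have "... + ennreal c * ennreal eta = ennreal ((\<Sum>s\<in>C'. delta / om * vol (b s)) + c * eta)"
    using d w c eta(1) by (simp add: ennreal_mult[symmetric] ennreal_plus[symmetric] sum_nonneg del: ennreal_plus)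
   also have "... <= ennreal eps"
    unfolding sum_distrib_left[symmetric] using order_trans[OF mult_left_mono[OF vV divide_nonneg_pos[OF less_imp_le[OF d] w]] d2(2)] eta(2)
    by (intro ennreal_leI) linarith
   finally show "(nns U (%x. ennreal (abs (f k x (H x) - g (i x) k x (H x))))) <= ennreal eps" .
  qed
 qed
 ultimately show ?thesis using i(1) iJ by blast
qed

end

subsection \<open>The limit integrand\<close>

context growth
begin

text \<open>Accuracy 1/(J+1) and height \<open>J\<close> in the \<open>J\<close>-th combination
  yield closeness. The selection criterion \<open>phi\<close> may vary with \<open>J\<close>, which
  permits an alternating choice of indices.\<close>

lemma glued_limit:
 fixes f :: "nat => real^'d => real^'d^'m => real"
 assumes F: "!!k. F_cl (f k)" and G: "!!j. Gconv (g j) (h j)" and U: "admissible D U" and E: "E <= {0<..}" "0 : closure E"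
  and osc: "osc_small f g E" and phi: "!!J j. integ (phi J j)" and b: "!!J. AEL x. x : U --> (ALL j. abs (phi J j x) <= B)"
  and fr: "!!J. AEL x. x : U --> (ALL e>0. FQ j. - e < phi J j x)" and B: "B >= 0"
 shows "EX i L. (ALL J x. J <= i J x) & (ALL J. glued (i J)) & (ALL J. - (1 / (real J + 1)) <= (LINT x:U|lebesgue. phi J (i J x) x)) &
  (ALL u. sobolev p D u --> (%J. energy (%x. h (i J x) x) U (grd u)) ----> L u) & Gc (%k. intfun p D (f k) U) L"
proof -
 define P where "P J i \<longleftrightarrow> glued i & (ALL x. J <= i x) & - (1 / (real J + 1)) <= (LINT x:U|lebesgue. phi J (i x) x) &
  (EV k. near (f k) (%x. g (i x) k x) U (real J) (1 / (real J + 1)))" for J i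
 have "EX i. P J i" for J unfolding P_def by (rule combination[OF F G U E osc phi b fr B]) simp
 then obtain i where "!!J. P J (i J)" by metis
 hence i: "glued (i J)" "J <= i J x" "- (1 / (real J + 1)) <= (LINT x:U|lebesgue. phi J (i J x) x)"
  "EV k. near (f k) (%x. g (i J x) k x) U (real J) (1 / (real J + 1))" for J x unfolding P_def by blast+
 have "closeF f (%J k x. g (i J x) k x) U" unfolding closeF_def
 proof (intro allI impI)
  fix T eps :: real assume eps: "eps > 0"
  obtain J0 where J0: "max T (1 / eps) <= real J0" using real_arch_simple by blast
  show "EX J0. ALL J>=J0. EV k. near (f k) (%x. g (i J x) k x) U T eps"
  proof (intro exI[of _ J0] allI impI)
   fix J assume "J0 <= J"
   hence J: "max T (1 / eps) <= real J" using J0 by linarith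
   hence "1 / (real J + 1) <= eps" using eps by (simp add: field_simps)
   hence "ennreal (1 / (real J + 1)) <= ennreal eps" by (rule ennreal_leI)
   moreover have "T <= real J" using J by simp
   ultimately show "EV k. near (f k) (%x. g (i J x) k x) U T eps" using i(4)[of J]
    by (elim eventually_mono) (blast intro: order_trans)
  qed
 qed
 from gamma_limit_of_close_functionals[OF F glued_Gconv[OF i(1) G] this U] show ?thesis using i by blast
qed

text \<open>A linear map need not belong to Lp on an unbounded \<open>D\<close>, so it is cut off
  outside a neighbourhood of the closure of \<open>U\<close>.\<close>

lemma linear_on_bounded:
 fixes \<xi> :: "real^'d^'m"
 assumes "bounded U"
 shows "EX u. sobolev p D u & (AEL x. x : D \<inter> U --> grd u x = \<xi>)"
proof -
 obtain theta W where t: "test_fun UNIV theta" "open W" "closure U <= W" "!!x. x : W ==> theta x = 1"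
  by (rule ex_cutoff[of "closure U" UNIV]) (use assms that in "auto simp: compact_closure")
 define u where "u x = theta x *R (\<xi> *v x)" for x
 note l = linear_cutoff[OF t(1), of \<xi>, folded u_def[abs_def]]
 have s: "sob p D u (cgrad u)" by (rule sob_subset[OF sob_test_fun[OF l(1) nums(2)] _ D nums(2)]) simp
 have "grd u x = \<xi>" if "x : D" "x : U" "sgrad p D u x = cgrad u x" for x
 proof -
  have "x : W" using that(2) t(3) closure_subset by blast
  thus ?thesis using that t(4) pdv_locally_const[OF t(2) _ t(4)] by (simp add: grd_def ext_simps l(2) gradient_def outer_def vec_eq_iff)
 qed
 with sgrad_unique[OF s nums(2) D] have "AEL x. x : D \<inter> U --> grd u x = \<xi>" by (auto elim: eventually_mono)
 thus ?thesis using sob_sobolev[OF s] by blast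
qed

text \<open>The indices alternate between an almost maximal and an almost minimal choice of \<open>h j x \<xi>\<close>. The energies nevertheless
 converge, so that the upper and the lower limit of \<open>h j x \<xi>\<close> have the same integral.\<close>

lemma limit_at_matrix:
 fixes f :: "nat => real^'d => real^'d^'m => real" and \<xi> :: "real^'d^'m"
 assumes F: "!!k. F_cl (f k)" and G: "!!j. Gconv (g j) (h j)" and U: "admissible D U" and E: "E <= {0<..}" "0 : closure E"
  and osc: "osc_small f g E"
 shows "AEL x. x : U --> convergent (%j. h j x \<xi>)"
proof -
 note UU = adm[OF U]
 have hF: "F_cl (h j)" for j using G by (simp add: Gconv_def)
 define C where "C = \<beta> * (1 + norm \<xi> powr p)"
 have C: "C >= 0" using nums by (simp add: C_def)
 \<comment> \<open>Clipping to the interval from 0 to \<open>C\<close> makes the bounds valid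
   everywhere without changing the values almost everywhere on \<open>U\<close>. For odd
   \<open>J\<close> the value is reflected, so a nearly maximal \<open>v\<close> means a nearly
   minimal \<open>h j x \<xi>\<close>.\<close>
 define v where "v J j x = (let t = max 0 (min C (ind U x * h j x \<xi>)) in if even J then t else C - t)" for J j :: nat and x
 have v: "0 <= v J j x" "v J j x <= C" for J j x using C by (auto simp: v_def Let_def)
 have [measurable]: "v J j : BL" for J j
 proof -
  have [measurable]: "(%x. ind U x * h j x \<xi>) : BL" by (rule F_class_measurable_on[OF hF _ UU(1,4)]) simp
  show ?thesis unfolding v_def Let_def by measurable
 qed
 define a where "a J x = real_limsup (%j. v J j x)" for J x
 have [measurable]: "a J : BL" for J unfolding a_def real_limsup_def by measurable
 have a: "0 <= a J x" "a J x <= C" "e > 0 ==> FQ j. a J x - e < v J j x" for J x e unfolding a_def by (rule real_limsup[OF v])+ simp_all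
 have int: "set_integrable lebesgue U w" if "w : BL" "!!x. abs (w x) <= C" for w
  by (rule set_integrable_bound[OF set_integrable_const[OF UU(2), of C]]) (use that UU(4) C in "auto simp: set_borel_measurable_def")
 have vi: "set_integrable lebesgue U (v J j)" and ai: "set_integrable lebesgue U (a J)" for J j by (rule int; use v a in auto)+
 \<comment> \<open>The integral of \<open>phi J\<close> along the chosen indices measures how far
   they fall short of the upper limit; by the definition of an upper limit, it exceeds any negative
   number infinitely often.\<close>
 define phi where "phi J j x = ind U x * (v J j x - a J x)" for J j x
 have b: "x : U --> (ALL j. abs (phi J j x) <= C)" for J x
  using v(1)[of J _ x] v(2)[of J _ x] a(1)[of J x] a(2)[of J x] by (auto simp: phi_def abs_le_iff) (smt (verit))+
 have fr: "x : U --> (ALL e>0. FQ j. - e < phi J j x)" for J x using a(3)[of _ J x] by (auto simp: phi_def algebra_simps)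
 have phi: "integ (phi J j)" for J j using set_integral_diff(1)[OF vi ai] by (simp add: phi_def[abs_def] set_integrable_def)
 from glued_limit[OF F G U E osc, of phi C, OF phi AE_I2[OF b] AE_I2[OF fr] C] obtain i L where
  i: "ALL J. glued (i J)" "ALL J. - (1 / (real J + 1)) <= (LINT x:U|lebesgue. phi J (i J x) x)"
  and L: "ALL u. sobolev p D u --> (%J. energy (%x. h (i J x) x) U (grd u)) ----> L u" by (elim exE conjE) (rule that)
 note i = i[rule_format]
 obtain u where u: "sobolev p D u" "AEL x. x : D \<inter> U --> grd u x = \<xi>" using linear_on_bounded[of U \<xi>] U unfolding admissible_def by blast
 define e where "e J = energy (%x. h (i J x) x) U (grd u)" for J
 define s where "s J t = (if even J then t else C * vol U - t)" for J :: nat and t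
 have "AEL x. ALL j. x : D --> 0 <= h j x \<xi> & h j x \<xi> <= C"
  unfolding AE_all_countable C_def by (intro allI eventually_mono[OF F_class_AE[OF hF]]) auto
 hence vh: "AEL x. x : U --> (ALL j. h j x (grd u x) = v 0 j x & h j x \<xi> = v 0 j x)"
  using u(2) by eventually_elim (use UU(1) in "auto simp: v_def Let_def")
 have bd: "- (1 / (real J + 1)) + (LINT x:U|lebesgue. a J x) <= s J (e J)" for J
 proof -
  have vg: "set_integrable lebesgue U (%x. v J' (i J x) x)" for J'
   unfolding set_integrable_def by (rule glued_integrable[OF i(1), of "%j x. ind U x *R v J' j x"]) (use vi in "simp add: set_integrable_def")
  have e: "e J = (LINT x:U|lebesgue. v 0 (i J x) x)" unfolding e_def energy_def set_lebesgue_integral_def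
  proof (rule integral_cong_AE)
   have "F_cl (%x. h (i J x) x)" using glued_Gconv[OF i(1), of g h, OF G] by (simp add: Gconv_def)
   from energy_integrable[OF this Lp_grd(1)[OF u(1)] UU(1,2)]
   show "(%x. ind U x *R h (i J x) x (grd u x)) : BL" by (simp add: set_integrable_def)
   show "(%x. ind U x *R v 0 (i J x) x) : BL" using vg by (simp add: set_integrable_def)
  qed (use vh in "auto simp: indicator_def elim!: eventually_mono")
  have "(LINT x:U|lebesgue. phi J (i J x) x) = (LINT x:U|lebesgue. v J (i J x) x - a J x)"
   unfolding set_lebesgue_integral_def by (rule Bochner_Integration.integral_cong) (auto simp: phi_def indicator_def)
  also have "... = (LINT x:U|lebesgue. v J (i J x) x) - (LINT x:U|lebesgue. a J x)" by (rule set_integral_diff(2)[OF vg ai])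
  also have "(LINT x:U|lebesgue. v J (i J x) x) = s J (e J)"
  proof (cases "even J")
   case False
   have "(LINT x:U|lebesgue. v J (i J x) x) = (LINT x:U|lebesgue. C - v 0 (i J x) x)" using False by (simp add: v_def Let_def)
   also have "... = s J (e J)" using set_integral_diff(2)[OF set_integrable_const[OF UU(2)] vg, of C 0] set_integral_const[OF UU(2), of C] False by (simp add: s_def e)
   finally show ?thesis .
  qed (simp add: e s_def v_def)
  finally show ?thesis using i(2)[of J] by linarith
 qed
 have e: "e ----> L u" using L u(1) by (simp add: e_def[abs_def])
 have lim: "(%n. - (1 / (real (2 * n) + 1)) + c) ----> c" "(%n. - (1 / (real (Suc (2 * n)) + 1)) + c) ----> c" for c by real_asymp+
 have par: "a (2 * n) = a 0" "a (Suc (2 * n)) = a 1" for n by (auto simp: a_def v_def Let_def fun_eq_iff)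
 \<comment> \<open>The full sequence of energies converges, so its even and odd parts share the
   limit \<open>L u\<close>. The even part bounds the integral of the upper limit, the odd part that
   of the reflected one.\<close>
 have "(LINT x:U|lebesgue. a 0 x) <= L u"
 proof (rule LIMSEQ_le)
  show "(%n. - (1 / (real (2 * n) + 1)) + (LINT x:U|lebesgue. a 0 x)) ----> (LINT x:U|lebesgue. a 0 x)" by (rule lim)
  show "(%n. e (2 * n)) ----> L u" using LIMSEQ_subseq_LIMSEQ[OF e, of "%n. 2 * n"] by (simp add: o_def strict_mono_def)
 qed (use bd[of "2 * n" for n] in "simp add: par s_def")
 moreover have "(LINT x:U|lebesgue. a 1 x) <= C * vol U - L u"
 proof (rule LIMSEQ_le)
  show "(%n. - (1 / (real (Suc (2 * n)) + 1)) + (LINT x:U|lebesgue. a 1 x)) ----> (LINT x:U|lebesgue. a 1 x)" by (rule lim)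
  show "(%n. C * vol U - e (Suc (2 * n))) ----> C * vol U - L u"
   using LIMSEQ_subseq_LIMSEQ[OF e, of "%n. Suc (2 * n)"] by (intro tendsto_intros) (simp add: o_def strict_mono_def)
 qed (use bd[of "Suc (2 * n)" for n] in "simp add: par s_def")
 moreover have "v 1 j x = C - v 0 j x" for j x by (simp add: v_def Let_def)
 hence a1: "a 1 x = real_limsup (%j. C - v 0 j x)" for x by (simp add: a_def)
 have si: "set_integrable lebesgue U (%x. a 0 x + a 1 x - C)" by (intro set_integral_diff set_integral_add ai set_integrable_const UU)
 have "(LINT x:U|lebesgue. a 0 x + a 1 x - C) = (LINT x:U|lebesgue. a 0 x) + (LINT x:U|lebesgue. a 1 x) - C * vol U"
  using set_integral_diff(2)[OF set_integral_add(1)[OF ai[of 0] ai[of 1]] set_integrable_const[OF UU(2), of C]] set_integral_add(2)[OF ai[of 0] ai[of 1]]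
   set_integral_const[OF UU(2), of C] by simp
 \<comment> \<open>The integrand is the gap between upper and lower limit, nonnegative everywhere;
   its integral is at most 0 by the two bounds, so it vanishes almost everywhere.\<close>
 moreover have nn: "0 <= ind U x *R (a 0 x + a 1 x - C)" for x unfolding a1 a_def[of 0] using real_limsup_reflect(1)[of "%j. v 0 j x" C, OF v] by (simp add: indicator_def)
 hence "0 <= (LI x. ind U x *R (a 0 x + a 1 x - C))" by (rule Bochner_Integration.integral_nonneg)
 ultimately have "(LI x. ind U x *R (a 0 x + a 1 x - C)) = 0"
  unfolding set_lebesgue_integral_def by linarith
 hence "AEL x. ind U x *R (a 0 x + a 1 x - C) = 0" using integral_nonneg_eq_0_iff_AE[OF si[unfolded set_integrable_def] AE_I2[OF nn]] by (simp only:)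
 with vh show ?thesis
 proof eventually_elim
  case (elim x)
  show ?case
  proof
   assume x: "x : U"
   have "h j x \<xi> = v 0 j x" for j using elim(1) x by blast
   moreover have "(%j. v 0 j x) ----> real_limsup (%j. v 0 j x)"
    using real_limsup_reflect(2)[of "%j. v 0 j x" C, OF v] elim(2) x unfolding a1 a_def[of 0] by simp
   ultimately show "convergent (%j. h j x \<xi>)" by (simp add: convergentI)
  qed
 qed
qed

lemma limit_integrand:
 fixes f :: "nat => real^'d => real^'d^'m => real"
 assumes F: "!!k. F_cl (f k)" and G: "!!j. Gconv (g j) (h j)" and E: "E <= {0<..}" "0 : closure E"
  and osc: "osc_small f g E"
 shows "AEL x. x : D --> (ALL \<xi>. convergent (%j. h j x \<xi>))"
proof -
 have hF: "F_cl (h j)" for j using G by (simp add: Gconv_def)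
 obtain Q :: "(real^'d^'m) set" where Q: "countable Q" "!!X. open X ==> X ~= {} ==> EX q:Q. q : X" using countable_dense_setE by blast
 \<comment> \<open>\<open>D\<close> may be unbounded, whereas admissible sets are bounded; these
   sets exhaust it.\<close>
 have "admissible D (D \<inter> ball 0 (real n))" for n using D by (auto simp: admissible_def)
 hence "AEL x. ALL n. ALL q:Q. x : D \<inter> ball 0 (real n) --> convergent (%j. h j x q)"
  unfolding AE_all_countable AE_ball_countable[OF Q(1)] by (intro allI ballI limit_at_matrix[OF F G _ E osc])
 moreover have "AEL x. ALL j. x : D --> (ALL \<xi> eta. \<bar>h j x eta - h j x \<xi>\<bar> <= lip_const p \<beta> (real CARD('d)) * (1 + norm \<xi> + norm eta) powr (p - 1) * norm (eta - \<xi>))"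
  unfolding AE_all_countable by (intro allI eventually_mono[OF F_class_AE[OF hF]]) auto
 ultimately show ?thesis
 proof eventually_elim
  case (elim x)
  show ?case
  proof (intro impI allI)
   fix \<xi> :: "real^'d^'m" assume x: "x : D"
   obtain n where "norm x < real n" using reals_Archimedean2 by blast
   hence cq: "convergent (%j. h j x q)" if "q : Q" for q using elim(1) that x by (auto simp: dist_norm)
   define K where "K = lip_const p \<beta> (real CARD('d)) * (2 + 2 * norm \<xi>) powr (p - 1)"
   have K: "K >= 0" using nums by (simp add: K_def lip_const_def)
   have "Cauchy (%j. h j x \<xi>)" unfolding Cauchy_altdef2
   proof (intro allI impI)
    fix e :: real assume e: "e > 0"
    define r where "r = min 1 (e / (3 * (K + 1)))"
    have r: "r > 0" "r <= 1" "K * r < e / 3" 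
    proof -
     show "r > 0" "r <= 1" using e K by (auto simp: r_def)
     have "K * r <= K * (e / (3 * (K + 1)))" using K by (intro mult_left_mono) (auto simp: r_def)
     also have "... < e / 3" using e K by (simp add: field_simps)
     finally show "K * r < e / 3" .
    qed
    obtain q where q: "q : Q" "norm (q - \<xi>) < r" using Q(2)[of "ball \<xi> r"] r(1) by (auto simp: dist_norm norm_minus_commute)
    have hq: "\<bar>h j x q - h j x \<xi>\<bar> < e / 3" for j
    proof -
     have "norm q <= 1 + norm \<xi>" using norm_triangle_sub[of q \<xi>] q(2) r(2) by linarith
     hence "(1 + norm \<xi> + norm q) powr (p - 1) <= (2 + 2 * norm \<xi>) powr (p - 1)" using p by (intro powr_mono2) auto
     hence "lip_const p \<beta> (real CARD('d)) * (1 + norm \<xi> + norm q) powr (p - 1) * norm (q - \<xi>) <= K * r"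
      unfolding K_def using q(2) nums by (intro mult_mono mult_left_mono) (auto simp: lip_const_def)
     thus ?thesis using elim(2) x r(3) by (meson order_le_less_trans)
    qed
    obtain N where N: "ALL n>=N. dist (h n x q) (h N x q) < e / 3"
     using convergent_Cauchy[OF cq[OF q(1)], unfolded Cauchy_altdef2, rule_format, of "e / 3"] e by auto
    hence "dist (h n x \<xi>) (h N x \<xi>) < e" if "n >= N" for n
     using N[rule_format, OF that] hq[of n] hq[of N] unfolding dist_real_def by linarith
    thus "EX N. ALL n>=N. dist (h n x \<xi>) (h N x \<xi>) < e" by blast
   qed
   thus "convergent (%j. h j x \<xi>)" by (simp add: Cauchy_convergent_iff)
  qed
 qed
qed

text \<open>With the void criterion \<open>phi = 0\<close> some sequence of combinations has the
  Gamma-limit of f_k as limit of its energies. Its indices satisfy \<open>J <= i J x\<close>, so the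
  integrands converge almost everywhere to the limit integrand, and dominated convergence yields the
  integral formula.\<close>

lemma gamma_limit:
 fixes f :: "nat => real^'d => real^'d^'m => real"
 assumes F: "!!k. F_cl (f k)" and G: "!!j. Gconv (g j) (h j)" and E: "E <= {0<..}" "0 : closure E"
  and osc: "osc_small f g E" and U: "admissible D U"
 shows "Gc (%k. intfun p D (f k) U) (intfun p D (%x \<xi>. lim (%j. h j x \<xi>)) U)"
proof -
 note UU = adm[OF U]
 have hF: "F_cl (h j)" for j using G by (simp add: Gconv_def)
 obtain i L where i: "!!J x. J <= i J x" "!!J. glued (i J)"
  and L: "!!u. sobolev p D u ==> (%J. energy (%x. h (i J x) x) U (grd u)) ----> L u" "Gc (%k. intfun p D (f k) U) L"
  using glued_limit[OF F G U E osc, of "%_ _ _. 0" 0] by auto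
 have "L u = intfun p D (%x \<xi>. lim (%j. h j x \<xi>)) U u" if u: "sobolev p D u" for u
 proof -
  have gF: "F_cl (%x. h (i J x) x)" for J using glued_Gconv[OF i(2), of g h, OF G] by (simp add: Gconv_def)
  note Lu = Lp_grd(1)[OF u]
  have "(%J. energy (%x. h (i J x) x) U (grd u)) ----> (LI x. ind U x *R lim (%j. h j x (grd u x)))"
   unfolding energy_def set_lebesgue_integral_def
  proof (rule integral_dominated_convergence)
   show "integ (%x. ind U x *R (\<beta> * (1 + norm (grd u x) powr p)))" using set_integral_add(1)[OF set_integrable_const[OF UU(2), of 1] Lp_set_integrable[OF Lu UU(4)]]
    by (simp add: set_integrable_def mult.left_commute[of _ \<beta>])
   show "(%x. ind U x *R h (i J x) x (grd u x)) : BL" for J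
    using F_class_measurable_on[OF gF Lp_measurable[OF Lu] UU(1,4)] by simp
   have [measurable]: "(%x. ind U x * h j x (grd u x)) : BL" for j by (rule F_class_measurable_on[OF hF Lp_measurable[OF Lu] UU(1,4)])
   have "(%x. lim (%j. ind U x * h j x (grd u x))) : BL" by measurable
   moreover have "lim (%j. ind U x * h j x (grd u x)) = ind U x *R lim (%j. h j x (grd u x))" for x by (simp add: indicator_def)
   ultimately show "(%x. ind U x *R lim (%j. h j x (grd u x))) : BL" by simp
   show "AEL x. norm (ind U x *R h (i J x) x (grd u x)) <= ind U x *R (\<beta> * (1 + norm (grd u x) powr p))" for J
    using F_class_AE[OF gF, of J] by eventually_elim (use UU(1) in "auto simp: indicator_def")
   show "AEL x. (%J. ind U x *R h (i J x) x (grd u x)) ----> ind U x *R lim (%j. h j x (grd u x))"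
    using limit_integrand[OF F G E osc]
   proof eventually_elim
    case (elim x)
    show ?case
    proof (cases "x : U")
     case True
     hence "(%j. h j x (grd u x)) ----> lim (%j. h j x (grd u x))" using elim UU(1) by (auto simp: convergent_LIMSEQ_iff)
     \<comment> \<open>At each fixed \<open>x\<close> the chosen index tends to infinity, though not
       monotonically; convergence of the whole sequence in \<open>j\<close> is therefore needed
       here.\<close>
     moreover have "filterlim (%J. i J x) sequentially sequentially" using i(1) by (intro filterlim_at_top_mono[OF filterlim_ident]) auto
     ultimately have "(%J. h (i J x) x (grd u x)) ----> lim (%j. h j x (grd u x))" by (rule filterlim_compose)
     thus ?thesis by (intro tendsto_intros)
    qed simp
   qed
  qed
  from LIMSEQ_unique[OF L(1)[OF u] this] show ?thesis unfolding intfun_grd[OF UU(1)] energy_def set_lebesgue_integral_def .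
 qed
 thus ?thesis using L(2) unfolding gamma_conv_def by simp
qed

end

theorem theorem4p1:
  fixes D :: "(real^'d) set" and p \<alpha> \<beta> :: real and E :: "real set"
    and f :: "nat \<Rightarrow> real^'d \<Rightarrow> real^'d^'m \<Rightarrow> real"
    and g :: "nat \<Rightarrow> nat \<Rightarrow> real^'d \<Rightarrow> real^'d^'m \<Rightarrow> real"
    and ginf :: "nat \<Rightarrow> real^'d \<Rightarrow> real^'d^'m \<Rightarrow> real"
  assumes "open D" and "p > 1" and "0 < \<alpha>" and "\<alpha> \<le> \<beta>"
    and "\<And>k. F_class p \<alpha> \<beta> D (f k)"
    and "\<And>j k. F_class p \<alpha> \<beta> D (g j k)"
    and "\<And>j. F_class p \<alpha> \<beta> D (ginf j)"
    and "E \<subseteq> {0<..}" and "0 \<in> closure E"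
    and "AE x in lebesgue. x \<in> D \<longrightarrow> (\<forall>t>0.
          (\<lambda>j. Limsup (at 0 within E) (\<lambda>\<rho>. limsup (\<lambda>k.
             ennreal (1 / \<rho> ^ CARD('d)) *
             (\<integral>\<^sup>+ y\<in>ball x \<rho>. (SUP \<xi>\<in>cball 0 t. ennreal \<bar>f k y \<xi> - g j k y \<xi>\<bar>) \<partial>lebesgue))))
          \<longlonglongrightarrow> 0)"
    and "\<And>j U. admissible D U \<Longrightarrow>
          gamma_conv {u. sobolev p D u} (weak_W1p p D)
            (\<lambda>k u. intfun p D (g j k) U u) (intfun p D (ginf j) U)"
  shows "(AE x in lebesgue. x \<in> D \<longrightarrow> (\<forall>\<xi>. convergent (\<lambda>j. ginf j x \<xi>))) \<and>
         (\<forall>U. admissible D U \<longrightarrow>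
            gamma_conv {u. sobolev p D u} (weak_W1p p D)
              (\<lambda>k u. intfun p D (f k) U u)
              (intfun p D (\<lambda>x \<xi>. lim (\<lambda>j. ginf j x \<xi>)) U))"
proof -
 interpret growth D p \<alpha> \<beta> using assms(1-4) by unfold_locales
 have G: "Gconv (g j) (ginf j)" for j using assms(6,7,11) by (simp add: Gconv_def)
 show ?thesis using limit_integrand[OF assms(5) G assms(8-10)] gamma_limit[OF assms(5) G assms(8-10)] by blast
qed

end
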